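(* Let $m\ge 2$ and let $G$ be a rooted graph with roots $x_0,x_1$, where $|V(G)|\ge 4$. Assume further that $\lambda_n(G)\ge 3$, $\lambda_n^i(G)\ge 4$, and $\lambda_s(G)\ge m$. Then $G$ has no rooted immersion of $D_m$ (that is, $G\nsucc_r D_m$) if and only if $G$ has type $A_m$ or type $B_m$.
   Context: All graphs are finite, loopless and undirected, and parallel edges are permitted. For $X\subseteq V(G)$, $d(X)$ is the number of edges with exactly one endpoint in $X$; for distinct vertices $u,v$, $E(u,v)$ is the set of edges between $u$ and $v$ and $e(u,v)=|E(u,v)|$. Rooted immersion: if $xy,yz$ are two distinct edges sharing the vertex $y$, splitting them off at $y$ means deleting both and adding a new edge $xz$ (a loop, if $x=z$, is discarded). A rooted graph is a connected graph with an ordered tuple of distinct vertices (its roots). For $G$ with roots $(x_1,\dots,x_k)$ and $H$ with roots $(y_1,\dots,y_k)$, $G$ has a rooted immersion of $H$, written $G\succ_r H$, if a sequence of splits and (vertex or edge) deletions transforms $G$ into a graph isomorphic to $H$ by an isomorphism sending $x_i$ to $y_i$ for all $i$. Equivalently, there is an injection $V(H)\to V(G)$ sending $y_i$ to $x_i$, and pairwise edge-disjoint paths of $G$, one for each edge of $H$, joining the images of the endpoints of that edge. The graph $D_m$ ($m\ge 2$): it has four vertices, two of which are roots $x_0,x_1$. $D_2$ is $K_4$ with the edge joining the two roots deleted, and $D_m$ is obtained from $D_2$ by adding $m-2$ parallel edges between $x_0$ and $x_1$ (so $D_3$ is $K_4$ with two roots). Since there is an automorphism exchanging the two roots, their order is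 irrelevant. Connectivity parameters for $G$ with roots $x_0,x_1$: an edge-cut is the set of edges with exactly one endpoint in $X$, for some $X$ with $|X|,|V(G)\setminus X|\ge 1$; it is internal if $|X|,|V(G)\setminus X|\ge 2$; it separates $x_0$ and $x_1$ if exactly one of them lies in $X$. $\lambda_s(G)$ is the minimum size of an edge-cut separating $x_0$ and $x_1$; $\lambda_n(G)$ (respectively $\lambda_n^i(G)$) is the minimum size of an edge-cut (respectively internal edge-cut) not separating $x_0$ and $x_1$. Segmentation: for disjoint $X,Y\subseteq V(G)$, a segmentation of $G$ relative to $(X,Y)$ is a nested family $X_1\subset X_2\subset\dots\subset X_k$ of vertex sets with $X_1=X$, $V(G)\setminus X_k=Y$, and $|X_{i+1}\setminus X_i|=1$ for $1\le i\le k-1$. It has width $w$ if $d(X_i)=w$ for every $1\le i\le k$. Type $A_m$: $G$ has a segmentation of width $m$ relative to some $(X_0,X_1)$ with $|X_i|\le 2$ and $x_i\in X_i$ for $i=0,1$. Type $B_m$: For the vertex set $C$ of a component of $G\setminus\{x_0,x_1\}$ (the graph with both roots removed), the graph obtained from $G[C\cup\{x_0,x_1\}]$ by deleting all edges between $x_0$ and $x_1$ is called a lobe of $G$. $G$ has type $B_m$ if: (i) every lobe $L$ consists of a path from $x_0$ to $x_1$ in which there are exactly $n_L$ parallel copies of each edge, for some $n_L\ge 2$; (ii) if $|V(L)|\ge 4$ then $n_L=2$; (iii) $e(x_0,x_1)+\sum_L n_L=m+1$, where the sum is over all lobes $L$ of $G$. *)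

theory Defs
  imports "HOL-Library.Multiset" "HOL-Library.Extended_Nat"
begin

text \<open>An edge is represented by the set of its two endpoints; parallel edges are accounted for by
  the multiplicity of that set in the edge multiset.\<close>

record 'v mgraph =
  verts :: "'v set"
  edges :: "'v set multiset"

definition multigraph :: "'v mgraph \<Rightarrow> bool" where
  "multigraph G \<longleftrightarrow> finite (verts G) \<and> (\<forall>e \<in># edges G. e \<subseteq> verts G \<and> card e = 2)"

definition edge_mult :: "'v mgraph \<Rightarrow> 'v \<Rightarrow> 'v \<Rightarrow> nat" where
  "edge_mult G u v = count (edges G) {u, v}"

definition cut_size :: "'v mgraph \<Rightarrow> 'v set \<Rightarrow> nat" where
  "cut_size G X = size {#e \<in># edges G. card (e \<inter> X) = 1#}"

definition induced :: "'v mgraph \<Rightarrow> 'v set \<Rightarrow> 'v mgraph" where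
  "induced G X = \<lparr>verts = verts G \<inter> X, edges = {#e \<in># edges G. e \<subseteq> X#}\<rparr>"

definition reachable :: "'v mgraph \<Rightarrow> 'v \<Rightarrow> 'v \<Rightarrow> bool" where
  "reachable G = (\<lambda>u v. {u, v} \<in># edges G)\<^sup>*\<^sup>*"

definition connected_graph :: "'v mgraph \<Rightarrow> bool" where
  "connected_graph G \<longleftrightarrow> verts G \<noteq> {} \<and> (\<forall>u \<in> verts G. \<forall>v \<in> verts G. reachable G u v)"

definition components :: "'v mgraph \<Rightarrow> 'v set set" where
  "components G = {{v \<in> verts G. reachable G u v} | u. u \<in> verts G}"

type_synonym 'v rooted = "'v mgraph \<times> 'v list"

fun rooted_graph :: "'v rooted \<Rightarrow> bool" where
  "rooted_graph (G, rs) \<longleftrightarrow>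
     multigraph G \<and> connected_graph G \<and> distinct rs \<and> set rs \<subseteq> verts G"

text \<open>In \<open>split\<close>, the case \<open>x = z\<close> concerns two parallel edges, which are two distinct edges
  because multiset inclusion requires multiplicity at least 2.\<close>

inductive immersion_step :: "'v mgraph \<Rightarrow> 'v mgraph \<Rightarrow> bool" where
  split: "{#{x, y}, {y, z}#} \<subseteq># edges G \<Longrightarrow>
    immersion_step G
      (G\<lparr>edges := edges G - {#{x, y}, {y, z}#} + (if x = z then {#} else {#{x, z}#})\<rparr>)"
| delete_edge: "e \<in># edges G \<Longrightarrow> immersion_step G (G\<lparr>edges := edges G - {#e#}\<rparr>)"
| delete_vertex: "v \<in> verts G \<Longrightarrow> immersion_step G (induced G (verts G - {v}))"

definition graph_iso :: "('v \<Rightarrow> 'w) \<Rightarrow> 'v mgraph \<Rightarrow> 'w mgraph \<Rightarrow> bool" where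
  "graph_iso f G H \<longleftrightarrow>
     bij_betw f (verts G) (verts H) \<and> image_mset (\<lambda>e. f ` e) (edges G) = edges H"

fun rooted_immersion :: "'v rooted \<Rightarrow> 'w rooted \<Rightarrow> bool" (infix \<open>\<succ>\<^sub>r\<close> 50) where
  "(G, xs) \<succ>\<^sub>r (H, ys) \<longleftrightarrow>
     (\<exists>G' f. immersion_step\<^sup>*\<^sup>* G G' \<and> set xs \<subseteq> verts G' \<and> graph_iso f G' H \<and> map f xs = ys)"

text \<open>The roots are 0 and 1; \<open>m\<close> is meant to be at least 2.\<close>

definition D :: "nat \<Rightarrow> nat rooted" where
  "D m = (\<lparr>verts = {0, 1, 2, 3},
           edges = {#{0, 2}, {0, 3}, {1, 2}, {1, 3}, {2, 3}#} + replicate_mset (m - 2) {0, 1}\<rparr>,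
          [0, 1])"

definition is_cut_side :: "'v mgraph \<Rightarrow> 'v set \<Rightarrow> bool" where
  "is_cut_side G X \<longleftrightarrow> X \<subseteq> verts G \<and> card X \<ge> 1 \<and> card (verts G - X) \<ge> 1"

definition is_internal_cut_side :: "'v mgraph \<Rightarrow> 'v set \<Rightarrow> bool" where
  "is_internal_cut_side G X \<longleftrightarrow> X \<subseteq> verts G \<and> card X \<ge> 2 \<and> card (verts G - X) \<ge> 2"

definition separates :: "'v set \<Rightarrow> 'v \<Rightarrow> 'v \<Rightarrow> bool" where
  "separates X x0 x1 \<longleftrightarrow> (x0 \<in> X) \<noteq> (x1 \<in> X)"

text \<open>The following minima are \<open>\<infinity>\<close> if there is no cut of the required kind.\<close>

definition lambda_s :: "'v mgraph \<Rightarrow> 'v \<Rightarrow> 'v \<Rightarrow> enat" where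
  "lambda_s G x0 x1 =
     (INF X \<in> {X. is_cut_side G X \<and> separates X x0 x1}. enat (cut_size G X))"

definition lambda_n :: "'v mgraph \<Rightarrow> 'v \<Rightarrow> 'v \<Rightarrow> enat" where
  "lambda_n G x0 x1 =
     (INF X \<in> {X. is_cut_side G X \<and> \<not> separates X x0 x1}. enat (cut_size G X))"

definition lambda_n_int :: "'v mgraph \<Rightarrow> 'v \<Rightarrow> 'v \<Rightarrow> enat" where
  "lambda_n_int G x0 x1 =
     (INF X \<in> {X. is_internal_cut_side G X \<and> \<not> separates X x0 x1}. enat (cut_size G X))"

definition segmentation :: "'v mgraph \<Rightarrow> 'v set \<Rightarrow> 'v set \<Rightarrow> 'v set list \<Rightarrow> bool" where
  "segmentation G X Y Xs \<longleftrightarrow>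
     X \<subseteq> verts G \<and> Y \<subseteq> verts G \<and> X \<inter> Y = {} \<and>
     Xs \<noteq> [] \<and> (\<forall>Z \<in> set Xs. Z \<subseteq> verts G) \<and> hd Xs = X \<and> verts G - last Xs = Y \<and>
     (\<forall>i. Suc i < length Xs \<longrightarrow> Xs ! i \<subset> Xs ! Suc i \<and> card (Xs ! Suc i - Xs ! i) = 1)"

definition has_width :: "'v mgraph \<Rightarrow> 'v set list \<Rightarrow> nat \<Rightarrow> bool" where
  "has_width G Xs w \<longleftrightarrow> (\<forall>Z \<in> set Xs. cut_size G Z = w)"

definition type_A :: "nat \<Rightarrow> 'v mgraph \<Rightarrow> 'v \<Rightarrow> 'v \<Rightarrow> bool" where
  "type_A m G x0 x1 \<longleftrightarrow>
     (\<exists>X0 X1 Xs. segmentation G X0 X1 Xs \<and> has_width G Xs m \<and>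
        card X0 \<le> 2 \<and> card X1 \<le> 2 \<and> x0 \<in> X0 \<and> x1 \<in> X1)"

definition lobe :: "'v mgraph \<Rightarrow> 'v \<Rightarrow> 'v \<Rightarrow> 'v set \<Rightarrow> 'v mgraph" where
  "lobe G x0 x1 C =
     \<lparr>verts = verts (induced G (C \<union> {x0, x1})),
      edges = {#e \<in># edges (induced G (C \<union> {x0, x1})). e \<noteq> {x0, x1}#}\<rparr>"

definition lobes :: "'v mgraph \<Rightarrow> 'v \<Rightarrow> 'v \<Rightarrow> 'v mgraph set" where
  "lobes G x0 x1 = lobe G x0 x1 ` components (induced G (verts G - {x0, x1}))"

text \<open>\<open>p\<close> lists the vertices of the path in order.\<close>

definition is_thick_path :: "'v mgraph \<Rightarrow> 'v \<Rightarrow> 'v \<Rightarrow> nat \<Rightarrow> bool" where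
  "is_thick_path L x0 x1 n \<longleftrightarrow>
     (\<exists>p. p \<noteq> [] \<and> distinct p \<and> hd p = x0 \<and> last p = x1 \<and> verts L = set p \<and>
        edges L = repeat_mset n (mset (map (\<lambda>i. {p ! i, p ! Suc i}) [0..<length p - 1])))"

text \<open>The multiplicity \<open>n L\<close> is determined by \<open>L\<close> because \<open>x0 \<noteq> x1\<close>.\<close>

definition type_B :: "nat \<Rightarrow> 'v mgraph \<Rightarrow> 'v \<Rightarrow> 'v \<Rightarrow> bool" where
  "type_B m G x0 x1 \<longleftrightarrow>
     (\<exists>n :: 'v mgraph \<Rightarrow> nat.
        (\<forall>L \<in> lobes G x0 x1. n L \<ge> 2 \<and> is_thick_path L x0 x1 (n L)) \<and>
        (\<forall>L \<in> lobes G x0 x1. card (verts L) \<ge> 4 \<longrightarrow> n L = 2) \<and>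
        edge_mult G x0 x1 + (\<Sum>L \<in> lobes G x0 x1. n L) = m + 1)"

end

theory Submission
  imports Defs
begin

text \<open>
  Both types obstruct an immersion of \<open>D\<^sub>m\<close>. Type A says that any two nonroots are separated by some
  \<open>m\<close>-edge cut between the roots (the \<open>m\<close>-cuts form a lattice, and a segmentation is a maximal chain in
  it), whereas the images of the two nonroots of \<open>D\<^sub>m\<close> lie on the same side of every such cut. Type B
  says that the edges decompose into \<open>m + 1\<close> paths between the roots of which any two sharing a nonroot
  are equal.

  For the converse, induct on the number of vertices and edges. An internal \<open>m\<close>-cut is handled by
  contracting either of its sides: the contracted root has degree \<open>m\<close>, which excludes type B, and two
  type A structures combine. For \<open>m \<ge> 3\<close> an edge between the roots can be removed together with
  lowering \<open>m\<close>; for \<open>m = 2\<close> two parallel such edges yield \<open>D\<^sub>2\<close>.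

  Otherwise take a maximum system of edge-disjoint paths between the roots whose complement \<open>R\<close> has as
  many vertices as possible linked to a root. Absence of \<open>D\<^sub>m\<close> forces every nontrivial component of \<open>R\<close>
  to contain a root. If a root has degree \<open>m\<close>, this gives a contradiction. If all cuts between the roots
  have size at least \<open>m + 1\<close>, then \<open>R\<close> turns out to be empty, two paths sharing a nonroot must coincide,
  and the graph has type B.
\<close>

section \<open>Edge multisets\<close>

text \<open>\<open>D m\<close> has \<open>m - 2\<close> root edges, so in a system of edge-disjoint
  paths between the roots that many must stay whole and the others may be cut up: two if the system
  has \<open>m\<close> paths, three if it has \<open>m + 1\<close>. The rest of D is a path between
  the roots through \<open>u\<close>, another through \<open>v\<close>, and a link from
  \<open>u\<close> to \<open>v\<close>. The bound 3 on nonseparating cuts supplies the material. A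
  nonroot on at most one path of the system has an edge in \<open>R\<close>, and Menger's theorem
  inside \<open>R\<close> yields three connections back to touched vertices or a root: two for a
  detour, one for the link. The bound 4 on internal nonseparating cuts is spent on
  \<open>m = 2\<close> with a root of degree 2 adjacent to the other root. The obstacle is a
  component of \<open>R\<close> that meets no root: it may hang on a single path, and then no D is
  in sight. Rerouting that path through the component puts the bypassed segment into
  \<open>R\<close>; the extremal choice of \<open>R\<close> makes this exchange useless unless the
  segment is as isolated as the component, and a whole stretch of such vertices has a cut of size at
  most 2.\<close>

definition cut :: "'v set multiset \<Rightarrow> 'v set \<Rightarrow> nat" where
  "cut M X = size {#e \<in># M. card (e \<inter> X) = 1#}"

text \<open>An immersion asks only for edge-disjoint connections, so connectedness within disjoint
  submultisets replaces chosen paths wherever the route does not matter.\<close>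

definition linked :: "'v set multiset \<Rightarrow> 'v \<Rightarrow> 'v \<Rightarrow> bool" where
  "linked E = (\<lambda>u v. {u, v} \<in># E)\<^sup>*\<^sup>*"

text \<open>The name means loopless with all ends in \<open>V\<close>; parallel edges remain
  allowed.\<close>

definition simple_edges :: "'v set \<Rightarrow> 'v set multiset \<Rightarrow> bool" where
  "simple_edges V M \<longleftrightarrow> finite V \<and> (\<forall>e \<in># M. e \<subseteq> V \<and> card e = 2)"

lemma cut_empty [simp]: "cut {#} X = 0"
  by (simp add: cut_def)

lemma cut_add [simp]: "cut (M + N) X = cut M X + cut N X"
  by (simp add: cut_def)

lemma cut_add_mset [simp]:
  "cut (add_mset e M) X = (if card (e \<inter> X) = 1 then 1 else 0) + cut M X"
  by (simp add: cut_def)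

lemma cut_mono: "M \<subseteq># N \<Longrightarrow> cut M X \<le> cut N X"
  unfolding cut_def by (intro size_mset_mono multiset_filter_mono)

lemma cut_zeroI: "(\<And>e. e \<in># M \<Longrightarrow> card (e \<inter> X) \<noteq> 1) \<Longrightarrow> cut M X = 0"
  by (auto simp: cut_def filter_mset_eq_conv)

lemma cut_cong: "(\<And>e. e \<in># M \<Longrightarrow> (card (e \<inter> X) = 1) = (card (e \<inter> Y) = 1)) \<Longrightarrow> cut M X = cut M Y"
  unfolding cut_def by (metis (mono_tags, lifting) filter_mset_cong)

lemma cut_pos_iff: "cut M X > 0 \<longleftrightarrow> (\<exists>e \<in># M. card (e \<inter> X) = 1)"
proof -
  have "cut M X > 0 \<longleftrightarrow> {#e \<in># M. card (e \<inter> X) = 1#} \<noteq> {#}"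
    by (simp add: cut_def flip: nonempty_has_size)
  also have "\<dots> \<longleftrightarrow> (\<exists>e \<in># M. card (e \<inter> X) = 1)" by (auto simp: filter_mset_eq_conv multiset_eq_iff)
  finally show ?thesis .
qed

lemma card_pair_Int: "a \<noteq> b \<Longrightarrow> card ({a, b} \<inter> X) = Suc 0 \<longleftrightarrow> (a \<in> X) \<noteq> (b \<in> X)"
  by (cases "a \<in> X"; cases "b \<in> X") auto

lemma simple_edgesD:
  assumes "simple_edges V M" "e \<in># M"
  obtains a b where "e = {a, b}" "a \<noteq> b" "a \<in> V" "b \<in> V"
proof -
  have "card e = 2" "e \<subseteq> V" using assms by (auto simp: simple_edges_def)
  then obtain a b where "e = {a, b}" "a \<noteq> b" by (meson card_2_iff)
  then show thesis using that \<open>e \<subseteq> V\<close> by auto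
qed

lemma simple_edges_pair: "simple_edges V M \<Longrightarrow> {a, b} \<in># M \<Longrightarrow> a \<in> V \<and> b \<in> V \<and> a \<noteq> b"
  by (auto simp: simple_edges_def)

lemma simple_edges_mono: "simple_edges V M \<Longrightarrow> N \<subseteq># M \<Longrightarrow> simple_edges V N"
  by (meson mset_subset_eqD simple_edges_def)

lemma simple_edges_finite: "simple_edges V M \<Longrightarrow> finite V"
  by (simp add: simple_edges_def)

lemma cut_compl:
  assumes "simple_edges V M"
  shows "cut M (V - X) = cut M X"
proof (rule cut_cong)
  fix e assume "e \<in># M"
  then obtain a b where "e = {a, b}" "a \<noteq> b" "a \<in> V" "b \<in> V" using simple_edgesD[OF assms] by blast
  then show "(card (e \<inter> (V - X)) = 1) = (card (e \<inter> X) = 1)" by (simp add: card_pair_Int)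
qed

text \<open>Both sides add over the edges, so a single edge has to be checked.\<close>

lemma cut_submodular:
  assumes "simple_edges V M"
  shows "cut M (X \<union> Y) + cut M (X \<inter> Y) \<le> cut M X + cut M Y"
  using assms
proof (induction M)
  case (add e M)
  have "simple_edges V M" using add.prems by (simp add: simple_edges_def)
  moreover obtain a b where "e = {a, b}" "a \<noteq> b" by (rule simple_edgesD[OF add.prems, of e]) simp_all
  moreover have "(if card (e \<inter> (X \<union> Y)) = 1 then 1 else 0) + (if card (e \<inter> (X \<inter> Y)) = 1 then 1 else 0)
      \<le> (if card (e \<inter> X) = 1 then 1 else 0) + (if card (e \<inter> Y) = 1 then 1 else (0::nat))"
    unfolding \<open>e = {a, b}\<close> using card_pair_Int[OF \<open>a \<noteq> b\<close>]
    by (cases "a \<in> X"; cases "b \<in> X"; cases "a \<in> Y"; cases "b \<in> Y") simp_all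
  ultimately show ?case using add.IH by simp
qed simp

lemma linked_refl [simp]: "linked E a a"
  by (simp add: linked_def)

lemma linked_edge: "{a, b} \<in># E \<Longrightarrow> linked E a b"
  by (auto simp: linked_def)

lemma linked_trans [trans]: "linked E a b \<Longrightarrow> linked E b c \<Longrightarrow> linked E a c"
  by (simp add: linked_def)

lemma linked_sym: "linked E a b \<Longrightarrow> linked E b a"
  unfolding linked_def
  by (rule sympD[OF symp_rtranclp]) (auto simp: symp_def insert_commute)

lemma linked_commute: "linked E a b \<longleftrightarrow> linked E b a"
  by (rule iffI; erule linked_sym)

lemma linked_mono: "linked E a b \<Longrightarrow> E \<subseteq># F \<Longrightarrow> linked F a b"
  unfolding linked_def
proof (induction rule: rtranclp_induct)
  case (step u v)
  then have "{u, v} \<in># F" by (simp add: mset_subset_eqD)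
  with step show ?case by (simp add: rtranclp.rtrancl_into_rtrancl)
qed simp

lemma linked_add1: "linked E a b \<Longrightarrow> linked (E + F) a b"
  by (erule linked_mono) simp

lemma linked_add2: "linked F a b \<Longrightarrow> linked (E + F) a b"
  by (erule linked_mono) simp

lemma linked_add_trans: "linked E a b \<Longrightarrow> linked F b c \<Longrightarrow> linked (E + F) a c"
  by (meson linked_add1 linked_add2 linked_trans)

lemma linked_cut: "linked E a b \<Longrightarrow> (a \<in> X) \<noteq> (b \<in> X) \<Longrightarrow> cut E X \<ge> 1"
proof -
  have *: "cut E X \<ge> 1" if "linked E a b" "a \<in> X" "b \<notin> X" for a b X
    using that unfolding linked_def
  proof (induction rule: rtranclp_induct)
    case (step u v)
    show ?case
    proof (cases "u \<in> X")
      case True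
      then have "{u, v} \<inter> X = {u}" using step by auto
      then have "\<exists>e \<in># E. card (e \<inter> X) = 1" using step(2) by (intro bexI[of _ "{u, v}"]) auto
      then show ?thesis using cut_pos_iff[of E X] by linarith
    qed (use step in auto)
  qed simp
  assume "linked E a b" "(a \<in> X) \<noteq> (b \<in> X)"
  then show ?thesis using * linked_sym by metis
qed

lemma linked_closed:
  assumes "linked E a b" "a \<in> X" "\<And>u v. {u, v} \<in># E \<Longrightarrow> u \<in> X \<Longrightarrow> v \<in> X"
  shows "b \<in> X"
  using assms(1,2) unfolding linked_def by (induction rule: rtranclp_induct) (use assms(3) in auto)

lemma linked_in: "linked E a b \<Longrightarrow> simple_edges V E \<Longrightarrow> a \<in> V \<Longrightarrow> b \<in> V"
  by (meson linked_closed simple_edges_pair)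

section \<open>Immersion of edge multisets\<close>

inductive red_step :: "'v set multiset \<Rightarrow> 'v set multiset \<Rightarrow> bool" where
  red_split: "red_step (C + {#{x, y}, {y, z}#}) (C + (if x = z then {#} else {#{x, z}#}))"
| red_delete: "red_step (C + {#e#}) C"

text \<open>Reduction of edges alone; vertex deletions are added back in
  \<open>rooted_immersion_D_iff\<close>.\<close>

definition immerses :: "'v set multiset \<Rightarrow> 'v set multiset \<Rightarrow> bool" where
  "immerses = red_step\<^sup>*\<^sup>*"

lemma immerses_refl [simp]: "immerses M M"
  by (simp add: immerses_def)

lemma immerses_trans [trans]: "immerses M N \<Longrightarrow> immerses N K \<Longrightarrow> immerses M K"
  by (simp add: immerses_def)

lemma red_step_add: "red_step M N \<Longrightarrow> red_step (M + K) (N + K)"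
proof (induction rule: red_step.induct)
  case (red_split C x y z)
  show ?case using red_step.red_split[of "C + K" x y z] by (simp add: ac_simps)
next
  case (red_delete C e)
  show ?case using red_step.red_delete[of "C + K" e] by (simp add: ac_simps)
qed

lemma immerses_add_right: "immerses M N \<Longrightarrow> immerses (M + K) (N + K)"
  unfolding immerses_def
  by (induction rule: rtranclp_induct) (auto intro: rtranclp.rtrancl_into_rtrancl red_step_add)

lemma immerses_add: "immerses M N \<Longrightarrow> immerses M' N' \<Longrightarrow> immerses (M + M') (N + N')"
  by (metis immerses_add_right immerses_trans add.commute)

lemma immerses_drop: "immerses (M + K) M"
proof (induction K)
  case (add e K)
  have "immerses (M + add_mset e K) (M + K)"
    using red_step.red_delete[of "M + K" e] by (simp add: immerses_def r_into_rtranclp)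
  then show ?case using add.IH by (rule immerses_trans)
qed simp

lemma immerses_sub: "N \<subseteq># M \<Longrightarrow> immerses M N"
  by (metis immerses_drop subset_mset.add_diff_inverse)

lemma immerses_split: "immerses (C + {#{x, y}, {y, z}#}) (C + {#{x, z}#})" if "x \<noteq> z"
  using red_step.red_split[of C x y z] that by (simp add: immerses_def r_into_rtranclp)

text \<open>The partition of the target is pulled back one step at a time: the two edges that were
  split go to the part containing the new edge, and edges that vanish go to \<open>A\<close>. Thus
  an immersion of a sum is a pair of immersions of disjoint edge sets.\<close>

lemma immerses_splitD:
  assumes "immerses M (A + B)"
  obtains A0 B0 where "M = A0 + B0" "immerses A0 A" "immerses B0 B"
proof -
  have one: "\<exists>A0 B0. M = A0 + B0 \<and> immerses A0 A \<and> immerses B0 B"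
    if "red_step M (A + B)" for M A B :: "'a set multiset"
    using that
  proof cases
    case (red_split C x y z)
    have aux: "\<exists>A0 B0. M = A0 + B0 \<and> immerses A0 A \<and> immerses B0 B"
      if "x \<noteq> z" "M = C + {#{x, y}, {y, z}#}" "A + B = C + {#{x, z}#}" "{x, z} \<in># A" for A B
    proof -
      obtain A' where A': "A = A' + {#{x, z}#}" using \<open>{x, z} \<in># A\<close> by (metis add_mset_add_single insert_DiffM)
      then have "C = A' + B" using that(3) by (simp add: ac_simps)
      then show ?thesis using A' immerses_split[OF that(1), of A' y] that(2)
        by (intro exI[of _ "A' + {#{x, y}, {y, z}#}"] exI[of _ B]) (simp add: ac_simps)
    qed
    show ?thesis
    proof (cases "x = z")
      case True
      then have "A + B = C" using red_split by simp
      then show ?thesis using red_split immerses_drop[of A "{#{x, y}, {y, z}#}"]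
        by (intro exI[of _ "A + {#{x, y}, {y, z}#}"] exI[of _ B]) (simp add: ac_simps)
    next
      case False
      then have eq: "A + B = C + {#{x, z}#}" using red_split by simp
      then have "{x, z} \<in># A + B" by simp
      then consider "{x, z} \<in># A" | "{x, z} \<in># B" by auto
      then show ?thesis
      proof cases
        case 2
        then obtain B0 A0 where "M = B0 + A0" "immerses B0 B" "immerses A0 A"
          using aux[OF False red_split(1), of B A] eq by (auto simp: ac_simps)
        then show ?thesis by (metis add.commute)
      qed (use aux[OF False red_split(1) eq] in blast)
    qed
  next
    case (red_delete e)
    then show ?thesis using immerses_drop[of A "{#e#}"]
      by (intro exI[of _ "A + {#e#}"] exI[of _ B]) (simp add: ac_simps)
  qed
  have "\<exists>A0 B0. M = A0 + B0 \<and> immerses A0 A \<and> immerses B0 B"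
    using assms unfolding immerses_def
  proof (induction rule: converse_rtranclp_induct)
    case (step M N)
    then obtain A0 B0 where AB: "N = A0 + B0" "immerses A0 A" "immerses B0 B"
      by (auto simp: immerses_def)
    with step(1) one obtain A1 B1 where "M = A1 + B1" "immerses A1 A0" "immerses B1 B0" by metis
    with AB show ?case by (metis immerses_trans immerses_def)
  next
    case base
    show ?case using immerses_refl by blast
  qed
  then show thesis using that by blast
qed

text \<open>Each edge produced by a split is replaced by the walk through the vertex at which it was
  split.\<close>

lemma immerses_linked:
  assumes "immerses E F" "linked F a b"
  shows "linked E a b"
proof -
  have one: "linked F a b \<Longrightarrow> linked E a b" if "red_step E F" for E F :: "'a set multiset" and a b
  proof -
    have edge: "linked E u v" if uv: "{u, v} \<in># F" for u v
      using \<open>red_step E F\<close>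
    proof cases
      case (red_split C x y z)
      show ?thesis
      proof (cases "{u, v} \<in># C")
        case False
        then have "{u, v} = {x, z}" using uv red_split by (auto split: if_splits)
        moreover have "linked E x z"
          by (rule linked_trans[of _ _ y]) (auto intro!: linked_edge simp: red_split)
        ultimately show ?thesis using linked_sym by (metis doubleton_eq_iff)
      qed (auto intro: linked_edge simp: red_split)
    qed (use uv in \<open>auto intro: linked_edge\<close>)
    show "linked E a b" if "linked F a b"
      using that unfolding linked_def[of F]
      by (induction rule: rtranclp_induct) (auto intro: linked_trans edge)
  qed
  from assms show ?thesis
    unfolding immerses_def by (induction rule: converse_rtranclp_induct) (auto intro: one)
qed

section \<open>Paths\<close>

fun path_edges :: "'v list \<Rightarrow> 'v set multiset" where
  "path_edges (a # b # p) = add_mset {a, b} (path_edges (b # p))"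
| "path_edges _ = {#}"

definition is_path :: "'v \<Rightarrow> 'v \<Rightarrow> 'v list \<Rightarrow> bool" where
  "is_path a b p \<longleftrightarrow> p \<noteq> [] \<and> hd p = a \<and> last p = b \<and> distinct p"

lemma path_edges_append: "path_edges (p @ v # q) = path_edges (p @ [v]) + path_edges (v # q)"
  by (induction p rule: path_edges.induct) auto

lemma path_edges_snoc: "p \<noteq> [] \<Longrightarrow> path_edges (p @ [v]) = add_mset {last p, v} (path_edges p)"
  by (induction p rule: path_edges.induct) auto

lemma path_edges_rev: "path_edges (rev p) = path_edges p"
proof (induction p rule: path_edges.induct)
  case (1 a b p)
  have "path_edges (rev (a # b # p)) = add_mset {b, a} (path_edges (rev (b # p)))"
    using path_edges_snoc[of "rev (b # p)" a] by simp
  then show ?case using 1 by (simp add: insert_commute)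
qed auto

lemma is_path_rev: "is_path a b p \<Longrightarrow> is_path b a (rev p)"
  by (auto simp: is_path_def hd_rev last_rev)

lemma path_edges_in: "e \<in># path_edges p \<Longrightarrow> e \<subseteq> set p"
  by (induction p rule: path_edges.induct) auto

lemma path_edges_card: "distinct p \<Longrightarrow> e \<in># path_edges p \<Longrightarrow> card e = 2"
  by (induction p rule: path_edges.induct) auto

lemma path_linked: "p \<noteq> [] \<Longrightarrow> linked (path_edges p) (hd p) (last p)"
proof (induction p rule: path_edges.induct)
  case (1 a b p)
  have "linked (path_edges (a # b # p)) b (last (b # p))"
    using 1 by (auto intro: linked_mono[of "path_edges (b # p)"])
  moreover have "linked (path_edges (a # b # p)) a b" by (rule linked_edge) simp
  ultimately show ?case by (simp add: linked_trans[of _ a b])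
qed auto

lemma is_path_linked: "is_path a b p \<Longrightarrow> linked (path_edges p) a b"
  by (metis is_path_def path_linked)

lemma is_path_ends: "is_path a b p \<Longrightarrow> a \<in> set p \<and> b \<in> set p"
  by (auto simp: is_path_def)

lemma path_linked_mem: "a \<in> set p \<Longrightarrow> b \<in> set p \<Longrightarrow> linked (path_edges p) a b"
proof -
  have *: "linked (path_edges p) (hd p) b" if "b \<in> set p" for b
  proof -
    obtain q r where "p = q @ b # r" using \<open>b \<in> set p\<close> split_list by fastforce
    moreover have "linked (path_edges (q @ [b])) (hd (q @ [b])) b"
      using path_linked[of "q @ [b]"] by simp
    ultimately show ?thesis
      using path_edges_append[of q b r] linked_add1 by (cases q) auto
  qed
  assume "a \<in> set p" "b \<in> set p"
  then show ?thesis using * linked_sym linked_trans by metis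
qed

lemma path_edges_set_sub:
  assumes "is_path a b p" "path_edges p \<subseteq># M" "simple_edges V M" "a \<in> V"
  shows "set p \<subseteq> V"
proof
  fix v assume "v \<in> set p"
  then have "linked (path_edges p) a v" using path_linked_mem assms(1) is_path_ends by metis
  then show "v \<in> V" using linked_in assms linked_mono by metis
qed

text \<open>If the vertex to be prepended already occurs, the suffix starting at it is kept
  instead.\<close>

lemma rtranclp_imp_path:
  assumes "r\<^sup>*\<^sup>* a b"
  obtains p where "is_path a b p" "successively r p"
proof -
  have "\<exists>p. is_path a b p \<and> successively r p"
    using assms
  proof (induction rule: converse_rtranclp_induct)
    case base
    show ?case by (rule exI[of _ "[b]"]) (simp add: is_path_def)
  next
    case (step a c)
    then obtain p where p: "is_path c b p" "successively r p" by blast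
    show ?case
    proof (cases "a \<in> set p")
      case True
      then obtain q s where "p = q @ a # s" using split_list by fastforce
      then show ?thesis using p
        by (intro exI[of _ "a # s"]) (auto simp: is_path_def successively_append_iff)
    next
      case False
      then show ?thesis using p step(1)
        by (intro exI[of _ "a # p"]) (auto simp: is_path_def successively_Cons)
    qed
  qed
  then show thesis using that by blast
qed

lemma count_path_edges_absent: "x \<notin> set p \<Longrightarrow> count (path_edges p) {x, y} = 0"
  by (metis count_eq_zero_iff insert_subset path_edges_in)

lemma distinct_path_edges: "distinct p \<Longrightarrow> count (path_edges p) e \<le> 1"
proof (induction p rule: path_edges.induct)
  case (1 a b p)
  have "count (path_edges (b # p)) {a, b} = 0" using 1 by (intro count_path_edges_absent) auto
  then show ?case using 1 by auto
qed auto

text \<open>A list without repetition uses every edge at most once, so containment of the edge sets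
  already gives inclusion of multisets.\<close>

lemma linked_imp_path:
  assumes "linked E a b"
  obtains p where "is_path a b p" "path_edges p \<subseteq># E"
proof -
  obtain p where p: "is_path a b p" "successively (\<lambda>u v. {u, v} \<in># E) p"
    using assms rtranclp_imp_path unfolding linked_def by metis
  have "set_mset (path_edges p) \<subseteq> set_mset E"
    using p(2) by (induction p rule: path_edges.induct) auto
  moreover have "count (path_edges p) e \<le> 1" for e using p(1) distinct_path_edges is_path_def by metis
  ultimately have "path_edges p \<subseteq># E"
    by (intro mset_subset_eqI) (metis count_greater_eq_one_iff count_inI le0 le_trans subsetD)
  then show thesis using that p(1) by blast
qed

text \<open>The tail is shortened to one edge and then split off together with the first edge;
  distinct ends keep the new edge from being a loop.\<close>

lemma path_immerses: "p \<noteq> [] \<Longrightarrow> distinct p \<Longrightarrow> hd p \<noteq> last p \<Longrightarrow> immerses (path_edges p) {#{hd p, last p}#}"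
proof (induction p rule: path_edges.induct)
  case (1 a b p)
  show ?case
  proof (cases "p = []")
    case False
    then have "b \<noteq> last p" using 1 by auto
    then have "immerses (path_edges (b # p)) {#{b, last p}#}" using 1 False by auto
    then have "immerses (path_edges (a # b # p)) ({#{b, last p}#} + {#{a, b}#})"
      using immerses_add_right[of "path_edges (b # p)" _ "{#{a, b}#}"] by simp
    also have "{#{b, last p}#} + {#{a, b}#} = {#} + {#{a, b}, {b, last p}#}" by simp
    also have "immerses \<dots> ({#} + {#{a, last p}#})"
      using 1 False by (intro immerses_split) simp
    finally show ?thesis using False by simp
  qed simp
qed simp_all

lemma linked_immerses: "linked E a b \<Longrightarrow> a \<noteq> b \<Longrightarrow> immerses E {#{a, b}#}"
proof -
  assume "linked E a b" "a \<noteq> b"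
  then obtain p where "is_path a b p" "path_edges p \<subseteq># E" using linked_imp_path by metis
  then show ?thesis
    using path_immerses[of p] immerses_sub immerses_trans \<open>a \<noteq> b\<close> unfolding is_path_def by metis
qed

text \<open>Each crossing changes the side. The parity later turns "at most one crossing" into
  "none".\<close>

lemma path_cut_parity: "distinct p \<Longrightarrow> p \<noteq> [] \<Longrightarrow> even (cut (path_edges p) X) \<longleftrightarrow> (hd p \<in> X \<longleftrightarrow> last p \<in> X)"
proof (induction p rule: path_edges.induct)
  case (1 a b p)
  have "a \<noteq> b" using 1 by auto
  have IH: "even (cut (path_edges (b # p)) X) \<longleftrightarrow> (b \<in> X \<longleftrightarrow> last (b # p) \<in> X)" using 1 by simp
  have eq: "cut (path_edges (a # b # p)) X =
      (if (a \<in> X) \<noteq> (b \<in> X) then 1 else 0) + cut (path_edges (b # p)) X"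
    using card_pair_Int[OF \<open>a \<noteq> b\<close>, of X] by simp
  have parity: "even ((if A \<noteq> B then 1 else 0) + c) \<longleftrightarrow> (A \<longleftrightarrow> L)" if "even c \<longleftrightarrow> (B \<longleftrightarrow> L)" for A B L and c :: nat
    using that by (cases A; cases B; cases L) simp_all
  have "hd (a # b # p) = a" "last (a # b # p) = last (b # p)" by simp_all
  then show ?case unfolding eq using parity[OF IH, of "a \<in> X"] by (simp only:)
qed simp_all

section \<open>Menger's theorem\<close>

definition edges_of :: "'v list multiset \<Rightarrow> 'v set multiset" where
  "edges_of P = (\<Sum>p\<in>#P. path_edges p)"

lemma edges_of_simps [simp]:
  "edges_of {#} = {#}" "edges_of (add_mset p P) = path_edges p + edges_of P"
  "edges_of (P + Q) = edges_of P + edges_of Q"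
  by (simp_all add: edges_of_def)

definition arc :: "'v \<Rightarrow> 'v \<Rightarrow> 'v \<Rightarrow> 'v \<Rightarrow> int" where
  "arc a b x y = of_bool (x = a \<and> y = b)"

text \<open>One unit sent along the list as a net flow. Its divergence telescopes to the difference
  of the indicators of the two ends (\<open>sum_unit_flow\<close>).\<close>

fun unit_flow :: "'v list \<Rightarrow> 'v \<Rightarrow> 'v \<Rightarrow> int" where
  "unit_flow (a # b # p) x y = arc a b x y - arc b a x y + unit_flow (b # p) x y"
| "unit_flow _ x y = 0"

text \<open>Net flows suit undirected edges: antisymmetry and the bound for both orders of the ends
  give an absolute value of at most the multiplicity.\<close>

definition feasible :: "'v set multiset \<Rightarrow> ('v \<Rightarrow> 'v \<Rightarrow> int) \<Rightarrow> bool" where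
  "feasible M f \<longleftrightarrow> (\<forall>x y. f x y = - f y x \<and> f x y \<le> int (count M {x, y}))"

lemma arc_swap: "arc a b y x = arc b a x y"
  unfolding arc_def by (simp add: conj_commute)

lemma arc_same [simp]: "arc a b a b = 1"
  by (simp add: arc_def)

lemma arc_eq_0: "x \<noteq> a \<or> y \<noteq> b \<Longrightarrow> arc a b x y = 0"
  unfolding arc_def by simp

lemma unit_flow_absent: "x \<notin> set p \<or> y \<notin> set p \<Longrightarrow> unit_flow p x y = 0"
proof (induction p rule: path_edges.induct)
  case (1 a b p)
  then have "unit_flow (b # p) x y = 0" by fastforce
  moreover have "arc a b x y = 0" "arc b a x y = 0" using 1(2) by (auto intro!: arc_eq_0)
  ultimately show ?case by simp
qed simp_all

lemma unit_flow_antisym: "unit_flow p x y = - unit_flow p y x"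
proof (induction p rule: path_edges.induct)
  case (1 a b p)
  then show ?case by (simp add: arc_swap[of a b x y] arc_swap[of b a x y])
qed simp_all

lemma unit_flow_count:
  assumes "distinct p" "x \<noteq> y"
  shows "\<bar>unit_flow p x y\<bar> = int (count (path_edges p) {x, y})"
  using assms(1)
proof (induction p rule: path_edges.induct)
  case (1 a b p)
  have ab: "a \<noteq> b" "distinct (b # p)" "a \<notin> set (b # p)" using 1(2) by simp_all
  consider "x = a" "y = b" | "x = b" "y = a" | "{x, y} \<noteq> {a, b}" by fastforce
  then show ?case
  proof cases
    case 3
    then have "arc a b x y = 0" "arc b a x y = 0" by (auto intro!: arc_eq_0)
    then show ?thesis using 1(1)[OF ab(2)] 3 by simp
  next
    case 1
    have "unit_flow (b # p) a b = 0" using ab(3) by (intro unit_flow_absent) simp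
    moreover have "count (path_edges (b # p)) {a, b} = 0" using ab(3) by (rule count_path_edges_absent)
    moreover have "arc b a a b = 0" using ab(1) by (simp add: arc_eq_0)
    ultimately show ?thesis using 1 by simp
  next
    case 2
    have "unit_flow (b # p) b a = 0" using ab(3) by (intro unit_flow_absent) simp
    moreover have "count (path_edges (b # p)) {a, b} = 0" using ab(3) by (rule count_path_edges_absent)
    moreover have "arc a b b a = 0" using ab(1) by (simp add: arc_eq_0)
    moreover have "{b, a} = {a, b}" by auto
    ultimately show ?thesis using 2 by simp
  qed
qed simp_all

lemma unit_flow_successively:
  assumes "distinct p" "unit_flow p x y > 0" "successively r p"
  shows "r x y"
  using assms
proof (induction p rule: path_edges.induct)
  case (1 a b p)
  show ?case
  proof (cases "x = a \<and> y = b")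
    case True
    then show ?thesis using 1(4) by simp
  next
    case False
    then have "arc a b x y = 0" by (auto intro!: arc_eq_0)
    moreover have "arc b a x y \<ge> 0" by (simp add: arc_def)
    ultimately have "unit_flow (b # p) x y > 0" using 1(3) by simp
    then show ?thesis using 1(1,2,4) by simp
  qed
qed simp_all

lemma sum_arc: "finite V \<Longrightarrow> b \<in> V \<Longrightarrow> (\<Sum>y\<in>V. arc a b v y) = of_bool (v = a)"
proof -
  assume "finite V" "b \<in> V"
  have "(\<Sum>y\<in>V. arc a b v y) = (\<Sum>y\<in>V. if y = b then of_bool (v = a) else 0)"
    by (intro sum.cong refl) (simp add: arc_def)
  then show ?thesis using \<open>finite V\<close> \<open>b \<in> V\<close> by simp
qed

lemma sum_unit_flow:
  assumes "finite V" "set p \<subseteq> V" "p \<noteq> []"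
  shows "(\<Sum>y\<in>V. unit_flow p v y) = of_bool (v = hd p) - of_bool (v = last p)"
  using assms(2,3)
proof (induction p rule: path_edges.induct)
  case (1 a b p)
  then have "(\<Sum>y\<in>V. unit_flow (b # p) v y) = of_bool (v = b) - of_bool (v = last (b # p))" by simp
  moreover have "(\<Sum>y\<in>V. arc a b v y) = of_bool (v = a)" "(\<Sum>y\<in>V. arc b a v y) = of_bool (v = b)"
    using 1(2) by (simp_all add: sum_arc assms(1))
  ultimately show ?case by (simp add: sum.distrib sum_subtractf)
qed simp_all

lemma cut_as_sum:
  assumes "simple_edges V M" "S \<subseteq> V"
  shows "cut M S = (\<Sum>x\<in>S. \<Sum>y\<in>V - S. count M {x, y})"
  using assms(1)
proof (induction M)
  case (add e M)
  have fin: "finite V" "finite S" using add.prems assms(2) by (auto simp: simple_edges_def finite_subset)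
  have IH: "cut M S = (\<Sum>x\<in>S. \<Sum>y\<in>V - S. count M {x, y})" using add by (simp add: simple_edges_def)
  obtain a b where e: "e = {a, b}" "a \<noteq> b" "a \<in> V" "b \<in> V"
    by (rule simple_edgesD[OF add.prems, of e]) simp_all
  have *: "(\<Sum>x\<in>S. \<Sum>y\<in>V - S. of_bool ({x, y} = {u, w})) = (1::nat)"
    if uw: "u \<in> S" "w \<in> V - S" for u w
  proof -
    have "(\<Sum>x\<in>S. \<Sum>y\<in>V - S. of_bool ({x, y} = {u, w})) = (\<Sum>x\<in>S. if x = u then (1::nat) else 0)"
    proof (rule sum.cong[OF refl])
      fix x assume "x \<in> S"
      have "{x, y} = {u, w} \<longleftrightarrow> x = u \<and> y = w" if "y \<in> V - S" for y
        using that uw \<open>x \<in> S\<close> by (metis DiffD2 doubleton_eq_iff)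
      then have "(\<Sum>y\<in>V - S. of_bool ({x, y} = {u, w}))
          = (\<Sum>y\<in>V - S. if y = w then of_bool (x = u) else (0::nat))"
        by (intro sum.cong refl) simp
      then show "(\<Sum>y\<in>V - S. of_bool ({x, y} = {u, w})) = (if x = u then (1::nat) else 0)"
        using uw fin by simp
    qed
    then show ?thesis using uw fin by simp
  qed
  have "(\<Sum>x\<in>S. \<Sum>y\<in>V - S. of_bool ({x, y} = e)) = (if card (e \<inter> S) = 1 then 1 else (0::nat))"
  proof (cases "card (e \<inter> S) = 1")
    case True
    then have "(a \<in> S) \<noteq> (b \<in> S)" using card_pair_Int[OF e(2)] e(1) by simp
    then consider "a \<in> S" "b \<in> V - S" | "b \<in> S" "a \<in> V - S" using e by blast
    then have "(\<Sum>x\<in>S. \<Sum>y\<in>V - S. of_bool ({x, y} = e)) = (1::nat)"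
    proof cases
      case 2
      then show ?thesis using *[of b a] e(1) by (simp add: insert_commute)
    qed (use * e(1) in simp)
    then show ?thesis using True by simp
  next
    case False
    then have "(a \<in> S) = (b \<in> S)" using card_pair_Int[OF e(2)] e(1) by simp
    then have "{x, y} \<noteq> e" if "x \<in> S" "y \<in> V - S" for x y
      using that e(1) by (metis DiffD2 doubleton_eq_iff)
    then have "(\<Sum>x\<in>S. \<Sum>y\<in>V - S. of_bool ({x, y} = e)) = (0::nat)"
      by (intro sum.neutral ballI) simp
    then show ?thesis using False by simp
  qed
  moreover have "(\<Sum>x\<in>S. \<Sum>y\<in>V - S. count (add_mset e M) {x, y})
      = (\<Sum>x\<in>S. \<Sum>y\<in>V - S. of_bool ({x, y} = e)) + (\<Sum>x\<in>S. \<Sum>y\<in>V - S. count M {x, y})"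
    unfolding sum.distrib[symmetric] by (intro sum.cong refl) simp
  ultimately show ?case using IH by simp
qed simp

text \<open>The flow between two vertices of \<open>S\<close> cancels by antisymmetry.\<close>

lemma flow_across:
  assumes "feasible M f" "finite V" "S \<subseteq> V"
  shows "(\<Sum>v\<in>S. \<Sum>y\<in>V. f v y) = (\<Sum>v\<in>S. \<Sum>y\<in>V - S. f v y)"
proof -
  have fin: "finite S" using assms finite_subset by auto
  have split: "(\<Sum>v\<in>S. \<Sum>y\<in>V. f v y) = (\<Sum>v\<in>S. \<Sum>y\<in>S. f v y) + (\<Sum>v\<in>S. \<Sum>y\<in>V - S. f v y)"
    unfolding sum.distrib[symmetric]
  proof (rule sum.cong[OF refl])
    fix v
    show "(\<Sum>y\<in>V. f v y) = (\<Sum>y\<in>S. f v y) + (\<Sum>y\<in>V - S. f v y)"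
      using sum.subset_diff[OF assms(3,2), of "f v"] by simp
  qed
  have "(\<Sum>v\<in>S. \<Sum>y\<in>S. f v y) = (\<Sum>v\<in>S. \<Sum>y\<in>S. - f y v)"
    using assms(1) unfolding feasible_def by (intro sum.cong refl) blast
  also have "\<dots> = - (\<Sum>y\<in>S. \<Sum>v\<in>S. f y v)" by (subst sum.swap) (simp add: sum_negf)
  finally have "(\<Sum>v\<in>S. \<Sum>y\<in>S. f v y) = 0" by simp
  then show ?thesis using split by simp
qed

definition is_flow :: "'v set \<Rightarrow> 'v set multiset \<Rightarrow> 'v \<Rightarrow> 'v \<Rightarrow> nat \<Rightarrow> ('v \<Rightarrow> 'v \<Rightarrow> int) \<Rightarrow> bool" where
  "is_flow V M s t k f \<longleftrightarrow> feasible M f \<and>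
     (\<forall>v\<in>V. (\<Sum>y\<in>V. f v y) = int k * (of_bool (v = s) - of_bool (v = t)))"

lemma flow_value:
  assumes "is_flow V M s t k f" "finite V" "S \<subseteq> V" "s \<in> S" "t \<notin> S"
  shows "int k = (\<Sum>v\<in>S. \<Sum>y\<in>V - S. f v y)"
proof -
  have "finite S" using assms finite_subset by auto
  have "(\<Sum>v\<in>S. \<Sum>y\<in>V. f v y) = (\<Sum>v\<in>S. if v = s then int k else 0)"
  proof (rule sum.cong[OF refl])
    fix v assume "v \<in> S"
    then have "v \<noteq> t" "v \<in> V" using assms by auto
    then show "(\<Sum>y\<in>V. f v y) = (if v = s then int k else 0)" using assms(1) by (simp add: is_flow_def)
  qed
  also have "\<dots> = int k" using \<open>finite S\<close> assms by simp
  finally show ?thesis using flow_across[of M f V S] assms by (simp add: is_flow_def)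
qed

text \<open>Augmentation along a residual path. If \<open>t\<close> is not reachable from
  \<open>s\<close> in the residual graph, the reachable set is a cut whose edges are all saturated,
  hence of size \<open>k\<close>, against the assumed bound \<open>Suc k\<close>.\<close>

lemma flow_exists:
  assumes M: "simple_edges V M" and st: "s \<in> V" "t \<in> V" "s \<noteq> t"
    and cuts: "\<And>X. X \<subseteq> V \<Longrightarrow> s \<in> X \<Longrightarrow> t \<notin> X \<Longrightarrow> k \<le> cut M X"
  shows "\<exists>f. is_flow V M s t k f"
  using cuts
proof (induction k)
  case 0
  show ?case by (rule exI[of _ "\<lambda>_ _. 0"]) (simp add: is_flow_def feasible_def)
next
  case (Suc k)
  have fin: "finite V" using M by (simp add: simple_edges_def)
  have "\<And>X. X \<subseteq> V \<Longrightarrow> s \<in> X \<Longrightarrow> t \<notin> X \<Longrightarrow> k \<le> cut M X" using Suc.prems Suc_leD by blast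
  then obtain f where f: "is_flow V M s t k f" using Suc.IH by blast
  then have feas: "f x y = - f y x" "f x y \<le> int (count M {x, y})" for x y
    unfolding is_flow_def feasible_def by blast+
  \<comment> \<open>The residual arcs.\<close>
  define r where "r = (\<lambda>x y. f x y < int (count M {x, y}))"
  have rV: "x \<in> V \<and> y \<in> V" if "r x y" for x y
  proof -
    have "count M {x, y} > 0"
    proof (rule ccontr)
      \<comment> \<open>Without an edge between \<open>x\<close> and \<open>y\<close> both
        \<open>f x y\<close> and \<open>f y x\<close> are at most 0, hence both 0, so the arc is not
        residual.\<close>
      assume "\<not> count M {x, y} > 0"
      then have z: "count M {x, y} = 0" by (simp only: not_gr_zero)
      have "f x y < 0" using that z unfolding r_def by (metis of_nat_0)
      moreover have "f y x \<le> 0" using feas(2)[of y x] z by (metis insert_commute of_nat_0)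
      ultimately show False using feas(1)[of x y] by linarith
    qed
    then show ?thesis using simple_edges_pair[OF M] by simp
  qed
  define S where "S = {v \<in> V. r\<^sup>*\<^sup>* s v}"
  have "t \<in> S"
  proof (rule ccontr)
    assume "t \<notin> S"
    have S: "S \<subseteq> V" "s \<in> S" using st by (auto simp: S_def)
    have "f x y = int (count M {x, y})" if "x \<in> S" "y \<in> V - S" for x y
    proof -
      have "\<not> r x y" using that by (auto simp: S_def dest: rtranclp.rtrancl_into_rtrancl)
      then show ?thesis using feas(2)[of x y] by (simp add: r_def)
    qed
    then have "int k = int (cut M S)"
      using flow_value[OF f fin S \<open>t \<notin> S\<close>] cut_as_sum[OF M S(1)] by simp
    then show False using Suc.prems[OF S \<open>t \<notin> S\<close>] by simp
  qed
  then obtain p where p: "is_path s t p" "successively r p"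
    using rtranclp_imp_path by (metis S_def mem_Collect_eq)
  have "r\<^sup>*\<^sup>* s v" if "v \<in> set p" for v
  proof -
    have "\<forall>v\<in>set p. r\<^sup>*\<^sup>* (hd p) v" using p(2)
    proof (induction p)
      case (Cons a p)
      then show ?case by (cases p) (auto intro: converse_rtranclp_into_rtranclp)
    qed simp
    then show ?thesis using p(1) that by (simp add: is_path_def)
  qed
  moreover have "v \<in> V" if "r\<^sup>*\<^sup>* s v" for v
    using that by (induction rule: rtranclp_induct) (use st rV in auto)
  ultimately have pV: "set p \<subseteq> V" by blast
  define g where "g = (\<lambda>x y. f x y + unit_flow p x y)"
  have pd: "distinct p" "p \<noteq> []" "hd p = s" "last p = t" using p by (auto simp: is_path_def)
  have "g x y \<le> int (count M {x, y})" for x y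
  proof (cases "unit_flow p x y > 0")
    case True
    then have "r x y" using unit_flow_successively pd p(2) by metis
    moreover have "x \<noteq> y" using True unit_flow_antisym[of p x y] by auto
    then have "unit_flow p x y \<le> 1"
      using unit_flow_count[OF pd(1), of x y] distinct_path_edges[OF pd(1), of "{x, y}"] by linarith
    ultimately show ?thesis by (simp add: g_def r_def)
  next
    case False
    then show ?thesis using feas(2)[of x y] by (simp add: g_def)
  qed
  moreover have "g x y = - g y x" for x y
    using feas(1)[of x y] unit_flow_antisym[of p x y] by (simp add: g_def)
  moreover have "(\<Sum>y\<in>V. g v y) = int (Suc k) * (of_bool (v = s) - of_bool (v = t))"
    if "v \<in> V" for v
  proof -
    define d :: int where "d = of_bool (v = s) - of_bool (v = t)"
    have "(\<Sum>y\<in>V. f v y) = int k * d" "(\<Sum>y\<in>V. unit_flow p v y) = d"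
      using f that sum_unit_flow[OF fin pV pd(2), of v] unfolding d_def pd(3,4) by (simp_all only: is_flow_def)
    moreover have "(\<Sum>y\<in>V. g v y) = (\<Sum>y\<in>V. f v y) + (\<Sum>y\<in>V. unit_flow p v y)"
      by (simp add: g_def sum.distrib)
    ultimately show ?thesis unfolding d_def[symmetric] by (simp add: algebra_simps)
  qed
  ultimately have "is_flow V M s t (Suc k) g" unfolding is_flow_def feasible_def by blast
  then show ?case by blast
qed

text \<open>A path is peeled off along arcs with positive flow, and its edges are removed from
  \<open>M\<close> so that the remaining paths are edge-disjoint from it.\<close>

lemma flow_decompose:
  assumes "simple_edges V M" "s \<in> V" "t \<in> V" "s \<noteq> t" "is_flow V M s t k f"
  shows "\<exists>P. size P = k \<and> (\<forall>p\<in>#P. is_path s t p) \<and> edges_of P \<subseteq># M"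
  using assms(1,5)
proof (induction k arbitrary: M f)
  case 0
  then show ?case by (intro exI[of _ "{#}"]) simp
next
  case (Suc k)
  note M = Suc.prems(1) and f = Suc.prems(2)
  have fin: "finite V" using M by (simp add: simple_edges_def)
  have feas: "f x y = - f y x" "f x y \<le> int (count M {x, y})" for x y
    using f unfolding is_flow_def feasible_def by blast+
  define r where "r = (\<lambda>x y. f x y > 0)"
  define S where "S = {v \<in> V. r\<^sup>*\<^sup>* s v}"
  have rM: "{x, y} \<in># M" if "r x y" for x y
    using that feas(2)[of x y] unfolding r_def by (metis count_inI leD of_nat_0)
  \<comment> \<open>Otherwise no positive arc leaves \<open>S\<close>, although the net flow out of
    \<open>S\<close> is \<open>Suc k\<close>.\<close>
  have "t \<in> S"
  proof (rule ccontr)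
    assume "t \<notin> S"
    have S: "S \<subseteq> V" "s \<in> S" using assms by (auto simp: S_def)
    have "f x y \<le> 0" if "x \<in> S" "y \<in> V - S" for x y
      using that by (force simp: S_def r_def dest: rtranclp.rtrancl_into_rtrancl)
    then have "(\<Sum>v\<in>S. \<Sum>y\<in>V - S. f v y) \<le> 0" by (intro sum_nonpos) auto
    then show False using flow_value[OF f fin S \<open>t \<notin> S\<close>] by simp
  qed
  then obtain p where p: "is_path s t p" "successively r p"
    using rtranclp_imp_path by (metis S_def mem_Collect_eq)
  have pd: "distinct p" "p \<noteq> []" "hd p = s" "last p = t" using p by (auto simp: is_path_def)
  have "set_mset (path_edges p) \<subseteq> set_mset M"
    using p(2) by (induction p rule: path_edges.induct) (auto dest: rM)
  then have sub: "path_edges p \<subseteq># M"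
    using distinct_path_edges[OF pd(1)]
    by (intro mset_subset_eqI) (metis count_greater_eq_one_iff count_inI le0 le_trans subsetD)
  have pV: "set p \<subseteq> V" using path_edges_set_sub[OF p(1) sub M assms(2)] .
  define g where "g = (\<lambda>x y. f x y - unit_flow p x y)"
  have "g x y \<le> int (count (M - path_edges p) {x, y})" for x y
  proof (cases "x = y")
    case True
    then show ?thesis using feas(1)[of x y] unit_flow_antisym[of p x y] by (simp add: g_def)
  next
    case False
    have c: "\<bar>unit_flow p x y\<bar> = int (count (path_edges p) {x, y})" using unit_flow_count[OF pd(1) False] .
    have le: "count (path_edges p) {x, y} \<le> 1" "count (path_edges p) {x, y} \<le> count M {x, y}"
      using distinct_path_edges[OF pd(1)] sub by (auto simp: mset_subset_eq_count)
    have pos: "f x y > 0" if "unit_flow p x y > 0" for x y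
      using unit_flow_successively[OF pd(1) that p(2)] by (simp add: r_def)
    have cnt: "int (count (M - path_edges p) {x, y}) = int (count M {x, y}) - int (count (path_edges p) {x, y})"
      using le by (simp add: of_nat_diff)
    consider "unit_flow p x y > 0" | "unit_flow p x y = 0" | "unit_flow p y x > 0"
      using unit_flow_antisym[of p x y] by linarith
    then show ?thesis
    proof cases
      case 1
      then have "unit_flow p x y = int (count (path_edges p) {x, y})" using c by simp
      then show ?thesis unfolding g_def cnt using feas(2)[of x y] by simp
    next
      case 2
      then have "int (count (path_edges p) {x, y}) = 0" using c by simp
      then show ?thesis unfolding g_def cnt 2 using feas(2)[of x y] by simp
    next
      \<comment> \<open>The path runs from \<open>y\<close> to \<open>x\<close>, so
        \<open>f x y\<close> is at most -1 and subtracting the path raises it to at most 0; the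
        capacity drops by 1 but stays nonnegative.\<close>
      case 3
      then have "f x y < 0" using pos[of y x] feas(1)[of x y] by simp
      moreover have "unit_flow p x y = - int (count (path_edges p) {x, y})"
        using 3 c unit_flow_antisym[of p x y] by simp
      moreover have "count (path_edges p) {x, y} = 1" using calculation(2) 3 le(1) unit_flow_antisym[of p x y]
        by linarith
      ultimately show ?thesis unfolding g_def cnt using le(2) by linarith
    qed
  qed
  moreover have "g x y = - g y x" for x y
    using feas(1)[of x y] unit_flow_antisym[of p x y] by (simp add: g_def)
  moreover have "(\<Sum>y\<in>V. g v y) = int k * (of_bool (v = s) - of_bool (v = t))"
    if "v \<in> V" for v
  proof -
    define d :: int where "d = of_bool (v = s) - of_bool (v = t)"
    have "(\<Sum>y\<in>V. f v y) = int (Suc k) * d" "(\<Sum>y\<in>V. unit_flow p v y) = d"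
      using f that sum_unit_flow[OF fin pV pd(2), of v] unfolding d_def pd(3,4) by (simp_all only: is_flow_def)
    moreover have "(\<Sum>y\<in>V. g v y) = (\<Sum>y\<in>V. f v y) - (\<Sum>y\<in>V. unit_flow p v y)"
      by (simp add: g_def sum_subtractf)
    ultimately show ?thesis unfolding d_def[symmetric] by (simp add: algebra_simps)
  qed
  ultimately have "is_flow V (M - path_edges p) s t k g" unfolding is_flow_def feasible_def by blast
  moreover have "simple_edges V (M - path_edges p)" using M by (rule simple_edges_mono) simp
  ultimately obtain P where P: "size P = k" "\<forall>p\<in>#P. is_path s t p" "edges_of P \<subseteq># M - path_edges p"
    using Suc.IH by blast
  then have "edges_of (add_mset p P) \<subseteq># M" using sub
    by (metis add.commute edges_of_simps(2) subset_mset.le_diff_conv2)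
  then show ?case using P p(1) by (intro exI[of _ "add_mset p P"]) simp
qed

theorem menger:
  assumes "simple_edges V M" "s \<in> V" "t \<in> V" "s \<noteq> t"
    and "\<And>X. X \<subseteq> V \<Longrightarrow> s \<in> X \<Longrightarrow> t \<notin> X \<Longrightarrow> k \<le> cut M X"
  obtains P where "size P = k" "\<forall>p \<in># P. is_path s t p" "edges_of P \<subseteq># M"
  using flow_exists[OF assms] flow_decompose[OF assms(1-4)] by metis

lemma edges_of_mono: "P \<subseteq># Q \<Longrightarrow> edges_of P \<subseteq># edges_of Q"
  by (metis edges_of_simps(3) mset_subset_eq_add_left subset_mset.add_diff_inverse)

lemma cut_paths_ge:
  assumes "\<And>p. p \<in># P \<Longrightarrow> is_path s t p" "(s \<in> X) \<noteq> (t \<in> X)"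
  shows "cut (edges_of P) X \<ge> size P"
  using assms(1)
proof (induction P)
  case (add p P)
  then have "cut (path_edges p) X \<ge> 1" using linked_cut[OF is_path_linked assms(2)] by simp
  then show ?case using add by simp
qed simp

text \<open>Adding \<open>k\<close> edges between the two targets turns them into a single one; each path is cut
  off at the first target it meets.\<close>

lemma menger_two_targets:
  assumes M: "simple_edges V M" and V: "y \<in> V" "t \<in> V" "t' \<in> V" "y \<noteq> t" "y \<noteq> t'" "t \<noteq> t'"
    and cuts: "\<And>X. X \<subseteq> V \<Longrightarrow> y \<in> X \<Longrightarrow> t \<notin> X \<Longrightarrow> t' \<notin> X \<Longrightarrow> k \<le> cut M X"
  obtains P where "size P = k" "\<forall>p \<in># P. is_path y t p \<or> is_path y t' p"
    "edges_of P \<subseteq># {#e \<in># M. e \<noteq> {t, t'}#}"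
proof -
  let ?N = "M + replicate_mset k {t, t'}"
  have N: "simple_edges V ?N" using M V by (auto simp: simple_edges_def)
  have "k \<le> cut ?N X" if "X \<subseteq> V" "y \<in> X" "t \<notin> X" for X
  proof (cases "t' \<in> X")
    case True
    then have "card ({t, t'} \<inter> X) = 1" using that card_pair_Int[OF V(6), of X] by simp
    then have "cut (replicate_mset k {t, t'}) X = k" by (induction k) simp_all
    then show ?thesis by simp
  next
    case False
    then show ?thesis using cuts[OF that] by (simp add: trans_le_add1)
  qed
  then obtain P where P: "size P = k" "\<And>p. p \<in># P \<Longrightarrow> is_path y t p" "edges_of P \<subseteq># ?N"
    using menger[OF N V(1,2,4)] by metis
  have trunc: "\<exists>q. (is_path y t q \<or> is_path y t' q) \<and> path_edges q \<subseteq># {#e \<in># path_edges p. e \<noteq> {t, t'}#}"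
    if p: "is_path y t p" for p
  proof -
    have "\<exists>x\<in>set p. x \<in> {t, t'}" using p is_path_ends by fastforce
    then obtain q x r where q: "p = q @ x # r" "x \<in> {t, t'}" "\<forall>z\<in>set q. z \<notin> {t, t'}"
      using split_list_first_prop[of p "\<lambda>x. x \<in> {t, t'}"] by blast
    have "q \<noteq> []" using p q V by (auto simp: is_path_def)
    then have "is_path y x (q @ [x])" using p q by (auto simp: is_path_def)
    moreover have "path_edges (q @ [x]) \<subseteq># path_edges p" unfolding q(1) path_edges_append[of q x r] by simp
    moreover have "{t, t'} \<notin># path_edges (q @ [x])"
    proof
      assume "{t, t'} \<in># path_edges (q @ [x])"
      then have "{t, t'} \<subseteq> set (q @ [x])" by (rule path_edges_in)
      then show False using q V(6) by auto
    qed
    moreover from this have "{#e \<in># path_edges (q @ [x]). e \<noteq> {t, t'}#} = path_edges (q @ [x])"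
      by (auto simp: filter_mset_eq_conv)
    ultimately have "path_edges (q @ [x]) \<subseteq># {#e \<in># path_edges p. e \<noteq> {t, t'}#}"
      by (metis multiset_filter_mono)
    then show ?thesis using q(2) \<open>is_path y x (q @ [x])\<close> by auto
  qed
  then obtain f where f: "\<And>p. is_path y t p \<Longrightarrow> is_path y t (f p) \<or> is_path y t' (f p)"
      "\<And>p. is_path y t p \<Longrightarrow> path_edges (f p) \<subseteq># {#e \<in># path_edges p. e \<noteq> {t, t'}#}"
    by metis
  have "edges_of (image_mset f P) \<subseteq># {#e \<in># edges_of P. e \<noteq> {t, t'}#}"
    using P(2)
  proof (induction P)
    case (add p P)
    then show ?case using f(2)[of p] by (simp add: subset_mset.add_mono)
  qed simp
  also have "\<dots> \<subseteq># {#e \<in># ?N. e \<noteq> {t, t'}#}" using P(3) by (rule multiset_filter_mono)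
  also have "\<dots> = {#e \<in># M. e \<noteq> {t, t'}#}" by (auto simp: filter_mset_eq_conv)
  finally have sub: "edges_of (image_mset f P) \<subseteq># {#e \<in># M. e \<noteq> {t, t'}#}" .
  show thesis
  proof (rule that[OF _ _ sub])
    show "size (image_mset f P) = k" using P(1) by simp
    show "\<forall>p \<in># image_mset f P. is_path y t p \<or> is_path y t' p"
    proof
      fix p assume "p \<in># image_mset f P"
      then obtain q where "q \<in># P" "p = f q" by auto
      then show "is_path y t p \<or> is_path y t' p" using f(1) P(2) by simp
    qed
  qed
qed

section \<open>Rooted immersions of D\<close>

definition D_edges :: "nat \<Rightarrow> 'v \<Rightarrow> 'v \<Rightarrow> 'v \<Rightarrow> 'v \<Rightarrow> 'v set multiset" where
  "D_edges m x0 x1 u v =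
     {#{x0, u}, {x0, v}, {x1, u}, {x1, v}, {u, v}#} + replicate_mset (m - 2) {x0, x1}"

definition has_D :: "nat \<Rightarrow> 'v set \<Rightarrow> 'v set multiset \<Rightarrow> 'v \<Rightarrow> 'v \<Rightarrow> bool" where
  "has_D m V M x0 x1 \<longleftrightarrow>
     (\<exists>u \<in> V - {x0, x1}. \<exists>v \<in> V - {x0, x1}. u \<noteq> v \<and> immerses M (D_edges m x0 x1 u v))"

lemma has_D_sym: "has_D m V M x0 x1 \<Longrightarrow> has_D m V M x1 x0"
proof -
  have "D_edges m x1 x0 u v = D_edges m x0 x1 u v" for u v
    by (simp add: D_edges_def insert_commute add_mset_commute)
  then show "has_D m V M x0 x1 \<Longrightarrow> has_D m V M x1 x0" by (simp add: has_D_def insert_commute)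
qed

lemma has_D_immerses: "has_D m W N x0 x1 \<Longrightarrow> immerses M N \<Longrightarrow> W \<subseteq> V \<Longrightarrow> has_D m V M x0 x1"
  unfolding has_D_def using immerses_trans by blast

text \<open>Peeling off one parallel edge at a time with \<open>immerses_splitD\<close>.\<close>

lemma immerses_replicateD:
  assumes "immerses M (replicate_mset k {a, b})" "a \<noteq> b"
  shows "\<exists>P. size P = k \<and> (\<forall>p\<in>#P. is_path a b p) \<and> edges_of P \<subseteq># M"
  using assms(1)
proof (induction k arbitrary: M)
  case 0
  show ?case by (intro exI[of _ "{#}"]) simp
next
  case (Suc k)
  then have "immerses M ({#{a, b}#} + replicate_mset k {a, b})" by simp
  then obtain A B where AB: "M = A + B" "immerses A {#{a, b}#}" "immerses B (replicate_mset k {a, b})"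
    by (rule immerses_splitD)
  have "linked A a b" using AB(2) by (rule immerses_linked) (simp add: linked_edge)
  then obtain p where p: "is_path a b p" "path_edges p \<subseteq># A" by (rule linked_imp_path)
  obtain P where P: "size P = k" "\<forall>p\<in>#P. is_path a b p" "edges_of P \<subseteq># B" using Suc.IH[OF AB(3)] by blast
  then show ?case using p AB(1) by (intro exI[of _ "add_mset p P"]) (simp add: subset_mset.add_mono)
qed

lemma immerses_replicateI:
  assumes "\<And>p. p \<in># P \<Longrightarrow> is_path a b p" "a \<noteq> b"
  shows "immerses (edges_of P) (replicate_mset (size P) {a, b})"
  using assms(1)
proof (induction P)
  case (add p P)
  have "immerses (path_edges p) {#{a, b}#}"
    using add.prems[of p] path_immerses[of p] assms(2) by (simp add: is_path_def)
  moreover have "immerses (edges_of P) (replicate_mset (size P) {a, b})"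
    using add by simp
  ultimately show ?case using immerses_add by fastforce
qed simp

lemma immerses_singleD: "immerses A {#{a, b}#} \<Longrightarrow> linked A a b"
  by (erule immerses_linked) (simp add: linked_edge)

text \<open>Pulling the partition of the edges of D back through the immersion leaves five
  connections and \<open>m - 2\<close> paths, all edge-disjoint. \<open>has_DI\<close> is the
  converse.\<close>

lemma has_DE:
  assumes "has_D m V M x0 x1" "x0 \<noteq> x1"
  obtains u v E1 E2 E3 E4 E5 P where
    "u \<in> V - {x0, x1}" "v \<in> V - {x0, x1}" "u \<noteq> v"
    "linked E1 x0 u" "linked E2 x0 v" "linked E3 x1 u" "linked E4 x1 v" "linked E5 u v"
    "size P = m - 2" "\<forall>p\<in>#P. is_path x0 x1 p"
    "E1 + E2 + E3 + E4 + E5 + edges_of P \<subseteq># M"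
proof -
  obtain u v where uv: "u \<in> V - {x0, x1}" "v \<in> V - {x0, x1}" "u \<noteq> v"
      "immerses M (D_edges m x0 x1 u v)"
    using assms(1) unfolding has_D_def by blast
  have "D_edges m x0 x1 u v =
      {#{x0, u}#} + ({#{x0, v}#} + ({#{x1, u}#} + ({#{x1, v}#} + ({#{u, v}#} + replicate_mset (m - 2) {x0, x1}))))"
    by (simp add: D_edges_def)
  with uv(4) have "immerses M ({#{x0, u}#} + ({#{x0, v}#} + ({#{x1, u}#} + ({#{x1, v}#} + ({#{u, v}#} + replicate_mset (m - 2) {x0, x1})))))"
    by simp
  then obtain E1 F1 where 1: "M = E1 + F1" "immerses E1 {#{x0, u}#}"
      "immerses F1 ({#{x0, v}#} + ({#{x1, u}#} + ({#{x1, v}#} + ({#{u, v}#} + replicate_mset (m - 2) {x0, x1}))))"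
    by (rule immerses_splitD)
  from 1(3) obtain E2 F2 where 2: "F1 = E2 + F2" "immerses E2 {#{x0, v}#}"
      "immerses F2 ({#{x1, u}#} + ({#{x1, v}#} + ({#{u, v}#} + replicate_mset (m - 2) {x0, x1})))"
    by (rule immerses_splitD)
  from 2(3) obtain E3 F3 where 3: "F2 = E3 + F3" "immerses E3 {#{x1, u}#}"
      "immerses F3 ({#{x1, v}#} + ({#{u, v}#} + replicate_mset (m - 2) {x0, x1}))"
    by (rule immerses_splitD)
  from 3(3) obtain E4 F4 where 4: "F3 = E4 + F4" "immerses E4 {#{x1, v}#}"
      "immerses F4 ({#{u, v}#} + replicate_mset (m - 2) {x0, x1})"
    by (rule immerses_splitD)
  from 4(3) obtain E5 F5 where 5: "F4 = E5 + F5" "immerses E5 {#{u, v}#}"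
      "immerses F5 (replicate_mset (m - 2) {x0, x1})"
    by (rule immerses_splitD)
  obtain P where P: "size P = m - 2" "\<forall>p\<in>#P. is_path x0 x1 p" "edges_of P \<subseteq># F5"
    using immerses_replicateD[OF 5(3) assms(2)] by blast
  have "M = E1 + E2 + E3 + E4 + E5 + F5" using 1 2 3 4 5 by (simp add: ac_simps)
  then have "E1 + E2 + E3 + E4 + E5 + edges_of P \<subseteq># M" using P(3) by (simp add: subset_mset.add_mono)
  then show thesis
    using that[OF uv(1-3) immerses_singleD[OF 1(2)] immerses_singleD[OF 2(2)] immerses_singleD[OF 3(2)]
        immerses_singleD[OF 4(2)] immerses_singleD[OF 5(2)] P(1)] P(2) by blast
qed

lemma has_DI:
  assumes "u \<in> V - {x0, x1}" "v \<in> V - {x0, x1}" "u \<noteq> v" "x0 \<noteq> x1"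
    and "linked E1 x0 u" "linked E2 x0 v" "linked E3 x1 u" "linked E4 x1 v" "linked E5 u v"
    and "m \<le> size P + 2" "\<And>p. p \<in># P \<Longrightarrow> is_path x0 x1 p"
    and sub: "E1 + E2 + E3 + E4 + E5 + edges_of P \<subseteq># M"
  shows "has_D m V M x0 x1"
proof -
  have "immerses (edges_of P) (replicate_mset (size P) {x0, x1})"
    using assms(11,4) by (rule immerses_replicateI)
  moreover have "replicate_mset (m - 2) {x0, x1} \<subseteq># replicate_mset (size P) {x0, x1}"
    using assms(10) by (simp add: mset_subset_eq_count subseteq_mset_def)
  ultimately have P: "immerses (edges_of P) (replicate_mset (m - 2) {x0, x1})"
    using immerses_sub immerses_trans by blast
  have "immerses (E1 + E2 + E3 + E4 + E5 + edges_of P)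
      ({#{x0, u}#} + {#{x0, v}#} + {#{x1, u}#} + {#{x1, v}#} + {#{u, v}#} + replicate_mset (m - 2) {x0, x1})"
    using assms(1-9) P by (intro immerses_add linked_immerses) auto
  also have "{#{x0, u}#} + {#{x0, v}#} + {#{x1, u}#} + {#{x1, v}#} + {#{u, v}#} + replicate_mset (m - 2) {x0, x1}
      = D_edges m x0 x1 u v"
    by (simp add: D_edges_def)
  finally show ?thesis using assms(1-3) immerses_sub[OF sub] immerses_trans unfolding has_D_def by blast
qed

text \<open>A trail from \<open>x0\<close> to \<open>x1\<close> through \<open>v\<close>: unlike on
  a path, the two halves may share vertices. This is what rerouted connections provide.\<close>

definition passes :: "'v set multiset \<Rightarrow> 'v \<Rightarrow> 'v \<Rightarrow> 'v \<Rightarrow> bool" where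
  "passes F x0 x1 v \<longleftrightarrow> (\<exists>A B. A + B \<subseteq># F \<and> linked A x0 v \<and> linked B v x1)"

lemma passesI: "linked A x0 v \<Longrightarrow> linked B v x1 \<Longrightarrow> A + B \<subseteq># F \<Longrightarrow> passes F x0 x1 v"
  unfolding passes_def by blast

lemma passes_path:
  assumes "is_path x0 x1 p" "v \<in> set p"
  shows "passes (path_edges p) x0 x1 v"
proof -
  obtain q r where p: "p = q @ v # r" using assms(2) split_list by fastforce
  have "linked (path_edges (q @ [v])) x0 v" "linked (path_edges (v # r)) v x1"
    using assms(1) path_linked[of "q @ [v]"] path_linked[of "v # r"] unfolding p is_path_def
    by (cases q; simp)+
  then show ?thesis by (rule passesI) (simp add: p path_edges_append[of q v r])
qed

text \<open>Without \<open>uv\<close> and the root edges, D consists of two paths between the roots,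
  one through \<open>u\<close> and one through \<open>v\<close>.\<close>

lemma has_D_passesI:
  assumes "passes F1 x0 x1 u" "passes F2 x0 x1 v" "linked Q u v"
    and "u \<in> V - {x0, x1}" "v \<in> V - {x0, x1}" "u \<noteq> v" "x0 \<noteq> x1"
    and "m \<le> size P + 2" "\<And>p. p \<in># P \<Longrightarrow> is_path x0 x1 p"
    and sub: "F1 + F2 + Q + edges_of P \<subseteq># M"
  shows "has_D m V M x0 x1"
proof -
  obtain A B where AB: "A + B \<subseteq># F1" "linked A x0 u" "linked B u x1"
    using assms(1) unfolding passes_def by blast
  obtain C D where CD: "C + D \<subseteq># F2" "linked C x0 v" "linked D v x1"
    using assms(2) unfolding passes_def by blast
  have "A + C + B + D + Q + edges_of P = (A + B) + (C + D) + Q + edges_of P" by (simp add: ac_simps)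
  also have "\<dots> \<subseteq># F1 + F2 + Q + edges_of P" using AB CD by (intro subset_mset.add_mono) auto
  also note sub
  finally show ?thesis
    using has_DI[OF assms(4-7) AB(2) CD(2) linked_sym[OF AB(3)] linked_sym[OF CD(3)] assms(3,8,9)] by blast
qed

lemma immersion_step_immerses:
  assumes "immersion_step G G'" "\<forall>e\<in>#edges G. e \<subseteq> verts G"
  shows "verts G' \<subseteq> verts G \<and> (\<forall>e\<in>#edges G'. e \<subseteq> verts G') \<and> immerses (edges G) (edges G')"
  using assms(1)
proof cases
  case (split x y z)
  then obtain C where C: "edges G = C + {#{x, y}, {y, z}#}"
    by (metis subset_mset.le_iff_add add.commute)
  then have "{x, y} \<subseteq> verts G" "{y, z} \<subseteq> verts G" "\<forall>e\<in>#C. e \<subseteq> verts G" using assms(2) by auto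
  moreover have "edges G' = C + (if x = z then {#} else {#{x, z}#})" "verts G' = verts G"
    using split C by auto
  moreover have "immerses (edges G) (C + (if x = z then {#} else {#{x, z}#}))"
    unfolding C immerses_def by (rule r_into_rtranclp) (rule red_split)
  ultimately show ?thesis by (auto split: if_splits)
next
  case (delete_edge e)
  then show ?thesis using assms(2) by (auto intro: immerses_sub dest: in_diffD)
next
  case (delete_vertex v)
  then show ?thesis using assms(2) by (auto simp: induced_def intro: immerses_sub)
qed

lemma immersion_steps_immerses:
  assumes "immersion_step\<^sup>*\<^sup>* G G'" "\<forall>e\<in>#edges G. e \<subseteq> verts G"
  shows "verts G' \<subseteq> verts G \<and> (\<forall>e\<in>#edges G'. e \<subseteq> verts G') \<and> immerses (edges G) (edges G')"
  using assms
proof (induction rule: rtranclp_induct)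
  case (step G1 G2)
  then have "verts G1 \<subseteq> verts G" "\<forall>e\<in>#edges G1. e \<subseteq> verts G1" "immerses (edges G) (edges G1)" by simp_all
  moreover from this have "verts G2 \<subseteq> verts G1 \<and> (\<forall>e\<in>#edges G2. e \<subseteq> verts G2) \<and> immerses (edges G1) (edges G2)"
    using immersion_step_immerses[OF step(2)] by simp
  ultimately show ?case using immerses_trans[of "edges G" "edges G1" "edges G2"] by auto
qed auto

lemma immerses_immersion_steps:
  assumes "immerses M N"
  shows "immersion_step\<^sup>*\<^sup>* \<lparr>verts = V, edges = M\<rparr> \<lparr>verts = V, edges = N\<rparr>"
  using assms unfolding immerses_def
proof (induction rule: rtranclp_induct)
  case (step M N)
  have "immersion_step \<lparr>verts = V, edges = M\<rparr> \<lparr>verts = V, edges = N\<rparr>"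
    using step(2)
  proof cases
    case (red_split C x y z)
    then show ?thesis using immersion_step.split[of x y z "\<lparr>verts = V, edges = M\<rparr>"] by simp
  next
    case (red_delete e)
    then show ?thesis using immersion_step.delete_edge[of e "\<lparr>verts = V, edges = M\<rparr>"] by simp
  qed
  with step(3) show ?case by (rule rtranclp.rtrancl_into_rtrancl)
qed simp

text \<open>No edge of \<open>N\<close> meets \<open>S\<close>, so each vertex deletion leaves the
  edges as they are.\<close>

lemma delete_vertices_steps:
  assumes "finite S" "S \<subseteq> V" "\<forall>e\<in>#N. e \<subseteq> V - S"
  shows "immersion_step\<^sup>*\<^sup>* \<lparr>verts = V, edges = N\<rparr> \<lparr>verts = V - S, edges = N\<rparr>"
  using assms
proof (induction S)
  case (insert v S)
  have N: "\<forall>e\<in>#N. e \<subseteq> V - insert v S" "\<forall>e\<in>#N. e \<subseteq> V - S - {v}" using insert.prems(2) by auto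
  have "\<forall>e\<in>#N. e \<subseteq> V - S" using N(1) by blast
  then have "immersion_step\<^sup>*\<^sup>* \<lparr>verts = V, edges = N\<rparr> \<lparr>verts = V - S, edges = N\<rparr>"
    using insert.IH insert.prems(1) by simp
  moreover have "immersion_step \<lparr>verts = V - S, edges = N\<rparr> \<lparr>verts = V - insert v S, edges = N\<rparr>"
  proof -
    have "{#e \<in># N. e \<subseteq> V - S - {v}#} = N" using N(2) by (simp add: filter_mset_eq_conv)
    moreover have "(V - S) \<inter> (V - S - {v}) = V - insert v S" by auto
    ultimately have "induced \<lparr>verts = V - S, edges = N\<rparr> (V - S - {v}) = \<lparr>verts = V - insert v S, edges = N\<rparr>"
      by (simp add: induced_def)
    then show ?thesis
      using immersion_step.delete_vertex[of v "\<lparr>verts = V - S, edges = N\<rparr>"] insert.hyps insert.prems by simp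
  qed
  ultimately show ?case by (rule rtranclp.rtrancl_into_rtrancl)
qed simp

lemma rooted_immersion_D_iff:
  fixes G :: "'v mgraph"
  assumes G: "multigraph G" "x0 \<in> verts G" "x1 \<in> verts G" "x0 \<noteq> x1"
  shows "(G, [x0, x1]) \<succ>\<^sub>r D m \<longleftrightarrow> has_D m (verts G) (edges G) x0 x1"
proof
  define H :: "nat mgraph" where "H = fst (D m)"
  have D: "D m = (H, [0, 1])" by (simp add: H_def D_def)
  assume "(G, [x0, x1]) \<succ>\<^sub>r D m"
  then obtain G' f where G': "immersion_step\<^sup>*\<^sup>* G G'" "graph_iso f G' H"
      "f x0 = 0" "f x1 = 1" "x0 \<in> verts G'" "x1 \<in> verts G'"
    unfolding D by auto
  have "\<forall>e\<in>#edges G. e \<subseteq> verts G" using G(1) by (auto simp: multigraph_def)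
  then have *: "verts G' \<subseteq> verts G" "\<forall>e\<in>#edges G'. e \<subseteq> verts G'" "immerses (edges G) (edges G')"
    using immersion_steps_immerses[OF G'(1)] by auto
  have bij: "bij_betw f (verts G') {0, 1, 2, 3}" and E: "image_mset (\<lambda>e. f ` e) (edges G') = edges H"
    using G'(2) by (auto simp: graph_iso_def H_def D_def)
  \<comment> \<open>The inverse of the isomorphism carries the explicit edge list of D back to
    \<open>G'\<close>.\<close>
  define g where "g = the_inv_into (verts G') f"
  have inj: "inj_on f (verts G')" and img: "f ` verts G' = {0, 1, 2, 3}" using bij by (auto simp: bij_betw_def)
  have gf: "g (f w) = w" if "w \<in> verts G'" for w
    using inj that by (simp add: g_def the_inv_into_f_f)
  have gin: "g i \<in> verts G'" "f (g i) = i" if "i \<in> {0, 1, 2, 3}" for i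
    using that inj img by (auto simp: g_def f_the_inv_into_f intro!: the_inv_into_into)
  have roots: "g 0 = x0" "g 1 = x1" using gf G'(3-6) by metis+
  have "edges G' = image_mset (\<lambda>e. g ` (f ` e)) (edges G')"
  proof -
    have "g ` f ` e = e" if "e \<in># edges G'" for e
    proof -
      have "g (f w) = w" if "w \<in> e" for w using that *(2) \<open>e \<in># edges G'\<close> gf by blast
      then show ?thesis by (simp add: image_image)
    qed
    then have "image_mset (\<lambda>e. g ` (f ` e)) (edges G') = image_mset (\<lambda>e. e) (edges G')"
      by (intro image_mset_cong) blast
    then show ?thesis by simp
  qed
  also have "\<dots> = image_mset ((`) g) (edges H)" unfolding E[symmetric] by (simp add: multiset.map_comp comp_def)
  also have "\<dots> = D_edges m x0 x1 (g 2) (g 3)"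
    using roots by (simp add: H_def D_def D_edges_def add_mset_commute)
  finally have "immerses (edges G) (D_edges m x0 x1 (g 2) (g 3))" using *(3) by simp
  moreover have "g 2 \<noteq> g 3" "g 2 \<noteq> x0" "g 2 \<noteq> x1" "g 3 \<noteq> x0" "g 3 \<noteq> x1"
    using gin(2)[of 2] gin(2)[of 3] G'(3,4) by auto
  moreover have "g 2 \<in> verts G" "g 3 \<in> verts G" using gin(1)[of 2] gin(1)[of 3] *(1) by auto
  ultimately show "has_D m (verts G) (edges G) x0 x1" unfolding has_D_def by blast
next
  define H :: "nat mgraph" where "H = fst (D m)"
  have D: "D m = (H, [0, 1])" by (simp add: H_def D_def)
  assume "has_D m (verts G) (edges G) x0 x1"
  then obtain u v where uv: "u \<in> verts G" "v \<in> verts G" "u \<noteq> x0" "u \<noteq> x1" "v \<noteq> x0" "v \<noteq> x1" "u \<noteq> v"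
      "immerses (edges G) (D_edges m x0 x1 u v)"
    unfolding has_D_def by blast
  let ?U = "{x0, x1, u, v}"
  have N: "\<forall>e\<in>#D_edges m x0 x1 u v. e \<subseteq> ?U" by (auto simp: D_edges_def)
  have "immersion_step\<^sup>*\<^sup>* G \<lparr>verts = verts G, edges = D_edges m x0 x1 u v\<rparr>"
  proof -
    have "\<lparr>verts = verts G, edges = edges G\<rparr> = G" by (rule mgraph.equality) simp_all
    then show ?thesis using immerses_immersion_steps[OF uv(8), of "verts G"] by metis
  qed
  also have "immersion_step\<^sup>*\<^sup>* \<dots> \<lparr>verts = verts G - (verts G - ?U), edges = D_edges m x0 x1 u v\<rparr>"
  proof (rule delete_vertices_steps)
    show "finite (verts G - ?U)" using G(1) by (simp add: multigraph_def)
    have "?U \<subseteq> verts G - (verts G - ?U)" using uv G by blast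
    then show "\<forall>e\<in>#D_edges m x0 x1 u v. e \<subseteq> verts G - (verts G - ?U)" using N by blast
  qed blast
  also have "verts G - (verts G - ?U) = ?U" using uv G by blast
  finally have steps: "immersion_step\<^sup>*\<^sup>* G \<lparr>verts = ?U, edges = D_edges m x0 x1 u v\<rparr>" .
  \<comment> \<open>The default value 3 is the image of \<open>v\<close>.\<close>
  define f :: "'v \<Rightarrow> nat" where "f = (\<lambda>_. 3)(x0 := 0, x1 := 1, u := 2)"
  have f: "f x0 = 0" "f x1 = 1" "f u = 2" "f v = 3" using uv G by (simp_all add: f_def)
  have "inj_on f ?U" using f by (auto simp: inj_on_def)
  then have "bij_betw f ?U {0, 1, 2, 3}" using f by (simp add: bij_betw_def)
  moreover have "image_mset (\<lambda>e. f ` e) (D_edges m x0 x1 u v) = edges H"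
    using f by (simp add: H_def D_def D_edges_def add_mset_commute)
  ultimately have "graph_iso f \<lparr>verts = ?U, edges = D_edges m x0 x1 u v\<rparr> H"
    by (simp add: graph_iso_def H_def D_def)
  then show "(G, [x0, x1]) \<succ>\<^sub>r D m"
    unfolding D rooted_immersion.simps using steps f(1,2)
    by (intro exI[of _ f] exI[of _ "\<lparr>verts = ?U, edges = D_edges m x0 x1 u v\<rparr>"] conjI) simp_all
qed

section \<open>The two obstructions\<close>

text \<open>Type A stated for pairs of nonroots. No chain has to be carried along, so the separating
  cuts found in two contracted graphs combine at once.\<close>

definition tight_separated :: "nat \<Rightarrow> 'v set \<Rightarrow> 'v set multiset \<Rightarrow> 'v \<Rightarrow> 'v \<Rightarrow> bool" where
  "tight_separated m V M x0 x1 \<longleftrightarrow>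
     (\<forall>u \<in> V - {x0, x1}. \<forall>v \<in> V - {x0, x1}. u \<noteq> v \<longrightarrow>
       (\<exists>X \<subseteq> V. x0 \<in> X \<and> x1 \<notin> X \<and> cut M X = m \<and> (u \<in> X) \<noteq> (v \<in> X)))"

text \<open>An \<open>m\<close>-cut between \<open>u\<close> and \<open>v\<close> is crossed by the
  link from \<open>u\<close> to \<open>v\<close>, by one connection from \<open>x0\<close>, by one
  from \<open>x1\<close>, and by the \<open>m - 2\<close> paths: \<open>m + 1\<close> edges in
  all.\<close>

lemma tight_separated_no_D:
  assumes "tight_separated m V M x0 x1" "m \<ge> 2" "x0 \<noteq> x1"
  shows "\<not> has_D m V M x0 x1"
proof
  assume D: "has_D m V M x0 x1"
  obtain u v E1 E2 E3 E4 E5 P where E: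
    "u \<in> V - {x0, x1}" "v \<in> V - {x0, x1}" "u \<noteq> v"
    "linked E1 x0 u" "linked E2 x0 v" "linked E3 x1 u" "linked E4 x1 v" "linked E5 u v"
    "size P = m - 2" "\<forall>p\<in>#P. is_path x0 x1 p"
    "E1 + E2 + E3 + E4 + E5 + edges_of P \<subseteq># M"
    by (rule has_DE[OF D assms(3)])
  obtain X where X: "x0 \<in> X" "x1 \<notin> X" "cut M X = m" "(u \<in> X) \<noteq> (v \<in> X)"
    using assms(1) E(1-3) unfolding tight_separated_def by meson
  have c: "cut E1 X + cut E2 X + cut E3 X + cut E4 X + cut E5 X + cut (edges_of P) X \<le> m"
    using cut_mono[OF E(11), of X] X(3) by simp
  have P: "cut (edges_of P) X \<ge> m - 2" using cut_paths_ge[of P x0 x1 X] E(9,10) X by simp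
  have "cut E5 X \<ge> 1" using linked_cut[OF E(8) X(4)] .
  moreover have "cut E2 X \<ge> 1 \<and> cut E3 X \<ge> 1 \<or> cut E1 X \<ge> 1 \<and> cut E4 X \<ge> 1"
  proof (cases "u \<in> X")
    case True
    then show ?thesis using linked_cut[OF E(5), of X] linked_cut[OF E(6), of X] X by auto
  next
    case False
    then show ?thesis using linked_cut[OF E(4), of X] linked_cut[OF E(7), of X] X by auto
  qed
  ultimately show False using c P assms(2) by linarith
qed

text \<open>Type B in terms of paths: a lobe whose edges have multiplicity n is one list occurring n
  times in \<open>P\<close>, and \<open>[x0, x1]\<close> stands for a root edge.
  \<open>length p \<ge> 4\<close> means that the lobe has at least two nonroots.\<close>

definition bundled :: "nat \<Rightarrow> 'v set \<Rightarrow> 'v set multiset \<Rightarrow> 'v \<Rightarrow> 'v \<Rightarrow> 'v list multiset \<Rightarrow> bool" where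
  "bundled k V M x0 x1 P \<longleftrightarrow>
     size P = k \<and> (\<forall>p \<in># P. is_path x0 x1 p) \<and> M = edges_of P \<and>
     V = {x0, x1} \<union> (\<Union>p \<in> set_mset P. set p) \<and>
     (\<forall>p \<in># P. \<forall>q \<in># P. \<forall>w \<in> V - {x0, x1}. w \<in> set p \<longrightarrow> w \<in> set q \<longrightarrow> p = q) \<and>
     (\<forall>p \<in># P. p \<noteq> [x0, x1] \<longrightarrow> count P p \<ge> 2 \<and> (length p \<ge> 4 \<longrightarrow> count P p = 2))"

lemma path_cut_hd:
  assumes "is_path a b p" "a \<noteq> b"
  shows "cut (path_edges p) {a} = 1"
proof -
  obtain c q where p: "p = a # c # q" using assms by (cases p rule: path_edges.cases) (auto simp: is_path_def)
  then have "a \<notin> set (c # q)" using assms by (auto simp: is_path_def)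
  have "cut (path_edges (c # q)) {a} = 0"
  proof (rule cut_zeroI)
    fix e assume "e \<in># path_edges (c # q)"
    then have "a \<notin> e" using path_edges_in \<open>a \<notin> set (c # q)\<close> by fastforce
    then show "card (e \<inter> {a}) \<noteq> 1" by simp
  qed
  then show ?thesis by (simp add: p)
qed

lemma path_cut_last: "is_path a b p \<Longrightarrow> a \<noteq> b \<Longrightarrow> cut (path_edges p) {b} = 1"
  using path_cut_hd[of b a "rev p"] is_path_rev[of a b p] by (simp add: path_edges_rev)

lemma cut_edges_of:
  assumes "\<And>p. p \<in># P \<Longrightarrow> cut (path_edges p) X = c"
  shows "cut (edges_of P) X = size P * c"
  using assms by (induction P) auto

text \<open>Every path uses exactly one edge at each root. So a root of degree \<open>m\<close>
  excludes type B.\<close>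

lemma bundled_degree:
  assumes "bundled k V M x0 x1 P" "x0 \<noteq> x1"
  shows "cut M {x0} = k" "cut M {x1} = k"
proof -
  have P: "size P = k" "\<And>p. p \<in># P \<Longrightarrow> is_path x0 x1 p" "M = edges_of P"
    using assms(1) unfolding bundled_def by blast+
  show "cut M {x0} = k" "cut M {x1} = k"
    using cut_edges_of[of P "{x0}" 1] cut_edges_of[of P "{x1}" 1] path_cut_hd path_cut_last P assms(2)
    by (metis mult.right_neutral)+
qed

lemma in_edges_of:
  "e \<in># edges_of P \<longleftrightarrow> (\<exists>p \<in># P. e \<in># path_edges p)"
  by (induction P) auto

lemma count_edges_of_unique:
  assumes "p \<in># P" "\<And>q. q \<in># P \<Longrightarrow> q \<noteq> p \<Longrightarrow> e \<notin># path_edges q"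
  shows "count (edges_of P) e = count P p * count (path_edges p) e"
  using assms(2)
proof (induction P)
  case (add q P)
  then have IH: "count (edges_of P) e = count P p * count (path_edges p) e" by simp
  show ?case
  proof (cases "q = p")
    case False
    then have "count (path_edges q) e = 0" using add.prems by (simp add: count_eq_zero_iff)
    then show ?thesis using IH False by simp
  qed (use IH in simp)
qed simp

lemma path_crossing_edge:
  assumes "distinct (l @ u # n # r)" "{a, b} \<in># path_edges (l @ u # n # r)"
    "a \<in> set l \<union> {u}" "b \<in> set r \<union> {n}"
  shows "a = u \<and> b = n"
proof -
  have "path_edges (l @ u # n # r) = path_edges (l @ [u]) + ({#{u, n}#} + path_edges (n # r))"
    using path_edges_append[of l u "n # r"] by simp
  then consider "{a, b} \<in># path_edges (l @ [u])" | "{a, b} = {u, n}" | "{a, b} \<in># path_edges (n # r)"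
    using assms(2) by auto
  then show ?thesis
  proof cases
    case 1
    then have "b \<in> set l \<union> {u}" using path_edges_in by fastforce
    then show ?thesis using assms(1,4) by auto
  next
    case 2
    then show ?thesis using assms(1,3,4) by (auto simp: doubleton_eq_iff)
  next
    case 3
    then have "a \<in> set r \<union> {n}" using path_edges_in by fastforce
    then show ?thesis using assms(1,3) by auto
  qed
qed

text \<open>Let \<open>u\<close> come before \<open>v\<close> on a bundle and let \<open>n\<close>
  follow \<open>u\<close>. As long as one stays away from the roots named in \<open>away\<close>,
  the only way from the part up to \<open>u\<close> to the part from \<open>n\<close> on is the
  double edge \<open>un\<close>. All three connections have to cross it, and they are
  edge-disjoint.\<close>

lemma bundled_no_D_aux:
  assumes B: "bundled (Suc m) V M x0 x1 P" and x: "x0 \<noteq> x1"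
    and u: "u \<in> V - {x0, x1}" "v \<in> V - {x0, x1}"
    and p: "l @ u # n # r \<in># P" "v \<in> set (n # r)"
    and E: "linked E2 x0 v" "linked E3 x1 u" "linked E5 u v"
    and sub: "E2 + E3 + E5 \<subseteq># M"
    and away: "\<And>e. e \<in># E2 \<Longrightarrow> x1 \<notin> e" "\<And>e. e \<in># E3 \<Longrightarrow> x0 \<notin> e" "\<And>e. e \<in># E5 \<Longrightarrow> x0 \<notin> e"
  shows False
proof -
  let ?p = "l @ u # n # r"
  have P: "\<And>p. p \<in># P \<Longrightarrow> is_path x0 x1 p" "M = edges_of P"
      "\<And>p q w. p \<in># P \<Longrightarrow> q \<in># P \<Longrightarrow> w \<in> V - {x0, x1} \<Longrightarrow> w \<in> set p \<Longrightarrow> w \<in> set q \<Longrightarrow> p = q"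
      "\<And>p. p \<in># P \<Longrightarrow> p \<noteq> [x0, x1] \<Longrightarrow> length p \<ge> 4 \<Longrightarrow> count P p = 2"
      "\<And>p w. p \<in># P \<Longrightarrow> w \<in> set p \<Longrightarrow> w \<in> V"
    using B unfolding bundled_def by blast+
  have ip: "is_path x0 x1 ?p" using P(1) p(1) .
  then have d: "distinct ?p" by (simp add: is_path_def)
  have x0l: "x0 \<in> set l" using ip u by (cases l) (auto simp: is_path_def)
  have x1r: "x1 = last (n # r)" using ip by (auto simp: is_path_def)
  \<comment> \<open>There are two nonroots \<open>u\<close> and \<open>v\<close> on this path, which
    fixes its multiplicity at 2.\<close>
  have len: "length ?p \<ge> 4"
  proof -
    have "l \<noteq> []" using x0l by auto
    moreover have "r \<noteq> []" using x1r p(2) u(2) by (cases r) auto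
    ultimately show ?thesis by (cases l; cases r) auto
  qed
  moreover have "?p \<noteq> [x0, x1]"
  proof
    assume eq: "?p = [x0, x1]"
    show False using len unfolding eq by simp
  qed
  ultimately have cnt: "count P ?p = 2" using P(4)[OF p(1)] by blast
  have only: "q = ?p" if "q \<in># P" "w \<in> set q" "w \<in> set ?p" "w \<noteq> x0" "w \<noteq> x1" for q w
    using P(3)[OF that(1) p(1) _ that(2,3)] P(5)[OF that(1,2)] that(4,5) by blast
  have dis: "x0 \<notin> set r \<union> {n, u}" "x1 \<notin> set l \<union> {u}" "x1 \<in> set r \<union> {n}"
    using d x0l x1r last_in_set[of "n # r"] u by auto
  have inside: "{a, b} \<in># path_edges ?p" "b \<in> set ?p"
    if e: "{a, b} \<in># M" "a \<in> set ?p" "a \<noteq> x0" "a \<noteq> x1" for a b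
  proof -
    obtain q where q: "q \<in># P" "{a, b} \<in># path_edges q" using e(1) in_edges_of P(2) by metis
    then have "a \<in> set q" "b \<in> set q" using path_edges_in[OF q(2)] by auto
    then show "{a, b} \<in># path_edges ?p" "b \<in> set ?p" using only[OF q(1) _ e(2-4)] q(2) by auto
  qed
  \<comment> \<open>Without \<open>un\<close>, the vertices up to \<open>u\<close> other than
    \<open>x0\<close> are closed under the edges of \<open>E\<close>; \<open>left\<close> is the
    mirror image.\<close>
  have right: "{u, n} \<in># E" if "E \<subseteq># M" "linked E u b" "b \<in> set r \<union> {n}" "\<And>e. e \<in># E \<Longrightarrow> x0 \<notin> e" for E b
  proof (rule ccontr)
    assume no: "{u, n} \<notin># E"
    have "b \<in> (set l \<union> {u}) - {x0}"
    proof (rule linked_closed[OF that(2)])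
      fix a c assume ac: "{a, c} \<in># E" "a \<in> (set l \<union> {u}) - {x0}"
      then have M: "{a, c} \<in># M" "a \<in> set ?p" "a \<noteq> x0" "a \<noteq> x1" "c \<noteq> x0"
        using that(1,4) dis by (auto dest: mset_subset_eqD)
      then have "{a, c} \<in># path_edges ?p" "c \<in> set ?p" using inside[of a c] by blast+
      moreover have "c \<notin> set r \<union> {n}"
        using path_crossing_edge[OF d calculation(1)] ac no by blast
      ultimately show "c \<in> (set l \<union> {u}) - {x0}" using \<open>c \<noteq> x0\<close> by auto
    qed (use u in simp)
    then show False using that(3) d by auto
  qed
  have left: "{u, n} \<in># E" if "E \<subseteq># M" "linked E v x0" "\<And>e. e \<in># E \<Longrightarrow> x1 \<notin> e" for E
  proof (rule ccontr)
    assume no: "{u, n} \<notin># E"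
    have "x0 \<in> (set r \<union> {n}) - {x1}"
    proof (rule linked_closed[OF that(2)])
      fix a c assume ac: "{a, c} \<in># E" "a \<in> (set r \<union> {n}) - {x1}"
      then have M: "{a, c} \<in># M" "a \<in> set ?p" "a \<noteq> x0" "a \<noteq> x1" "c \<noteq> x1"
        using that(1,3) dis by (auto dest: mset_subset_eqD)
      then have "{c, a} \<in># path_edges ?p" "c \<in> set ?p" using inside[of a c] by (auto simp: insert_commute)
      moreover have "c \<notin> set l \<union> {u}"
        using path_crossing_edge[OF d calculation(1)] ac no by (auto simp: insert_commute)
      ultimately show "c \<in> (set r \<union> {n}) - {x1}" using \<open>c \<noteq> x1\<close> by auto
    qed (use u p(2) in auto)
    then show False using dis by auto
  qed
  have sub': "E2 \<subseteq># M" "E3 \<subseteq># M" "E5 \<subseteq># M"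
    using sub by (meson subset_mset.order_trans mset_subset_eq_add_left mset_subset_eq_add_right)+
  have "{u, n} \<in># E2" using left[OF sub'(1) linked_sym[OF E(1)] away(1)] .
  moreover have "{u, n} \<in># E3" using right[OF sub'(2) linked_sym[OF E(2)] dis(3) away(2)] .
  moreover have "{u, n} \<in># E5" using right[OF sub'(3) E(3) _ away(3)] p(2) by auto
  ultimately have "count E2 {u, n} > 0" "count E3 {u, n} > 0" "count E5 {u, n} > 0"
    by (simp_all only: count_greater_zero_iff)
  then have "count (E2 + E3 + E5) {u, n} \<ge> 3" by (simp only: count_union)
  then have "count M {u, n} \<ge> 3" using sub mset_subset_eq_count le_trans by metis
  moreover have "count M {u, n} = count P ?p * count (path_edges ?p) {u, n}"
    unfolding P(2)
  proof (rule count_edges_of_unique[OF p(1)])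
    fix q assume "q \<in># P" "q \<noteq> ?p"
    then show "{u, n} \<notin># path_edges q" using only[of q u] path_edges_in[of "{u, n}" q] u by auto
  qed
  moreover have "count (path_edges ?p) {u, n} \<le> 1" using distinct_path_edges[OF d] .
  ultimately show False using cnt by simp
qed

lemma even_path_cut_small:
  assumes "is_path a b p" "(a \<in> X) = (b \<in> X)" "cut (path_edges p) X \<le> 1"
  shows "cut (path_edges p) X = 0"
proof -
  have "even (cut (path_edges p) X)"
    using path_cut_parity[of p X] assms(1,2) by (simp add: is_path_def)
  then show ?thesis using assms(3) by (cases "cut (path_edges p) X") auto
qed

lemma cut_singleton_0D:
  assumes "cut E {x} = 0" "e \<in># E" shows "x \<notin> e"
proof
  assume "x \<in> e"
  then have "card (e \<inter> {x}) = 1" by simp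
  then show False using cut_pos_iff[of E "{x}"] assms by auto
qed

text \<open>Both roots have degree \<open>m + 1\<close>, and the connections of D starting at a root
  take up \<open>m\<close> of these edges. Hence the other connections avoid the root,
  \<open>u\<close> and \<open>v\<close> lie in one bundle, and their order on it selects the three
  connections to which \<open>bundled_no_D_aux\<close> applies.\<close>

lemma bundled_no_D:
  assumes B: "bundled (Suc m) V M x0 x1 P" and x: "x0 \<noteq> x1" and m: "m \<ge> 2"
  shows "\<not> has_D m V M x0 x1"
proof
  assume D: "has_D m V M x0 x1"
  obtain u v E1 E2 E3 E4 E5 Q where E:
    "u \<in> V - {x0, x1}" "v \<in> V - {x0, x1}" "u \<noteq> v"
    "linked E1 x0 u" "linked E2 x0 v" "linked E3 x1 u" "linked E4 x1 v" "linked E5 u v"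
    "size Q = m - 2" "\<forall>p\<in>#Q. is_path x0 x1 p"
    "E1 + E2 + E3 + E4 + E5 + edges_of Q \<subseteq># M"
    by (rule has_DE[OF D x])
  obtain p1 p2 p3 p4 p5 where p: "is_path x0 u p1" "path_edges p1 \<subseteq># E1"
      "is_path x0 v p2" "path_edges p2 \<subseteq># E2" "is_path x1 u p3" "path_edges p3 \<subseteq># E3"
      "is_path x1 v p4" "path_edges p4 \<subseteq># E4" "is_path u v p5" "path_edges p5 \<subseteq># E5"
    using linked_imp_path[OF E(4)] linked_imp_path[OF E(5)] linked_imp_path[OF E(6)]
      linked_imp_path[OF E(7)] linked_imp_path[OF E(8)] by metis
  let ?S = "path_edges p1 + path_edges p2 + path_edges p3 + path_edges p4 + path_edges p5 + edges_of Q"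
  have "?S \<subseteq># E1 + E2 + E3 + E4 + E5 + edges_of Q"
    using p by (intro subset_mset.add_mono) auto
  then have sub: "?S \<subseteq># M" using E(11) by (rule subset_mset.order_trans)
  have deg: "cut ?S {x0} \<le> Suc m" "cut ?S {x1} \<le> Suc m"
    using cut_mono[OF sub] bundled_degree[OF B x] by metis+
  have Q: "cut (edges_of Q) {x0} \<ge> m - 2" "cut (edges_of Q) {x1} \<ge> m - 2"
    using cut_paths_ge[of Q x0 x1] E(9,10) x by auto
  have c0: "cut (path_edges p1) {x0} \<ge> 1" "cut (path_edges p2) {x0} \<ge> 1"
    using linked_cut[OF is_path_linked[OF p(1)], of "{x0}"] linked_cut[OF is_path_linked[OF p(3)], of "{x0}"] E(1,2)
    by auto
  have c1: "cut (path_edges p3) {x1} \<ge> 1" "cut (path_edges p4) {x1} \<ge> 1"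
    using linked_cut[OF is_path_linked[OF p(5)], of "{x1}"] linked_cut[OF is_path_linked[OF p(7)], of "{x1}"] E(1,2)
    by auto
  \<comment> \<open>The paths \<open>p1\<close> and \<open>p2\<close> and the \<open>m - 2\<close>
    paths of \<open>Q\<close> leave one edge at \<open>x0\<close>; \<open>p3\<close>,
    \<open>p4\<close> and \<open>p5\<close> have both ends off \<open>x0\<close>, so by parity they
    use no edge there.\<close>
  have le0: "cut (path_edges p3) {x0} \<le> 1" "cut (path_edges p4) {x0} \<le> 1" "cut (path_edges p5) {x0} \<le> 1"
    using deg(1) Q(1) c0 m by (simp_all only: cut_add)
  have le1: "cut (path_edges p1) {x1} \<le> 1" "cut (path_edges p2) {x1} \<le> 1" "cut (path_edges p5) {x1} \<le> 1"
    using deg(2) Q(2) c1 m by (simp_all only: cut_add)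
  have z0: "cut (path_edges p3) {x0} = 0" "cut (path_edges p4) {x0} = 0" "cut (path_edges p5) {x0} = 0"
    using even_path_cut_small[OF p(5) _ le0(1)] even_path_cut_small[OF p(7) _ le0(2)]
      even_path_cut_small[OF p(9) _ le0(3)] E(1,2) x by auto
  have z1: "cut (path_edges p1) {x1} = 0" "cut (path_edges p2) {x1} = 0" "cut (path_edges p5) {x1} = 0"
    using even_path_cut_small[OF p(1) _ le1(1)] even_path_cut_small[OF p(3) _ le1(2)]
      even_path_cut_small[OF p(9) _ le1(3)] E(1,2) x by auto
  note away = cut_singleton_0D[OF z0(1)] cut_singleton_0D[OF z0(2)] cut_singleton_0D[OF z0(3)]
    cut_singleton_0D[OF z1(1)] cut_singleton_0D[OF z1(2)] cut_singleton_0D[OF z1(3)]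
  obtain q where q: "q \<in># P" "u \<in> set q" using B E(1) unfolding bundled_def by auto
  have PM: "M = edges_of P" and
    P: "\<And>p r w. p \<in># P \<Longrightarrow> r \<in># P \<Longrightarrow> w \<in> V - {x0, x1} \<Longrightarrow> w \<in> set p \<Longrightarrow> w \<in> set r \<Longrightarrow> p = r"
    and PV: "\<And>p w. p \<in># P \<Longrightarrow> w \<in> set p \<Longrightarrow> w \<in> V" and Pp: "\<And>p. p \<in># P \<Longrightarrow> is_path x0 x1 p"
    using B unfolding bundled_def by blast+
  have s5: "path_edges p5 \<subseteq># M"
    using sub by (meson subset_mset.order_trans mset_subset_eq_add_left mset_subset_eq_add_right)
  \<comment> \<open>\<open>p5\<close> avoids the roots, and only at the roots can one change from a
    bundle to another.\<close>
  have "v \<in> set q - {x0, x1}"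
  proof (rule linked_closed[OF is_path_linked[OF p(9)]])
    fix a b assume ab: "{a, b} \<in># path_edges p5" "a \<in> set q - {x0, x1}"
    then have "{a, b} \<in># edges_of P" using s5 PM by (auto dest: mset_subset_eqD)
    then obtain r where r: "r \<in># P" "{a, b} \<in># path_edges r" using in_edges_of by metis
    then have "a \<in> set r" "b \<in> set r" using path_edges_in[OF r(2)] by auto
    then have "r = q" using P[OF r(1) q(1), of a] PV[OF q(1), of a] ab(2) by blast
    moreover have "b \<noteq> x0" "b \<noteq> x1" using away(3,6)[OF ab(1)] by auto
    ultimately show "b \<in> set q - {x0, x1}" using \<open>b \<in> set r\<close> by blast
  qed (use q E(1) in blast)
  then have vq: "v \<in> set q" by blast
  obtain l t where lt: "q = l @ u # t" using split_list q(2) by fastforce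
  have "t \<noteq> []" using Pp[OF q(1)] E(1) unfolding lt is_path_def by auto
  then obtain n r where nr: "q = l @ u # n # r" using lt by (cases t) auto
  consider "v \<in> set (n # r)" | "v \<in> set l" using vq E(3) nr by auto
  then show False
  proof cases
    case 1
    have "path_edges p2 + path_edges p3 + path_edges p5 \<subseteq># ?S"
      by (simp add: subset_mset.add_increasing2 ac_simps subseteq_mset_def)
    then have "path_edges p2 + path_edges p3 + path_edges p5 \<subseteq># M" using sub by (rule subset_mset.order_trans)
    then show False
      using bundled_no_D_aux[OF B x E(1,2) _ 1 is_path_linked[OF p(3)] is_path_linked[OF p(5)] is_path_linked[OF p(9)]]
        q(1) nr away(1,3,5) by blast
  next
    case 2
    then obtain l' t' where l': "l = l' @ v # t'" using split_list by fastforce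
    obtain n' r' where nr': "q = l' @ v # n' # r'" "u \<in> set (n' # r')"
      using l' nr by (cases t') auto
    have "path_edges p1 + path_edges p4 + path_edges p5 \<subseteq># ?S"
      by (simp add: subset_mset.add_increasing2 ac_simps subseteq_mset_def)
    then have "path_edges p1 + path_edges p4 + path_edges p5 \<subseteq># M" using sub by (rule subset_mset.order_trans)
    then show False
      using bundled_no_D_aux[OF B x E(2,1) _ nr'(2) is_path_linked[OF p(1)] is_path_linked[OF p(7)]
          linked_sym[OF is_path_linked[OF p(9)]]] q(1) nr'(1) away(2,3,4) by blast
  qed
qed

section \<open>Reductions\<close>

text \<open>A cut that does not separate the roots has a side containing neither of them, and a
  separating one has a side containing just \<open>x0\<close>; the bounds are stated for these
  sides.\<close>

locale admissible =
  fixes m :: nat and V :: "'v set" and M :: "'v set multiset" and x0 x1 :: 'v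
  assumes simple: "simple_edges V M"
    and roots: "x0 \<in> V" "x1 \<in> V" "x0 \<noteq> x1"
    and card_V: "card V \<ge> 4"
    and m_ge_2: "m \<ge> 2"
    and nonsep: "\<And>X. X \<subseteq> V - {x0, x1} \<Longrightarrow> X \<noteq> {} \<Longrightarrow> cut M X \<ge> 3"
    and nonsep_int: "\<And>X. X \<subseteq> V - {x0, x1} \<Longrightarrow> card X \<ge> 2 \<Longrightarrow> cut M X \<ge> 4"
    and sep: "\<And>X. X \<subseteq> V \<Longrightarrow> x0 \<in> X \<Longrightarrow> x1 \<notin> X \<Longrightarrow> cut M X \<ge> m"

definition outcome :: "nat \<Rightarrow> 'v set \<Rightarrow> 'v set multiset \<Rightarrow> 'v \<Rightarrow> 'v \<Rightarrow> bool" where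
  "outcome m V M x0 x1 \<longleftrightarrow>
     has_D m V M x0 x1 \<or> tight_separated m V M x0 x1 \<or> (\<exists>P. bundled (Suc m) V M x0 x1 P)"

lemma image_subset_edge:
  assumes "i \<le> count M a" "j \<le> count M b" "k \<le> count M c" "l \<le> count M d"
    "a \<noteq> b" "a \<noteq> c" "a \<noteq> d" "b \<noteq> c" "b \<noteq> d" "c \<noteq> d"
  shows "replicate_mset i a + replicate_mset j b + replicate_mset k c + replicate_mset l d \<subseteq># M"
  using assms by (auto simp: subseteq_mset_def)

text \<open>The induction hypothesis as a predicate, so that it can be handed to lemmas. The value
  of \<open>m\<close> and the roots may change: removing a root edge lowers \<open>m\<close>, and
  symmetry swaps the roots.\<close>

definition outcome_below :: "'v set \<Rightarrow> 'v set multiset \<Rightarrow> bool" where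
  "outcome_below V M \<longleftrightarrow> (\<forall>m' V' M' y0 y1. admissible m' V' M' y0 y1 \<longrightarrow>
     card V' + size M' < card V + size (M :: 'v set multiset) \<longrightarrow> outcome m' (V' :: 'v set) M' y0 y1)"

lemma outcome_belowD:
  fixes V V' :: "'v set"
  shows "outcome_below V M \<Longrightarrow> admissible m' V' M' y0 y1 \<Longrightarrow> card V' + size M' < card V + size M \<Longrightarrow> outcome m' V' M' y0 y1"
  unfolding outcome_below_def by blast

context admissible
begin

lemma finite_V: "finite V"
  using simple by (rule simple_edges_finite)

lemma finite_sub: "X \<subseteq> V \<Longrightarrow> finite X"
  using finite_V by (rule rev_finite_subset)

lemma sym: "admissible m V M x1 x0"
proof
  show "cut M X \<ge> m" if X: "X \<subseteq> V" "x1 \<in> X" "x0 \<notin> X" for X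
  proof -
    have "cut M (V - X) \<ge> m" using X roots by (intro sep) auto
    then show ?thesis using cut_compl[OF simple] by simp
  qed
qed (use simple roots card_V m_ge_2 nonsep nonsep_int in \<open>auto simp: insert_commute\<close>)

section \<open>The lattice of tight cuts\<close>

lemma tight_Un_Int:
  assumes "X \<subseteq> V" "x0 \<in> X" "x1 \<notin> X" "cut M X = m" "Y \<subseteq> V" "x0 \<in> Y" "x1 \<notin> Y" "cut M Y = m"
  shows "cut M (X \<union> Y) = m" "cut M (X \<inter> Y) = m"
proof -
  have "cut M (X \<union> Y) \<ge> m" using assms by (intro sep) auto
  moreover have "cut M (X \<inter> Y) \<ge> m" using assms by (intro sep) auto
  ultimately show "cut M (X \<union> Y) = m" "cut M (X \<inter> Y) = m"
    using cut_submodular[OF simple, of X Y] assms(4,8) by linarith+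
qed

text \<open>Any tight cut \<open>W\<close> between \<open>t\<close> and \<open>t'\<close> can be
  moved into the interval from \<open>X\<close> to \<open>Y\<close> by lattice operations:
  \<open>X \<union> (W \<inter> Y)\<close>.\<close>

lemma tight_refine:
  assumes sepd: "tight_separated m V M x0 x1"
    and X: "X \<subseteq> V" "x0 \<in> X" "cut M X = m" and Y: "Y \<subseteq> V" "x1 \<notin> Y" "cut M Y = m"
    and XY: "X \<subseteq> Y" "t \<in> Y - X" "t' \<in> Y - X" "t \<noteq> t'"
  obtains Z where "X \<subset> Z" "Z \<subset> Y" "cut M Z = m"
proof -
  have "t \<in> V - {x0, x1}" "t' \<in> V - {x0, x1}" using X Y XY by auto
  then obtain W where W: "W \<subseteq> V" "x0 \<in> W" "x1 \<notin> W" "cut M W = m" "(t \<in> W) \<noteq> (t' \<in> W)"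
    using sepd XY(4) unfolding tight_separated_def by meson
  have "cut M (W \<inter> Y) = m" using W X Y XY by (intro tight_Un_Int(2)) auto
  then have "cut M (X \<union> (W \<inter> Y)) = m" using W X Y XY by (intro tight_Un_Int(1)) auto
  moreover have "X \<subset> X \<union> (W \<inter> Y)" "X \<union> (W \<inter> Y) \<subset> Y" using W(5) XY by auto
  ultimately show thesis using that by blast
qed

text \<open>Among three nonroots, a tight cut puts two on the same side; a second cut separating
  these two yields, by intersection or union with the first, a strictly nested pair. A nested pair
  with smallest difference differs in one vertex, since otherwise \<open>tight_refine\<close>
  applies.\<close>

lemma tight_consecutive:
  assumes sepd: "tight_separated m V M x0 x1" and "card V \<ge> 5"
  obtains X t where "X \<subseteq> V" "x0 \<in> X" "x1 \<notin> X" "t \<in> V - {x0, x1}" "t \<notin> X"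
    "cut M X = m" "cut M (insert t X) = m"
proof -
  define T where "T = {X. X \<subseteq> V \<and> x0 \<in> X \<and> x1 \<notin> X \<and> cut M X = m}"
  have T: "X \<union> Y \<in> T" "X \<inter> Y \<in> T" if "X \<in> T" "Y \<in> T" for X Y
    using that tight_Un_Int[of X Y] unfolding T_def by auto
  have sepT: "\<exists>X\<in>T. (u \<in> X) \<noteq> (v \<in> X)" if "u \<in> V - {x0, x1}" "v \<in> V - {x0, x1}" "u \<noteq> v" for u v
    using sepd that unfolding tight_separated_def T_def by blast
  have "card (V - {x0, x1}) \<ge> 3" using assms(2) roots by (simp add: card_Diff_subset)
  then obtain B where B: "B \<subseteq> V - {x0, x1}" "card B = 3" by (meson obtain_subset_with_card_n)
  obtain a b c where abc: "B = {a, b, c}" "a \<noteq> b" "a \<noteq> c" "b \<noteq> c" using B(2) by (metis card_3_iff)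
  obtain X1 where X1: "X1 \<in> T" "(a \<in> X1) \<noteq> (b \<in> X1)" using sepT abc B(1) by blast
  have "\<exists>X Y. X \<in> T \<and> Y \<in> T \<and> X \<subset> Y"
  proof -
    have split: "\<exists>X Y. X \<in> T \<and> Y \<in> T \<and> X \<subset> Y" if "s \<in> V - {x0, x1}" "t \<in> V - {x0, x1}" "s \<noteq> t" "(s \<in> X1) = (t \<in> X1)" for s t
    proof -
      obtain X2 where "X2 \<in> T" "(s \<in> X2) \<noteq> (t \<in> X2)" using sepT \<open>s \<in> V - {x0, x1}\<close> \<open>t \<in> V - {x0, x1}\<close> \<open>s \<noteq> t\<close> by blast
      moreover from this have "X1 \<inter> X2 \<subset> X1 \<or> X1 \<subset> X1 \<union> X2" using that(4) by blast
      ultimately show ?thesis using T X1(1) by blast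
    qed
    have "(a \<in> X1) = (c \<in> X1) \<or> (b \<in> X1) = (c \<in> X1)" using X1(2) by blast
    then show ?thesis using split[of a c] split[of b c] abc B(1) by blast
  qed
  define Q where "Q n \<longleftrightarrow> (\<exists>X Y. X \<in> T \<and> Y \<in> T \<and> X \<subset> Y \<and> card (Y - X) = n)" for n
  have "\<exists>n. Q n" using \<open>\<exists>X Y. X \<in> T \<and> Y \<in> T \<and> X \<subset> Y\<close> unfolding Q_def by blast
  then obtain n where n: "Q n" "\<forall>k<n. \<not> Q k" using exists_least_iff[of Q] by blast
  from n(1) obtain X Y where XY: "X \<in> T" "Y \<in> T" "X \<subset> Y" "card (Y - X) = n"
    unfolding Q_def by blast
  have min: "card (Y - X) \<le> card (Y' - X')" if "X' \<in> T" "Y' \<in> T" "X' \<subset> Y'" for X' Y'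
  proof (rule ccontr)
    assume "\<not> card (Y - X) \<le> card (Y' - X')"
    then have "\<not> Q (card (Y' - X'))" using n(2) XY(4) by simp
    then show False using that unfolding Q_def by blast
  qed
  have fY: "finite Y" using XY(2) finite_sub unfolding T_def by blast
  obtain t where t: "t \<in> Y - X" using XY by blast
  have "Y = insert t X"
  proof (rule ccontr)
    assume "Y \<noteq> insert t X"
    then obtain t' where t': "t' \<in> Y - X" "t \<noteq> t'" using XY t by blast
    obtain Z where Z: "X \<subset> Z" "Z \<subset> Y" "cut M Z = m"
      using tight_refine[OF sepd, of X Y t t'] XY t t' unfolding T_def by blast
    then have "Z \<in> T" using XY unfolding T_def by auto
    moreover have "card (Z - X) < card (Y - X)" using Z fY by (intro psubset_card_mono) auto
    ultimately show False using min[OF XY(1) \<open>Z \<in> T\<close>] Z(1) by simp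
  qed
  then show thesis using XY(1,2) t unfolding T_def by (intro that[of X t]) auto
qed

section \<open>Contraction of one side of a tight cut\<close>

definition contract_map :: "'v set \<Rightarrow> 'v \<Rightarrow> 'v" where
  "contract_map X v = (if v \<in> X then v else x1)"

text \<open>Everything outside \<open>X\<close> becomes \<open>x1\<close>; the filter discards the
  loops that arise.\<close>

definition contract_edges :: "'v set \<Rightarrow> 'v set multiset \<Rightarrow> 'v set multiset" where
  "contract_edges X N = {#e \<in># image_mset ((`) (contract_map X)) N. card e = 2#}"

lemma contract_edges_add [simp]: "contract_edges X (A + B) = contract_edges X A + contract_edges X B"
  by (simp add: contract_edges_def)

lemma contract_pair:
  assumes "a \<noteq> b" "x1 \<notin> X"
  shows "contract_edges X {#{a, b}#} =
    (if a \<in> X \<and> b \<in> X then {#{a, b}#} else if a \<in> X then {#{a, x1}#} else if b \<in> X then {#{b, x1}#} else {#})"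
proof -
  have "a \<noteq> x1" if "a \<in> X" using that assms(2) by auto
  moreover have "b \<noteq> x1" if "b \<in> X" using that assms(2) by auto
  ultimately show ?thesis using assms(1)
    by (cases "a \<in> X"; cases "b \<in> X") (simp_all add: contract_edges_def contract_map_def doubleton_eq_iff)
qed

lemma cut_contract:
  assumes "simple_edges V N" "Y \<subseteq> X" "x1 \<notin> X"
  shows "cut (contract_edges X N) Y = cut N Y"
  using assms(1)
proof (induction N)
  case empty
  show ?case by (simp add: contract_edges_def)
next
  case (add e N)
  obtain a b where e: "e = {a, b}" "a \<noteq> b" by (rule simple_edgesD[OF add.prems, of e]) simp_all
  have ab: "a \<noteq> x1" if "a \<in> X" using that assms(3) by auto
  have bx: "b \<noteq> x1" if "b \<in> X" using that assms(3) by auto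
  have nY: "w \<notin> Y" if "w \<notin> X" for w using that assms(2) by auto
  have x1Y: "x1 \<notin> Y" using assms by auto
  have "cut (contract_edges X {#e#}) Y = cut {#e#} Y"
    unfolding e(1) contract_pair[OF e(2) assms(3)]
    using card_pair_Int[OF e(2), of Y] card_pair_Int[OF ab, of Y] card_pair_Int[OF bx, of Y] nY[of a] nY[of b] x1Y
    by (cases "a \<in> X"; cases "b \<in> X") (simp_all add: insert_commute)
  moreover have "cut (contract_edges X N) Y = cut N Y" using add by (simp add: simple_edges_def)
  moreover have "contract_edges X (add_mset e N) = contract_edges X {#e#} + contract_edges X N"
    by (simp add: contract_edges_def)
  ultimately show ?case by simp
qed

lemma simple_contract:
  assumes "simple_edges V N" "X \<subseteq> V" "x1 \<notin> X"
  shows "simple_edges (insert x1 X) (contract_edges X N)"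
proof -
  have "finite X" using assms(2) finite_sub by blast
  then show ?thesis unfolding simple_edges_def contract_edges_def contract_map_def by auto
qed

lemma path_single_crossing:
  assumes "is_path x0 x1 p" "x0 \<in> X" "x1 \<notin> X" "cut (path_edges p) X = 1"
  obtains l a b r where "p = l @ a # b # r" "set l \<subseteq> X" "a \<in> X" "b \<notin> X" "set r \<inter> X = {}"
proof -
  have "x1 \<in> set p" using assms(1) is_path_ends by metis
  then obtain q b r where p: "p = q @ b # r" "b \<notin> X" "\<forall>z\<in>set q. z \<in> X"
    using split_list_first_prop[of p "\<lambda>z. z \<notin> X"] assms(3) by blast
  have "q \<noteq> []" using p assms(1,2) by (auto simp: is_path_def)
  then obtain l a where q: "q = l @ [a]" by (metis rev_exhaust)
  have aX: "a \<in> X" using p(3) q by simp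
  have "set r \<inter> X = {}"
  proof (rule ccontr)
    assume "set r \<inter> X \<noteq> {}"
    then obtain w where w: "w \<in> set r" "w \<in> X" by blast
    have "linked (path_edges (b # r)) b w" using w by (intro path_linked_mem) auto
    then have "cut (path_edges (b # r)) X \<ge> 1" using linked_cut[of _ b w X] w(2) p(2) by blast
    moreover have "path_edges p = path_edges (l @ [a]) + path_edges (a # b # r)"
      unfolding p(1) q using path_edges_append[of l a "b # r"] by simp
    moreover have "card ({a, b} \<inter> X) = 1" using aX p(2) card_pair_Int[of a b X] by auto
    ultimately show False using assms(4) by simp
  qed
  then show thesis using that[of l a b r] p q aX by auto
qed

lemma contract_edges_inside:
  assumes "\<And>e. e \<in># N \<Longrightarrow> card e = 2 \<and> e \<subseteq> X"
  shows "contract_edges X N = N"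
proof -
  have "contract_map X ` e = e" if "e \<in># N" for e
  proof -
    have "contract_map X v = v" if "v \<in> e" for v using assms \<open>e \<in># N\<close> that by (auto simp: contract_map_def)
    then show ?thesis by simp
  qed
  then have "image_mset ((`) (contract_map X)) N = image_mset (\<lambda>e. e) N" by (intro image_mset_cong) blast
  then show ?thesis using assms by (simp add: contract_edges_def filter_mset_eq_conv)
qed

lemma contract_edges_outside:
  assumes "\<And>e. e \<in># N \<Longrightarrow> e \<inter> X = {}"
  shows "contract_edges X N = {#}"
proof -
  have "card (contract_map X ` e) \<noteq> 2" if "e \<in># N" for e
  proof -
    have "contract_map X ` e \<subseteq> {x1}" using assms[OF that] by (auto simp: contract_map_def)
    then have "card (contract_map X ` e) \<le> 1" using card_mono[of "{x1}"] by simp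
    then show ?thesis by simp
  qed
  then show ?thesis by (auto simp: contract_edges_def filter_mset_eq_conv)
qed

text \<open>After its only crossing the path stays outside \<open>X\<close>, so its tail together
  with the crossing edge can be split into a single edge to \<open>x1\<close>.\<close>

lemma immerses_contract_path:
  assumes p: "is_path x0 x1 p" and X: "x0 \<in> X" "x1 \<notin> X" "cut (path_edges p) X = 1"
  shows "immerses (path_edges p) (contract_edges X (path_edges p))"
proof -
  obtain l a b r where lr: "p = l @ a # b # r" "set l \<subseteq> X" "a \<in> X" "b \<notin> X" "set r \<inter> X = {}"
    by (rule path_single_crossing[OF p X])
  have d: "distinct p" "last (b # r) = x1" using p lr(1) by (auto simp: is_path_def)
  have pe: "path_edges p = path_edges (l @ [a]) + ({#{a, b}#} + path_edges (b # r))"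
    unfolding lr(1) using path_edges_append[of l a "b # r"] by simp
  have "contract_edges X (path_edges (l @ [a])) = path_edges (l @ [a])"
  proof (rule contract_edges_inside)
    fix e assume "e \<in># path_edges (l @ [a])"
    then show "card e = 2 \<and> e \<subseteq> X"
      using path_edges_in[of e "l @ [a]"] path_edges_card[of "l @ [a]" e] d(1) lr by auto
  qed
  moreover have "contract_edges X (path_edges (b # r)) = {#}"
  proof (rule contract_edges_outside)
    fix e assume "e \<in># path_edges (b # r)"
    then show "e \<inter> X = {}" using path_edges_in[of e "b # r"] lr(4,5) by auto
  qed
  moreover have "contract_edges X {#{a, b}#} = {#{a, x1}#}"
    using contract_pair[of a b X] X(2) lr(3,4) by auto
  ultimately have c: "contract_edges X (path_edges p) = path_edges (l @ [a]) + {#{a, x1}#}"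
    unfolding pe by (simp only: contract_edges_add add_0_right)
  have "immerses (path_edges (a # b # r)) {#{a, x1}#}"
    using path_immerses[of "a # b # r"] d lr X(2) by auto
  then show ?thesis unfolding c unfolding pe by (intro immerses_add) simp_all
qed

text \<open>By Menger's theorem there are \<open>m\<close> paths, and since the cut has only
  \<open>m\<close> edges each path crosses it once and no other edge crosses. So contraction is
  splitting along the tails of the paths and deleting the other edges outside
  \<open>X\<close>.\<close>

lemma immerses_contract:
  assumes X: "X \<subseteq> V" "x0 \<in> X" "x1 \<notin> X" "cut M X = m"
  shows "immerses M (contract_edges X M)"
proof -
  obtain P where P: "size P = m" "\<forall>p\<in>#P. is_path x0 x1 p" "edges_of P \<subseteq># M"
    using menger[OF simple roots sep] by blast
  define N where "N = M - edges_of P"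
  have M: "M = N + edges_of P" using P(3) by (simp add: N_def)
  have ge: "\<forall>p\<in>#P. cut (path_edges p) X \<ge> 1"
    using linked_cut[OF is_path_linked] P(2) X by metis
  have le: "cut N X + cut (edges_of P) X = m" using M X(4) by (metis cut_add)
  have "cut (edges_of P) X \<ge> m" using cut_paths_ge[of P x0 x1 X] P X by auto
  then have cP: "cut (edges_of P) X = size P" "cut N X = 0" using le P(1) by linarith+
  \<comment> \<open>Each path crosses at least once and the crossings number at most
    \<open>size Q\<close>, so equality holds for every path.\<close>
  have each: "immerses (edges_of Q) (contract_edges X (edges_of Q))"
    if "\<forall>p\<in>#Q. is_path x0 x1 p \<and> cut (path_edges p) X \<ge> 1" "cut (edges_of Q) X \<le> size Q" for Q
    using that
  proof (induction Q)
    case (add p Q)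
    have "size Q \<le> cut (edges_of Q) X"
      using cut_paths_ge[of Q x0 x1 X] add.prems(1) X by auto
    moreover have "cut (path_edges p) X \<ge> 1" using add.prems(1) by simp
    ultimately have "cut (path_edges p) X = 1" "cut (edges_of Q) X \<le> size Q"
      using add.prems(2) by simp_all
    then show ?case using add immerses_contract_path[of p X] X by (simp add: immerses_add)
  qed (simp add: contract_edges_def)
  have "immerses N (contract_edges X N)"
  proof -
    let ?I = "{#e \<in># N. e \<subseteq> X#}" and ?O = "{#e \<in># N. \<not> e \<subseteq> X#}"
    have N: "N = ?I + ?O" by (rule multiset_partition)
    have sN: "simple_edges V N" using simple unfolding N_def by (rule simple_edges_mono) simp
    have "contract_edges X ?I = ?I" using sN by (intro contract_edges_inside) (auto simp: simple_edges_def)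
    moreover have "contract_edges X ?O = {#}"
    proof (rule contract_edges_outside)
      fix e assume "e \<in># ?O"
      then have e: "e \<in># N" "\<not> e \<subseteq> X" by auto
      obtain a b where ab: "e = {a, b}" "a \<noteq> b" by (rule simple_edgesD[OF sN e(1)])
      have "card (e \<inter> X) \<noteq> 1" using cP(2) e(1) cut_pos_iff[of N X] by auto
      then show "e \<inter> X = {}" using card_pair_Int[OF ab(2), of X] ab(1) e(2) by auto
    qed
    ultimately have "contract_edges X N = ?I" using N contract_edges_add by (metis add.right_neutral)
    then show ?thesis by (simp add: immerses_sub)
  qed
  then show ?thesis unfolding M using each[of P] P(2) ge cP(1) by (simp add: immerses_add)
qed

lemma contract_admissible:
  assumes X: "X \<subseteq> V" "x0 \<in> X" "x1 \<notin> X" "card X \<ge> 3"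
  shows "admissible m (insert x1 X) (contract_edges X M) x0 x1"
proof
  have c: "cut (contract_edges X M) Y = cut M Y" if "Y \<subseteq> X" for Y
    using cut_contract[OF simple that X(3)] .
  show "simple_edges (insert x1 X) (contract_edges X M)" by (rule simple_contract[OF simple X(1,3)])
  have "finite X" using X(1) finite_V by (rule finite_subset)
  then show "card (insert x1 X) \<ge> 4" using X by simp
  have sub: "Y \<subseteq> X" "Y \<subseteq> V - {x0, x1}" if "Y \<subseteq> insert x1 X - {x0, x1}" for Y
    using that X(1) by blast+
  show "cut (contract_edges X M) Y \<ge> 3" if "Y \<subseteq> insert x1 X - {x0, x1}" "Y \<noteq> {}" for Y
    using c[OF sub(1)[OF that(1)]] nonsep[OF sub(2)[OF that(1)] that(2)] by simp
  show "cut (contract_edges X M) Y \<ge> 4" if "Y \<subseteq> insert x1 X - {x0, x1}" "card Y \<ge> 2" for Y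
    using c[OF sub(1)[OF that(1)]] nonsep_int[OF sub(2)[OF that(1)] that(2)] by simp
  show "cut (contract_edges X M) Y \<ge> m" if "Y \<subseteq> insert x1 X" "x0 \<in> Y" "x1 \<notin> Y" for Y
  proof -
    have "Y \<subseteq> X" using that by blast
    then show ?thesis using c[of Y] sep[of Y] X(1) that(2,3) by auto
  qed
qed (use roots m_ge_2 X in auto)

lemma size_contract: "size (contract_edges X M) \<le> size M"
  unfolding contract_edges_def by (metis size_filter_mset_lesseq size_image_mset)

text \<open>The induction hypothesis applies to the contracted graph because at least two vertices
  were merged. There \<open>x1\<close> has degree \<open>m\<close>, whereas type B would give it
  degree \<open>m + 1\<close>; a D would lift back. The tight cuts that remain are tight in the
  original graph too.\<close>

lemma contract_side:
  assumes X: "X \<subseteq> V" "x0 \<in> X" "x1 \<notin> X" "cut M X = m" "card (V - X) \<ge> 2"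
    and IH: "outcome_below V M"
    and no: "\<not> has_D m V M x0 x1"
    and uv: "u \<in> X - {x0}" "v \<in> X - {x0}" "u \<noteq> v"
  shows "\<exists>Y \<subseteq> X. x0 \<in> Y \<and> cut M Y = m \<and> (u \<in> Y) \<noteq> (v \<in> Y)"
proof -
  let ?W = "insert x1 X" and ?N = "contract_edges X M"
  have fX: "finite X" using X(1) finite_V by (rule finite_subset)
  have "card {x0, u, v} \<le> card X" using fX uv X(2) by (intro card_mono) auto
  then have c3: "card X \<ge> 3" using uv by auto
  have adm: "admissible m ?W ?N x0 x1" using contract_admissible[OF X(1-3) c3] .
  have "card V = card X + card (V - X)" using card_Diff_subset[OF fX X(1)] card_mono[OF finite_V X(1)] by simp
  then have "card ?W < card V" using X(3,5) fX by simp
  then have "outcome m ?W ?N x0 x1" using outcome_belowD[OF IH adm] size_contract[of X] by simp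
  moreover have "\<not> has_D m ?W ?N x0 x1"
    using has_D_immerses[OF _ immerses_contract[OF X(1-4)]] no X(1) roots by blast
  moreover have "\<not> bundled (Suc m) ?W ?N x0 x1 P" for P
  proof
    assume "bundled (Suc m) ?W ?N x0 x1 P"
    then have "cut ?N {x1} = Suc m" using bundled_degree(2) roots(3) by metis
    moreover have "cut ?N (?W - X) = cut ?N X"
      using cut_compl[OF simple_contract[OF simple X(1,3)]] .
    moreover have "?W - X = {x1}" using X(3) by auto
    moreover have "cut ?N X = m" using cut_contract[OF simple _ X(3), of X] X(4) by simp
    ultimately show False by simp
  qed
  ultimately have "tight_separated m ?W ?N x0 x1" unfolding outcome_def by blast
  then obtain Y where Y: "Y \<subseteq> ?W" "x0 \<in> Y" "x1 \<notin> Y" "cut ?N Y = m" "(u \<in> Y) \<noteq> (v \<in> Y)"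
    using uv X(3) unfolding tight_separated_def by blast
  then have "Y \<subseteq> X" by auto
  then show ?thesis using Y cut_contract[OF simple _ X(3), of Y] by auto
qed

text \<open>A pair of nonroots on the same side is separated by a cut of the contraction that keeps
  this side, a pair on different sides by \<open>X\<close> itself.\<close>

lemma tight_cut_outcome:
  assumes X: "X \<subseteq> V" "x0 \<in> X" "x1 \<notin> X" "cut M X = m" "card X \<ge> 2" "card (V - X) \<ge> 2"
    and IH: "outcome_below V M"
  shows "outcome m V M x0 x1"
proof (cases "has_D m V M x0 x1")
  case False
  interpret s: admissible m V M x1 x0 by (rule sym)
  have no: "\<not> has_D m V M x1 x0" using False has_D_sym by metis
  have X': "V - X \<subseteq> V" "x1 \<in> V - X" "x0 \<notin> V - X" "cut M (V - X) = m" "card (V - (V - X)) \<ge> 2"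
    using X roots cut_compl[OF simple, of X] by (auto simp: double_diff)
  have "\<exists>Y\<subseteq>V. x0 \<in> Y \<and> x1 \<notin> Y \<and> cut M Y = m \<and> (u \<in> Y) \<noteq> (v \<in> Y)"
    if uv: "u \<in> V - {x0, x1}" "v \<in> V - {x0, x1}" "u \<noteq> v" for u v
  proof -
    consider "u \<in> X" "v \<in> X" | "u \<in> V - X" "v \<in> V - X" | "(u \<in> X) \<noteq> (v \<in> X)" using uv by blast
    then show ?thesis
    proof cases
      case 1
      then obtain Y where "Y \<subseteq> X" "x0 \<in> Y" "cut M Y = m" "(u \<in> Y) \<noteq> (v \<in> Y)"
        using contract_side[OF X(1-4,6) IH False, of u v] uv by blast
      then show ?thesis using X by blast
    next
      case 2
      then obtain Y where Y: "Y \<subseteq> V - X" "x1 \<in> Y" "cut M Y = m" "(u \<in> Y) \<noteq> (v \<in> Y)"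
        using s.contract_side[OF X' IH no, of u v] uv by blast
      then show ?thesis using cut_compl[OF simple, of Y] X uv roots by (intro exI[of _ "V - Y"]) auto
    qed (use X in blast)
  qed
  then show ?thesis unfolding outcome_def tight_separated_def by blast
qed (simp add: outcome_def)

section \<open>Edges between the roots\<close>

lemma cut_root_edge:
  assumes "{x0, x1} \<in># M"
  shows "x0 \<in> X \<Longrightarrow> x1 \<notin> X \<Longrightarrow> cut M X = Suc (cut (M - {#{x0, x1}#}) X)"
    "X \<subseteq> V - {x0, x1} \<Longrightarrow> cut (M - {#{x0, x1}#}) X = cut M X"
proof -
  have c: "cut M X = (if card ({x0, x1} \<inter> X) = 1 then 1 else 0) + cut (M - {#{x0, x1}#}) X"
    using assms by (metis cut_add_mset insert_DiffM)
  show "cut M X = Suc (cut (M - {#{x0, x1}#}) X)" if "x0 \<in> X" "x1 \<notin> X"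
    using c that card_pair_Int[OF roots(3), of X] by simp
  show "cut (M - {#{x0, x1}#}) X = cut M X" if "X \<subseteq> V - {x0, x1}"
  proof -
    have "x0 \<notin> X" "x1 \<notin> X" using that by auto
    then show ?thesis using c card_pair_Int[OF roots(3), of X] by simp
  qed
qed

lemma delete_root_edge_admissible:
  assumes e: "{x0, x1} \<in># M" and k: "k \<ge> 2" "\<And>X. X \<subseteq> V \<Longrightarrow> x0 \<in> X \<Longrightarrow> x1 \<notin> X \<Longrightarrow> cut M X \<ge> Suc k"
  shows "admissible k V (M - {#{x0, x1}#}) x0 x1"
proof
  show "simple_edges V (M - {#{x0, x1}#})" using simple by (rule simple_edges_mono) simp
  show "cut (M - {#{x0, x1}#}) X \<ge> k" if "X \<subseteq> V" "x0 \<in> X" "x1 \<notin> X" for X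
    using cut_root_edge(1)[OF e that(2,3)] k(2)[OF that] by simp
qed (use roots card_V k nonsep nonsep_int cut_root_edge(2)[OF e] in auto)

text \<open>Each outcome for \<open>m - 1\<close> survives putting the edge back: D gains a root
  edge, every tight separating cut gains one edge, and the bundles gain the path
  \<open>[x0, x1]\<close>. The assumption on \<open>m\<close> keeps \<open>m - 1\<close> at least
  2.\<close>

lemma root_edge_outcome:
  assumes "m \<ge> 3" and e: "{x0, x1} \<in># M"
    and IH: "outcome_below V M"
  shows "outcome m V M x0 x1"
proof -
  let ?N = "M - {#{x0, x1}#}"
  have M: "M = ?N + {#{x0, x1}#}" using e by simp
  have m: "Suc (m - 1) = m" using assms(1) by simp
  have "admissible (m - 1) V ?N x0 x1"
    using delete_root_edge_admissible[OF e, of "m - 1"] sep assms(1) m by simp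
  moreover have "size ?N < size M" using e by (simp add: size_Diff1_less)
  ultimately have "outcome (m - 1) V ?N x0 x1" using outcome_belowD[OF IH, of "m - 1" V ?N x0 x1] by simp
  then consider "has_D (m - 1) V ?N x0 x1" | "tight_separated (m - 1) V ?N x0 x1" | P where "bundled m V ?N x0 x1 P"
    unfolding outcome_def m by blast
  then show ?thesis
  proof cases
    case 1
    then obtain u v where uv: "u \<in> V - {x0, x1}" "v \<in> V - {x0, x1}" "u \<noteq> v"
        "immerses ?N (D_edges (m - 1) x0 x1 u v)"
      unfolding has_D_def by blast
    have "m - 2 = Suc (m - 1 - 2)" using assms(1) by simp
    then have D: "D_edges m x0 x1 u v = D_edges (m - 1) x0 x1 u v + {#{x0, x1}#}"
      unfolding D_edges_def by simp
    have "immerses M (D_edges m x0 x1 u v)"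
      unfolding D using immerses_add_right[OF uv(4), of "{#{x0, x1}#}"] unfolding M[symmetric] .
    then have "has_D m V M x0 x1" unfolding has_D_def using uv(1-3) by blast
    then show ?thesis by (simp add: outcome_def)
  next
    case 2
    have "tight_separated m V M x0 x1"
      unfolding tight_separated_def
    proof (intro ballI impI)
      fix u v assume uv: "u \<in> V - {x0, x1}" "v \<in> V - {x0, x1}" "u \<noteq> v"
      obtain X where X: "X \<subseteq> V" "x0 \<in> X" "x1 \<notin> X" "cut ?N X = m - 1" "(u \<in> X) \<noteq> (v \<in> X)"
        using 2[unfolded tight_separated_def, rule_format, OF uv] by (elim exE conjE)
      then have "cut M X = m" using cut_root_edge(1)[OF e X(2,3)] m by simp
      then show "\<exists>X\<subseteq>V. x0 \<in> X \<and> x1 \<notin> X \<and> cut M X = m \<and> (u \<in> X) \<noteq> (v \<in> X)"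
        using X by (intro exI[of _ X] conjI)
    qed
    then show ?thesis by (simp add: outcome_def)
  next
    case 3
    have p0: "is_path x0 x1 [x0, x1]" using roots by (simp add: is_path_def)
    have "bundled (Suc m) V M x0 x1 (add_mset [x0, x1] P)"
      unfolding bundled_def
    proof (intro conjI)
      have P: "size P = m" "\<forall>p\<in>#P. is_path x0 x1 p" "?N = edges_of P"
        "V = {x0, x1} \<union> (\<Union>p \<in> set_mset P. set p)"
        "\<And>p q w. p \<in># P \<Longrightarrow> q \<in># P \<Longrightarrow> w \<in> V - {x0, x1} \<Longrightarrow> w \<in> set p \<Longrightarrow> w \<in> set q \<Longrightarrow> p = q"
        "\<And>p. p \<in># P \<Longrightarrow> p \<noteq> [x0, x1] \<Longrightarrow> count P p \<ge> 2 \<and> (length p \<ge> 4 \<longrightarrow> count P p = 2)"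
        using 3 unfolding bundled_def by blast+
      show "size (add_mset [x0, x1] P) = Suc m" using P by simp
      show "\<forall>p\<in>#add_mset [x0, x1] P. is_path x0 x1 p" using P p0 by simp
      have "edges_of (add_mset [x0, x1] P) = ?N + {#{x0, x1}#}" using P(3) by simp
      then show "M = edges_of (add_mset [x0, x1] P)" unfolding M[symmetric] by (rule HOL.sym)
      show "V = {x0, x1} \<union> (\<Union>p \<in> set_mset (add_mset [x0, x1] P). set p)" using P(4) by auto
      show "\<forall>p\<in>#add_mset [x0, x1] P. \<forall>q\<in>#add_mset [x0, x1] P. \<forall>w\<in>V - {x0, x1}. w \<in> set p \<longrightarrow> w \<in> set q \<longrightarrow> p = q"
        using P(5) by auto
      show "\<forall>p\<in>#add_mset [x0, x1] P. p \<noteq> [x0, x1] \<longrightarrow>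
          2 \<le> count (add_mset [x0, x1] P) p \<and> (4 \<le> length p \<longrightarrow> count (add_mset [x0, x1] P) p = 2)"
        using P(6) by auto
    qed
    then show ?thesis unfolding outcome_def by (intro disjI2) (rule exI)
  qed
qed

end

context admissible
begin

lemma linked_doubleton: "linked {#{a, b}#} a b" "linked {#{a, b}#} b a"
  by (simp_all add: linked_edge insert_commute)

lemma linked_two: "linked {#{a, b}, {b, c}#} a c"
  using linked_add_trans[OF linked_doubleton(1)[of a b] linked_doubleton(1)[of b c]] by (simp add: add_mset_commute)

lemma linked_three: "linked {#{a, b}, {b, c}, {c, d}#} a d"
  using linked_add_trans[OF linked_doubleton(1)[of a b] linked_two[of b c d]] by (simp add: add_mset_commute)

text \<open>Both roots lend one edge to \<open>x0x1\<close>: the path from \<open>x1\<close> to \<open>y\<close> runs through \<open>x0\<close> and the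
  one from \<open>x0\<close> to \<open>z\<close> through \<open>x1\<close>.\<close>

lemma has_D_two_root_edges:
  assumes yz: "y \<in> V - {x0, x1}" "z \<in> V - {x0, x1}" "y \<noteq> z" and "linked Q y z"
    and sub: "replicate_mset 2 {x0, x1} + replicate_mset 2 {x0, y} + replicate_mset 2 {x1, z} + Q \<subseteq># N"
  shows "has_D 2 V N x0 x1"
proof (rule has_DI[OF yz roots(3)])
  show "linked {#{x0, y}#} x0 y" "linked {#{x1, z}#} x1 z" by (rule linked_doubleton)+
  show "linked {#{x0, x1}, {x1, z}#} x0 z" by (rule linked_two)
  show "linked {#{x0, x1}, {x0, y}#} x1 y"
    using linked_two[of x1 x0 y] by (simp add: insert_commute)
  show "linked Q y z" by fact
  show "2 \<le> size ({#} :: 'v list multiset) + 2" by simp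
  have eq: "{#{x0, y}#} + {#{x0, x1}, {x1, z}#} + {#{x0, x1}, {x0, y}#} + {#{x1, z}#} + Q + edges_of {#}
      = replicate_mset 2 {x0, x1} + replicate_mset 2 {x0, y} + replicate_mset 2 {x1, z} + Q"
    by (simp add: numeral_2_eq_2)
  show "{#{x0, y}#} + {#{x0, x1}, {x1, z}#} + {#{x0, x1}, {x0, y}#} + {#{x1, z}#} + Q + edges_of {#} \<subseteq># N"
    unfolding eq by (rule sub)
qed simp

text \<open>The set \<open>{t}\<close> is the symmetric difference of \<open>X\<close> and
  \<open>insert t X\<close>, so an edge leaving it crosses one of these.\<close>

lemma cut_singleton_le:
  assumes "simple_edges V N" "t \<notin> X"
  shows "cut N {t} \<le> cut N X + cut N (insert t X)"
  using assms(1)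
proof (induction N)
  case (add e N)
  obtain a b where e: "e = {a, b}" "a \<noteq> b" by (rule simple_edgesD[OF add.prems, of e]) simp_all
  have "cut {#e#} {t} \<le> cut {#e#} X + cut {#e#} (insert t X)"
    using assms(2) e(2) card_pair_Int[OF e(2), of "{t}"] card_pair_Int[OF e(2), of X]
      card_pair_Int[OF e(2), of "insert t X"] unfolding e(1)
    by (cases "a = t"; cases "b = t"; cases "a \<in> X"; cases "b \<in> X"; simp)
  moreover have "cut N {t} \<le> cut N X + cut N (insert t X)" using add by (simp add: simple_edges_def)
  moreover have s: "cut (add_mset e N) Y = cut {#e#} Y + cut N Y" for Y by simp
  ultimately show ?case using s[of "{t}"] s[of X] s[of "insert t X"] by linarith
qed simp

text \<open>Of the three edges across the cut at least two are root edges, so at most one joins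
  other vertices. The degrees of \<open>y\<close> and \<open>z\<close> are at least 3, which forces
  double edges \<open>x0 y\<close> and \<open>x1 z\<close>; a link from \<open>y\<close> to
  \<open>z\<close> is found in each case, and \<open>has_D_two_root_edges\<close> applies.\<close>

lemma double_root_edge_tight_small:
  assumes V: "V = {x0, x1, y, z}" "y \<noteq> z" and yz: "y \<in> V - {x0, x1}" "z \<in> V - {x0, x1}"
    and e: "count M {x0, x1} \<ge> 2" and X: "cut M {x0, y} = 3"
  shows "has_D 2 V M x0 x1"
proof -
  have ne: "y \<noteq> x0" "y \<noteq> x1" "z \<noteq> x0" "z \<noteq> x1" "x0 \<noteq> x1" "y \<noteq> z" using yz roots(3) V(2) by auto
  have "{x0, y} \<subseteq> V" using V by auto
  moreover have "V - {x0, y} = {x1, z}" using V yz roots(3) by auto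
  ultimately have "cut M {x0, y} = (\<Sum>a\<in>{x0, y}. \<Sum>b\<in>{x1, z}. count M {a, b})"
    using cut_as_sum[OF simple, of "{x0, y}"] by simp
  then have c: "count M {x0, x1} + count M {x0, z} + count M {y, x1} + count M {y, z} = 3"
    unfolding X using ne by simp
  have "{y} \<subseteq> V" "V - {y} = {x0, x1, z}" "{z} \<subseteq> V" "V - {z} = {x0, x1, y}" using V yz roots(3) by auto
  then have dy: "count M {y, x0} + count M {y, x1} + count M {y, z} \<ge> 3"
    and dz: "count M {z, x0} + count M {z, x1} + count M {z, y} \<ge> 3"
    using cut_as_sum[OF simple, of "{y}"] cut_as_sum[OF simple, of "{z}"] nonsep[of "{y}"] nonsep[of "{z}"]
      yz ne by simp_all
  have comm: "{y, x0} = {x0, y}" "{z, x0} = {x0, z}" "{z, x1} = {x1, z}" "{z, y} = {y, z}" by auto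
  have d1: "{x0, x1} \<noteq> {x0, y}" "{x0, x1} \<noteq> {x1, z}" "{x0, y} \<noteq> {x1, z}"
    "{x0, x1} \<noteq> {y, z}" "{x0, y} \<noteq> {y, z}" "{x1, z} \<noteq> {y, z}"
    "{x0, x1} \<noteq> {y, x1}" "{x0, y} \<noteq> {y, x1}" "{x1, z} \<noteq> {y, x1}"
    "{x0, x1} \<noteq> {x0, z}" "{x0, y} \<noteq> {x0, z}" "{x1, z} \<noteq> {x0, z}"
    using ne by (simp_all add: doubleton_eq_iff)
  \<comment> \<open>The third edge across the cut is a root edge or one of \<open>yz\<close>,
    \<open>yx1\<close>, \<open>x0z\<close>.\<close>
  consider "count M {x0, x1} = 3" "count M {x0, z} = 0" "count M {y, x1} = 0" "count M {y, z} = 0"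
    | "count M {y, z} = 1" "count M {x0, z} = 0" "count M {y, x1} = 0"
    | "count M {y, x1} = 1" "count M {x0, z} = 0" "count M {y, z} = 0"
    | "count M {x0, z} = 1" "count M {y, x1} = 0" "count M {y, z} = 0"
    using c e by linarith
  then show ?thesis
  proof cases
    case 1
    have "count M {x0, x1} \<ge> 3" "count M {x0, y} \<ge> 3" "count M {x1, z} \<ge> 3" using 1 dy dz unfolding comm by linarith+
    then have "replicate_mset 3 {x0, x1} + replicate_mset 3 {x0, y} + replicate_mset 3 {x1, z} + replicate_mset 0 {y, z} \<subseteq># M"
      using d1 by (intro image_subset_edge) simp_all
    moreover have "replicate_mset 3 {x0, x1} + replicate_mset 3 {x0, y} + replicate_mset 3 {x1, z} + replicate_mset 0 {y, z}
      = replicate_mset 2 {x0, x1} + replicate_mset 2 {x0, y} + replicate_mset 2 {x1, z} + {#{x0, y}, {x0, x1}, {x1, z}#}"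
      by (simp add: numeral_2_eq_2 numeral_3_eq_3)
    ultimately show ?thesis
      using has_D_two_root_edges[OF yz V(2), of "{#{x0, y}, {x0, x1}, {x1, z}#}" M]
        linked_three[of y x0 x1 z] by (simp add: insert_commute)
  next
    case 2
    have "count M {x0, x1} \<ge> 2" "count M {x0, y} \<ge> 2" "count M {x1, z} \<ge> 2" "count M {y, z} \<ge> 1"
      using 2 dy dz e unfolding comm by linarith+
    then have "replicate_mset 2 {x0, x1} + replicate_mset 2 {x0, y} + replicate_mset 2 {x1, z} + replicate_mset 1 {y, z} \<subseteq># M"
      using d1 by (intro image_subset_edge) simp_all
    then show ?thesis
      using has_D_two_root_edges[OF yz V(2), of "{#{y, z}#}" M] linked_doubleton[of y z] by simp
  next
    case 3
    have "count M {x0, x1} \<ge> 2" "count M {x0, y} \<ge> 2" "count M {x1, z} \<ge> 3" "count M {y, x1} \<ge> 1"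
      using 3 dy dz e unfolding comm by linarith+
    then have "replicate_mset 2 {x0, x1} + replicate_mset 2 {x0, y} + replicate_mset 3 {x1, z} + replicate_mset 1 {y, x1} \<subseteq># M"
      using d1 by (intro image_subset_edge) simp_all
    moreover have "replicate_mset 2 {x0, x1} + replicate_mset 2 {x0, y} + replicate_mset 3 {x1, z} + replicate_mset 1 {y, x1}
      = replicate_mset 2 {x0, x1} + replicate_mset 2 {x0, y} + replicate_mset 2 {x1, z} + {#{y, x1}, {x1, z}#}"
      by (simp add: numeral_2_eq_2 numeral_3_eq_3)
    ultimately show ?thesis
      using has_D_two_root_edges[OF yz V(2) linked_two[of y x1 z]] by simp
  next
    case 4
    have "count M {x0, x1} \<ge> 2" "count M {x0, y} \<ge> 3" "count M {x1, z} \<ge> 2" "count M {x0, z} \<ge> 1"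
      using 4 dy dz e unfolding comm by linarith+
    then have "replicate_mset 2 {x0, x1} + replicate_mset 3 {x0, y} + replicate_mset 2 {x1, z} + replicate_mset 1 {x0, z} \<subseteq># M"
      using d1 by (intro image_subset_edge) simp_all
    moreover have "replicate_mset 2 {x0, x1} + replicate_mset 3 {x0, y} + replicate_mset 2 {x1, z} + replicate_mset 1 {x0, z}
      = replicate_mset 2 {x0, x1} + replicate_mset 2 {x0, y} + replicate_mset 2 {x1, z} + {#{y, x0}, {x0, z}#}"
      unfolding comm by (simp add: numeral_2_eq_2 numeral_3_eq_3)
    ultimately show ?thesis
      using has_D_two_root_edges[OF yz V(2) linked_two[of y x0 z]] by (simp add: add_mset_commute)
  qed
qed

lemma is_path_root_edge:
  assumes "is_path x0 x1 p" "{x0, x1} \<in># path_edges p"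
  shows "p = [x0, x1]"
proof -
  obtain c q where p: "p = x0 # c # q" using assms roots(3) by (cases p rule: path_edges.cases) (auto simp: is_path_def)
  have "{x0, x1} \<notin># path_edges (c # q)"
    using path_edges_in[of "{x0, x1}" "c # q"] assms(1) by (auto simp: p is_path_def)
  then have "c = x1" using assms(2) roots(3) by (auto simp: p doubleton_eq_iff)
  then show ?thesis using assms(1) by (auto simp: p is_path_def split: if_splits)
qed

text \<open>Deleting one root edge keeps all separating cuts at 2 or more, so the induction
  hypothesis applies with the same \<open>m\<close>. A D lifts back at once; either obstruction is
  so restricted by the second root edge that D is found or a contradiction arises.\<close>

lemma double_root_edge_has_D:
  assumes m: "m = 2" and e: "count M {x0, x1} \<ge> 2"
    and cuts: "\<And>X. X \<subseteq> V \<Longrightarrow> x0 \<in> X \<Longrightarrow> x1 \<notin> X \<Longrightarrow> cut M X \<ge> 3"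
    and IH: "outcome_below V M"
  shows "has_D 2 V M x0 x1"
proof -
  let ?N = "M - {#{x0, x1}#}"
  have eM: "{x0, x1} \<in># M" using e by (metis count_greater_zero_iff less_le_trans zero_less_numeral)
  have adm: "admissible 2 V ?N x0 x1"
    by (rule delete_root_edge_admissible[OF eM]) (use cuts in auto)
  interpret N: admissible 2 V ?N x0 x1 by (rule adm)
  have eN: "count ?N {x0, x1} \<ge> 1" using e by simp
  then have eN': "{x0, x1} \<in># ?N" by (simp only: count_greater_eq_one_iff)
  have "outcome 2 V ?N x0 x1"
    using outcome_belowD[OF IH adm] eM by (simp add: size_Diff1_less)
  then consider "has_D 2 V ?N x0 x1" | "tight_separated 2 V ?N x0 x1" | P where "bundled (Suc 2) V ?N x0 x1 P"
    unfolding outcome_def by blast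
  then show ?thesis
  proof cases
    case 1
    show ?thesis by (rule has_D_immerses[OF 1 immerses_sub[OF diff_subset_eq_self] subset_refl])
  next
    case 2
    show ?thesis
    proof (cases "card V \<ge> 5")
      case True
      obtain X t where X: "X \<subseteq> V" "x0 \<in> X" "x1 \<notin> X" "t \<in> V - {x0, x1}" "t \<notin> X"
          "cut ?N X = 2" "cut ?N (insert t X) = 2"
        by (rule N.tight_consecutive[OF 2 True])
      \<comment> \<open>Without the second root edge as well, the cuts \<open>X\<close> and
        \<open>insert t X\<close> have size 1, so \<open>t\<close> has degree at most 2, against
        \<open>nonsep\<close>.\<close>
      let ?K = "?N - {#{x0, x1}#}"
      have "cut ?N X = Suc (cut ?K X)" using N.cut_root_edge(1)[OF eN' X(2,3)] .
      moreover have "cut ?N (insert t X) = Suc (cut ?K (insert t X))"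
        using N.cut_root_edge(1)[OF eN', of "insert t X"] X by auto
      moreover have "cut ?K {t} = cut ?N {t}" using N.cut_root_edge(2)[OF eN', of "{t}"] X(4) by simp
      moreover have "cut ?N {t} \<ge> 3" using N.nonsep[of "{t}"] X(4) by simp
      moreover have "simple_edges V ?K" using N.simple diff_subset_eq_self by (rule simple_edges_mono)
      then have "cut ?K {t} \<le> cut ?K X + cut ?K (insert t X)" using X(5) by (rule cut_singleton_le)
      ultimately show ?thesis using X(6,7) by linarith
    next
      case False
      then have "card (V - {x0, x1}) = 2" using card_V roots by (simp add: card_Diff_subset)
      then obtain y z where yz: "V - {x0, x1} = {y, z}" "y \<noteq> z" by (meson card_2_iff)
      have small: "has_D 2 V M x0 x1"
        if "V - {x0, x1} = {y, z}" "y \<noteq> z" "X \<subseteq> V" "x0 \<in> X" "x1 \<notin> X" "cut ?N X = 2" "y \<in> X" "z \<notin> X" for X y z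
      proof (rule double_root_edge_tight_small)
        show "V = {x0, x1, y, z}" using that(1) roots by auto
        have "X = {x0, y}" using that by auto
        then show "cut M {x0, y} = 3" using cut_root_edge(1)[OF eM that(4,5)] that(6) by simp
      qed (use that e in auto)
      have yzV: "y \<in> V - {x0, x1}" "z \<in> V - {x0, x1}" using yz(1) by auto
      obtain X where X: "X \<subseteq> V" "x0 \<in> X" "x1 \<notin> X" "cut ?N X = 2" "(y \<in> X) \<noteq> (z \<in> X)"
        using 2[unfolded tight_separated_def, rule_format, OF yzV yz(2)] by (elim exE conjE)
      have zy: "V - {x0, x1} = {z, y}" "z \<noteq> y" using yz by auto
      show ?thesis
      proof (cases "y \<in> X")
        case True
        then show ?thesis using small[OF yz X(1-4)] X(5) by blast
      next
        case False
        then show ?thesis using small[OF zy X(1-4)] X(5) by blast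
      qed
    qed
  next
    case 3
    have P: "size P = 3" "\<And>p. p \<in># P \<Longrightarrow> is_path x0 x1 p" "?N = edges_of P"
      "V = {x0, x1} \<union> (\<Union>p \<in> set_mset P. set p)"
      "\<And>p. p \<in># P \<Longrightarrow> p \<noteq> [x0, x1] \<Longrightarrow> count P p \<ge> 2"
      using 3 unfolding bundled_def by auto
    obtain q where "q \<in># P" "{x0, x1} \<in># path_edges q" using eN' in_edges_of P(3) by metis
    then have q: "[x0, x1] \<in># P" using is_path_root_edge P(2) by metis
    have "\<not> V \<subseteq> {x0, x1}"
    proof
      assume "V \<subseteq> {x0, x1}"
      then have "card V \<le> card {x0, x1}" by (intro card_mono) auto
      then show False using card_V roots(3) by simp
    qed
    then obtain p where p: "p \<in># P" "\<not> set p \<subseteq> {x0, x1}" using P(4) by auto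
    then have pne: "p \<noteq> [x0, x1]" by auto
    \<comment> \<open>The three paths are the remaining root edge and two copies of one path, which
      therefore contains all vertices.\<close>
    have "{#p, p, [x0, x1]#} \<subseteq># P"
      using P(5)[OF p(1) pne] q pne by (auto simp: subseteq_mset_def Suc_le_eq)
    then obtain K where K: "P = {#p, p, [x0, x1]#} + K" by (meson subset_mset.le_iff_add)
    then have "size K = 0" using P(1) by simp
    then have Peq: "{#p, p, [x0, x1]#} = P" using K by simp
    have ip: "is_path x0 x1 p" using P(2) p(1) .
    have Vp: "V = set p"
      using P(4) ip is_path_ends[OF ip] unfolding Peq[symmetric] by auto
    obtain u s where us: "p = x0 # u # s" using ip roots(3) by (cases p rule: path_edges.cases) (auto simp: is_path_def)
    have "s \<noteq> []" using us pne ip by (auto simp: is_path_def)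
    then obtain q x where "s = q @ [x]" by (metis rev_exhaust)
    then have pq: "p = x0 # (u # q) @ [x1]" using us ip by (auto simp: is_path_def)
    have "card V = length p" unfolding Vp using ip by (simp add: is_path_def distinct_card)
    then have "q \<noteq> []" using card_V pq by auto
    \<comment> \<open>The first and the last nonroot of \<open>p\<close>, which differ because there
      are at least four vertices. The double edges \<open>x0 u\<close> and \<open>x1 v\<close> serve
      as corners, the interior of \<open>p\<close> as the link.\<close>
    define v where "v = last (u # q)"
    have vq: "v \<in> set q" using \<open>q \<noteq> []\<close> by (simp add: v_def)
    have d: "distinct p" using ip by (simp add: is_path_def)
    have uv: "u \<in> V - {x0, x1}" "v \<in> V - {x0, x1}" "u \<noteq> v"
      using d vq unfolding Vp pq by auto
    have pe: "path_edges p = {#{x0, u}, {x1, v}#} + path_edges (u # q)"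
      using path_edges_snoc[of "u # q" x1] unfolding pq v_def by (simp add: insert_commute)
    have "?N = path_edges p + path_edges p + {#{x0, x1}#}" unfolding P(3) Peq[symmetric] by simp
    then have "M = path_edges p + path_edges p + {#{x0, x1}, {x0, x1}#}"
      using eM by (metis add_mset_add_single insert_DiffM union_assoc union_mset_add_mset_right)
    also have "\<dots> = replicate_mset 2 {x0, x1} + replicate_mset 2 {x0, u} + replicate_mset 2 {x1, v}
        + path_edges (u # q) + path_edges (u # q)"
      unfolding pe by (simp add: numeral_2_eq_2)
    finally have "replicate_mset 2 {x0, x1} + replicate_mset 2 {x0, u} + replicate_mset 2 {x1, v}
        + path_edges (u # q) \<subseteq># M" by simp
    moreover have "linked (path_edges (u # q)) u v" using path_linked[of "u # q"] by (simp add: v_def)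
    ultimately show ?thesis using has_D_two_root_edges[OF uv] by blast
  qed
qed

end

section \<open>Path systems\<close>

lemma linked_class: "linked R w a \<Longrightarrow> linked R w b \<Longrightarrow> linked R a b"
  by (rule linked_trans[OF linked_sym])

lemma two_in_mset: "p \<in># P \<Longrightarrow> q \<in># P \<Longrightarrow> p \<noteq> q \<Longrightarrow> {#p, q#} \<subseteq># P"
proof -
  assume "p \<in># P" "q \<in># P" "p \<noteq> q"
  then obtain P' where "P = add_mset p P'" by (meson multi_member_split)
  then show ?thesis using \<open>q \<in># P\<close> \<open>p \<noteq> q\<close> by simp
qed

lemma size_3_msetE:
  assumes "size Q = 3"
  obtains a b c where "Q = {#a, b, c#}"
proof -
  obtain a Q1 where 1: "Q = add_mset a Q1" using size_eq_Suc_imp_eq_union[of Q 2] assms by auto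
  obtain b Q2 where 2: "Q1 = add_mset b Q2" using size_eq_Suc_imp_eq_union[of Q1 1] assms 1 by auto
  obtain c Q3 where 3: "Q2 = add_mset c Q3" using size_eq_Suc_imp_eq_union[of Q2 0] assms 1 2 by auto
  show thesis using that[of a b c] assms 1 2 3 by simp
qed

lemma cut_path_untouched: "set p \<inter> Y = {} \<Longrightarrow> cut (path_edges p) Y = 0"
proof (rule cut_zeroI)
  fix e assume "set p \<inter> Y = {}" "e \<in># path_edges p"
  then have "e \<inter> Y = {}" using path_edges_in[of e p] by blast
  then show "card (e \<inter> Y) \<noteq> 1" by simp
qed

lemma cut_edges_of_untouched: "\<forall>p\<in>#P. set p \<inter> Y = {} \<Longrightarrow> cut (edges_of P) Y = 0"
  by (induction P) (auto simp: cut_path_untouched)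

locale D_free = admissible +
  assumes no_D: "\<not> has_D m V M x0 x1"
begin

definition system :: "'a list multiset \<Rightarrow> 'a set multiset \<Rightarrow> bool" where
  "system P R \<longleftrightarrow> (\<forall>p\<in>#P. is_path x0 x1 p) \<and> m \<le> size P \<and> M = edges_of P + R"

definition rooted :: "'a set multiset \<Rightarrow> 'a set" where
  "rooted R = {v \<in> V. linked R v x0 \<or> linked R v x1}"

lemma systemD:
  assumes "system P R"
  shows "\<And>p. p \<in># P \<Longrightarrow> is_path x0 x1 p" "m \<le> size P" "M = edges_of P + R" "simple_edges V R"
    "simple_edges V (edges_of P)"
    "\<And>p. p \<in># P \<Longrightarrow> set p \<subseteq> V" "\<And>p. p \<in># P \<Longrightarrow> distinct p"
proof -
  show 1: "\<And>p. p \<in># P \<Longrightarrow> is_path x0 x1 p" and 2: "m \<le> size P" and 3: "M = edges_of P + R"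
    using assms by (auto simp: system_def)
  show "simple_edges V R" "simple_edges V (edges_of P)"
    using simple_edges_mono[OF simple] 3 by simp_all
  show "distinct p" if "p \<in># P" for p using 1[OF that] by (simp add: is_path_def)
  show "set p \<subseteq> V" if "p \<in># P" for p
  proof (rule path_edges_set_sub[OF 1[OF that] _ simple roots(1)])
    have "path_edges p \<subseteq># edges_of P" using edges_of_mono[of "{#p#}" P] that by simp
    then show "path_edges p \<subseteq># M" using 3 by (simp add: subset_mset.add_increasing2)
  qed
qed

lemma no_D_passes:
  assumes "passes F1 x0 x1 u" "passes F2 x0 x1 v" "linked Q u v"
    "u \<in> V - {x0, x1}" "v \<in> V - {x0, x1}" "u \<noteq> v" "m \<le> size P + 2"
    "\<And>p. p \<in># P \<Longrightarrow> is_path x0 x1 p" "F1 + F2 + Q + edges_of P \<subseteq># M"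
  shows False
  using has_D_passesI[OF assms(1-6) roots(3) assms(7-9)] no_D by blast

text \<open>The path \<open>p\<close> passes \<open>u\<close>, the path \<open>q\<close> passes
  \<open>v\<close>, and \<open>R\<close> links them; the remaining paths are at least
  \<open>m - 2\<close> in number. So a component of \<open>R\<close> cannot touch two paths in
  different nonroots.\<close>

lemma no_D_linked:
  assumes "system P R" "{#p, q#} \<subseteq># P" "u \<in> set p" "v \<in> set q" "linked R u v"
    "u \<in> V - {x0, x1}" "v \<in> V - {x0, x1}" "u \<noteq> v"
  shows False
proof -
  obtain P' where "P = {#p, q#} + P'" using assms(2) by (meson subset_mset.le_iff_add)
  then have P: "P = add_mset p (add_mset q P')" by simp
  note S = systemD[OF assms(1)]
  have ip: "is_path x0 x1 p" "is_path x0 x1 q" using S(1) P by auto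
  show False
  proof (rule no_D_passes[OF passes_path[OF ip(1) assms(3)] passes_path[OF ip(2) assms(4)] assms(5-8)])
    show "m \<le> size P' + 2" using S(2) P by simp
    show "\<And>p. p \<in># P' \<Longrightarrow> is_path x0 x1 p" using S(1) P by simp
    show "path_edges p + path_edges q + R + edges_of P' \<subseteq># M"
      unfolding S(3) P by (simp add: ac_simps)
  qed
qed

lemma cut_linked_class:
  assumes "simple_edges V R"
  shows "cut R {z. linked R w z} = 0"
proof (rule cut_zeroI)
  fix e assume e: "e \<in># R"
  obtain a b where ab: "e = {a, b}" "a \<noteq> b" by (rule simple_edgesD[OF assms e])
  have "linked R a b" using e ab by (simp add: linked_edge)
  then have "linked R w a \<longleftrightarrow> linked R w b" using linked_trans linked_sym by metis
  then show "card (e \<inter> {z. linked R w z}) \<noteq> 1" using card_pair_Int[OF ab(2)] ab(1) by simp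
qed

text \<open>The assumption says that the positions of vertices in \<open>S\<close> form an interval,
  which a path enters and leaves at most once.\<close>

lemma cut_path_le_2:
  assumes "distinct p" and "\<And>i j k. i < j \<Longrightarrow> j < k \<Longrightarrow> k < length p \<Longrightarrow> p ! i \<in> S \<Longrightarrow> p ! k \<in> S \<Longrightarrow> p ! j \<in> S"
  shows "cut (path_edges p) S \<le> 2"
proof -
  \<comment> \<open>Strengthened for the induction: a path that starts in \<open>S\<close> only
    leaves it.\<close>
  have "cut (path_edges p) S \<le> (if p \<noteq> [] \<and> hd p \<in> S then 1 else 2)"
    using assms
  proof (induction p rule: path_edges.induct)
    case (1 a b p)
    note conv1 = 1(3) and IH1 = 1(1)
    have ab: "a \<noteq> b" "distinct (b # p)" using 1(2) by auto
    have conv: "(b # p) ! j \<in> S" if "i < j" "j < k" "k < length (b # p)" "(b # p) ! i \<in> S" "(b # p) ! k \<in> S" for i j k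
      using conv1[of "Suc i" "Suc j" "Suc k"] that by simp
    have IH: "cut (path_edges (b # p)) S \<le> (if b \<in> S then 1 else 2)" using IH1[OF ab(2) conv] by simp
    have e: "cut (path_edges (a # b # p)) S \<le> 1 + cut (path_edges (b # p)) S" by simp
    have same: "cut (path_edges (a # b # p)) S = cut (path_edges (b # p)) S" if "(a \<in> S) = (b \<in> S)"
    proof -
      have "card ({a, b} \<inter> S) \<noteq> 1"
        using card_pair_Int[OF ab(1), of S] that by simp
      then show ?thesis by simp
    qed
    show ?case
    proof (cases "a \<in> S"; cases "b \<in> S")
      assume S: "a \<in> S" "b \<notin> S"
      have "set (b # p) \<inter> S = {}"
      proof (rule ccontr)
        assume "set (b # p) \<inter> S \<noteq> {}"
        then obtain k where "k < length (b # p)" "(b # p) ! k \<in> S" by (metis disjoint_iff in_set_conv_nth)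
        moreover from this have "k > 0" using S(2) by (cases k) auto
        ultimately show False using conv1[of 0 1 "Suc k"] S by simp
      qed
      then have "cut (path_edges (b # p)) S = 0"
by (rule cut_path_untouched)
      then show ?thesis using e S(1) by (simp del: path_edges.simps)
    qed (use IH e same in \<open>auto simp del: path_edges.simps\<close>)
  qed auto
  then show ?thesis by (auto split: if_splits)
qed

text \<open>Let the class \<open>K\<close> of \<open>w\<close> in \<open>R\<close> have an edge and
  no root. Edges leaving \<open>K\<close> lie on paths, and there are at least 3. If the paths met
  \<open>K\<close> in one vertex only, then either a single path passes it, giving at most 2 edges,
  or a second path does and D arises. If two paths met \<open>K\<close> in different vertices,
  \<open>no_D_linked\<close> would apply. So exactly one path occurrence meets \<open>K\<close>, in
  at least two vertices.\<close>

lemma linked_class_touch: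
  assumes sys: "system P R" and w: "w \<in> V" "w \<notin> rooted R" "{w, w'} \<in># R"
  obtains p P' z1 z2 where "P = add_mset p P'" "\<forall>q \<in># P'. \<forall>z. linked R w z \<longrightarrow> z \<notin> set q"
    "z1 \<in> set p" "z2 \<in> set p" "z1 \<noteq> z2" "linked R w z1" "linked R w z2"
proof -
  note S = systemD[OF sys]
  define K where "K = {z. linked R w z}"
  have KV: "K \<subseteq> V - {x0, x1}"
    using linked_in[OF _ S(4) w(1)] w(1,2) by (auto simp: K_def rooted_def)
  have wK: "w \<in> K" "w' \<in> K" "w \<noteq> w'"
    using w(3) simple_edges_pair[OF S(4)] by (auto simp: K_def linked_edge)
  have cutK: "cut M K = cut (edges_of P) K" using cut_linked_class[OF S(4), of w] unfolding S(3) K_def by simp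
  have cutK3: "cut M K \<ge> 3" using nonsep[OF KV] wK by blast
  have "\<exists>z\<in>K. \<exists>p\<in>#P. z \<in> set p"
  proof (rule ccontr)
    assume "\<not> ?thesis"
    then have "cut (edges_of P) K = 0" by (intro cut_edges_of_untouched) blast
    then show False using cutK cutK3 by simp
  qed
  then obtain z1 p where z1: "z1 \<in> K" "p \<in># P" "z1 \<in> set p" by blast
  then obtain P' where P': "P = add_mset p P'" by (meson multi_member_split)
  have "\<exists>z\<in>K. z \<noteq> z1 \<and> (\<exists>q\<in>#P. z \<in> set q)"
  proof (rule ccontr)
    assume no: "\<not> ?thesis"
    show False
    proof (cases "\<exists>q\<in>#P'. z1 \<in> set q")
      case False
      then have "cut (edges_of P') K = 0" using no P' by (intro cut_edges_of_untouched) auto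
      moreover have "cut (path_edges p) K \<le> 2"
      proof (rule cut_path_le_2[OF S(7)[OF z1(2)]])
        fix i j k assume ijk: "i < j" "j < k" "k < length p" "p ! i \<in> K" "p ! k \<in> K"
        then have "p ! i \<in> set p" "p ! k \<in> set p" by auto
        then have "p ! i = z1" "p ! k = z1" using no z1(2) ijk by blast+
        then show "p ! j \<in> K" using S(7)[OF z1(2)] ijk nth_eq_iff_index_eq[of p i k] by simp
      qed
      ultimately show False using cutK cutK3 P' by simp
    next
      case True
      then obtain q P'' where q: "P' = add_mset q P''" "z1 \<in> set q" by (meson multi_member_split)
      obtain y where y: "y \<in> K" "y \<noteq> z1" using wK by metis
      have yV: "y \<in> V - {x0, x1}" "z1 \<in> V - {x0, x1}" using KV y z1 by auto
      \<comment> \<open>No path meets \<open>X \<inter> K\<close>, so its cut consists of edges of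
        \<open>R\<close>, and no edge of \<open>R\<close> leaves \<open>K\<close>.\<close>
      have "3 \<le> cut R X" if X: "X \<subseteq> V" "y \<in> X" "z1 \<notin> X" for X
      proof -
        have "cut (edges_of P) (X \<inter> K) = 0" using no X(3) by (intro cut_edges_of_untouched) auto
        then have "cut M (X \<inter> K) = cut R (X \<inter> K)" unfolding S(3) by simp
        moreover have "cut M (X \<inter> K) \<ge> 3" using KV y X by (intro nonsep) auto
        moreover have "cut R (X \<inter> K) \<le> cut R X + cut R K"
          using cut_submodular[OF S(4), of X K] by simp
        ultimately show ?thesis using cut_linked_class[OF S(4), of w] by (simp add: K_def)
      qed
      then obtain Q where Q: "size Q = 3" "\<forall>p\<in>#Q. is_path y z1 p" "edges_of Q \<subseteq># R"
        using menger[OF S(4), of y z1 3] yV y(2) by (metis DiffD1)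
      obtain q1 q2 q3 where Q3: "Q = {#q1, q2, q3#}" using Q(1) by (rule size_3_msetE)
      have l: "linked (path_edges q1) y z1" "linked (path_edges q2) y z1" "linked (path_edges q3) y z1"
        using Q(2) Q3 is_path_linked by auto
      have ip: "is_path x0 x1 p" "is_path x0 x1 q" using S(1) P' q by auto
      obtain A B where AB: "A + B \<subseteq># path_edges p" "linked A x0 z1" "linked B z1 x1"
        using passes_path[OF ip(1) z1(3)] unfolding passes_def by blast
      \<comment> \<open>At \<open>z1\<close> the path \<open>p\<close> makes a detour to
        \<open>y\<close> and back along \<open>q1\<close> and \<open>q2\<close>; \<open>q\<close>
        passes \<open>z1\<close>, and \<open>q3\<close> links \<open>y\<close> to
        \<open>z1\<close>.\<close>
      have "passes (path_edges p + path_edges q1 + path_edges q2) x0 x1 y"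
      proof (rule passesI)
        show "linked (A + path_edges q1) x0 y" using linked_add_trans[OF AB(2) linked_sym[OF l(1)]] .
        show "linked (path_edges q2 + B) y x1" using linked_add_trans[OF l(2) AB(3)] .
        have "A + path_edges q1 + (path_edges q2 + B) = A + B + path_edges q1 + path_edges q2" by (simp add: ac_simps)
        then show "A + path_edges q1 + (path_edges q2 + B) \<subseteq># path_edges p + path_edges q1 + path_edges q2"
          using AB(1) by (simp add: subset_mset.add_mono)
      qed
      then show False
      proof (rule no_D_passes[OF _ passes_path[OF ip(2) q(2)] l(3) yV y(2), where P = P''])
        show "m \<le> size P'' + 2" using S(2) P' q by simp
        show "is_path x0 x1 p" if "p \<in># P''" for p using S(1) P' q that by simp
        have "path_edges p + path_edges q1 + path_edges q2 + path_edges q + path_edges q3 + edges_of P''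
            = edges_of P + edges_of Q"
          unfolding P' q Q3 by (simp add: ac_simps)
        also have "\<dots> \<subseteq># M" using Q(3) unfolding S(3) by simp
        finally show "path_edges p + path_edges q1 + path_edges q2 + path_edges q + path_edges q3 + edges_of P'' \<subseteq># M" .
      qed
    qed
  qed
  then obtain z2 q where z2: "z2 \<in> K" "z2 \<noteq> z1" "q \<in># P" "z2 \<in> set q" by blast
  have link: "linked R a b" if "a \<in> K" "b \<in> K" for a b
    using that linked_class[of R w a b] unfolding K_def by simp
  have clash: False if "a \<in> K" "b \<in> K" "a \<noteq> b" "a \<in> set s" "b \<in> set t" "{#s, t#} \<subseteq># P" for a b s t
    using no_D_linked[OF sys that(6,4,5) link[OF that(1,2)] _ _ that(3)] that(1,2) KV by blast
  have pq: "q = p"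
    using clash[OF z1(1) z2(1) _ z1(3) z2(4)] z2(2) two_in_mset[OF z1(2) z2(3)] by metis
  have other: "z \<notin> set s" if s: "s \<in># P'" "z \<in> K" for s z
  proof
    assume "z \<in> set s"
    have ps: "{#p, s#} \<subseteq># P" using P' s(1) by simp
    show False
    proof (cases "z = z1")
      case True
      then show False using clash[OF z2(1) s(2) _ _ \<open>z \<in> set s\<close> ps] z2 pq by blast
    next
      case False
      then show False using clash[OF z1(1) s(2) _ z1(3) \<open>z \<in> set s\<close> ps] by blast
    qed
  qed
  show thesis
  proof (rule that[OF P'])
    show "\<forall>q \<in># P'. \<forall>z. linked R w z \<longrightarrow> z \<notin> set q" using other by (simp add: K_def)
    show "z1 \<in> set p" "z2 \<in> set p" "z1 \<noteq> z2" "linked R w z1" "linked R w z2"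
      using z1 z2 pq by (auto simp: K_def)
  qed
qed

text \<open>Maximal under inclusion of the rooted vertices, among systems with equally many
  paths.\<close>

definition maximal_system :: "'a list multiset \<Rightarrow> 'a set multiset \<Rightarrow> bool" where
  "maximal_system P R \<longleftrightarrow> system P R \<and>
     (\<forall>P' R'. system P' R' \<longrightarrow> size P' = size P \<longrightarrow> \<not> rooted R \<subset> rooted R')"

lemma maximal_system_exists:
  assumes "system P R"
  obtains P' R' where "maximal_system P' R'" "size P' = size P" "rooted R \<subseteq> rooted R'"
proof -
  have "\<exists>P' R'. maximal_system P' R' \<and> size P' = size P \<and> rooted R \<subseteq> rooted R'"
    using assms
  proof (induction "card V - card (rooted R)" arbitrary: P R rule: less_induct)
    case less
    show ?case
    proof (cases "maximal_system P R")
      case False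
      then obtain P' R' where P': "system P' R'" "size P' = size P" "rooted R \<subset> rooted R'"
        using less.prems unfolding maximal_system_def by blast
      have "rooted R' \<subseteq> V" by (auto simp: rooted_def)
      then have "card (rooted R) < card (rooted R')" "card (rooted R') \<le> card V"
        using P'(3) finite_V finite_sub by (auto intro: psubset_card_mono card_mono)
      then have "card V - card (rooted R') < card V - card (rooted R)" by linarith
      from less.hyps[OF this P'(1)] obtain P2 R2 where
        "maximal_system P2 R2" "size P2 = size P'" "rooted R' \<subseteq> rooted R2" by blast
      then show ?thesis using P'(2,3) by (intro exI[of _ P2] exI[of _ R2]) auto
    qed blast
  qed
  then show thesis using that by blast
qed

text \<open>All ends of the edges in \<open>C\<close> lie in the class of \<open>z\<close>, which
  does not contain \<open>x\<close>, so a walk to \<open>x\<close> never meets them.\<close>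

lemma linked_avoid:
  assumes "linked R v x" "\<not> linked R z x" "\<And>e w. e \<in># C \<Longrightarrow> w \<in> e \<Longrightarrow> linked R z w"
  shows "linked (R - C) v x"
  using assms(1) unfolding linked_def[of R]
proof (induction rule: converse_rtranclp_induct)
  case (step v u)
  have "linked R u x" using step(2) by (simp add: linked_def)
  have "{v, u} \<notin># C"
  proof
    assume "{v, u} \<in># C"
    then have "linked R z u" using assms(3)[of "{v, u}" u] by simp
    then show False using linked_trans[OF _ \<open>linked R u x\<close>] assms(2) by blast
  qed
  then have "count C {v, u} = 0" by (simp only: not_in_iff)
  then have "count (R - C) {v, u} = count R {v, u}" by simp
  then have "{v, u} \<in># R - C" using step(1) unfolding count_greater_zero_iff[symmetric] by (simp only:)
  then show ?case by (rule linked_trans[OF linked_edge step(3)])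
qed simp

lemma list_split_two:
  assumes "i < j" "j < length p"
  obtains l mid r where "p = l @ p ! i # mid @ p ! j # r" "length l = i" "length mid = j - i - 1"
    "\<forall>k. i < k \<longrightarrow> k < j \<longrightarrow> p ! k \<in> set mid"
proof -
  define l where "l = take i p"
  define mid where "mid = take (j - Suc i) (drop (Suc i) p)"
  define r where "r = drop (Suc j) p"
  have 1: "p = l @ p ! i # drop (Suc i) p" using assms id_take_nth_drop[of i p] by (simp add: l_def)
  have "drop (Suc i) p = mid @ drop (Suc i) p ! (j - Suc i) # drop (Suc (j - Suc i)) (drop (Suc i) p)"
    using assms id_take_nth_drop[of "j - Suc i" "drop (Suc i) p"] by (simp add: mid_def)
  moreover have "drop (Suc i) p ! (j - Suc i) = p ! j" using assms by simp
  moreover have "drop (Suc (j - Suc i)) (drop (Suc i) p) = r"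
  proof -
    have "Suc (j - Suc i) + Suc i = Suc j" using assms by simp
    then show ?thesis by (simp only: drop_drop r_def)
  qed
  ultimately have 2: "drop (Suc i) p = mid @ p ! j # r" by (simp only:)
  have "p ! k \<in> set mid" if "i < k" "k < j" for k
  proof -
    have "mid ! (k - Suc i) = p ! k" "k - Suc i < length mid" using that assms by (simp_all add: mid_def)
    then show ?thesis by (metis nth_mem)
  qed
  moreover have "length l = i" "length mid = j - i - 1" using assms by (simp_all add: l_def mid_def)
  ultimately show thesis using that[of l mid r] 1 unfolding 2 by blast
qed

text \<open>Rerouting \<open>p\<close> through the class of \<open>w\<close> frees the segment of \<open>p\<close> between the first and the last
  vertex of that class: a vertex there on another path yields D, a rooted one contradicts
  maximality.\<close>

lemma linked_class_hull:
  assumes max: "maximal_system P R" and w: "w \<in> V" "w \<notin> rooted R"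
    and P: "P = add_mset p P'" and untouched: "\<forall>q \<in># P'. \<forall>z. linked R w z \<longrightarrow> z \<notin> set q"
    and ij: "i < j" "j < length p" "linked R w (p ! i)" "linked R w (p ! j)" and k: "i \<le> k" "k \<le> j"
  shows "p ! k \<in> V - {x0, x1}" "p ! k \<notin> rooted R" "\<forall>q\<in>#P'. p ! k \<notin> set q"
proof -
  have sys: "system P R" using max by (simp add: maximal_system_def)
  note S = systemD[OF sys]
  define K where "K = {z. linked R w z}"
  have KV: "K \<subseteq> V - {x0, x1}"
    using linked_in[OF _ S(4) w(1)] w by (auto simp: K_def rooted_def)
  have Krooted: "z \<notin> rooted R" if "z \<in> K" for z
    using that w linked_trans[of R w z] by (auto simp: K_def rooted_def)
  have link: "linked R a b" if "a \<in> K" "b \<in> K" for a b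
    using that linked_class[of R w a b] unfolding K_def by simp
  have ip: "is_path x0 x1 p" using S(1) P by simp
  have d: "distinct p" using ip by (simp add: is_path_def)
  define I where "I = {a. a < length p \<and> p ! a \<in> K}"
  have I: "finite I" "i \<in> I" "j \<in> I" using ij by (auto simp: I_def K_def)
  have I0: "I \<noteq> {}" using I(2) by blast
  define a where "a = Min I"
  define b where "b = Max I"
  have ab: "a \<in> I" "b \<in> I" "a \<le> i" "j \<le> b" "\<And>c. c \<in> I \<Longrightarrow> a \<le> c \<and> c \<le> b"
    unfolding a_def b_def using I Min_in[OF I(1) I0] Max_in[OF I(1) I0] by auto
  have abl: "a < b" "b < length p" using ab ij(1) by (auto simp: I_def)
  obtain l mid r where p: "p = l @ p ! a # mid @ p ! b # r" "length l = a" "length mid = b - a - 1"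
      "\<forall>k. a < k \<longrightarrow> k < b \<longrightarrow> p ! k \<in> set mid"
    by (rule list_split_two[OF abl])
  define z1 z2 where "z1 = p ! a" and "z2 = p ! b"
  have pz: "p = l @ z1 # mid @ z2 # r" using p(1) by (simp add: z1_def z2_def)
  have z: "z1 \<in> K" "z2 \<in> K" using ab by (auto simp: I_def z1_def z2_def)
  have outside: "K \<inter> set l = {}" "K \<inter> set r = {}"
  proof -
    have "p ! c \<notin> K" if "c < a" for c using that ab(5)[of c] abl by (auto simp: I_def)
    moreover have "p ! c = l ! c" if "c < a" for c using that p(2) by (subst pz) (simp add: nth_append)
    ultimately show "K \<inter> set l = {}" using p(2) by (auto simp: in_set_conv_nth)
    have "p ! (Suc b + c) = r ! c" if "c < length r" for c
    proof -
      have "length (l @ z1 # mid @ [z2]) = Suc b" using p(2,3) abl by simp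
      moreover have "p = (l @ z1 # mid @ [z2]) @ r" using pz by simp
      ultimately show ?thesis using nth_append_length_plus[of "l @ z1 # mid @ [z2]" r c] by (simp only:)
    qed
    moreover have "p ! (Suc b + c) \<notin> K" if "c < length r" for c
    proof -
      have "length p = Suc b + length r" using arg_cong[OF pz, of length] p(2,3) abl by simp
      then show ?thesis using ab(5)[of "Suc b + c"] that by (auto simp: I_def)
    qed
    ultimately show "K \<inter> set r = {}" by (auto simp: in_set_conv_nth)
  qed
  obtain c where c: "is_path z1 z2 c" "path_edges c \<subseteq># R" using linked_imp_path[OF link[OF z]] .
  have cK: "set c \<subseteq> K"
  proof
    fix y assume "y \<in> set c"
    then have "linked (path_edges c) z1 y" using path_linked_mem is_path_ends[OF c(1)] by metis
    then have "linked R z1 y" using c(2) linked_mono by metis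
    then show "y \<in> K" using linked_trans[of R w z1 y] z(1) by (simp add: K_def)
  qed
  define p' where "p' = l @ c @ r"
  define F where "F = path_edges (z1 # mid @ [z2])"
  define R' where "R' = R - path_edges c + F"
  have pe: "path_edges p = path_edges (l @ [z1]) + (F + path_edges (z2 # r))"
    unfolding pz F_def using path_edges_append[of l z1 "mid @ z2 # r"] path_edges_append[of "z1 # mid" z2 r] by simp
  obtain c1 where c1: "c = z1 # c1" using c(1) by (cases c) (auto simp: is_path_def)
  obtain c2 where c2: "c = c2 @ [z2]" using c(1) by (metis append_butlast_last_id is_path_def)
  have "path_edges p' = path_edges (l @ [z1]) + path_edges (c @ r)"
    unfolding p'_def c1 using path_edges_append[of l z1 "c1 @ r"] by simp
  also have "path_edges (c @ r) = path_edges c + path_edges (z2 # r)"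
    unfolding c2 using path_edges_append[of c2 z2 r] by simp
  finally have pe': "path_edges p' = path_edges (l @ [z1]) + (path_edges c + path_edges (z2 # r))" .
  have ip': "is_path x0 x1 p'"
  proof -
    have "distinct p'" using d c(1) cK outside unfolding p'_def pz is_path_def by auto
    moreover have "hd p' = x0" using ip c1 unfolding p'_def pz is_path_def by (cases l) auto
    moreover have "last p' = x1" using ip c2 unfolding p'_def pz is_path_def by (cases r) auto
    ultimately show ?thesis using c1 by (simp add: is_path_def p'_def)
  qed
  have "M = edges_of (add_mset p' P') + R'"
  proof -
    have "R = path_edges c + (R - path_edges c)" using c(2) by simp
    then have "M = path_edges p + edges_of P' + (path_edges c + (R - path_edges c))" using S(3) P by simp
    then show ?thesis unfolding R'_def pe using pe' by (simp add: ac_simps)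
  qed
  moreover have "\<forall>q\<in>#add_mset p' P'. is_path x0 x1 q" "m \<le> size (add_mset p' P')"
    using S(1,2) P ip' by simp_all
  ultimately have sys': "system (add_mset p' P') R'" unfolding system_def by blast
  have FR': "F \<subseteq># R'" by (simp add: R'_def)
  have Fl: "linked R' z1 y" if "y \<in> set mid" for y
  proof -
    have "linked F z1 y" unfolding F_def using that by (intro path_linked_mem) auto
    then show ?thesis using FR' linked_mono by metis
  qed
  have z1p': "z1 \<in> set p'" using c1 by (simp add: p'_def)
  have mid3: "y \<in> V - {x0, x1}" if y: "y \<in> set mid" for y
  proof -
    have "x0 \<in> set (l @ [z1])" using ip unfolding pz is_path_def by (cases l) auto
    moreover have "x1 \<in> set (z2 # r)"
      using ip last_in_set[of "z2 # r"] unfolding pz is_path_def by simp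
    ultimately have "y \<noteq> x0" "y \<noteq> x1" using d y unfolding pz by auto
    moreover have "y \<in> V" using S(6)[of p] P y pz by auto
    ultimately show ?thesis by simp
  qed
  have mid1: "\<forall>q\<in>#P'. y \<notin> set q" if y: "y \<in> set mid" for y
  proof (rule ballI, rule notI)
    fix q assume q: "q \<in># P'" "y \<in> set q"
    have "y \<in> V - {x0, x1}" using mid3[OF y] .
    moreover have "z1 \<noteq> y" using d y unfolding pz by auto
    moreover have "{#p', q#} \<subseteq># add_mset p' P'" using q(1) by simp
    ultimately show False
      using no_D_linked[OF sys' _ z1p' q(2) Fl[OF y]] z(1) KV by blast
  qed
  have mid2: "y \<notin> rooted R" if y: "y \<in> set mid" for y
  proof
    assume "y \<in> rooted R"
    \<comment> \<open>The exchange takes from \<open>R\<close> only edges inside the class of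
      \<open>w\<close>, which contains no root, so every rooted vertex remains rooted.\<close>
    have keep: "linked R' v x" if "linked R v x" "x = x0 \<or> x = x1" for v x
    proof -
      have "\<not> linked R z1 x" using Krooted[OF z(1)] z(1) KV that(2) by (auto simp: rooted_def)
      moreover have "linked R z1 u" if "e \<in># path_edges c" "u \<in> e" for e u
        using path_edges_in[OF that(1)] that(2) cK z(1) link by blast
      ultimately have "linked (R - path_edges c) v x" using linked_avoid[OF that(1)] by blast
      then show ?thesis unfolding R'_def by (rule linked_add1)
    qed
    have "rooted R \<subseteq> rooted R'" using keep by (auto simp: rooted_def)
    moreover have "z1 \<in> rooted R'"
    proof -
      obtain x where x: "linked R y x" "x = x0 \<or> x = x1" using \<open>y \<in> rooted R\<close> by (auto simp: rooted_def)
      have "linked R' z1 x" by (rule linked_trans[OF Fl[OF y] keep[OF x]])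
      then show ?thesis using x(2) z(1) KV by (auto simp: rooted_def)
    qed
    moreover have "z1 \<notin> rooted R" using Krooted z(1) .
    ultimately have "rooted R \<subset> rooted R'" by blast
    then show False using max sys' P unfolding maximal_system_def by simp
  qed
  consider "p ! k \<in> K" | "p ! k \<in> set mid"
  proof (cases "k = a \<or> k = b")
    case False
    then have "a < k" "k < b" using k ab(3,4) by linarith+
    then show ?thesis using p(4) that(2) by blast
  qed (use z that(1) in \<open>auto simp: z1_def z2_def\<close>)
  then have "p ! k \<in> V - {x0, x1} \<and> p ! k \<notin> rooted R \<and> (\<forall>q\<in>#P'. p ! k \<notin> set q)"
  proof cases
    case 1
    then show ?thesis using KV Krooted[OF 1] untouched by (auto simp: K_def)
  next
    case 2
    then show ?thesis using mid1 mid2 mid3 by blast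
  qed
  then show "p ! k \<in> V - {x0, x1}" "p ! k \<notin> rooted R" "\<forall>q\<in>#P'. p ! k \<notin> set q" by auto
qed

text \<open>An unrooted class hangs on one path \<open>p\<close>, and by
  \<open>linked_class_hull\<close> the stretch of \<open>p\<close> that it spans is unrooted and met
  by no other path. The vertices of this stretch have degree at least 3, so they carry edges of
  \<open>R\<close> and unrooted classes of their own. A maximal such stretch together with all its
  classes is left only by \<open>p\<close>, at most twice: a nonseparating cut of size at most
  2.\<close>

lemma maximal_system_rooted:
  assumes max: "maximal_system P R" and e: "{w, w'} \<in># R"
  shows "w \<in> rooted R"
proof (rule ccontr)
  assume nr: "w \<notin> rooted R"
  have sys: "system P R" using max by (simp add: maximal_system_def)
  note S = systemD[OF sys]
  have wV: "w \<in> V" using simple_edges_pair[OF S(4) e] by simp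
  obtain p P' z1 z2 where P: "P = add_mset p P'" and untouched: "\<forall>q \<in># P'. \<forall>z. linked R w z \<longrightarrow> z \<notin> set q"
    and z: "z1 \<in> set p" "z2 \<in> set p" "z1 \<noteq> z2" "linked R w z1" "linked R w z2"
    by (rule linked_class_touch[OF sys wV nr e])
  have d: "distinct p" using S(7) P by simp
  have pV: "set p \<subseteq> V" using S(6) P by simp
  \<comment> \<open>A good vertex on \<open>p\<close> gets at most 2 edges from \<open>p\<close> and
    none from the other paths, so an edge of \<open>R\<close> ends there and
    \<open>linked_class_touch\<close> applies to its class.\<close>
  define good where "good t \<longleftrightarrow> t \<in> V - {x0, x1} \<and> t \<notin> rooted R \<and> (\<forall>q\<in>#P'. t \<notin> set q)" for t
  have "class": "\<forall>q \<in># P'. \<forall>y. linked R t y \<longrightarrow> y \<notin> set q"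
      "\<exists>y \<in> set p. y \<noteq> t \<and> linked R t y"
    if t: "good t" "t \<in> set p" for t
  proof -
    have tV: "t \<in> V" "t \<notin> rooted R" using t(1) by (auto simp: good_def)
    have "cut M {t} \<ge> 3" using t(1) by (intro nonsep) (auto simp: good_def)
    moreover have "cut (edges_of P') {t} = 0" using t(1) by (intro cut_edges_of_untouched) (auto simp: good_def)
    moreover have "cut (path_edges p) {t} \<le> 2"
    proof (rule cut_path_le_2[OF d])
      fix i j k assume "i < j" "j < k" "k < length p" "p ! i \<in> {t}" "p ! k \<in> {t}"
      then show "p ! j \<in> {t}" using d nth_eq_iff_index_eq[of p i k] by simp
    qed
    ultimately have "cut R {t} > 0" using S(3) P by simp
    then obtain e where e: "e \<in># R" "card (e \<inter> {t}) = 1" using cut_pos_iff by metis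
    obtain t' where t': "{t, t'} \<in># R"
    proof -
      obtain c d where cd: "e = {c, d}" "c \<noteq> d" by (rule simple_edgesD[OF S(4) e(1)])
      then have "c = t \<or> d = t" using e(2) card_pair_Int[OF cd(2), of "{t}"] by auto
      then show thesis using that e(1) cd(1) by (metis insert_commute)
    qed
    obtain s Q y1 y2 where Q: "P = add_mset s Q" "\<forall>q \<in># Q. \<forall>z. linked R t z \<longrightarrow> z \<notin> set q"
        "y1 \<in> set s" "y2 \<in> set s" "y1 \<noteq> y2" "linked R t y1" "linked R t y2"
      by (rule linked_class_touch[OF sys tV t'])
    have "p \<notin># Q" using Q(2) t(2) by auto
    then have sp: "s = p" using Q(1) P by (metis insert_noteq_member union_single_eq_member)
    then have sp: "s = p" "Q = P'" using Q(1) P by simp_all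
    show "\<forall>q \<in># P'. \<forall>y. linked R t y \<longrightarrow> y \<notin> set q" using Q(2) sp by simp
    show "\<exists>y \<in> set p. y \<noteq> t \<and> linked R t y" using Q(3-7) sp by metis
  qed
  have hull: "good (p ! k)"
    if t: "good t" "t \<in> set p" and a: "a < length p" "linked R t (p ! a)" and b: "b < length p" "linked R t (p ! b)"
      and k: "a \<le> k" "k \<le> b" for t a b k
  proof -
    have tV: "t \<in> V" "t \<notin> rooted R" using t(1) by (auto simp: good_def)
    note use_hull = linked_class_hull[OF max tV P "class"(1)[OF t]]
    show ?thesis
    proof (cases "a = b")
      case False
      then have "a < b" using k by simp
      then show ?thesis using use_hull[OF _ b(1) a(2) b(2) k] by (auto simp: good_def)
    next
      case True
      then have ka: "k = a" using k by simp
      \<comment> \<open>The class meets \<open>p\<close> in two vertices at least, so even a single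
        position lies in a proper hull.\<close>
      have "\<exists>i < length p. i \<noteq> a \<and> linked R t (p ! i)"
      proof (cases "p ! a = t")
        case True
        then show ?thesis using "class"(2)[OF t] by (metis in_set_conv_nth)
      next
        case False
        then show ?thesis using t(2) by (metis in_set_conv_nth linked_refl)
      qed
      then obtain i where i: "i < length p" "i \<noteq> a" "linked R t (p ! i)" by blast
      show ?thesis
      proof (cases "i < a")
        case True
        then show ?thesis using use_hull[OF True a(1) i(3) a(2), of k] ka by (auto simp: good_def)
      next
        case False
        then have "a < i" using i(2) by simp
        then show ?thesis using use_hull[OF \<open>a < i\<close> i(1) a(2) i(3), of k] ka by (auto simp: good_def)
      qed
    qed
  qed
  obtain k0 where k0: "k0 < length p" "p ! k0 = z1" using z(1) by (metis in_set_conv_nth)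
  have g0: "good z1"
  proof -
    have "z1 \<in> V - {x0, x1}" using linked_in[OF z(4) S(4) wV] nr z(4) wV by (auto simp: rooted_def)
    moreover have "z1 \<notin> rooted R" using nr wV linked_trans[OF z(4)] by (auto simp: rooted_def)
    ultimately show ?thesis using untouched z(4) by (auto simp: good_def)
  qed
  \<comment> \<open>The positions that can be reached from \<open>k0\<close> along \<open>p\<close>
    through good vertices only: the maximal good interval around \<open>z1\<close>.\<close>
  define I where "I = {k. k < length p \<and> (\<forall>j. min k k0 \<le> j \<and> j \<le> max k k0 \<longrightarrow> good (p ! j))}"
  define S' where "S' = {y. \<exists>k\<in>I. linked R (p ! k) y}"
  have Igood: "good (p ! k)" if "k \<in> I" for k using that by (auto simp: I_def)
  \<comment> \<open>A class of a vertex of the interval cannot reach a position beyond it: the hull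
    would extend the good stretch.\<close>
  have S'I: "a \<in> I" if a: "a < length p" "p ! a \<in> S'" for a
  proof -
    obtain k where k: "k \<in> I" "linked R (p ! k) (p ! a)" using a(2) by (auto simp: S'_def)
    have kl: "k < length p" using k by (simp add: I_def)
    have "good (p ! j)" if j: "min a k0 \<le> j" "j \<le> max a k0" for j
    proof (cases "min k k0 \<le> j \<and> j \<le> max k k0")
      case True
      then show ?thesis using k(1) by (simp add: I_def)
    next
      case False
      then have "a \<le> j \<and> j \<le> k \<or> k \<le> j \<and> j \<le> a" using j by (auto simp: min_def max_def split: if_splits)
      then show ?thesis
        using hull[OF Igood[OF k(1)] nth_mem[OF kl] a(1) k(2) kl linked_refl]
          hull[OF Igood[OF k(1)] nth_mem[OF kl] kl linked_refl a(1) k(2)] by blast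
    qed
    then show ?thesis using a(1) by (simp add: I_def)
  qed
  have IS': "p ! k \<in> S'" if "k \<in> I" for k
    unfolding S'_def mem_Collect_eq by (rule bexI[OF linked_refl that])
  have "k0 \<in> I" using k0 g0 by (auto simp: I_def)
  then have ne: "S' \<noteq> {}" using IS' by blast
  have S'V: "S' \<subseteq> V - {x0, x1}"
  proof
    fix y assume "y \<in> S'"
    then obtain k where k: "k \<in> I" "linked R (p ! k) y" by (auto simp: S'_def)
    have g: "p ! k \<in> V" "p ! k \<notin> rooted R" using Igood[OF k(1)] by (auto simp: good_def)
    show "y \<in> V - {x0, x1}" using linked_in[OF k(2) S(4) g(1)] g k(2) by (auto simp: rooted_def)
  qed
  have "cut R S' = 0"
  proof (rule cut_zeroI)
    fix e assume e: "e \<in># R"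
    obtain a b where ab: "e = {a, b}" "a \<noteq> b" by (rule simple_edgesD[OF S(4) e])
    have l: "linked R a b" "linked R b a" using e ab linked_edge linked_sym by metis+
    have "a \<in> S' \<longleftrightarrow> b \<in> S'"
      unfolding S'_def mem_Collect_eq using linked_trans[OF _ l(1)] linked_trans[OF _ l(2)] by blast
    then show "card (e \<inter> S') \<noteq> 1" using card_pair_Int[OF ab(2)] ab(1) by simp
  qed
  moreover have "cut (path_edges p) S' \<le> 2"
  proof (rule cut_path_le_2[OF d])
    fix i j k assume ijk: "i < j" "j < k" "k < length p" "p ! i \<in> S'" "p ! k \<in> S'"
    then have "i \<in> I" "k \<in> I" using S'I by auto
    then have "j \<in> I" using ijk unfolding I_def by (auto simp: min_def max_def split: if_splits)
    then show "p ! j \<in> S'" by (rule IS')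
  qed
  moreover have "cut (edges_of P') S' = 0"
  proof (rule cut_edges_of_untouched, rule ballI, rule ccontr)
    fix q assume q: "q \<in># P'" "set q \<inter> S' \<noteq> {}"
    then obtain y k where y: "y \<in> set q" "k \<in> I" "linked R (p ! k) y" by (auto simp: S'_def)
    have "k < length p" using y(2) by (simp add: I_def)
    then have "p ! k \<in> set p" by simp
    then show False using "class"(1)[OF Igood[OF y(2)]] q(1) y(1,3) by blast
  qed
  moreover have "cut M S' \<ge> 3" using nonsep[OF S'V ne] .
  moreover have "cut M S' = cut (path_edges p) S' + cut (edges_of P') S' + cut R S'"
    unfolding S(3) P by simp
  ultimately show False by linarith
qed

end

section \<open>A root of degree m\<close>

lemma size_2_msetE:
  assumes "size Q = 2"
  obtains a b where "Q = {#a, b#}"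
proof -
  obtain a Q1 where 1: "Q = add_mset a Q1" using size_eq_Suc_imp_eq_union[of Q 1] assms by auto
  obtain b Q2 where 2: "Q1 = add_mset b Q2" using size_eq_Suc_imp_eq_union[of Q1 0] assms 1 by auto
  show thesis using that[of a b] assms 1 2 by simp
qed

lemma linked_first_edge: "linked E a b \<Longrightarrow> a \<noteq> b \<Longrightarrow> \<exists>w. {a, w} \<in># E"
  unfolding linked_def by (erule converse_rtranclpE) auto

lemma cut_single: "a \<noteq> b \<Longrightarrow> cut {#{a, b}#} X = (if (a \<in> X) \<noteq> (b \<in> X) then 1 else 0)"
  by (simp add: card_pair_Int)

text \<open>Moving \<open>x\<close> into \<open>Y\<close> loses, twice, just the edges from
  \<open>x\<close> to \<open>Y\<close>, and these all go to \<open>z\<close>.\<close>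

lemma cut_insert_root:
  assumes "simple_edges V N" "x \<notin> Y" "\<And>v. {x, v} \<in># N \<Longrightarrow> v \<in> Y \<Longrightarrow> v = z"
  shows "cut N {x} + cut N Y \<le> cut N (insert x Y) + 2 * (if z \<in> Y then count N {x, z} else 0)"
  using assms(1,3)
proof (induction N)
  case (add e N)
  obtain a b where e: "e = {a, b}" "a \<noteq> b" by (rule simple_edgesD[OF add.prems(1), of e]) simp_all
  have IH: "cut N {x} + cut N Y \<le> cut N (insert x Y) + 2 * (if z \<in> Y then count N {x, z} else 0)"
    using add by (simp add: simple_edges_def)
  have s: "cut (add_mset e N) X = cut {#e#} X + cut N X" for X by simp
  have one: "cut {#e#} {x} + cut {#e#} Y \<le> cut {#e#} (insert x Y) + 2 * (if z \<in> Y \<and> e = {x, z} then 1 else 0)"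
  proof (cases "x \<in> e")
    case True
    then obtain v where v: "e = {x, v}" "x \<noteq> v" using e by blast
    have "v = z" if "v \<in> Y" using add.prems(2)[of v] that v(1) by simp
    then show ?thesis unfolding v(1) cut_single[OF v(2)] using assms(2) v(2) by (cases "v \<in> Y") auto
  next
    case False
    then show ?thesis unfolding e(1) cut_single[OF e(2)] using e by auto
  qed
  have c: "(if z \<in> Y then count (add_mset e N) {x, z} else 0)
      = (if z \<in> Y \<and> e = {x, z} then 1 else 0) + (if z \<in> Y then count N {x, z} else 0)" by auto
  have arith: "a1 + b1 \<le> c1 + 2 * k \<Longrightarrow> a2 + b2 \<le> c2 + 2 * l \<Longrightarrow> a3 = a2 + a1 \<Longrightarrow> b3 = b2 + b1 \<Longrightarrow> c3 = c2 + c1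
      \<Longrightarrow> a3 + b3 \<le> c3 + 2 * (l + k)" for a1 a2 a3 b1 b2 b3 c1 c2 c3 k l :: nat
    by presburger
  show ?case unfolding c by (rule arith[OF IH one s s s])
qed simp

lemma cut_count_le: "x \<noteq> y \<Longrightarrow> count N {x, y} \<le> cut N {x}"
proof (induction N)
  case (add e N)
  show ?case
  proof (cases "e = {x, y}")
    case True
    then have "card (e \<inter> {x}) = 1" using add.prems card_pair_Int[of x y "{x}"] by simp
    then show ?thesis using add True by simp
  qed (use add in simp)
qed simp

context D_free
begin

text \<open>Splitting \<open>x0 x1\<close> and \<open>x1 w\<close> off at \<open>x1\<close> gives a
  smaller graph, still admissible for \<open>m = 2\<close> and without D. Type B is excluded there
  since \<open>x0\<close> keeps degree 2. Type A would provide a 2-cut between \<open>z\<close> and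
  \<open>w\<close>, but on either side the cuts are too large.\<close>

lemma split_root_edge_contradiction:
  assumes m: "m = 2" and d0: "cut M {x0} = 2" and e: "{x0, x1} \<in># M"
    and nbr: "\<And>v. {x0, v} \<in># M \<Longrightarrow> v = x1 \<or> v = z"
    and z: "z \<in> V - {x0, x1}" and w: "w \<in> V - {x0, x1}" "w \<noteq> z" "{x1, w} \<in># M"
    and internal: "\<And>X. X \<subseteq> V \<Longrightarrow> x0 \<in> X \<Longrightarrow> x1 \<notin> X \<Longrightarrow> card X \<ge> 2 \<Longrightarrow> card (V - X) \<ge> 2 \<Longrightarrow> cut M X \<ge> 3"
    and IH: "outcome_below V M"
  shows False
proof -
  have wne: "w \<noteq> x0" "w \<noteq> x1" "x1 \<noteq> w" "x0 \<noteq> w" using w by auto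
  have "{x0, x1} \<noteq> {x1, w}" using wne by (simp add: doubleton_eq_iff)
  then have "{#{x0, x1}, {x1, w}#} \<subseteq># M" using two_in_mset[OF e w(3)] by blast
  then obtain C where C: "M = C + {#{x0, x1}, {x1, w}#}" by (metis subset_mset.le_iff_add add.commute)
  define M' where "M' = C + {#{x0, w}#}"
  have imm: "immerses M M'" unfolding C M'_def by (rule immerses_split) (use wne in simp)
  have noD': "\<not> has_D 2 V M' x0 x1" using has_D_immerses[OF _ imm subset_refl] no_D m by blast
  have MC: "cut M X = cut C X + (if (x0 \<in> X) \<noteq> (x1 \<in> X) then 1 else 0) + (if (x1 \<in> X) \<noteq> (w \<in> X) then 1 else 0)" for X
  proof -
    have "cut M X = cut C X + cut {#{x0, x1}#} X + cut {#{x1, w}#} X" unfolding C by simp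
    then show ?thesis unfolding cut_single[OF roots(3)] cut_single[OF wne(3)] .
  qed
  have M'C: "cut M' X = cut C X + (if (x0 \<in> X) \<noteq> (w \<in> X) then 1 else 0)" for X
  proof -
    have "cut M' X = cut C X + cut {#{x0, w}#} X" unfolding M'_def by simp
    then show ?thesis unfolding cut_single[OF wne(4)] .
  qed
  have same: "cut M' X = cut M X" if "x0 \<in> X" "x1 \<notin> X" "w \<notin> X" for X
    using MC[of X] M'C[of X] that by simp
  have less: "cut M' X + 2 = cut M X" if "x0 \<in> X" "x1 \<notin> X" "w \<in> X" for X
    using MC[of X] M'C[of X] that by simp
  have same': "cut M' X = cut M X" if "X \<subseteq> V - {x0, x1}" for X
  proof -
    have "x0 \<notin> X" "x1 \<notin> X" using that by auto
    then show ?thesis using MC[of X] M'C[of X] by simp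
  qed
  have cz: "count M {x0, z} \<le> 1"
  proof -
    have z01: "z \<noteq> x0" "z \<noteq> x1" using z by auto
    obtain C' where C': "M = add_mset {x0, x1} C'" using e by (meson multi_member_split)
    have "cut M {x0} = 1 + cut C' {x0}" unfolding C' using card_pair_Int[OF roots(3), of "{x0}"] roots(3) by simp
    moreover have "count C' {x0, z} \<le> cut C' {x0}" using cut_count_le[of x0 z C'] z01 by simp
    moreover have "count M {x0, z} = count C' {x0, z}" unfolding C' using z01 roots(3) by (simp add: doubleton_eq_iff)
    ultimately show ?thesis using d0 by simp
  qed
  \<comment> \<open>Cuts with \<open>w\<close> on the side of \<open>x0\<close> lose 2 by the
    splitting. Taking \<open>x0\<close> out of \<open>X\<close> and using its degree 2 gives at
    least 2 + 4 - 2 edges if \<open>z\<close> is in \<open>X\<close> (then two nonroots are left,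
    and \<open>x0 z\<close> is at most a single edge) and at least 2 + 3 otherwise.\<close>
  have big: "cut M X \<ge> (if z \<in> X then 4 else 5)" if X: "X \<subseteq> V" "x0 \<in> X" "x1 \<notin> X" "w \<in> X" for X
  proof -
    let ?Y = "X - {x0}"
    have Y: "?Y \<subseteq> V - {x0, x1}" "?Y \<noteq> {}" using X wne by auto
    have "cut M {x0} + cut M ?Y \<le> cut M (insert x0 ?Y) + 2 * (if z \<in> ?Y then count M {x0, z} else 0)"
      by (rule cut_insert_root[OF simple]) (use nbr X in blast)+
    moreover have "insert x0 ?Y = X" using X by blast
    moreover have "z \<in> ?Y \<longleftrightarrow> z \<in> X" using z by auto
    ultimately have i: "2 + cut M ?Y \<le> cut M X + 2 * (if z \<in> X then count M {x0, z} else 0)" using d0 by simp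
    show ?thesis
    proof (cases "z \<in> X")
      case True
      then have "{z, w} \<subseteq> ?Y" using z w X by auto
      then have "card {z, w} \<le> card ?Y" using finite_sub[OF X(1)] by (intro card_mono) auto
      then have "card ?Y \<ge> 2" using w(2) by simp
      then have "cut M ?Y \<ge> 4" using nonsep_int[OF Y(1)] by blast
      then show ?thesis using i cz True by simp
    next
      case False
      then show ?thesis using i nonsep[OF Y] by simp
    qed
  qed
  have adm: "admissible 2 V M' x0 x1"
  proof
    have "simple_edges V C" using simple unfolding C by (auto simp: simple_edges_def)
    then show "simple_edges V M'" using w(1) roots wne unfolding M'_def simple_edges_def by auto
    show "cut M' X \<ge> 2" if X: "X \<subseteq> V" "x0 \<in> X" "x1 \<notin> X" for X
    proof (cases "w \<in> X")
      case True
      then show ?thesis using big[OF X True] less[OF X(2,3) True] by (auto split: if_splits)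
    next
      case False
      then show ?thesis using same[OF X(2,3)] sep[OF X] m by simp
    qed
  qed (use roots card_V nonsep nonsep_int same' in auto)
  have "size M' < size M" unfolding C M'_def by simp
  then have "outcome 2 V M' x0 x1" using outcome_belowD[OF IH adm] by simp
  then consider "tight_separated 2 V M' x0 x1" | P where "bundled (Suc 2) V M' x0 x1 P"
    using noD' unfolding outcome_def by blast
  then show False
  proof cases
    case 1
    \<comment> \<open>With \<open>w\<close> in \<open>X\<close> the cut of the old graph has at
      least 5 edges, of which 3 remain; with \<open>z\<close> in \<open>X\<close> it is internal and
      unchanged.\<close>
    obtain X where X: "X \<subseteq> V" "x0 \<in> X" "x1 \<notin> X" "cut M' X = 2" "(z \<in> X) \<noteq> (w \<in> X)"
      using 1[unfolded tight_separated_def, rule_format, OF z w(1) w(2)[symmetric]] by (elim exE conjE)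
    show False
    proof (cases "w \<in> X")
      case True
      then show False using big[OF X(1-3) True] less[OF X(2,3) True] X(4,5) by simp
    next
      case False
      have "card {x0, z} \<le> card X" using finite_sub[OF X(1)] X False by (intro card_mono) auto
      moreover have "card {x1, w} \<le> card (V - X)"
        using finite_sub[of "V - X"] X False w(1) roots by (intro card_mono) auto
      moreover have "card {x0, z} = 2" "card {x1, w} = 2" using z wne by auto
      ultimately have "cut M X \<ge> 3" using internal[OF X(1-3)] by simp
      then show False using same[OF X(2,3) False] X(4) by simp
    qed
  next
    case 2
    then have "cut M' {x0} = 3" using bundled_degree(1) roots(3) by fastforce
    moreover have "cut M' {x0} = cut M {x0}" using same[of "{x0}"] roots(3) wne by simp
    ultimately show False using d0 by simp
  qed
qed

text \<open>Only \<open>z\<close> joins the roots to the other vertices, so the bound 4 on internal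
  cuts yields three edges \<open>x1 z\<close>. For another nonroot \<open>y\<close> there are three
  edge-disjoint paths to \<open>z\<close> avoiding the roots. The corners of D are \<open>z\<close>
  and \<open>y\<close>: \<open>x0\<close> reaches \<open>y\<close> through \<open>x1\<close> and
  \<open>z\<close>, \<open>x1\<close> reaches it through \<open>z\<close>, and the third path is the
  link.\<close>

lemma pendant_root_contradiction:
  assumes m: "m = 2" and e: "{x0, x1} \<in># M"
    and nbr: "\<And>v. {x0, v} \<in># M \<Longrightarrow> v = x1 \<or> v = z" "\<And>v. {x1, v} \<in># M \<Longrightarrow> v = x0 \<or> v = z"
    and z: "z \<in> V - {x0, x1}" "count M {x0, z} = 1"
  shows False
proof -
  have zne: "z \<noteq> x0" "z \<noteq> x1" "x0 \<noteq> z" "x1 \<noteq> z" using z by auto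
  define S where "S = V - {x0, x1}"
  have cS: "card S \<ge> 2" using card_V roots by (simp add: S_def card_Diff_subset)
  have zS: "z \<in> S" using z by (simp add: S_def)
  have SV: "S \<subseteq> V" "V - S = {x0, x1}" using roots by (auto simp: S_def)
  have "cut M (V - S) = cut M S" by (rule cut_compl[OF simple])
  moreover have "cut M (V - S) = (\<Sum>x\<in>{x0, x1}. \<Sum>y\<in>S. count M {x, y})"
  proof -
    have "V - (V - S) = S" using SV(1) by blast
    then show ?thesis using cut_as_sum[OF simple, of "V - S"] unfolding SV(2) using roots by simp
  qed
  moreover have "(\<Sum>y\<in>S. count M {x, y}) = count M {x, z}" if "x \<in> {x0, x1}" for x
  proof -
    have "count M {x, y} = 0" if "y \<in> S - {z}" for y
    proof -
      have "{x, y} \<notin># M" using nbr[of y] \<open>x \<in> {x0, x1}\<close> that by (auto simp: S_def)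
      then show ?thesis by (simp only: not_in_iff)
    qed
    then have "(\<Sum>y\<in>S. count M {x, y}) = (\<Sum>y\<in>{z}. count M {x, y})"
      using zS finite_sub[OF SV(1)] by (intro sum.mono_neutral_right) auto
    then show ?thesis by simp
  qed
  ultimately have "cut M S = count M {x0, z} + count M {x1, z}" using roots(3) by simp
  moreover have "cut M S \<ge> 4" using nonsep_int[of S] cS by (simp add: S_def)
  ultimately have c1: "count M {x1, z} \<ge> 3" using z(2) by simp
  obtain y where y: "y \<in> S" "y \<noteq> z"
  proof -
    have "S \<noteq> {z}" using cS by auto
    then show thesis using that zS by blast
  qed
  define N where "N = {#e \<in># M. x0 \<notin> e \<and> x1 \<notin> e#}"
  have sN: "simple_edges V N" using simple by (rule simple_edges_mono) (simp add: N_def)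
  \<comment> \<open>Since \<open>z\<close> is not in \<open>X\<close>, no edge at a root contributes
    to the cut of the nonroots in \<open>X\<close>.\<close>
  have "cut N X \<ge> 3" if X: "X \<subseteq> V" "y \<in> X" "z \<notin> X" for X
  proof -
    let ?Y = "X - {x0, x1}"
    have "cut M ?Y \<ge> 3" using X y by (intro nonsep) (auto simp: S_def)
    moreover have "cut M ?Y \<le> cut N X"
    proof -
      have "{#e \<in># M. card (e \<inter> ?Y) = 1#} \<subseteq># {#e \<in># N. card (e \<inter> X) = 1#}"
      proof -
        have "x0 \<notin> e \<and> x1 \<notin> e \<and> card (e \<inter> X) = 1" if e: "e \<in># M" "card (e \<inter> ?Y) = 1" for e
        proof -
          obtain a b where ab: "e = {a, b}" "a \<noteq> b" by (rule simple_edgesD[OF simple e(1)])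
          have "{b, a} = e" using ab by auto
          have "(a \<in> ?Y) \<noteq> (b \<in> ?Y)" using e(2) card_pair_Int[OF ab(2), of ?Y] ab(1) by simp
          moreover have "b \<notin> ?Y" if "a = x0 \<or> a = x1" using nbr[of b] e(1) ab(1) that X(3) by auto
          moreover have "a \<notin> ?Y" if "b = x0 \<or> b = x1" using nbr[of a] e(1) \<open>{b, a} = e\<close> that X(3) by auto
          ultimately show ?thesis using card_pair_Int[OF ab(2), of X] ab(1) by auto
        qed
        then have "{#e \<in># M. card (e \<inter> ?Y) = 1#} = {#e \<in># {#e \<in># N. card (e \<inter> X) = 1#}. card (e \<inter> ?Y) = 1#}"
          unfolding N_def filter_filter_mset by (intro filter_mset_cong) auto
        then show ?thesis by simp
      qed
      then show ?thesis unfolding cut_def by (rule size_mset_mono)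
    qed
    ultimately show ?thesis by linarith
  qed
  then obtain Q where Q: "size Q = 3" "\<forall>p\<in>#Q. is_path y z p" "edges_of Q \<subseteq># N"
    using menger[OF sN, of y z 3] y zS SV by blast
  obtain q1 q2 q3 where Q3: "Q = {#q1, q2, q3#}" using Q(1) by (rule size_3_msetE)
  have l: "linked (path_edges q1) y z" "linked (path_edges q2) y z" "linked (path_edges q3) y z"
    using Q(2) Q3 is_path_linked by auto
  let ?B = "replicate_mset 1 {x0, x1} + replicate_mset 1 {x0, z} + replicate_mset 3 {x1, z} + replicate_mset 0 {}"
  define Z where "Z = {#e \<in># M. \<not> (x0 \<notin> e \<and> x1 \<notin> e)#}"
  have MN: "M = N + Z" unfolding N_def Z_def by (rule multiset_partition)
  have cO: "count Z e = count M e" if "x0 \<in> e \<or> x1 \<in> e" for e using that by (simp add: Z_def)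
  have eO: "1 \<le> count Z {x0, x1}" using e cO[of "{x0, x1}"] by simp
  have zO: "1 \<le> count Z {x0, z}" "3 \<le> count Z {x1, z}" using z(2) c1 cO[of "{x0, z}"] cO[of "{x1, z}"] by simp_all
  have "?B \<subseteq># Z"
    by (rule image_subset_edge[OF eO zO]) (use zne roots(3) in \<open>simp_all add: doubleton_eq_iff\<close>)
  then have "?B + edges_of Q \<subseteq># M" unfolding MN using Q(3) by (metis add.commute subset_mset.add_mono)
  moreover have "{#{x0, z}#} + ({#{x0, x1}, {x1, z}#} + path_edges q1) + {#{x1, z}#} + ({#{x1, z}#} + path_edges q2)
      + path_edges q3 + edges_of {#} = ?B + edges_of Q"
    unfolding Q3 by (simp add: numeral_3_eq_3 ac_simps)
  ultimately have sub: "{#{x0, z}#} + ({#{x0, x1}, {x1, z}#} + path_edges q1) + {#{x1, z}#} + ({#{x1, z}#} + path_edges q2)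
      + path_edges q3 + edges_of {#} \<subseteq># M" by (simp only:)
  have "has_D 2 V M x0 x1"
  proof (rule has_DI[OF z(1) _ y(2)[symmetric] roots(3) _ _ _ _ _ _ _ sub])
    show "y \<in> V - {x0, x1}" using y by (simp add: S_def)
    show "linked {#{x0, z}#} x0 z" "linked {#{x1, z}#} x1 z" by (rule linked_doubleton)+
    show "linked ({#{x0, x1}, {x1, z}#} + path_edges q1) x0 y"
      using linked_add_trans[OF linked_two linked_sym[OF l(1)]] .
    show "linked ({#{x1, z}#} + path_edges q2) x1 y"
      using linked_add_trans[OF linked_doubleton(1) linked_sym[OF l(2)]] .
    show "linked (path_edges q3) z y" using linked_sym[OF l(3)] .
  qed simp_all
  then show False using no_D m by simp
qed

lemma cut_singleton_path_le_2: "distinct p \<Longrightarrow> cut (path_edges p) {y} \<le> 2"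
proof (rule cut_path_le_2)
  fix i j k assume "distinct p" "i < j" "j < k" "k < length p" "p ! i \<in> {y}" "p ! k \<in> {y}"
  then show "p ! j \<in> {y}" using nth_eq_iff_index_eq[of p i k] by simp
qed

text \<open>The degree is at least 3, and the single path through \<open>y\<close> accounts for at
  most 2 of it.\<close>

lemma once_touched:
  assumes sys: "system (add_mset p P) R" and y: "y \<in> V - {x0, x1}" "\<forall>q\<in>#P. y \<notin> set q"
  obtains y' where "{y, y'} \<in># R"
proof -
  note S = systemD[OF sys]
  have "cut M {y} \<ge> 3" using y(1) by (intro nonsep) auto
  moreover have "cut (edges_of P) {y} = 0" using y(2) by (intro cut_edges_of_untouched) auto
  moreover have "cut (path_edges p) {y} \<le> 2" using S(7) by (intro cut_singleton_path_le_2) simp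
  moreover have "cut M {y} = cut (path_edges p) {y} + cut (edges_of P) {y} + cut R {y}" unfolding S(3) by simp
  ultimately have "cut R {y} > 0" by linarith
  then obtain e where e: "e \<in># R" "card (e \<inter> {y}) = 1" using cut_pos_iff by metis
  obtain a b where ab: "e = {a, b}" "a \<noteq> b" by (rule simple_edgesD[OF S(4) e(1)])
  then have "a = y \<or> b = y" using e(2) card_pair_Int[OF ab(2), of "{y}"] by auto
  then show thesis using that e(1) ab(1) by (metis insert_commute)
qed

text \<open>Each path uses one edge at \<open>x0\<close>, so together they use them all.\<close>

lemma root_saturated:
  assumes sys: "system P R" and d: "cut M {x0} = size P"
  shows "\<And>e. x0 \<in> e \<Longrightarrow> e \<notin># R" "\<And>v. linked R v x0 \<Longrightarrow> v = x0"
proof -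
  note S = systemD[OF sys]
  have "cut (edges_of P) {x0} = size P * 1"
    by (rule cut_edges_of) (rule path_cut_hd[OF S(1) roots(3)])
  then have z: "cut R {x0} = 0" using d unfolding S(3) by simp
  show "\<And>e. x0 \<in> e \<Longrightarrow> e \<notin># R" using cut_singleton_0D[OF z] by fast
  show "v = x0" if "linked R v x0" for v
  proof (rule ccontr)
    assume "v \<noteq> x0"
    then have "cut R {x0} \<ge> 1" using linked_cut[OF that, of "{x0}"] by simp
    then show False using z by simp
  qed
qed

end

lemma pair_cut:
  assumes "simple_edges V N" "x \<noteq> z"
  shows "cut N {x, z} + 2 * count N {x, z} = cut N {x} + cut N {z}"
  using assms(1)
proof (induction N)
  case (add e N)
  obtain a b where e: "e = {a, b}" "a \<noteq> b" by (rule simple_edgesD[OF add.prems(1), of e]) simp_all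
  have IH: "cut N {x, z} + 2 * count N {x, z} = cut N {x} + cut N {z}"
    using add by (simp add: simple_edges_def)
  have s: "cut (add_mset e N) X = cut {#e#} X + cut N X" for X by simp
  have one: "cut {#e#} {x, z} + 2 * count {#e#} {x, z} = cut {#e#} {x} + cut {#e#} {z}"
  proof (cases "e = {x, z}")
    case True
    show ?thesis unfolding True cut_single[OF assms(2)] using assms(2) by simp
  next
    case False
    then have "\<not> (a = x \<and> b = z)" "\<not> (a = z \<and> b = x)" using e by auto
    moreover have "count {#e#} {x, z} = 0" using False by simp
    ultimately show ?thesis unfolding e(1) cut_single[OF e(2)] using e(2) assms(2)
      by (cases "a = x"; cases "a = z"; cases "b = x"; cases "b = z") simp_all
  qed
  have c: "count (add_mset e N) {x, z} = count {#e#} {x, z} + count N {x, z}" by simp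
  have arith: "a1 + 2 * k = b1 + c1 \<Longrightarrow> a2 + 2 * l = b2 + c2 \<Longrightarrow> a3 = a2 + a1 \<Longrightarrow> b3 = b2 + b1 \<Longrightarrow> c3 = c2 + c1
      \<Longrightarrow> a3 + 2 * (l + k) = b3 + c3" for a1 a2 a3 b1 b2 b3 c1 c2 c3 k l :: nat
    by presburger
  show ?case unfolding c by (rule arith[OF IH one s s s])
qed simp

text \<open>What remains of a smallest counterexample to the trichotomy once the reductions by
  internal tight cuts and by root edges have been made.\<close>

locale reduced = D_free +
  assumes internal: "\<And>X. X \<subseteq> V \<Longrightarrow> x0 \<in> X \<Longrightarrow> x1 \<notin> X \<Longrightarrow> card X \<ge> 2 \<Longrightarrow> card (V - X) \<ge> 2 \<Longrightarrow> cut M X \<ge> Suc m"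
    and root_edge: "m \<ge> 3 \<Longrightarrow> {x0, x1} \<notin># M"
    and IH: "outcome_below V M"
begin

lemma reduced_sym: "reduced m V M x1 x0"
proof -
  interpret s: admissible m V M x1 x0 by (rule sym)
  show ?thesis
  proof
    show "\<not> has_D m V M x1 x0" using no_D has_D_sym by metis
    show "cut M X \<ge> Suc m" if X: "X \<subseteq> V" "x1 \<in> X" "x0 \<notin> X" "card X \<ge> 2" "card (V - X) \<ge> 2" for X
    proof -
      have "V - (V - X) = X" using X(1) by blast
      then have "cut M (V - X) \<ge> Suc m" using X roots by (intro internal) auto
      then show ?thesis using cut_compl[OF simple, of X] by simp
    qed
    show "m \<ge> 3 \<Longrightarrow> {x1, x0} \<notin># M" using root_edge by (simp add: insert_commute)
    show "outcome_below V M" by (rule IH)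
  qed
qed

lemma sep_cases:
  assumes X: "X \<subseteq> V" "x0 \<in> X" "x1 \<notin> X"
  shows "X = {x0} \<or> V - X = {x1} \<or> cut M X \<ge> Suc m"
proof (cases "X = {x0} \<or> V - X = {x1}")
  case False
  then obtain y y' where "y \<in> X" "y \<noteq> x0" "y' \<in> V - X" "y' \<noteq> x1" using X roots by blast
  have "card {x0, y} \<le> card X" using \<open>y \<in> X\<close> X(2) by (intro card_mono finite_sub[OF X(1)]) blast
  moreover have "card {x1, y'} \<le> card (V - X)" using \<open>y' \<in> V - X\<close> X(3) roots(2)
    by (intro card_mono finite_sub[of "V - X"]) blast+
  moreover have "card {x0, y} = 2" "card {x1, y'} = 2" using \<open>y \<noteq> x0\<close> \<open>y' \<noteq> x1\<close> by auto
  ultimately show ?thesis using internal[OF X] by simp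
qed blast

lemma cut_compl_root: "V - X = {x1} \<Longrightarrow> cut M X = cut M {x1}"
  using cut_compl[OF simple, of X] by simp

text \<open>There is an edge \<open>ab\<close> between nonroots, and it can be kept out of
  \<open>m\<close> paths, because the tight cuts are those at the roots. In \<open>R\<close> both
  roots are isolated, so \<open>ab\<close> lies in an unrooted component, against
  \<open>maximal_system_rooted\<close>.\<close>

lemma both_roots_tight_contradiction:
  assumes d: "cut M {x0} = m" "cut M {x1} = m"
  shows False
proof -
  have "\<exists>a b. {a, b} \<in># M \<and> a \<in> V - {x0, x1} \<and> b \<in> V - {x0, x1}"
  proof (rule ccontr)
    assume no: "\<not> ?thesis"
    have "\<not> V \<subseteq> {x0, x1}"
    proof
      assume "V \<subseteq> {x0, x1}"
      then have "card V \<le> card {x0, x1}" by (intro card_mono) auto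
      then show False using card_V roots(3) by simp
    qed
    then obtain z where z: "z \<in> V - {x0, x1}" by blast
    have zne: "x0 \<noteq> z" "x1 \<noteq> z" "z \<noteq> x0" "z \<noteq> x1" using z by auto
    have "cut M {z} = (\<Sum>y\<in>V - {z}. count M {z, y})" using cut_as_sum[OF simple, of "{z}"] z by simp
    also have "\<dots> = (\<Sum>y\<in>{x0, x1}. count M {z, y})"
    proof (rule sum.mono_neutral_right)
      show "\<forall>y\<in>V - {z} - {x0, x1}. count M {z, y} = 0"
      proof
        fix y assume "y \<in> V - {z} - {x0, x1}"
        then have "{z, y} \<notin># M" using no z by blast
        then show "count M {z, y} = 0" by (simp only: not_in_iff)
      qed
    qed (use finite_V roots zne in auto)
    also have "\<dots> = count M {z, x0} + count M {z, x1}" using roots(3) by simp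
    finally have cz: "cut M {z} = count M {x0, z} + count M {x1, z}" by (simp add: insert_commute)
    \<comment> \<open>With no edge between nonroots the degree of \<open>z\<close> is the sum of its
      multiplicities to the roots. Both cuts are internal and have size at least
      \<open>m + 1\<close>; adding the two equations gives \<open>2 * d + 2 \<le> 2 * d\<close> for
      this degree \<open>d\<close>.\<close>
    have c0: "cut M {x0, z} + 2 * count M {x0, z} = m + cut M {z}" using pair_cut[OF simple zne(1)] d by simp
    have c1: "cut M {x1, z} + 2 * count M {x1, z} = m + cut M {z}" using pair_cut[OF simple zne(2)] d by simp
    have "card (V - {x0, z}) \<ge> 2" "card (V - {x1, z}) \<ge> 2"
      using card_V z roots zne by (simp_all add: card_Diff_subset)
    moreover have "cut M {x0, z} \<ge> Suc m" using calculation z roots zne by (intro internal) auto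
    moreover have "cut M {x1, z} \<ge> Suc m"
      using calculation z roots zne by (intro reduced.internal[OF reduced_sym]) auto
    ultimately show False using c0 c1 cz by linarith
  qed
  then obtain a b where ab: "{a, b} \<in># M" "a \<in> V - {x0, x1}" "b \<in> V - {x0, x1}" by blast
  let ?N = "M - {#{a, b}#}"
  have abne: "a \<noteq> b" using simple_edges_pair[OF simple ab(1)] by simp
  have MN: "M = ?N + {#{a, b}#}" using ab(1) by simp
  have cN: "cut M X = cut ?N X + (if (a \<in> X) \<noteq> (b \<in> X) then 1 else 0)" for X
    using cut_add[of ?N "{#{a, b}#}" X] unfolding MN[symmetric] cut_single[OF abne] .
  have sN: "simple_edges V ?N" using simple diff_subset_eq_self by (rule simple_edges_mono)
  have "m \<le> cut ?N X" if X: "X \<subseteq> V" "x0 \<in> X" "x1 \<notin> X" for X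
  proof -
    consider "X = {x0}" | "V - X = {x1}" | "cut M X \<ge> Suc m" using sep_cases[OF X] by blast
    then show ?thesis
    proof cases
      case 1
      then show ?thesis using cN[of X] d(1) ab by auto
    next
      case 2
      then have "a \<in> X" "b \<in> X" using ab by auto
      then show ?thesis using cN[of X] d(2) cut_compl_root[OF 2] by simp
    next
      case 3
      then show ?thesis using cN[of X] by (auto split: if_splits)
    qed
  qed
  then obtain P where P: "size P = m" "\<forall>p\<in>#P. is_path x0 x1 p" "edges_of P \<subseteq># ?N"
    using menger[OF sN roots] by blast
  define R where "R = ?N - edges_of P + {#{a, b}#}"
  have "edges_of P + (?N - edges_of P) = ?N" using P(3) by (rule subset_mset.add_diff_inverse)
  then have "edges_of P + R = ?N + {#{a, b}#}" unfolding R_def by (simp only: add.assoc[symmetric])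
  then have MR: "M = edges_of P + R" using MN by (simp only:)
  have sys: "system P R" unfolding system_def using P MR by simp
  \<comment> \<open>Every system of \<open>m\<close> paths saturates both roots, so no nonroot is
    ever rooted and maximality is automatic.\<close>
  have rooted: "rooted R' \<subseteq> {x0, x1}" if "system P' R'" "size P' = m" for P' R'
  proof -
    interpret s: reduced m V M x1 x0 by (rule reduced_sym)
    have "s.system (image_mset rev P') R'"
    proof -
      have "edges_of (image_mset rev P') = edges_of P'" by (induction P') (simp_all add: path_edges_rev)
      then show ?thesis using that(1) unfolding s.system_def system_def by (auto intro: is_path_rev)
    qed
    then show ?thesis
      using root_saturated(2)[OF that(1)] s.root_saturated(2) d that(2) unfolding rooted_def by fastforce
  qed
  have "x0 \<in> rooted R" "x1 \<in> rooted R" using roots by (auto simp: rooted_def)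
  then have "maximal_system P R" using sys rooted P(1) unfolding maximal_system_def by blast
  then have "a \<in> rooted R" by (rule maximal_system_rooted[of _ _ a b]) (simp add: R_def)
  then show False using rooted[OF sys P(1)] ab(2) by auto
qed

lemma link_of_in_path:
  assumes "is_path x0 x1 p" "p = l @ z # t"
  shows "linked (path_edges (l @ [z])) x0 z" "path_edges p = path_edges (l @ [z]) + path_edges (z # t)"
    "linked (path_edges (z # t)) z x1"
proof -
  show "linked (path_edges (l @ [z])) x0 z"
    using assms path_linked[of "l @ [z]"] by (cases l) (auto simp: is_path_def)
  show "linked (path_edges (z # t)) z x1"
    using assms path_linked[of "z # t"] by (auto simp: is_path_def)
  show "path_edges p = path_edges (l @ [z]) + path_edges (z # t)"
    unfolding assms(2) by (rule path_edges_append)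
qed

text \<open>The case in which every path of the system through \<open>z\<close> is \<open>[x0, z, x1]\<close>; the three paths are
  those from an untouched vertex \<open>y\<close> to \<open>{z, x1}\<close>.\<close>

lemma star_has_D:
  assumes sub: "path_edges [x0, z, x1] + path_edges [x0, z, x1] + edges_of {#q1, q2, q3#} + {#{z, x1}#} + edges_of P \<subseteq># M
      \<or> (is_path y z q1 \<and> path_edges [x0, z, x1] + path_edges [x0, z, x1] + edges_of {#q1, q2, q3#} + edges_of P \<subseteq># M)"
    and q: "\<forall>q\<in>#{#q1, q2, q3#}. is_path y z q \<or> is_path y x1 q"
    and z: "z \<in> V - {x0, x1}" and y: "y \<in> V - {x0, x1}" "y \<noteq> z"
    and P: "\<forall>p\<in>#P. is_path x0 x1 p" "m \<le> size P + 2"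
  shows "has_D m V M x0 x1"
proof -
  have pz: "path_edges [x0, z, x1] = {#{x0, z}#} + {#{z, x1}#}" by simp
  have l0: "linked {#{x0, z}#} x0 z" "linked {#{z, x1}#} z x1" by (rule linked_doubleton)+
  have p2: "passes (path_edges [x0, z, x1]) x0 x1 z" by (rule passesI[OF l0]) simp
  note D = has_D_passesI[OF _ p2 _ y(1) z y(2) roots(3) P(2)]
  have one: "has_D m V M x0 x1"
    if "linked A y z" "linked B y x1" "linked C y z \<or> linked C y x1"
      "path_edges [x0, z, x1] + path_edges [x0, z, x1] + (A + B + C) + edges_of P \<subseteq># M" for A B C
  proof (rule D)
    show "passes ({#{x0, z}#} + A + B) x0 x1 y"
      by (rule passesI[OF linked_add_trans[OF l0(1) linked_sym[OF that(1)]] that(2)]) simp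
    show "linked ({#{z, x1}#} + C) y z"
    proof (cases "linked C y z")
      case True
      then show ?thesis by (rule linked_add2)
    next
      case False
      then have "linked C y x1" using that(3) by blast
      from linked_add_trans[OF this linked_sym[OF l0(2)]] show ?thesis by (simp only: add.commute)
    qed
    show "{#{x0, z}#} + A + B + path_edges [x0, z, x1] + ({#{z, x1}#} + C) + edges_of P \<subseteq># M"
      using that(4) unfolding pz by (simp add: ac_simps add_mset_commute)
  qed (use P in blast)
  have l: "linked (path_edges q) y z \<or> linked (path_edges q) y x1" if "q \<in># {#q1, q2, q3#}" for q
    using q that is_path_linked by metis
  show ?thesis
  proof (cases "\<exists>a b c. {#a, b, c#} = {#q1, q2, q3#} \<and> linked (path_edges a) y z \<and> linked (path_edges b) y x1")
    case True
    then obtain a b c where abc: "{#a, b, c#} = {#q1, q2, q3#}" "linked (path_edges a) y z" "linked (path_edges b) y x1" by blast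
    have "c \<in># {#a, b, c#}" by simp
    then have lc: "linked (path_edges c) y z \<or> linked (path_edges c) y x1" using l unfolding abc(1) by blast
    have e: "edges_of {#q1, q2, q3#} = path_edges a + path_edges b + path_edges c" unfolding abc(1)[symmetric] by simp
    show ?thesis
    proof (rule one[OF abc(2,3) lc])
      let ?X = "path_edges [x0, z, x1] + path_edges [x0, z, x1] + (path_edges a + path_edges b + path_edges c) + edges_of P"
      from sub show "?X \<subseteq># M"
      proof
        assume a: "path_edges [x0, z, x1] + path_edges [x0, z, x1] + edges_of {#q1, q2, q3#} + {#{z, x1}#} + edges_of P \<subseteq># M"
        have "?X \<subseteq># ?X + {#{z, x1}#}" by simp
        also have "\<dots> \<subseteq># M" using a unfolding e by (simp add: ac_simps add_mset_commute)
        finally show ?thesis .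
      qed (elim conjE, simp only: e)
    qed
  next
    case no: False
    show ?thesis
    proof (cases "linked (path_edges q1) y z")
      case True
      have all: "linked (path_edges q2) y z" "linked (path_edges q3) y z"
      proof -
        have "{#q1, q2, q3#} = {#q1, q2, q3#}" "{#q1, q3, q2#} = {#q1, q2, q3#}" by simp_all
        then have "\<not> linked (path_edges q2) y x1" "\<not> linked (path_edges q3) y x1" using no True by blast+
        then show "linked (path_edges q2) y z" "linked (path_edges q3) y z" using l[of q2] l[of q3] by auto
      qed
      show ?thesis
      proof (rule D)
        show "passes ({#{x0, z}#} + path_edges q1 + (path_edges q2 + {#{z, x1}#})) x0 x1 y"
          by (rule passesI[OF linked_add_trans[OF l0(1) linked_sym[OF True]] linked_add_trans[OF all(1) l0(2)]]) simp
        show "linked (path_edges q3) y z" by (rule all)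
        let ?X = "{#{x0, z}#} + path_edges q1 + (path_edges q2 + {#{z, x1}#}) + path_edges [x0, z, x1] + path_edges q3 + edges_of P"
        from sub show "?X \<subseteq># M"
        proof
          assume a: "path_edges [x0, z, x1] + path_edges [x0, z, x1] + edges_of {#q1, q2, q3#} + {#{z, x1}#} + edges_of P \<subseteq># M"
          have "?X \<subseteq># ?X + {#{z, x1}#}" by simp
          also have "\<dots> \<subseteq># M" using a by (simp add: ac_simps add_mset_commute)
          finally show ?thesis .
        qed (simp add: ac_simps add_mset_commute)
      qed (use P in blast)
    next
      case False
      then have q1: "linked (path_edges q1) y x1" using l[of q1] by auto
      have "\<not> is_path y z q1" using False is_path_linked[of y z q1] by blast
      then have sub': "path_edges [x0, z, x1] + path_edges [x0, z, x1] + edges_of {#q1, q2, q3#} + {#{z, x1}#} + edges_of P \<subseteq># M"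
        using sub by blast
      have all: "linked (path_edges q2) y x1" "linked (path_edges q3) y x1"
      proof -
        have "{#q2, q1, q3#} = {#q1, q2, q3#}" "{#q3, q1, q2#} = {#q1, q2, q3#}" by simp_all
        then have "\<not> linked (path_edges q2) y z" "\<not> linked (path_edges q3) y z" using no q1 by blast+
        then show "linked (path_edges q2) y x1" "linked (path_edges q3) y x1" using l[of q2] l[of q3] by auto
      qed
      show ?thesis
      proof (rule D)
        show "passes ({#{x0, z}#} + {#{z, x1}#} + path_edges q1 + path_edges q2) x0 x1 y"
          by (rule passesI[OF linked_add_trans[OF linked_add_trans[OF l0] linked_sym[OF q1]] all(1)]) simp
        show "linked (path_edges q3 + {#{z, x1}#}) y z"
          by (rule linked_add_trans[OF all(2) linked_sym[OF l0(2)]])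
        show "{#{x0, z}#} + {#{z, x1}#} + path_edges q1 + path_edges q2 + path_edges [x0, z, x1]
            + (path_edges q3 + {#{z, x1}#}) + edges_of P \<subseteq># M"
          using sub' by (simp add: ac_simps add_mset_commute)
      qed (use P in blast)
    qed
  qed
qed

text \<open>An extra copy of \<open>x0 z\<close> lifts all separating cuts to \<open>m + 1\<close>.
  Among \<open>m + 1\<close> paths, which saturate \<open>x0\<close>, one starts with this edge;
  without its first edge it becomes a connection from \<open>z\<close> to \<open>x1\<close> in
  \<open>R\<close>. Passing to a maximal system keeps \<open>z\<close> rooted, and the saturated
  \<open>x0\<close> cannot be its root.\<close>

lemma tight_root_system:
  assumes d: "cut M {x0} = m" "cut M {x1} \<ge> Suc m" and z: "z \<in> V - {x0, x1}" "{x0, z} \<in># M"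
  obtains P R where "maximal_system P R" "size P = m" "linked R z x1"
proof -
  have zne: "x0 \<noteq> z" "z \<noteq> x0" using z by auto
  let ?N = "M + {#{x0, z}#}"
  have sN: "simple_edges V ?N" using simple z roots by (auto simp: simple_edges_def)
  have cN: "cut ?N X = cut M X + (if (x0 \<in> X) \<noteq> (z \<in> X) then 1 else 0)" for X
    by (simp only: cut_add cut_single[OF zne(1)])
  have "Suc m \<le> cut ?N X" if X: "X \<subseteq> V" "x0 \<in> X" "x1 \<notin> X" for X
  proof -
    consider "X = {x0}" | "V - X = {x1}" | "cut M X \<ge> Suc m" using sep_cases[OF X] by blast
    then show ?thesis
    proof cases
      case 1
      then show ?thesis using cN[of X] d zne by simp
    next
      case 2
      then show ?thesis using cN[of X] d(2) cut_compl_root[OF 2] by simp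
    next
      case 3
      then show ?thesis using cN[of X] by simp
    qed
  qed
  then obtain Q where Q: "size Q = Suc m" "\<forall>p\<in>#Q. is_path x0 x1 p" "edges_of Q \<subseteq># ?N"
    using menger[OF sN roots] by blast
  define R0 where "R0 = ?N - edges_of Q"
  have N: "?N = edges_of Q + R0" using Q(3) by (simp add: R0_def)
  have "cut (edges_of Q) {x0} = size Q * 1"
    by (rule cut_edges_of) (rule path_cut_hd[OF Q(2)[rule_format] roots(3)])
  moreover have "cut ?N {x0} = Suc m" using cN[of "{x0}"] d(1) zne by simp
  ultimately have "cut R0 {x0} = 0" using Q(1) unfolding N by simp
  then have "{x0, z} \<notin># R0" using cut_singleton_0D[of R0 x0 "{x0, z}"] by blast
  then have "{x0, z} \<in># edges_of Q" using N by (metis union_iff union_single_eq_member add_mset_add_single)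
  then obtain p where p: "p \<in># Q" "{x0, z} \<in># path_edges p" using in_edges_of by metis
  obtain P where P: "Q = add_mset p P" using p(1) by (meson multi_member_split)
  have ip: "is_path x0 x1 p" using Q(2) p(1) by blast
  obtain c t where ct: "p = x0 # c # t"
    using ip roots(3) by (cases p rule: path_edges.cases) (auto simp: is_path_def)
  have "{x0, z} \<notin># path_edges (c # t)"
    using path_edges_in[of "{x0, z}" "c # t"] ip by (auto simp: ct is_path_def)
  then have "{x0, z} = {x0, c}" using p(2) unfolding ct by simp
  then have cz: "c = z" using zne by (auto simp: doubleton_eq_iff)
  define R where "R = R0 + path_edges (z # t)"
  have "?N = edges_of P + R + {#{x0, z}#}" unfolding N P ct cz R_def by (simp add: ac_simps)
  then have "M = edges_of P + R" by simp
  then have sys: "system P R" unfolding system_def using Q P by auto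
  have "linked (path_edges (z # t)) z x1"
    using path_linked[of "z # t"] ip unfolding ct cz is_path_def by simp
  then have zR: "linked R z x1" unfolding R_def by (rule linked_add2)
  obtain P' R' where M': "maximal_system P' R'" "size P' = size P" "rooted R \<subseteq> rooted R'"
    by (rule maximal_system_exists[OF sys])
  have sz: "size P' = m" using M'(2) Q(1) P by simp
  have sys': "system P' R'" using M'(1) by (simp add: maximal_system_def)
  have "z \<in> rooted R'" using M'(3) zR z(1) by (auto simp: rooted_def)
  then have "linked R' z x1" using root_saturated(2)[OF sys', of z] d(1) sz zne by (auto simp: rooted_def)
  then show thesis using that M'(1) sz by blast
qed

lemma direct_path:
  assumes "is_path x0 x1 p" "set p \<subseteq> {x0, x1}"
  shows "p = [x0, x1]"
proof -
  obtain c q where cq: "p = x0 # c # q"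
    using assms(1) roots(3) by (cases p rule: path_edges.cases) (auto simp: is_path_def)
  then have "c = x1" using assms by (auto simp: is_path_def)
  moreover have qs: "x0 \<notin> set q" "x1 \<notin> set q" "set q \<subseteq> {x0, x1}"
    using assms cq calculation by (auto simp: is_path_def)
  have "v \<notin> set q" for v using subsetD[OF qs(3), of v] qs(1,2) by auto
  then have "q = []" by (cases q) auto
  ultimately show ?thesis using cq by simp
qed

text \<open>Let \<open>K\<close> be the class of \<open>x1\<close> in \<open>R\<close>, which
  contains \<open>z\<close>. Every path enters \<open>K\<close> exactly once, so \<open>K\<close>
  has an \<open>m\<close>-cut and must be everything but \<open>x0\<close>. If a second path passes
  \<open>z\<close>, all paths stay within the roots and \<open>z\<close>, and
  \<open>star_has_D\<close> applies. Otherwise the paths other than \<open>p1\<close> are root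
  edges, so \<open>m = 2\<close>, and \<open>x0\<close> has no neighbours except \<open>x1\<close>
  and \<open>z\<close>: the case delegated to \<open>nbr2\<close>.\<close>

lemma tight_root_contradiction:
  assumes d: "cut M {x0} = m" "cut M {x1} \<ge> Suc m" and z: "z \<in> V - {x0, x1}" "{x0, z} \<in># M"
    and nbr2: "m = 2 \<Longrightarrow> {x0, x1} \<in># M \<Longrightarrow> (\<And>v. {x0, v} \<in># M \<Longrightarrow> v = x1 \<or> v = z) \<Longrightarrow> False"
  shows False
proof -
  have zne: "x0 \<noteq> z" "z \<noteq> x0" "z \<noteq> x1" using z by auto
  obtain P R where max: "maximal_system P R" and sP: "size P = m" and zR: "linked R z x1"
    by (rule tight_root_system[OF d z])
  have sys: "system P R" using max by (simp add: maximal_system_def)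
  note S = systemD[OF sys]
  have sat: "\<And>e. x0 \<in> e \<Longrightarrow> e \<notin># R" "\<And>v. linked R v x0 \<Longrightarrow> v = x0"
    using root_saturated[OF sys] d(1) sP by auto
  have Redge: "linked R w x1" if "{w, w'} \<in># R" for w w'
  proof -
    have "w \<in> rooted R" by (rule maximal_system_rooted[OF max that])
    moreover have "w \<noteq> x0" using sat(1)[of "{w, w'}"] that by auto
    ultimately show ?thesis using sat(2)[of w] by (auto simp: rooted_def)
  qed
  define K where "K = {v. linked R x1 v}"
  have Kiff: "v \<in> K \<longleftrightarrow> linked R v x1" for v unfolding K_def mem_Collect_eq by (rule linked_commute)
  have KV: "K \<subseteq> V" using linked_in[OF _ S(4) roots(2)] by (auto simp: K_def)
  have x0K: "x0 \<notin> K" using sat(2)[of x1] roots(3) by (auto simp: K_def)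
  have x1K: "x1 \<in> K" and zK: "z \<in> K" using zR by (simp_all add: Kiff)
  have link: "linked R a b" if "a \<in> K" "b \<in> K" for a b
    using that linked_class[of R x1 a b] by (simp add: K_def)
  have "{x0, z} \<in># edges_of P" using z(2) sat(1)[of "{x0, z}"] S(3) by auto
  then obtain p1 where p1: "p1 \<in># P" "{x0, z} \<in># path_edges p1" using in_edges_of by metis
  obtain c t where ct: "p1 = x0 # c # t"
    using S(1)[OF p1(1)] roots(3) by (cases p1 rule: path_edges.cases) (auto simp: is_path_def)
  have "{x0, z} \<notin># path_edges (c # t)"
    using path_edges_in[of "{x0, z}" "c # t"] S(1)[OF p1(1)] by (auto simp: ct is_path_def)
  then have "{x0, z} = {x0, c}" using p1(2) unfolding ct by simp
  then have p1t: "p1 = x0 # z # t" using zne ct by (auto simp: doubleton_eq_iff)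
  have zp1: "z \<in> set p1" by (simp add: p1t)
  \<comment> \<open>Here \<open>p\<close> passes \<open>v\<close>, \<open>p1\<close> passes
    \<open>z\<close>, and \<open>R\<close> links them inside \<open>K\<close>.\<close>
  have other: "p = p1" if p: "p \<in># P" "v \<in> set p" "v \<in> K" "v \<notin> {x0, x1, z}" for p v
  proof (rule ccontr)
    assume "p \<noteq> p1"
    then have "{#p, p1#} \<subseteq># P" using two_in_mset p(1) p1(1) by metis
    then show False using no_D_linked[OF sys _ p(2) zp1 link[OF p(3) zK] _ z(1)] p(3,4) KV by blast
  qed
  \<comment> \<open>If another path passed \<open>y\<close>, then \<open>p\<close> could turn off
    into \<open>R\<close> at \<open>z\<close>, and its own segment from \<open>z\<close> to
    \<open>y\<close> would be the link. So \<open>y\<close> is touched once, has an edge in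
    \<open>R\<close>, and is therefore linked to \<open>x1\<close>.\<close>
  have tail: "y \<in> K" if p: "p \<in># P" "p = l @ z # s" "y \<in> set s" for p l s y
  proof (cases "y = x1")
    case False
    have ip: "is_path x0 x1 p" using S(1)[OF p(1)] .
    have "x0 \<in> set (l @ [z])" using ip p(2) by (cases l) (auto simp: is_path_def)
    then have yV: "y \<in> V - {x0, x1}" "y \<noteq> z" using ip False p S(6)[OF p(1)] by (auto simp: is_path_def)
    obtain P' where P': "P = add_mset p P'" using p(1) by (meson multi_member_split)
    have "y \<notin> set q" if q: "q \<in># P'" for q
    proof
      assume yq: "y \<in> set q"
      obtain P'' where P'': "P' = add_mset q P''" using q by (meson multi_member_split)
      note lp = link_of_in_path[OF ip p(2)]
      have "passes (path_edges (l @ [z]) + R) x0 x1 z" by (rule passesI[OF lp(1) zR]) simp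
      moreover have "is_path x0 x1 q" using S(1) P' q by simp
      then have "passes (path_edges q) x0 x1 y" using yq by (rule passes_path)
      ultimately show False
      proof (rule no_D_passes)
        show "linked (path_edges (z # s)) z y" using p(3) by (intro path_linked_mem) auto
        show "z \<in> V - {x0, x1}" "y \<in> V - {x0, x1}" "z \<noteq> y" using z yV by auto
        show "m \<le> size P'' + 2" using sP P' P'' by simp
        show "is_path x0 x1 r" if "r \<in># P''" for r using S(1) P' P'' that by simp
        have "M = path_edges (l @ [z]) + R + path_edges q + path_edges (z # s) + edges_of P''"
          unfolding S(3) P' P'' using lp(2) by (simp add: ac_simps)
        then show "path_edges (l @ [z]) + R + path_edges q + path_edges (z # s) + edges_of P'' \<subseteq># M" by (simp only: subset_mset.order_refl)
      qed
    qed
    then obtain y' where "{y, y'} \<in># R" using once_touched[of p P' R y] sys yV(1) P' by blast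
    then show ?thesis using Redge Kiff by blast
  qed (simp add: x1K)
  \<comment> \<open>A path through \<open>z\<close> has its vertices in \<open>K\<close> from
    \<open>z\<close> on and none before; any other path meets \<open>K\<close> only in
    \<open>x1\<close>.\<close>
  have single: "cut (path_edges p) K = 1" if p: "p \<in># P" for p
  proof -
    have ip: "is_path x0 x1 p" using S(1)[OF p] .
    have split: "cut (path_edges p) K = 1" if "p = l @ a # s" "set l \<inter> K = {}" "set (a # s) \<subseteq> K" "l \<noteq> []" for l a s
    proof -
      obtain l' b where l': "l = l' @ [b]" using \<open>l \<noteq> []\<close> by (metis rev_exhaust)
      have pe: "path_edges p = path_edges (l' @ [b]) + ({#{b, a}#} + path_edges (a # s))"
        unfolding that(1) l' using path_edges_append[of l' b "a # s"] by simp
      have ba: "b \<noteq> a" "b \<notin> K" "a \<in> K" using that(2,3) l' by auto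
      have "cut (path_edges (l' @ [b])) K = 0" using that(2) l' by (intro cut_path_untouched) simp
      moreover have "cut (path_edges (a # s)) K = 0"
      proof (rule cut_zeroI)
        fix e assume "e \<in># path_edges (a # s)"
        moreover have "distinct (a # s)" using ip that(1) by (simp add: is_path_def)
        ultimately have "card e = 2" "e \<subseteq> K" using path_edges_card path_edges_in that(3) by blast+
        then show "card (e \<inter> K) \<noteq> 1" by (simp add: Int_absorb2)
      qed
      moreover have "cut {#{b, a}#} K = 1" unfolding cut_single[OF ba(1)] using ba by simp
      ultimately show ?thesis unfolding pe by (simp only: cut_add)
    qed
    show ?thesis
    proof (cases "z \<in> set p")
      case True
      then obtain l s where ls: "p = l @ z # s" using split_list by fastforce
      have "l \<noteq> []" using ip ls zne by (auto simp: is_path_def)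
      have "v \<notin> K" if v: "v \<in> set l" for v
      proof
        assume "v \<in> K"
        have "x1 = last (z # s)" using ip ls by (auto simp: is_path_def)
        then have "x1 \<in> set (z # s)" using last_in_set[of "z # s"] by simp
        then have "v \<notin> {x0, x1, z}" using ip ls v \<open>v \<in> K\<close> x0K by (auto simp: is_path_def)
        then have "p = p1" using other[OF p _ \<open>v \<in> K\<close>] v ls by simp
        then have "l @ z # s = [x0] @ z # t" using ls p1t by simp
        moreover have "z \<notin> set l" using ip ls by (auto simp: is_path_def)
        ultimately have "l = [x0]" using zne by (cases l; cases "tl l") auto
        then show False using v \<open>v \<in> K\<close> x0K by simp
      qed
      then show ?thesis using split[OF ls] tail[OF p ls] zK \<open>l \<noteq> []\<close> by auto
    next
      case False
      have "p \<noteq> []" "last p = x1" using ip by (auto simp: is_path_def)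
      then obtain l where l: "p = l @ [x1]" by (metis append_butlast_last_id)
      have "l \<noteq> []" using ip l roots(3) by (auto simp: is_path_def)
      moreover have "v \<notin> K" if v: "v \<in> set l" for v
      proof
        assume "v \<in> K"
        then have "v \<notin> {x0, x1, z}" using ip l v x0K False by (auto simp: is_path_def)
        then have "p = p1" using other[OF p _ \<open>v \<in> K\<close>] v l by simp
        then show False using False zp1 by simp
      qed
      ultimately show ?thesis using split[of l x1 "[]"] l x1K by auto
    qed
  qed
  have "cut (edges_of P) K = size P * 1" by (rule cut_edges_of) (rule single)
  moreover have "cut R K = 0" unfolding K_def by (rule cut_linked_class[OF S(4)])
  ultimately have "cut M K = m" using sP unfolding S(3) by simp
  then have cK: "cut M (V - K) = m" using cut_compl[OF simple] by simp
  \<comment> \<open>Every \<open>m\<close>-cut is the star of a root, and \<open>K\<close> contains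
    \<open>z\<close> besides \<open>x1\<close>.\<close>
  have VK: "V - K = {x0}"
  proof (rule ccontr)
    assume "V - K \<noteq> {x0}"
    then have "V - K \<noteq> {x0}" "x0 \<in> V - K" "x1 \<notin> V - K" using roots x0K x1K by auto
    moreover have "V - (V - K) \<noteq> {x1}" using zK zne KV z by auto
    ultimately show False using sep_cases[of "V - K"] cK by auto
  qed
  have nonroot_K: "v \<in> K" if "v \<in> V" "v \<noteq> x0" for v using that VK by blast
  have inp1: "p = p1" if "p \<in># P" "v \<in> set p" "v \<notin> {x0, x1, z}" for p v
    using other[OF that(1,2) nonroot_K that(3)] S(6)[OF that(1)] that(2,3) by auto
  obtain P1 where P1: "P = add_mset p1 P1" using p1(1) by (meson multi_member_split)
  have path_z: "p = [x0, z, x1]" if pz: "is_path x0 x1 p" "set p \<subseteq> {x0, x1, z}" "z \<in> set p" for p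
  proof -
    obtain l s where ls: "p = l @ z # s" using pz(3) split_list by fastforce
    have "l = [x0]"
    proof -
      have "l \<noteq> []" "hd l = x0" "last p = x1" "distinct p" using pz(1) ls zne by (cases l; auto simp: is_path_def)+
      moreover have "s \<noteq> []" using calculation(3) ls zne by auto
      moreover have "set l \<subseteq> {x0, x1, z}" "set s \<subseteq> {x0, x1, z}" using pz(2) ls by auto
      moreover have "last s = x1" using calculation(3,5) ls by simp
      moreover from this have "x1 \<in> set s" using calculation(5) last_in_set by metis
      ultimately show ?thesis using ls by (cases l; cases "tl l") auto
    qed
    moreover have "s = [x1]"
    proof -
      have "last p = x1" "distinct p" using pz(1) by (auto simp: is_path_def)
      moreover have "s \<noteq> []" using calculation(1) ls zne by auto
      moreover have "set s \<subseteq> {x1}" using pz(2) ls calculation \<open>l = [x0]\<close> by auto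
      ultimately show ?thesis using ls by (cases s; cases "tl s") auto
    qed
    ultimately show ?thesis using ls by simp
  qed
  show False
  proof (cases "\<exists>p\<in>#P1. z \<in> set p")
    case True
    then obtain p2 P2 where p2: "P1 = add_mset p2 P2" "z \<in> set p2" by (meson multi_member_split)
    have p12: "{#p1, p2#} \<subseteq># P" using P1 p2 by simp
    have "set p \<subseteq> {x0, x1, z}" if p: "p \<in># P" for p
    proof
      fix v assume v: "v \<in> set p"
      show "v \<in> {x0, x1, z}"
      proof (rule ccontr)
        assume nv: "v \<notin> {x0, x1, z}"
        then have "p = p1" using inp1[OF p v] by blast
        moreover have "v \<in> V" using S(6)[OF p] v by auto
        ultimately show False
          using no_D_linked[OF sys p12 _ p2(2) link[OF nonroot_K zK] _ z(1)] v nv by auto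
      qed
    qed
    then have sets: "\<And>p. p \<in># P \<Longrightarrow> set p \<subseteq> {x0, x1, z}" .
    have p12eq: "p1 = [x0, z, x1]" "p2 = [x0, z, x1]"
      using path_z[OF S(1) sets] P1 p2 zp1 by auto
    have "\<not> V \<subseteq> {x0, x1, z}"
    proof
      assume "V \<subseteq> {x0, x1, z}"
      then have "card V \<le> card {x0, x1, z}" by (intro card_mono) auto
      moreover have "card {x0, x1, z} \<le> 3" using card_insert_le_m1[of 3 "{x1, z}" x0] by (simp add: card_insert_if)
      ultimately show False using card_V by simp
    qed
    then obtain y0 where y0: "y0 \<in> V - {x0, x1, z}" by blast
    \<comment> \<open>An edge of \<open>R\<close> at \<open>z\<close> leads to \<open>x1\<close> or
      to a nonroot; in the second case that nonroot is taken as \<open>y\<close>.\<close>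
    have "\<exists>y \<in> V - {x0, x1, z}. {z, x1} \<in># R \<or> {z, y} \<in># R"
    proof -
      obtain w where "{z, w} \<in># R" using linked_first_edge[OF zR zne(3)] by blast
      moreover have "w \<noteq> x0" using sat(1)[of "{z, w}"] calculation by auto
      moreover have "w \<noteq> z" "w \<in> V" using simple_edges_pair[OF S(4) calculation(1)] by auto
      ultimately show ?thesis using y0 by (cases "w = x1") auto
    qed
    then obtain y where y: "y \<in> V - {x0, x1, z}" "{z, x1} \<in># R \<or> {z, y} \<in># R" by blast
    \<comment> \<open>No path meets \<open>X\<close> apart from \<open>x0\<close>, and
      \<open>R\<close> has no edge at \<open>x0\<close>.\<close>
    have cR: "3 \<le> cut R X" if X: "X \<subseteq> V" "y \<in> X" "z \<notin> X" "x1 \<notin> X" for X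
    proof -
      have "cut M (X - {x0}) \<ge> 3" using X y by (intro nonsep) auto
      moreover have "set p \<inter> (X - {x0}) = {}" if "p \<in># P" for p using sets[OF that] X by auto
      then have "cut (edges_of P) (X - {x0}) = 0" by (intro cut_edges_of_untouched) blast
      moreover have "cut R (X - {x0}) = cut R X"
      proof (rule cut_cong)
        fix e assume e: "e \<in># R"
        then have "x0 \<notin> e" using sat(1) by blast
        then have "e \<inter> (X - {x0}) = e \<inter> X" by auto
        then show "(card (e \<inter> (X - {x0})) = 1) = (card (e \<inter> X) = 1)" by (simp only:)
      qed
      ultimately show ?thesis unfolding S(3) by simp
    qed
    have zV: "z \<in> V" using z(1) by simp
    have yV: "y \<in> V" "y \<in> V - {x0, x1}" "y \<noteq> z" "y \<noteq> x1" using y(1) by auto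
    obtain Q where Q: "size Q = 3" "\<forall>p\<in>#Q. is_path y z p \<or> is_path y x1 p" "edges_of Q \<subseteq># {#e \<in># R. e \<noteq> {z, x1}#}"
      using menger_two_targets[OF S(4) yV(1) zV roots(2) yV(3,4) zne(3) cR] .
    have MP: "M = path_edges [x0, z, x1] + path_edges [x0, z, x1] + edges_of P2 + R"
      unfolding S(3) P1 p2 p12eq by (simp only: edges_of_simps add.assoc)
    have P2: "\<forall>p\<in>#P2. is_path x0 x1 p" "m \<le> size P2 + 2" using S(1) sP P1 p2 by auto
    have QR: "edges_of Q \<subseteq># R" using Q(3) multiset_filter_subset subset_mset.order_trans by blast
    \<comment> \<open>If \<open>z x1\<close> is in \<open>R\<close>, it is spare, because the three
      paths avoid it. Otherwise the edge \<open>z y\<close> serves as one of the three paths, so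
      that one of them ends at \<open>z\<close>.\<close>
    obtain q1 q2 q3 where q: "\<forall>q\<in>#{#q1, q2, q3#}. is_path y z q \<or> is_path y x1 q"
      and sub: "edges_of {#q1, q2, q3#} + {#{z, x1}#} \<subseteq># R \<or> (is_path y z q1 \<and> edges_of {#q1, q2, q3#} \<subseteq># R)"
    proof (cases "{z, x1} \<in># R")
      case True
      obtain q1 q2 q3 where Q3: "Q = {#q1, q2, q3#}" using Q(1) by (rule size_3_msetE)
      have "{z, x1} \<notin># edges_of Q" using Q(3) by (auto dest: mset_subset_eqD)
      then have "edges_of Q + {#{z, x1}#} \<subseteq># R"
        using QR True by (auto simp: subseteq_mset_def not_in_iff Suc_le_eq)
      then show thesis using that[of q1 q2 q3] Q(2) unfolding Q3 by blast
    next
      case False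
      then have zy: "{z, y} \<in># R" using y(2) by blast
      have yz: "is_path y z [y, z]" using yV by (simp add: is_path_def)
      show thesis
      proof (cases "{z, y} \<in># edges_of Q")
        case True
        then obtain q where q: "q \<in># Q" "{z, y} \<in># path_edges q" using in_edges_of by metis
        obtain Q' where Q': "Q = add_mset q Q'" using q(1) by (meson multi_member_split)
        obtain q2 q3 where Q3: "Q' = {#q2, q3#}"
        proof -
          have "size Q' = 2" using Q(1) Q' by simp
          then show thesis using that size_2_msetE by blast
        qed
        have "path_edges [y, z] \<subseteq># path_edges q" using q(2) by (simp add: insert_commute)
        then have "edges_of {#[y, z], q2, q3#} \<subseteq># edges_of Q"
          unfolding Q' Q3 by (simp only: edges_of_simps) (rule subset_mset.add_right_mono)
        then have "edges_of {#[y, z], q2, q3#} \<subseteq># R" using QR subset_mset.order_trans by blast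
        then show thesis using that[of "[y, z]" q2 q3] Q(2) yz unfolding Q' Q3 by auto
      next
        case False
        obtain q1 q2 q3 where Q3: "Q = {#q1, q2, q3#}" using Q(1) by (rule size_3_msetE)
        have "edges_of Q + {#{z, y}#} \<subseteq># R"
          using QR zy False by (auto simp: subseteq_mset_def not_in_iff Suc_le_eq)
        moreover have "edges_of {#[y, z], q2, q3#} \<subseteq># edges_of Q + {#{z, y}#}"
          unfolding Q3 by (simp add: insert_commute)
        ultimately have "edges_of {#[y, z], q2, q3#} \<subseteq># R" using subset_mset.order_trans by blast
        then show thesis using that[of "[y, z]" q2 q3] Q(2) yz unfolding Q3 by auto
      qed
    qed
    have "has_D m V M x0 x1"
    proof (rule star_has_D[OF _ q z(1) yV(2,3) P2])
      let ?B = "path_edges [x0, z, x1] + path_edges [x0, z, x1] + edges_of {#q1, q2, q3#}"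
      from sub show "?B + {#{z, x1}#} + edges_of P2 \<subseteq># M \<or> is_path y z q1 \<and> ?B + edges_of P2 \<subseteq># M"
      proof
        assume "edges_of {#q1, q2, q3#} + {#{z, x1}#} \<subseteq># R"
        then have "path_edges [x0, z, x1] + path_edges [x0, z, x1] + edges_of P2 + (edges_of {#q1, q2, q3#} + {#{z, x1}#}) \<subseteq># M"
          unfolding MP by (rule subset_mset.add_left_mono)
        then show ?thesis by (simp only: ac_simps simp_thms)
      next
        assume a: "is_path y z q1 \<and> edges_of {#q1, q2, q3#} \<subseteq># R"
        then have "path_edges [x0, z, x1] + path_edges [x0, z, x1] + edges_of P2 + edges_of {#q1, q2, q3#} \<subseteq># M"
          unfolding MP by (intro subset_mset.add_left_mono) blast
        then show ?thesis using a by (simp only: ac_simps simp_thms)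
      qed
    qed
    then show False using no_D by blast
  next
    case False
    have direct: "p = [x0, x1]" if p: "p \<in># P1" for p
    proof (rule direct_path)
      have pP: "p \<in># P" using p P1 by simp
      show "is_path x0 x1 p" using S(1)[OF pP] .
      show "set p \<subseteq> {x0, x1}"
      proof
        fix v assume v: "v \<in> set p"
        show "v \<in> {x0, x1}"
        proof (rule ccontr)
          assume nv: "v \<notin> {x0, x1}"
          have "v \<noteq> z" using False p v by blast
          then have "p = p1" using inp1[OF pP v] nv by blast
          then show False using False p zp1 by blast
        qed
      qed
    qed
    have "Suc (size P1) = m" using sP P1 by simp
    then have "size P1 > 0" using m_ge_2 by linarith
    then obtain p where p: "p \<in># P1" by (metis nonempty_has_size multiset_nonemptyE)
    have "{x0, x1} \<in># edges_of P"
      using p P1 direct[OF p] in_edges_of[of "{x0, x1}" P] by fastforce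
    then have e: "{x0, x1} \<in># M" using S(3) by simp
    have m2: "m = 2" using root_edge e m_ge_2 by fastforce
    show False
    proof (rule nbr2[OF m2 e])
      fix v assume v: "{x0, v} \<in># M"
      have v0: "v \<noteq> x0" using simple_edges_pair[OF simple v] by auto
      have "{x0, v} \<in># edges_of P" using v sat(1)[of "{x0, v}"] S(3) by auto
      then obtain q where q: "q \<in># P" "{x0, v} \<in># path_edges q" using in_edges_of by metis
      show "v = x1 \<or> v = z"
      proof (cases "q = p1")
        case True
        have "x0 \<notin> set (z # t)" using S(1)[OF p1(1)] by (simp add: p1t is_path_def)
        then have "{x0, v} \<notin># path_edges (z # t)" using path_edges_in[of "{x0, v}" "z # t"] by auto
        then have "{x0, v} = {x0, z}" using q(2) unfolding True p1t by simp
        then show ?thesis using v0 by (auto simp: doubleton_eq_iff)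
      next
        case False
        then have "q \<in># P1" using q(1) P1 by simp
        then have "{x0, v} = {x0, x1}" using direct[of q] q(2) by simp
        then show ?thesis using v0 by (auto simp: doubleton_eq_iff)
      qed
    qed
  qed
qed

text \<open>Only \<open>m = 2\<close> with a root edge is left after
  \<open>tight_root_contradiction\<close>. Then \<open>x1\<close> either has a nonroot neighbour
  besides \<open>z\<close>, where splitting works, or hangs on \<open>z\<close> as \<open>x0\<close>
  does. If \<open>x0\<close> has no nonroot neighbour at all, splitting works for any nonroot
  neighbour of \<open>x1\<close>.\<close>

lemma root_degree_contradiction:
  assumes d: "cut M {x0} = m"
  shows False
proof (cases "cut M {x1} = m")
  case True
  then show False using both_roots_tight_contradiction d by blast
next
  case False
  have "cut M {x1} \<ge> m"
    using admissible.sep[OF sym, of "{x1}"] roots by auto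
  then have d1: "cut M {x1} \<ge> Suc m" using False by simp
  have int3: "cut M X \<ge> 3" if "m = 2" "X \<subseteq> V" "x0 \<in> X" "x1 \<notin> X" "card X \<ge> 2" "card (V - X) \<ge> 2" for X
    using internal[OF that(2-6)] that(1) by simp
  define S where "S = V - {x0, x1}"
  have cS: "card S \<ge> 2" using card_V roots by (simp add: S_def card_Diff_subset)
  show False
  proof (cases "\<exists>z \<in> S. {x0, z} \<in># M")
    case True
    then obtain z where z: "z \<in> V - {x0, x1}" "{x0, z} \<in># M" by (auto simp: S_def)
    have zne: "x0 \<noteq> z" "x1 \<noteq> z" using z by auto
    show False
    proof (rule tight_root_contradiction[OF d d1 z])
      assume m2: "m = 2" and e: "{x0, x1} \<in># M" and nbr: "\<And>v. {x0, v} \<in># M \<Longrightarrow> v = x1 \<or> v = z"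
      have d2: "cut M {x0} = 2" using d m2 by simp
      show False
      proof (cases "\<exists>w \<in> S - {z}. {x1, w} \<in># M")
        case True
        then obtain w where w: "w \<in> V - {x0, x1}" "w \<noteq> z" "{x1, w} \<in># M" by (auto simp: S_def)
        show False by (rule split_root_edge_contradiction[OF m2 d2 e nbr z(1) w int3[OF m2] IH])
      next
        case False
        have nbr1: "v = x0 \<or> v = z" if "{x1, v} \<in># M" for v
          using False that simple_edges_pair[OF simple that] by (auto simp: S_def)
        have "count M {x0, z} = 1"
        proof -
          obtain C where C: "M = add_mset {x0, x1} C" using e by (meson multi_member_split)
          have "cut M {x0} = 1 + cut C {x0}" unfolding C using card_pair_Int[OF roots(3), of "{x0}"] roots(3) by simp
          moreover have "count C {x0, z} \<le> cut C {x0}" by (rule cut_count_le[OF zne(1)])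
          moreover have "count M {x0, z} = count C {x0, z}"
            unfolding C using zne roots(3) by (simp add: doubleton_eq_iff)
          moreover have "count M {x0, z} > 0" using z(2) by simp
          ultimately show ?thesis using d2 by linarith
        qed
        then show False using pendant_root_contradiction[OF m2 e nbr nbr1 z(1)] by blast
      qed
    qed
  next
    case False
    have nbr: "v = x1" if "{x0, v} \<in># M" for v
      using False that simple_edges_pair[OF simple that] by (auto simp: S_def)
    have "cut M {x0} > 0" using d m_ge_2 by simp
    then obtain e where e: "e \<in># M" "card (e \<inter> {x0}) = 1" using cut_pos_iff by metis
    obtain a b where ab: "e = {a, b}" "a \<noteq> b" by (rule simple_edgesD[OF simple e(1)])
    then have "a = x0 \<or> b = x0" using e(2) card_pair_Int[OF ab(2), of "{x0}"] by auto
    then obtain v where "{x0, v} \<in># M" using e(1) ab(1) by (metis insert_commute)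
    then have e01: "{x0, x1} \<in># M" using nbr by metis
    then have m2: "m = 2" using root_edge m_ge_2 by fastforce
    have "S \<noteq> {}" using cS by auto
    moreover have "S \<subseteq> V - {x0, x1}" by (simp add: S_def)
    ultimately have "cut M S \<ge> 3" by (intro nonsep)
    then have "cut M S > 0" by simp
    then obtain f where f: "f \<in># M" "card (f \<inter> S) = 1" using cut_pos_iff by metis
    obtain a b where ab: "f = {a, b}" "a \<noteq> b" "a \<in> V" "b \<in> V" by (rule simple_edgesD[OF simple f(1)])
    then have "(a \<in> S) \<noteq> (b \<in> S)" using f(2) card_pair_Int[OF ab(2), of S] by simp
    then obtain s r where sr: "{r, s} \<in># M" "s \<in> S" "r \<in> {x0, x1}"
      using f(1) ab by (metis DiffI S_def insert_commute)
    have "r \<noteq> x0" using nbr[of s] sr by (auto simp: S_def)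
    then have w: "{x1, s} \<in># M" using sr by auto
    have "S \<noteq> {s}" using cS by auto
    then obtain z where z: "z \<in> S" "z \<noteq> s" using sr(2) by blast
    show False
      by (rule split_root_edge_contradiction[OF m2 _ e01 _ _ _ _ w int3[OF m2] IH, of z])
        (use d m2 nbr z sr(2) in \<open>auto simp: S_def\<close>)
  qed
qed

end

section \<open>More than m disjoint paths\<close>

text \<open>The edges of one component of \<open>R\<close>. If the roots are not linked in
  \<open>R\<close>, the parts belonging to \<open>x0\<close> and to \<open>x1\<close> can be used
  side by side.\<close>

definition class_edges :: "'v set multiset \<Rightarrow> 'v \<Rightarrow> 'v set multiset" where
  "class_edges R x = {#e \<in># R. e \<subseteq> {z. linked R x z}#}"

lemma class_edges_linked: "linked R x v \<Longrightarrow> linked (class_edges R x) x v"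
proof -
  assume "linked R x v"
  then have "linked R x v \<and> linked (class_edges R x) x v"
    unfolding linked_def[of R]
  proof (induction rule: rtranclp_induct)
    case (step u w)
    have xu: "linked R x u" using step(1) by (simp add: linked_def)
    have xw: "linked R x w" using linked_trans[OF xu linked_edge[OF step(2)]] .
    have "{u, w} \<in># class_edges R x" using step(2) xu xw by (simp add: class_edges_def)
    then have "linked (class_edges R x) x w"
      using linked_trans[OF conjunct2[OF step(3)] linked_edge] by blast
    then show ?case using xw by (simp add: linked_def)
  qed simp
  then show ?thesis by blast
qed

lemma class_edges_disjoint:
  assumes "simple_edges V R" "\<not> linked R x y"
  shows "class_edges R x + class_edges R y \<subseteq># R"
proof (rule mset_subset_eqI)
  fix e
  show "count (class_edges R x + class_edges R y) e \<le> count R e"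
  proof (cases "e \<in># R")
    case True
    then obtain a b where "e = {a, b}" by (rule simple_edgesD[OF assms(1)])
    then have "\<not> (e \<subseteq> {z. linked R x z} \<and> e \<subseteq> {z. linked R y z})"
      using assms(2) linked_trans[of R x a y] linked_sym[of R y a] by auto
    then show ?thesis by (auto simp: class_edges_def)
  next
    case False
    then have "count R e = 0" by (simp only: not_in_iff)
    then show ?thesis by (simp add: class_edges_def)
  qed
qed

text \<open>No edge of \<open>R\<close> leaves the class, so edges leaving the intersection leave
  \<open>X\<close> as well.\<close>

lemma cut_class_le:
  assumes "simple_edges V R"
  shows "cut R (X \<inter> {z. linked R x z}) \<le> cut (class_edges R x) X"
proof -
  let ?U = "{z. linked R x z}"
  have "e \<subseteq> ?U \<and> card (e \<inter> X) = 1" if e: "e \<in># R" "card (e \<inter> (X \<inter> ?U)) = 1" for e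
  proof -
    obtain a b where ab: "e = {a, b}" "a \<noteq> b" by (rule simple_edgesD[OF assms e(1)])
    have l: "linked R a b" "linked R b a" using e(1) ab linked_edge linked_sym by metis+
    have one: "(a \<in> X \<inter> ?U) \<noteq> (b \<in> X \<inter> ?U)" using e(2) card_pair_Int[OF ab(2), of "X \<inter> ?U"] ab(1) by simp
    then have "linked R x a \<or> linked R x b" by auto
    then have U: "linked R x a" "linked R x b" using linked_trans[OF _ l(1)] linked_trans[OF _ l(2)] by blast+
    then have "(a \<in> X) \<noteq> (b \<in> X)" using one by simp
    then show ?thesis using U ab(1) card_pair_Int[OF ab(2), of X] by simp
  qed
  then have "{#e \<in># R. card (e \<inter> (X \<inter> ?U)) = 1#} = {#e \<in># {#e \<in># class_edges R x. card (e \<inter> X) = 1#}. card (e \<inter> (X \<inter> ?U)) = 1#}"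
    unfolding class_edges_def filter_filter_mset by (intro filter_mset_cong) auto
  then have "{#e \<in># R. card (e \<inter> (X \<inter> ?U)) = 1#} \<subseteq># {#e \<in># class_edges R x. card (e \<inter> X) = 1#}" by simp
  then show ?thesis unfolding cut_def by (rule size_mset_mono)
qed

lemma third_path:
  assumes "{#p, q#} \<subseteq># P" "size P \<ge> 3"
  obtains t P' where "P = add_mset p (add_mset q (add_mset t P'))"
proof -
  obtain K where K: "P = {#p, q#} + K" using assms(1) by (meson subset_mset.le_iff_add)
  then have "size K > 0" using assms(2) by simp
  then obtain t where "t \<in># K" by (metis nonempty_has_size multiset_nonemptyE)
  then obtain P' where "K = add_mset t P'" by (meson multi_member_split)
  then show thesis using that[of t P'] K by simp
qed

text \<open>Behind the longest common prefix the next entries differ, and each occurs later in the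
  other list.\<close>

lemma inverted_pair:
  assumes "distinct p" "distinct q" "set p = set q" "p \<noteq> q"
  obtains u v l1 l2 l3 k1 k2 k3 where "p = l1 @ u # l2 @ v # l3" "q = k1 @ v # k2 @ u # k3"
proof -
  have "\<exists>u v l1 l2 l3 k1 k2 k3. p = l1 @ u # l2 @ v # l3 \<and> q = k1 @ v # k2 @ u # k3"
    using assms
  proof (induction p arbitrary: q)
    case (Cons a p)
    then obtain b q' where q: "q = b # q'" by (cases q) auto
    show ?case
    proof (cases "a = b")
      case True
      then have "set p = set q'" "p \<noteq> q'" "distinct p" "distinct q'"
        using Cons.prems q by (auto simp: insert_ident)
      then obtain u v l1 l2 l3 k1 k2 k3 where "p = l1 @ u # l2 @ v # l3" "q' = k1 @ v # k2 @ u # k3"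
        using Cons.IH[of q'] by blast
      then have "a # p = (a # l1) @ u # l2 @ v # l3" "q = (a # k1) @ v # k2 @ u # k3"
        using q True by simp_all
      then show ?thesis by blast
    next
      case False
      then have "b \<in> set p" "a \<in> set q'" using Cons.prems(3) q by auto
      then obtain l2 l3 k2 k3 where "p = l2 @ b # l3" "q' = k2 @ a # k3" using split_list by metis
      then have "a # p = [] @ a # l2 @ b # l3" "q = [] @ b # k2 @ a # k3" using q by simp_all
      then show ?thesis by blast
    qed
  qed simp
  then show thesis using that by blast
qed

lemma count_root_paths_le: "count P [x, y] \<le> count (edges_of P) {x, y}"
proof (induction P)
  case (add p P)
  show ?case using add by (cases "p = [x, y]") simp_all
qed simp

text \<open>The case left after roots of degree \<open>m\<close> and double root edges are
  excluded.\<close>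

locale critical = reduced +
  assumes sep1: "\<And>X. X \<subseteq> V \<Longrightarrow> x0 \<in> X \<Longrightarrow> x1 \<notin> X \<Longrightarrow> cut M X \<ge> Suc m"
    and one_root_edge: "count M {x0, x1} \<le> 1"
begin

text \<open>One path more than in \<open>system\<close>: three paths can be spent on D while
  \<open>m - 2\<close> stay whole.\<close>

definition wide_system :: "'a list multiset \<Rightarrow> 'a set multiset \<Rightarrow> bool" where
  "wide_system P R \<longleftrightarrow> maximal_system P R \<and> Suc m \<le> size P \<and> \<not> linked R x0 x1"

lemma wide_systemD:
  assumes "wide_system P R"
  shows "maximal_system P R" "system P R" "Suc m \<le> size P" "3 \<le> size P" "\<not> linked R x0 x1" "\<not> linked R x1 x0"
proof -
  show *: "maximal_system P R" "Suc m \<le> size P" "\<not> linked R x0 x1" using assms by (auto simp: wide_system_def)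
  show "system P R" using * by (simp add: maximal_system_def)
  show "3 \<le> size P" using * m_ge_2 by simp
  show "\<not> linked R x1 x0" using * linked_sym[of R x1 x0] by blast
qed

text \<open>With as many paths as the smallest separating cut has edges, that cut is used up by the
  paths, so the roots are not linked in \<open>R\<close>.\<close>

lemma wide_system_exists: obtains P R where "wide_system P R"
proof -
  define C where "C = {cut M X | X. X \<subseteq> V \<and> x0 \<in> X \<and> x1 \<notin> X}"
  have "C \<subseteq> (\<lambda>X. cut M X) ` Pow V" by (auto simp: C_def)
  then have finC: "finite C" using finite_V by (meson finite_Pow_iff finite_surj)
  have "cut M {x0} \<in> C" using roots by (auto simp: C_def)
  then have "Min C \<in> C" using finC by (intro Min_in) auto
  then obtain X where X: "X \<subseteq> V" "x0 \<in> X" "x1 \<notin> X" "Min C = cut M X" by (auto simp: C_def)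
  have low: "Min C \<le> cut M Y" if "Y \<subseteq> V" "x0 \<in> Y" "x1 \<notin> Y" for Y
    using finC that by (intro Min_le) (auto simp: C_def)
  obtain P where P: "size P = Min C" "\<forall>p\<in>#P. is_path x0 x1 p" "edges_of P \<subseteq># M"
    using menger[OF simple roots low] .
  have k: "Suc m \<le> Min C" using sep1[OF X(1-3)] X(4) by simp
  have "system P (M - edges_of P)" unfolding system_def using P k by simp
  then obtain P' R' where P': "maximal_system P' R'" "size P' = size P" by (rule maximal_system_exists)
  have S: "system P' R'" using P'(1) by (simp add: maximal_system_def)
  have "cut (edges_of P') X \<ge> size P'" using systemD(1)[OF S] X by (intro cut_paths_ge[of _ x0 x1]) auto
  then have "cut R' X = 0" using X(4) P(1) P'(2) unfolding systemD(3)[OF S] by simp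
  then have "\<not> linked R' x0 x1" using linked_cut[of R' x0 x1 X] X by auto
  then show thesis using that[of P' R'] P' P(1) k by (simp add: wide_system_def)
qed

text \<open>No path touches the nonroots of the class, so their cuts, of size at least 3, consist of
  edges of \<open>R\<close>; Menger's theorem inside the class then gives three paths to the
  root.\<close>

lemma class_fan:
  assumes W: "wide_system P R" and x: "x = x0 \<or> x = x1"
    and untouched: "\<And>v p. linked R x v \<Longrightarrow> v \<in> V - {x0, x1} \<Longrightarrow> p \<in># P \<Longrightarrow> v \<notin> set p"
    and y: "y \<in> V - {x0, x1}" "linked R x y"
  obtains q1 q2 q3 where "linked (path_edges q1) y x" "linked (path_edges q2) y x" "linked (path_edges q3) y x"
    "edges_of {#q1, q2, q3#} \<subseteq># class_edges R x"
proof -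
  note S = systemD[OF wide_systemD(2)[OF W]]
  let ?U = "{z. linked R x z}"
  let ?N = "class_edges R x"
  have sN: "simple_edges V ?N" using S(4) by (rule simple_edges_mono) (simp add: class_edges_def)
  have UV: "?U - {x} \<subseteq> V - {x0, x1}"
    using linked_in[OF _ S(4)] roots x wide_systemD(5,6)[OF W] by auto
  have cuts: "3 \<le> cut ?N X" if X: "X \<subseteq> V" "y \<in> X" "x \<notin> X" for X
  proof -
    have Y: "X \<inter> ?U \<subseteq> V - {x0, x1}" using UV X by auto
    have "y \<in> X \<inter> ?U" using X(2) y(2) by simp
    then have "cut M (X \<inter> ?U) \<ge> 3" using nonsep[OF Y] by blast
    moreover have "\<forall>p\<in>#P. set p \<inter> (X \<inter> ?U) = {}" using untouched Y by blast
    then have "cut (edges_of P) (X \<inter> ?U) = 0" by (rule cut_edges_of_untouched)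
    moreover have "cut M (X \<inter> ?U) = cut (edges_of P) (X \<inter> ?U) + cut R (X \<inter> ?U)" unfolding S(3) by simp
    ultimately show ?thesis using cut_class_le[OF S(4), of X x] by linarith
  qed
  have yx: "y \<in> V" "x \<in> V" "y \<noteq> x" using y x roots by auto
  obtain Q where Q: "size Q = 3" "\<forall>p\<in>#Q. is_path y x p" "edges_of Q \<subseteq># ?N"
    using menger[OF sN yx cuts] .
  obtain q1 q2 q3 where Q3: "Q = {#q1, q2, q3#}" using Q(1) by (rule size_3_msetE)
  then show thesis using that[of q1 q2 q3] Q(2,3) is_path_linked[of y x q1] is_path_linked[of y x q2]
      is_path_linked[of y x q3] by auto
qed

lemma rooted_of_edge:
  assumes W: "wide_system P R" and v: "v \<in> V - {x0, x1}" "{v, v'} \<in># R"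
  shows "linked R x0 v \<or> linked R x1 v"
  using maximal_system_rooted[OF wide_systemD(1)[OF W] v(2)] linked_sym[of R v x0] linked_sym[of R v x1]
  by (auto simp: rooted_def)

text \<open>Two of three paths from \<open>c\<close> back to \<open>x0\<close> form a closed detour
  that any path of the system can make at its start; the third leads from \<open>c\<close> to
  \<open>x0\<close> and on to another nonroot \<open>v\<close> of the system, along a second path
  through \<open>v\<close> or through \<open>x1\<close> and its class. Such a \<open>v\<close>
  exists, as the paths cannot all be root edges.\<close>

lemma isolated_class_contradiction:
  assumes W: "wide_system P R" and c: "{x0, c} \<in># R"
    and untouched: "\<And>v p. linked R x0 v \<Longrightarrow> v \<in> V - {x0, x1} \<Longrightarrow> p \<in># P \<Longrightarrow> v \<notin> set p"
  shows False
proof -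
  note S = systemD[OF wide_systemD(2)[OF W]] and N3 = wide_systemD(4)[OF W] and Nm = wide_systemD(3)[OF W]
  have lc: "linked R x0 c" using c by (rule linked_edge)
  have cV: "c \<in> V - {x0, x1}"
    using simple_edges_pair[OF S(4) c] lc wide_systemD(5)[OF W] by auto
  obtain q1 q2 q3 where q: "linked (path_edges q1) c x0" "linked (path_edges q2) c x0" "linked (path_edges q3) c x0"
    "edges_of {#q1, q2, q3#} \<subseteq># class_edges R x0"
    by (rule class_fan[OF W disjI1[OF refl] untouched cV lc])
  have "class_edges R x0 \<subseteq># R" by (simp add: class_edges_def)
  then have qR: "edges_of {#q1, q2, q3#} \<subseteq># R" using q(4) by (rule subset_mset.order_trans[rotated])
  \<comment> \<open>From \<open>x0\<close> along \<open>q1\<close> to \<open>c\<close>, back along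
    \<open>q2\<close>, and then along \<open>p\<close>.\<close>
  have ride: "passes (path_edges p + path_edges q1 + path_edges q2) x0 x1 c" if "is_path x0 x1 p" for p
  proof (rule passesI[OF linked_sym[OF q(1)] linked_add_trans[OF q(2) is_path_linked[OF that]]])
    show "path_edges q1 + (path_edges q2 + path_edges p) \<subseteq># path_edges p + path_edges q1 + path_edges q2"
      by (simp add: ac_simps)
  qed
  show False
  proof (cases "\<exists>p\<in>#P. \<not> set p \<subseteq> {x0, x1}")
    case False
    have "p = [x0, x1]" if "p \<in># P" for p using direct_path[OF S(1)[OF that]] False that by blast
    then have "P = replicate_mset (size P) [x0, x1]" by (intro multiset_eqI) (metis count_replicate_mset not_in_iff replicate_mset_eq_iff set_mset_subset_singletonD singletonI subsetI)
    then have "count P [x0, x1] = size P" by (metis count_replicate_mset)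
    moreover have "count P [x0, x1] \<le> count M {x0, x1}"
      using count_root_paths_le[of P x0 x1] unfolding S(3) by simp
    ultimately show False using one_root_edge N3 by linarith
  next
    case True
    then obtain s v where sv: "s \<in># P" "v \<in> set s" "v \<in> V - {x0, x1}" using S(6) by blast
    have vc: "c \<noteq> v" using untouched[OF lc cV sv(1)] sv(2) by blast
    obtain P0 where P0: "P = add_mset s P0" using sv(1) by (meson multi_member_split)
    show False
    proof (cases "\<exists>r\<in>#P0. v \<in> set r")
      case True
      then obtain r where r: "r \<in># P0" "v \<in> set r" by blast
      have "{#s, r#} \<subseteq># P" using P0 r(1) by simp
      then obtain t P' where P': "P = add_mset s (add_mset r (add_mset t P'))" using N3 by (rule third_path)
      have ip: "is_path x0 x1 s" "is_path x0 x1 r" "is_path x0 x1 t" using S(1) P' by auto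
      have rv: "linked (path_edges r) x0 v" using path_linked_mem[of x0 r v] is_path_ends[OF ip(2)] r(2) by blast
      show False
      proof (rule no_D_passes[OF ride[OF ip(3)] passes_path[OF ip(1) sv(2)] linked_add_trans[OF q(3) rv] cV sv(3) vc])
        show "m \<le> size P' + 2" using Nm P' by simp
        show "is_path x0 x1 p" if "p \<in># P'" for p using S(1) P' that by simp
        have "path_edges t + path_edges q1 + path_edges q2 + path_edges s + (path_edges q3 + path_edges r) + edges_of P'
            = edges_of P + edges_of {#q1, q2, q3#}" unfolding P' by (simp add: ac_simps)
        also have "\<dots> \<subseteq># M" unfolding S(3) using qR by (rule subset_mset.add_left_mono)
        finally show "path_edges t + path_edges q1 + path_edges q2 + path_edges s + (path_edges q3 + path_edges r) + edges_of P' \<subseteq># M" .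
      qed
    next
      case False
      obtain v' where v': "{v, v'} \<in># R"
        by (rule once_touched[of s P0 R v]) (use wide_systemD(2)[OF W] P0 sv(3) False in auto)
      have "\<not> linked R x0 v" using untouched[OF _ sv(3,1)] sv(2) by blast
      then have "linked R x1 v" using rooted_of_edge[OF W sv(3) v'] by blast
      then have l1: "linked (class_edges R x1) x1 v" by (rule class_edges_linked)
      have "\<exists>r. {#s, r#} \<subseteq># P"
      proof -
        have "size P0 > 0" using N3 P0 by simp
        then obtain r where "r \<in># P0" by (metis nonempty_has_size multiset_nonemptyE)
        then show ?thesis using P0 by auto
      qed
      then obtain r where "{#s, r#} \<subseteq># P" by blast
      then obtain t P' where P': "P = add_mset s (add_mset r (add_mset t P'))" using N3 by (rule third_path)
      have ip: "is_path x0 x1 s" "is_path x0 x1 r" "is_path x0 x1 t" using S(1) P' by auto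
      have link: "linked (path_edges q3 + path_edges r + class_edges R x1) c v"
        by (rule linked_add_trans[OF linked_add_trans[OF q(3) is_path_linked[OF ip(2)]] l1])
      show False
      proof (rule no_D_passes[OF ride[OF ip(3)] passes_path[OF ip(1) sv(2)] link cV sv(3) vc])
        show "m \<le> size P' + 2" using Nm P' by simp
        show "is_path x0 x1 p" if "p \<in># P'" for p using S(1) P' that by simp
        have "path_edges t + path_edges q1 + path_edges q2 + path_edges s + (path_edges q3 + path_edges r + class_edges R x1) + edges_of P'
            = edges_of P + (edges_of {#q1, q2, q3#} + class_edges R x1)" unfolding P' by (simp add: ac_simps)
        also have "\<dots> \<subseteq># edges_of P + (class_edges R x0 + class_edges R x1)"
          using q(4) by (intro subset_mset.add_left_mono subset_mset.add_right_mono)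
        also have "\<dots> \<subseteq># M" unfolding S(3)
          using class_edges_disjoint[OF S(4) wide_systemD(5)[OF W]] by (rule subset_mset.add_left_mono)
        finally show "path_edges t + path_edges q1 + path_edges q2 + path_edges s + (path_edges q3 + path_edges r + class_edges R x1) + edges_of P' \<subseteq># M" .
      qed
    qed
  qed
qed

text \<open>Here \<open>E\<close> holds the at most three paths that are cut up and
  \<open>P'\<close> those that stay whole.\<close>

lemma wide_no_D:
  assumes W: "wide_system P R" and P: "edges_of P = E + edges_of P'" "\<And>p. p \<in># P' \<Longrightarrow> p \<in># P" "size P \<le> size P' + 3"
    and F: "passes F1 x0 x1 u" "passes F2 x0 x1 v" "linked Q u v"
    and uv: "u \<in> V - {x0, x1}" "v \<in> V - {x0, x1}" "u \<noteq> v" and sub: "F1 + F2 + Q \<subseteq># E + R"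
  shows False
proof -
  note S = systemD[OF wide_systemD(2)[OF W]] and Nm = wide_systemD(3)[OF W]
  show False
  proof (rule no_D_passes[OF F uv])
    show "m \<le> size P' + 2" using Nm P(3) by simp
    show "\<And>p. p \<in># P' \<Longrightarrow> is_path x0 x1 p" using S(1) P(2) by blast
    have "F1 + F2 + Q + edges_of P' \<subseteq># E + R + edges_of P'" using sub by (rule subset_mset.add_right_mono)
    also have "\<dots> = M" unfolding S(3) P(1) by (simp add: ac_simps)
    finally show "F1 + F2 + Q + edges_of P' \<subseteq># M" .
  qed
qed

text \<open>If \<open>p\<close>, \<open>r\<close>, \<open>s\<close> are three members,
  \<open>p\<close> passes \<open>a\<close>, \<open>s\<close> passes \<open>v\<close>, and
  \<open>R\<close> and \<open>r\<close> link them through \<open>x0\<close>. Otherwise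
  \<open>v\<close> lies on \<open>p\<close> too, and the segment of \<open>p\<close> between
  \<open>a\<close> and \<open>v\<close> is the link. Then \<open>a\<close> is joined to the roots by
  the other part of \<open>p\<close> and by \<open>R\<close>, the latter prolonged by a third path
  if \<open>v\<close> comes after \<open>a\<close>.\<close>

lemma touched_class_single:
  assumes W: "wide_system P R" and a: "a \<in> V - {x0, x1}" "linked R x0 a" "p \<in># P" "a \<in> set p"
    and v: "v \<in> V - {x0, x1}" "v \<noteq> a" "{#r, s#} \<subseteq># P" "v \<in> set r" "v \<in> set s"
  shows False
proof -
  note S = systemD[OF wide_systemD(2)[OF W]] and N3 = wide_systemD(4)[OF W]
  have disj: "{#p, r, s#} \<subseteq># P \<or> (\<exists>s'. {#p, s'#} \<subseteq># P \<and> v \<in> set p \<and> v \<in> set s')"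
  proof -
    obtain K where K: "P = {#r, s#} + K" using v(3) by (meson subset_mset.le_iff_add)
    consider "p = r" | "p = s" | "p \<in># K" using a(3) K by auto
    then show ?thesis
    proof cases
      case 1
      then show ?thesis using v(3-5) by blast
    next
      case 2
      then have "{#p, r#} \<subseteq># P" using v(3) by (simp add: add_mset_commute)
      then show ?thesis using v(4,5) 2 by blast
    next
      case 3
      then obtain K' where "K = add_mset p K'" by (meson multi_member_split)
      then have "P = {#p, r, s#} + K'" using K by (simp add: add_mset_commute)
      then show ?thesis by simp
    qed
  qed
  then show False
  proof
    assume "{#p, r, s#} \<subseteq># P"
    then obtain P' where P': "P = {#p, r, s#} + P'" by (meson subset_mset.le_iff_add)
    have ip: "is_path x0 x1 p" "is_path x0 x1 r" "is_path x0 x1 s" using S(1) P' by auto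
    have l: "linked (path_edges r) x0 v" using path_linked_mem[of x0 r v] is_path_ends[OF ip(2)] v(4) by blast
    show False
    proof (rule wide_no_D[OF W _ _ _ passes_path[OF ip(1) a(4)] passes_path[OF ip(3) v(5)]
          linked_add_trans[OF linked_sym[OF a(2)] l] a(1) v(1) v(2)[symmetric]])
      show "edges_of P = (path_edges p + path_edges r + path_edges s) + edges_of P'" unfolding P' by (simp add: ac_simps)
      show "path_edges p + path_edges s + (R + path_edges r) \<subseteq># path_edges p + path_edges r + path_edges s + R"
        by (simp add: ac_simps)
    qed (use P' in auto)
  next
    assume "\<exists>s'. {#p, s'#} \<subseteq># P \<and> v \<in> set p \<and> v \<in> set s'"
    then obtain s' where s': "{#p, s'#} \<subseteq># P" "v \<in> set p" "v \<in> set s'" by blast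
    obtain t P' where P': "P = add_mset p (add_mset s' (add_mset t P'))" using s'(1) N3 by (rule third_path)
    have ip: "is_path x0 x1 p" "is_path x0 x1 s'" "is_path x0 x1 t" using S(1) P' by auto
    obtain l b where lb: "p = l @ a # b" using a(4) split_list by fastforce
    note la = link_of_in_path[OF ip(1) lb]
    have "v \<in> set b \<or> v \<in> set l" using s'(2) v(2) lb by auto
    then show False
    proof
      assume vb: "v \<in> set b"
      have pass: "passes (path_edges (l @ [a]) + R + path_edges t) x0 x1 a"
        by (rule passesI[OF la(1) linked_add_trans[OF linked_sym[OF a(2)] is_path_linked[OF ip(3)]]]) (simp add: ac_simps)
      have link: "linked (path_edges (a # b)) a v" using vb by (intro path_linked_mem) auto
      show False
      proof (rule wide_no_D[OF W _ _ _ pass passes_path[OF ip(2) s'(3)] link a(1) v(1) v(2)[symmetric]])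
        show "edges_of P = (path_edges p + path_edges s' + path_edges t) + edges_of P'" unfolding P' by (simp add: ac_simps)
        show "path_edges (l @ [a]) + R + path_edges t + path_edges s' + path_edges (a # b)
            \<subseteq># path_edges p + path_edges s' + path_edges t + R"
          unfolding la(2) by (simp add: ac_simps)
      qed (use P' in auto)
    next
      assume vl: "v \<in> set l"
      have pass: "passes (R + path_edges (a # b)) x0 x1 a" by (rule passesI[OF a(2) la(3)]) simp
      have link: "linked (path_edges (l @ [a])) a v" using vl by (intro path_linked_mem) auto
      show False
      proof (rule wide_no_D[OF W _ _ _ pass passes_path[OF ip(2) s'(3)] link a(1) v(1) v(2)[symmetric]])
        show "edges_of P = (path_edges p + path_edges s') + edges_of (add_mset t P')" unfolding P' by (simp add: ac_simps)
        show "R + path_edges (a # b) + path_edges s' + path_edges (l @ [a]) \<subseteq># path_edges p + path_edges s' + R"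
          unfolding la(2) by (simp add: ac_simps)
      qed (use P' in auto)
    qed
  qed
qed

text \<open>On different paths, \<open>a\<close> and \<open>b\<close> are linked through the class
  of \<open>x0\<close>, a third path, and the class of \<open>x1\<close>. On the same path the
  segment between them is the link; the connections lost by this are replaced by the two classes,
  prolonged by two further paths if \<open>a\<close> comes first.\<close>

lemma both_classes_touched:
  assumes W: "wide_system P R" and a: "a \<in> V - {x0, x1}" "linked R x0 a" "p \<in># P" "a \<in> set p"
    and b: "b \<in> V - {x0, x1}" "linked R x1 b" "q \<in># P" "b \<in> set q"
  shows False
proof -
  note S = systemD[OF wide_systemD(2)[OF W]] and N3 = wide_systemD(4)[OF W]
  have ab: "a \<noteq> b"
    using a(2) b(2) linked_trans[of R x0 a x1] linked_sym[of R x1 a] wide_systemD(5)[OF W] by auto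
  let ?C0 = "class_edges R x0" and ?C1 = "class_edges R x1"
  have c0: "linked ?C0 x0 a" and c1: "linked ?C1 x1 b" using a(2) b(2) by (auto intro: class_edges_linked)
  have CR: "?C0 + ?C1 \<subseteq># R" by (rule class_edges_disjoint[OF S(4) wide_systemD(5)[OF W]])
  have third: "\<exists>s t P'. P = add_mset p (add_mset s (add_mset t P'))" if "p \<in># P"
  proof -
    obtain P0 where P0: "P = add_mset p P0" using \<open>p \<in># P\<close> by (meson multi_member_split)
    then have "size P0 > 0" using N3 by simp
    then obtain s where "s \<in># P0" by (metis nonempty_has_size multiset_nonemptyE)
    then have "{#p, s#} \<subseteq># P" using P0 by simp
    from third_path[OF this N3] show ?thesis by blast
  qed
  show False
  proof (cases "q = p")
    case False
    have "{#p, q#} \<subseteq># P" using two_in_mset[OF a(3) b(3)] False by metis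
    then obtain t P' where P': "P = add_mset p (add_mset q (add_mset t P'))" using N3 by (rule third_path)
    have ip: "is_path x0 x1 p" "is_path x0 x1 q" "is_path x0 x1 t" using S(1) P' by auto
    have link: "linked (?C0 + path_edges t + ?C1) a b"
      by (rule linked_add_trans[OF linked_add_trans[OF linked_sym[OF c0] is_path_linked[OF ip(3)]] c1])
    show False
    proof (rule wide_no_D[OF W _ _ _ passes_path[OF ip(1) a(4)] passes_path[OF ip(2) b(4)] link a(1) b(1) ab])
      show "edges_of P = (path_edges p + path_edges q + path_edges t) + edges_of P'" unfolding P' by (simp add: ac_simps)
      have "path_edges p + path_edges q + (?C0 + path_edges t + ?C1)
          = path_edges p + path_edges q + path_edges t + (?C0 + ?C1)" by (simp add: ac_simps)
      also have "\<dots> \<subseteq># path_edges p + path_edges q + path_edges t + R" using CR by (rule subset_mset.add_left_mono)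
      finally show "path_edges p + path_edges q + (?C0 + path_edges t + ?C1) \<subseteq># path_edges p + path_edges q + path_edges t + R" .
    qed (use P' in auto)
  next
    case True
    obtain s t P' where P': "P = add_mset p (add_mset s (add_mset t P'))" using third[OF a(3)] by blast
    have ip: "is_path x0 x1 p" "is_path x0 x1 s" "is_path x0 x1 t" using S(1) P' by auto
    obtain l r where lr: "p = l @ a # r" using a(4) split_list by fastforce
    note la = link_of_in_path[OF ip(1) lr]
    have "b \<in> set r \<or> b \<in> set l" using b(4) True ab lr by auto
    then show False
    proof
      assume "b \<in> set r"
      then obtain r1 r2 where r: "r = r1 @ b # r2" using split_list by fastforce
      have pr: "path_edges (a # r) = path_edges (a # r1 @ [b]) + path_edges (b # r2)"
        using path_edges_append[of "a # r1" b r2] r by simp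
      have lb: "linked (path_edges (b # r2)) b x1" using path_linked[of "b # r2"] ip(1) lr r by (simp add: is_path_def)
      have pa: "passes (path_edges (l @ [a]) + (?C0 + path_edges s)) x0 x1 a"
        by (rule passesI[OF la(1) linked_add_trans[OF linked_sym[OF c0] is_path_linked[OF ip(2)]]]) simp
      have pb: "passes (path_edges t + ?C1 + path_edges (b # r2)) x0 x1 b"
        by (rule passesI[OF linked_add_trans[OF is_path_linked[OF ip(3)] c1] lb]) simp
      have link: "linked (path_edges (a # r1 @ [b])) a b" by (intro path_linked_mem) auto
      show False
      proof (rule wide_no_D[OF W _ _ _ pa pb link a(1) b(1) ab])
        show "edges_of P = (path_edges p + path_edges s + path_edges t) + edges_of P'" unfolding P' by (simp add: ac_simps)
        have "path_edges (l @ [a]) + (?C0 + path_edges s) + (path_edges t + ?C1 + path_edges (b # r2)) + path_edges (a # r1 @ [b])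
            = path_edges p + path_edges s + path_edges t + (?C0 + ?C1)" unfolding la(2) pr by (simp add: ac_simps)
        also have "\<dots> \<subseteq># path_edges p + path_edges s + path_edges t + R" using CR by (rule subset_mset.add_left_mono)
        finally show "path_edges (l @ [a]) + (?C0 + path_edges s) + (path_edges t + ?C1 + path_edges (b # r2)) + path_edges (a # r1 @ [b])
            \<subseteq># path_edges p + path_edges s + path_edges t + R" .
      qed (use P' in auto)
    next
      assume "b \<in> set l"
      then obtain l1 l2 where l: "l = l1 @ b # l2" using split_list by fastforce
      have p: "p = l1 @ b # (l2 @ a # r)" using lr l by simp
      note lb = link_of_in_path[OF ip(1) p]
      have pl: "path_edges (b # l2 @ a # r) = path_edges (b # l2 @ [a]) + path_edges (a # r)"
        using path_edges_append[of "b # l2" a r] by simp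
      have pa: "passes (?C0 + path_edges (a # r)) x0 x1 a" by (rule passesI[OF c0 la(3)]) simp
      have pb: "passes (path_edges (l1 @ [b]) + ?C1) x0 x1 b" by (rule passesI[OF lb(1) linked_sym[OF c1]]) simp
      have link: "linked (path_edges (b # l2 @ [a])) a b" by (intro path_linked_mem) auto
      show False
      proof (rule wide_no_D[OF W _ _ _ pa pb link a(1) b(1) ab])
        show "edges_of P = path_edges p + edges_of (add_mset s (add_mset t P'))" unfolding P' by (simp add: ac_simps)
        have "?C0 + path_edges (a # r) + (path_edges (l1 @ [b]) + ?C1) + path_edges (b # l2 @ [a])
            = path_edges p + (?C0 + ?C1)" unfolding lb(2) pl by (simp add: ac_simps)
        also have "\<dots> \<subseteq># path_edges p + R" using CR by (rule subset_mset.add_left_mono)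
        finally show "?C0 + path_edges (a # r) + (path_edges (l1 @ [b]) + ?C1) + path_edges (b # l2 @ [a]) \<subseteq># path_edges p + R" .
      qed (use P' in auto)
    qed
  qed
qed

text \<open>A nonroot other than \<open>a\<close> is on at most one path, so it has an edge in
  \<open>R\<close> and belongs to the class of a root. If this root is \<open>x1\<close>, no path
  touches that class, and the fan at \<open>x1\<close> provides a detour through \<open>v\<close>
  and a link that reaches \<open>a\<close> along a third path and the class of
  \<open>x0\<close>.\<close>

lemma touched_class_spanning:
  assumes W: "wide_system P R" and a: "a \<in> V - {x0, x1}" "linked R x0 a" "p \<in># P" "a \<in> set p"
    and v: "v \<in> V - {x0, x1}"
  shows "linked R x0 v"
proof (cases "v = a")
  case False
  note S = systemD[OF wide_systemD(2)[OF W]] and N3 = wide_systemD(4)[OF W]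
  have split: "\<exists>s P0. P = add_mset s P0 \<and> (\<forall>q\<in>#P0. w \<notin> set q)" if w: "w \<in> V - {x0, x1}" "w \<noteq> a" for w
  proof (cases "\<exists>s\<in>#P. w \<in> set s")
    case True
    then obtain s P0 where s: "P = add_mset s P0" "w \<in> set s" by (meson multi_member_split)
    have "w \<notin> set q" if "q \<in># P0" for q
      using touched_class_single[OF W a w, of s q] s that by auto
    then show ?thesis using s by blast
  next
    case False
    obtain P0 where "P = add_mset p P0" using a(3) by (meson multi_member_split)
    then show ?thesis using False by auto
  qed
  have in_class: "linked R x0 w \<or> linked R x1 w" if w: "w \<in> V - {x0, x1}" "w \<noteq> a" for w
  proof -
    obtain s P0 where s: "P = add_mset s P0" "\<forall>q\<in>#P0. w \<notin> set q" using split[OF w] by blast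
    obtain w' where "{w, w'} \<in># R" by (rule once_touched[of s P0 R w]) (use wide_systemD(2)[OF W] s w in auto)
    then show ?thesis by (rule rooted_of_edge[OF W w(1)])
  qed
  show ?thesis
  proof (rule ccontr)
    assume "\<not> linked R x0 v"
    then have lv: "linked R x1 v" using in_class[OF v False] by blast
    have untouched: "w \<notin> set q" if "linked R x1 w" "w \<in> V - {x0, x1}" "q \<in># P" for w q
      using both_classes_touched[OF W a that(2,1,3)] by blast
    obtain q1 q2 q3 where q: "linked (path_edges q1) v x1" "linked (path_edges q2) v x1" "linked (path_edges q3) v x1"
      "edges_of {#q1, q2, q3#} \<subseteq># class_edges R x1"
      by (rule class_fan[OF W disjI2[OF refl] untouched v lv])
    obtain P0 where P0: "P = add_mset p P0" using a(3) by (meson multi_member_split)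
    then have "size P0 > 0" using N3 by simp
    then obtain s where "s \<in># P0" by (metis nonempty_has_size multiset_nonemptyE)
    then have "{#p, s#} \<subseteq># P" using P0 by simp
    then obtain t P' where P': "P = add_mset p (add_mset s (add_mset t P'))" using N3 by (rule third_path)
    have ip: "is_path x0 x1 p" "is_path x0 x1 s" "is_path x0 x1 t" using S(1) P' by auto
    have pv: "passes (path_edges s + path_edges q1 + path_edges q2) x0 x1 v"
      by (rule passesI[OF linked_add_trans[OF is_path_linked[OF ip(2)] linked_sym[OF q(1)]] q(2)]) simp
    have link: "linked (class_edges R x0 + path_edges t + path_edges q3) a v"
      by (rule linked_add_trans[OF linked_add_trans[OF linked_sym[OF class_edges_linked[OF a(2)]] is_path_linked[OF ip(3)]]
            linked_sym[OF q(3)]])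
    show False
    proof (rule wide_no_D[OF W _ _ _ passes_path[OF ip(1) a(4)] pv link a(1) v False[symmetric]])
      show "edges_of P = (path_edges p + path_edges s + path_edges t) + edges_of P'" unfolding P' by (simp add: ac_simps)
      have "path_edges p + (path_edges s + path_edges q1 + path_edges q2) + (class_edges R x0 + path_edges t + path_edges q3)
          = path_edges p + path_edges s + path_edges t + (class_edges R x0 + edges_of {#q1, q2, q3#})" by (simp add: ac_simps)
      also have "\<dots> \<subseteq># path_edges p + path_edges s + path_edges t + (class_edges R x0 + class_edges R x1)"
        using q(4) by (intro subset_mset.add_left_mono)
      also have "\<dots> \<subseteq># path_edges p + path_edges s + path_edges t + R"
        using class_edges_disjoint[OF S(4) wide_systemD(5)[OF W]] by (rule subset_mset.add_left_mono)
      finally show "path_edges p + (path_edges s + path_edges q1 + path_edges q2) + (class_edges R x0 + path_edges t + path_edges q3)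
          \<subseteq># path_edges p + path_edges s + path_edges t + R" .
    qed (use P' in auto)
  qed
qed (use a in simp)

text \<open>Now \<open>R\<close> links all nonroots, so by \<open>no_D_linked\<close> two paths
  never touch different nonroots. If only \<open>p\<close> contains \<open>a\<close>, the others are
  at least two root edges. If \<open>q\<close> contains it as well, \<open>a\<close> is the only
  nonroot on any path, and three paths in \<open>R\<close> from another nonroot \<open>y\<close> to
  \<open>{x0, a}\<close> give D.\<close>

lemma touched_class_contradiction:
  assumes W: "wide_system P R" and a: "a \<in> V - {x0, x1}" "linked R x0 a" "p \<in># P" "a \<in> set p"
  shows False
proof -
  note S = systemD[OF wide_systemD(2)[OF W]] and N3 = wide_systemD(4)[OF W]
  note span = touched_class_spanning[OF W a]
  have link: "linked R v w" if "v \<in> V - {x0, x1}" "w \<in> V - {x0, x1}" for v w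
    by (rule linked_class[OF span[OF that(1)] span[OF that(2)]])
  have clash: False if "{#s, t#} \<subseteq># P" "v \<in> set s" "w \<in> set t" "v \<noteq> w" "v \<in> V - {x0, x1}" "w \<in> V - {x0, x1}" for s t v w
    by (rule no_D_linked[OF wide_systemD(2)[OF W] that(1-3) link[OF that(5,6)] that(5,6,4)])
  obtain P0 where P0: "P = add_mset p P0" using a(3) by (meson multi_member_split)
  show False
  proof (cases "\<exists>q\<in>#P0. a \<in> set q")
    case False
    have dir: "q = [x0, x1]" if q: "q \<in># P0" for q
    proof (rule direct_path)
      show "is_path x0 x1 q" using S(1) P0 q by simp
      have pq: "{#p, q#} \<subseteq># P" using P0 q by simp
      show "set q \<subseteq> {x0, x1}"
      proof
        fix v assume v: "v \<in> set q"
        have "v \<in> V" using S(6)[of q] P0 q v by auto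
        moreover have "a \<noteq> v" using False q v by blast
        ultimately show "v \<in> {x0, x1}" using clash[OF pq a(4) v _ a(1)] by blast
      qed
    qed
    have "size P0 \<ge> 2" using N3 P0 by simp
    moreover have "\<forall>q\<in>#P0. q = [x0, x1]" using dir by blast
    then have "count P0 [x0, x1] = size P0" by (induction P0) auto
    moreover have "count P [x0, x1] \<le> count M {x0, x1}"
      using count_root_paths_le[of P x0 x1] unfolding S(3) by simp
    ultimately show False using one_root_edge P0 by (simp split: if_splits)
  next
    case True
    then obtain q where q: "q \<in># P0" "a \<in> set q" by blast
    have pq: "{#p, q#} \<subseteq># P" using P0 q by simp
    have only: "v \<notin> set s" if s: "s \<in># P" and v: "v \<in> V - {x0, x1}" "v \<noteq> a" for s v
    proof
      assume vs: "v \<in> set s"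
      have "{#p, s#} \<subseteq># P \<or> {#q, s#} \<subseteq># P"
      proof (cases "s = p")
        case True
        then show ?thesis using pq by (simp add: add_mset_commute)
      next
        case False
        then show ?thesis using two_in_mset[OF a(3) s] by blast
      qed
      then show False using clash[OF _ a(4) vs v(2)[symmetric] a(1) v(1)] clash[OF _ q(2) vs v(2)[symmetric] a(1) v(1)] by blast
    qed
    obtain t P' where P': "P = add_mset p (add_mset q (add_mset t P'))" using pq N3 by (rule third_path)
    have ip: "is_path x0 x1 p" "is_path x0 x1 q" "is_path x0 x1 t" using S(1) P' by auto
    have "\<not> V \<subseteq> {x0, x1, a}"
    proof
      assume "V \<subseteq> {x0, x1, a}"
      then have "card V \<le> card {x0, x1, a}" by (intro card_mono) auto
      moreover have "card {x0, x1, a} \<le> 3" by (simp add: card_insert_if)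
      ultimately show False using card_V by simp
    qed
    then obtain y where y: "y \<in> V - {x0, x1}" "y \<noteq> a" by blast
    have cuts: "3 \<le> cut R X" if X: "X \<subseteq> V" "y \<in> X" "x0 \<notin> X" "a \<notin> X" for X
    proof -
      let ?Y = "X \<inter> {z. linked R x0 z}"
      have YV: "?Y \<subseteq> V - {x0, x1}" using X wide_systemD(5)[OF W] by auto
      have "y \<in> ?Y" using X(2) span[OF y(1)] by simp
      then have "cut M ?Y \<ge> 3" using nonsep[OF YV] by blast
      moreover have "\<forall>s\<in>#P. set s \<inter> ?Y = {}" using only YV X(4) by blast
      then have "cut (edges_of P) ?Y = 0" by (rule cut_edges_of_untouched)
      moreover have "cut M ?Y = cut (edges_of P) ?Y + cut R ?Y" unfolding S(3) by simp
      moreover have "cut R ?Y \<le> cut R X + cut R {z. linked R x0 z}"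
        using cut_submodular[OF S(4), of X "{z. linked R x0 z}"] by simp
      ultimately show ?thesis using cut_linked_class[OF S(4), of x0] by linarith
    qed
    have yx: "y \<in> V" "a \<in> V" "y \<noteq> x0" "x0 \<noteq> a" using y a by auto
    obtain Q where Q: "size Q = 3" "\<forall>s\<in>#Q. is_path y x0 s \<or> is_path y a s" "edges_of Q \<subseteq># {#e \<in># R. e \<noteq> {x0, a}#}"
      using menger_two_targets[OF S(4) yx(1) roots(1) yx(2,3) y(2) yx(4) cuts] .
    have QR: "edges_of Q \<subseteq># R" using Q(3) by (rule subset_mset.order_trans) simp
    have lq: "linked (path_edges s) y x0 \<or> linked (path_edges s) y a" if "s \<in># Q" for s
      using Q(2) that is_path_linked[of y x0 s] is_path_linked[of y a s] by blast
    obtain c1 c2 c3 where C: "Q = {#c1, c2, c3#}" using Q(1) by (rule size_3_msetE)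
    \<comment> \<open>Two of the three paths have the same target; they are numbered so that the
      remaining one may have either.\<close>
    have "\<exists>q1 q2 q3. Q = {#q1, q2, q3#} \<and> (linked (path_edges q1) y x0 \<and> linked (path_edges q2) y x0
        \<or> linked (path_edges q2) y a \<and> linked (path_edges q3) y a)"
    proof -
      have "Q = {#c1, c2, c3#}" "Q = {#c1, c3, c2#}" "Q = {#c2, c3, c1#}" "Q = {#c3, c1, c2#}" "Q = {#c2, c1, c3#}"
        using C by (simp_all add: add_mset_commute)
      moreover have "linked (path_edges c1) y x0 \<or> linked (path_edges c1) y a"
        "linked (path_edges c2) y x0 \<or> linked (path_edges c2) y a"
        "linked (path_edges c3) y x0 \<or> linked (path_edges c3) y a"
        using lq C by simp_all
      ultimately show ?thesis by metis
    qed
    then obtain q1 q2 q3 where Q3: "Q = {#q1, q2, q3#}" and two: "linked (path_edges q1) y x0 \<and> linked (path_edges q2) y x0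
        \<or> linked (path_edges q2) y a \<and> linked (path_edges q3) y a" by blast
    have EP: "edges_of P = (path_edges p + path_edges q + path_edges t) + edges_of P'" unfolding P' by (simp add: ac_simps)
    have sub: "path_edges p + path_edges q + path_edges t + edges_of Q \<subseteq># path_edges p + path_edges q + path_edges t + R"
      using QR by (rule subset_mset.add_left_mono)
    from two show False
    proof
      assume l: "linked (path_edges q1) y x0 \<and> linked (path_edges q2) y x0"
      have pass: "passes (path_edges q1 + (path_edges q2 + path_edges t)) x0 x1 y"
        by (rule passesI[OF linked_sym[OF conjunct1[OF l]] linked_add_trans[OF conjunct2[OF l] is_path_linked[OF ip(3)]]]) simp
      \<comment> \<open>If \<open>q3\<close> ends at \<open>x0\<close>, it is continued along
        \<open>q\<close> to \<open>a\<close>.\<close>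
      have lk: "linked (path_edges q3 + path_edges q) y a"
      proof (cases "linked (path_edges q3) y a")
        case True
        then show ?thesis by (rule linked_add1)
      next
        case False
        then have "linked (path_edges q3) y x0" using lq[of q3] Q3 by auto
        moreover have "linked (path_edges q) x0 a"
          using path_linked_mem[of x0 q a] is_path_ends[OF ip(2)] q(2) by blast
        ultimately show ?thesis by (rule linked_add_trans)
      qed
      show False
      proof (rule wide_no_D[OF W EP _ _ pass passes_path[OF ip(1) a(4)] lk y(1) a(1) y(2)])
        have "path_edges q1 + (path_edges q2 + path_edges t) + path_edges p + (path_edges q3 + path_edges q)
            = path_edges p + path_edges q + path_edges t + edges_of Q" unfolding Q3 by (simp add: ac_simps)
        then show "path_edges q1 + (path_edges q2 + path_edges t) + path_edges p + (path_edges q3 + path_edges q)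
            \<subseteq># path_edges p + path_edges q + path_edges t + R" using sub by (simp only:)
      qed (use P' in auto)
    next
      assume l: "linked (path_edges q2) y a \<and> linked (path_edges q3) y a"
      obtain lp r where lr: "p = lp @ a # r" using a(4) split_list by fastforce
      note la = link_of_in_path[OF ip(1) lr]
      \<comment> \<open>If \<open>q1\<close> ends at \<open>a\<close>, it is reached from
        \<open>x0\<close> along the first part of \<open>p\<close>.\<close>
      have "linked (path_edges (lp @ [a]) + path_edges q1) x0 y"
      proof (cases "linked (path_edges q1) y a")
        case True
        show ?thesis by (rule linked_add_trans[OF la(1) linked_sym[OF True]])
      next
        case False
        then have "linked (path_edges q1) y x0" using lq[of q1] Q3 by auto
        then show ?thesis by (rule linked_add2[OF linked_sym])
      qed
      then have pass: "passes (path_edges (lp @ [a]) + path_edges q1 + (path_edges q2 + path_edges (a # r))) x0 x1 y"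
        by (rule passesI[OF _ linked_add_trans[OF conjunct1[OF l] la(3)]]) simp
      show False
      proof (rule wide_no_D[OF W EP _ _ pass passes_path[OF ip(2) q(2)] conjunct2[OF l] y(1) a(1) y(2)])
        have "path_edges (lp @ [a]) + path_edges q1 + (path_edges q2 + path_edges (a # r)) + path_edges q + path_edges q3
            = path_edges p + path_edges q + edges_of Q" unfolding Q3 la(2) by (simp add: ac_simps)
        also have "\<dots> \<subseteq># path_edges p + path_edges q + path_edges t + edges_of Q" by (simp add: ac_simps)
        also note sub
        finally show "path_edges (lp @ [a]) + path_edges q1 + (path_edges q2 + path_edges (a # r)) + path_edges q + path_edges q3
            \<subseteq># path_edges p + path_edges q + path_edges t + R" .
      qed (use P' in auto)
    qed
  qed
qed

lemma wide_root_isolated: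
  assumes W: "wide_system P R"
  shows "x0 \<in> e \<Longrightarrow> e \<notin># R"
proof
  assume e: "x0 \<in> e" "e \<in># R"
  note S = systemD[OF wide_systemD(2)[OF W]]
  obtain a b where ab: "e = {a, b}" by (rule simple_edgesD[OF S(4) e(2)])
  then obtain c where "{x0, c} \<in># R" using e by (metis insertE insert_commute singletonD)
  then show False
  proof (rule isolated_class_contradiction[OF W])
    fix v p
    assume "linked R x0 v" "v \<in> V - {x0, x1}" "p \<in># P"
    then show "v \<notin> set p" using touched_class_contradiction[OF W \<open>v \<in> V - {x0, x1}\<close>] by blast
  qed
qed

end

section \<open>No leftover edges: the paths form bundles\<close>

context critical
begin

lemma critical_sym: "critical m V M x1 x0"
proof -
  interpret s: reduced m V M x1 x0 by (rule reduced_sym)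
  show ?thesis
  proof
    fix X assume X: "X \<subseteq> V" "x1 \<in> X" "x0 \<notin> X"
    have "cut M (V - X) \<ge> Suc m" using X roots by (intro sep1) auto
    then show "Suc m \<le> cut M X" using cut_compl[OF simple, of X] by simp
  next
    show "count M {x1, x0} \<le> 1" using one_root_edge by (simp add: insert_commute)
  qed
qed

text \<open>Reversing the paths carries \<open>wide_root_isolated\<close> over to the other
  root.\<close>

lemma wide_system_rev:
  assumes "wide_system P R"
  shows "critical.wide_system m V M x1 x0 (image_mset rev P) R"
proof -
  interpret s: critical m V M x1 x0 by (rule critical_sym)
  have E: "edges_of (image_mset rev Q) = edges_of Q" for Q :: "'a list multiset"
    by (induction Q) (simp_all add: path_edges_rev)
  have sys: "s.system (image_mset rev P) R"
    using wide_systemD(2)[OF assms] E unfolding s.system_def system_def by (auto intro: is_path_rev)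
  have sys': "system (image_mset rev Q) R'" if "s.system Q R'" for Q R'
    using that E unfolding s.system_def system_def by (auto intro: is_path_rev)
  have roo: "s.rooted R' = rooted R'" for R' by (auto simp: s.rooted_def rooted_def)
  have max: "\<not> rooted R \<subset> rooted R'" if "s.system P' R'" "size P' = size P" for P' R'
  proof -
    have "size (image_mset rev P') = size P" using that(2) by simp
    then show ?thesis using sys'[OF that(1)] wide_systemD(1)[OF assms] unfolding maximal_system_def by blast
  qed
  show ?thesis
    unfolding s.wide_system_def s.maximal_system_def roo
    using sys max wide_systemD(3,6)[OF assms] by simp
qed

text \<open>Every edge of \<open>R\<close> lies in the component of a root, and neither root has an
  edge in \<open>R\<close>.\<close>

lemma wide_rest_empty:
  assumes W: "wide_system P R"
  shows "R = {#}"
proof (rule ccontr)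
  interpret s: critical m V M x1 x0 by (rule critical_sym)
  note S = systemD[OF wide_systemD(2)[OF W]]
  have iso: "x \<notin> e" if "e \<in># R" "x = x0 \<or> x = x1" for e x
    using that wide_root_isolated[OF W, of e] s.wide_root_isolated[OF wide_system_rev[OF W], of e] by blast
  assume "R \<noteq> {#}"
  then obtain e where e: "e \<in># R" by (rule multiset_nonemptyE)
  obtain a b where ab: "e = {a, b}" by (rule simple_edgesD[OF S(4) e])
  have ab_in: "{a, b} \<in># R" using e ab by simp
  have "a \<in> rooted R" by (rule maximal_system_rooted[OF wide_systemD(1)[OF W] ab_in])
  then obtain x where x: "x = x0 \<or> x = x1" "linked R a x" by (auto simp: rooted_def)
  have "a \<noteq> x" using iso[OF ab_in x(1)] by auto
  then have "x \<noteq> a" by blast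
  then obtain w where "{x, w} \<in># R" using linked_first_edge[OF linked_sym[OF x(2)]] by blast
  then show False using iso[OF _ x(1)] by blast
qed

lemma wide_edges:
  assumes W: "wide_system P R"
  shows "M = edges_of P"
  using systemD(3)[OF wide_systemD(2)[OF W]] wide_rest_empty[OF W] by simp

lemma wide_touched_twice:
  assumes W: "wide_system (add_mset p P) R" and v: "v \<in> V - {x0, x1}"
  shows "\<exists>q\<in>#P. v \<in> set q"
proof (rule ccontr)
  assume "\<not> ?thesis"
  then obtain v' where "{v, v'} \<in># R"
    using once_touched[OF wide_systemD(2)[OF W] v] by blast
  then show False using wide_rest_empty[OF W] by simp
qed

text \<open>\<open>p\<close> and \<open>q\<close> pass \<open>u\<close> and \<open>v\<close>, and
  \<open>r\<close> links them. The three are occurrences in \<open>P\<close> and may be equal lists,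
  which bounds multiplicities later.\<close>

lemma wide_three_paths:
  assumes W: "wide_system P R" and P: "{#p, q, r#} \<subseteq># P"
    and u: "u \<in> V - {x0, x1}" "u \<in> set p" "u \<in> set r"
    and v: "v \<in> V - {x0, x1}" "v \<in> set q" "v \<in> set r" and uv: "u \<noteq> v"
  shows False
proof -
  note S = systemD[OF wide_systemD(2)[OF W]]
  obtain P' where P': "P = {#p, q, r#} + P'" using P by (meson subset_mset.le_iff_add)
  have ip: "is_path x0 x1 p" "is_path x0 x1 q" using S(1) P' by auto
  show False
  proof (rule wide_no_D[OF W _ _ _ passes_path[OF ip(1) u(2)] passes_path[OF ip(2) v(2)]
        path_linked_mem[OF u(3) v(3)] u(1) v(1) uv])
    show "edges_of P = (path_edges p + path_edges q + path_edges r) + edges_of P'" unfolding P' by (simp add: ac_simps)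
  qed (use P' in auto)
qed

text \<open>The two paths exchange tails, \<open>p\<close> to \<open>q\<close> at \<open>u\<close>
  and \<open>q\<close> to \<open>p\<close> at \<open>v\<close>; this leaves the segment of
  \<open>p\<close> from \<open>u\<close> to \<open>v\<close> as the link.\<close>

lemma wide_no_inverted_pair:
  assumes W: "wide_system P R" and P: "{#p, q#} \<subseteq># P"
    and p: "p = l1 @ u # l2 @ v # l3" and q: "q = k1 @ v # k2 @ u # k3"
    and uv: "u \<in> V - {x0, x1}" "v \<in> V - {x0, x1}" "u \<noteq> v"
  shows False
proof -
  note S = systemD[OF wide_systemD(2)[OF W]]
  obtain P' where P': "P = {#p, q#} + P'" using P by (meson subset_mset.le_iff_add)
  have ip: "is_path x0 x1 p" "is_path x0 x1 q" using S(1) P' by auto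
  note lp = link_of_in_path[OF ip(1) p] and lq = link_of_in_path[OF ip(2) q]
  have pe: "path_edges (u # l2 @ v # l3) = path_edges (u # l2 @ [v]) + path_edges (v # l3)"
    "path_edges (v # k2 @ u # k3) = path_edges (v # k2 @ [u]) + path_edges (u # k3)"
    using path_edges_append[of "u # l2" v l3] path_edges_append[of "v # k2" u k3] by simp_all
  have l: "linked (path_edges (u # k3)) u x1" "linked (path_edges (v # l3)) v x1"
    using path_linked[of "u # k3"] path_linked[of "v # l3"] ip p q by (simp_all add: is_path_def)
  have pu: "passes (path_edges (l1 @ [u]) + path_edges (u # k3)) x0 x1 u" by (rule passesI[OF lp(1) l(1)]) simp
  have pv: "passes (path_edges (k1 @ [v]) + path_edges (v # l3)) x0 x1 v" by (rule passesI[OF lq(1) l(2)]) simp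
  have link: "linked (path_edges (u # l2 @ [v])) u v" by (intro path_linked_mem) auto
  show False
  proof (rule wide_no_D[OF W _ _ _ pu pv link uv])
    show "edges_of P = (path_edges p + path_edges q) + edges_of P'" unfolding P' by (simp add: ac_simps)
    show "path_edges (l1 @ [u]) + path_edges (u # k3) + (path_edges (k1 @ [v]) + path_edges (v # l3)) + path_edges (u # l2 @ [v])
        \<subseteq># path_edges p + path_edges q + R"
      unfolding lp(2) lq(2) pe by (simp add: ac_simps)
  qed (use P' in auto)
qed

text \<open>A nonroot on \<open>r\<close> but not on \<open>s\<close> lies on a further occurrence
  besides \<open>r\<close>, and \<open>wide_three_paths\<close> applies with \<open>r\<close> as the
  link. So distinct paths sharing \<open>w\<close> have the same vertices, and they contain an
  inverted pair.\<close>

lemma wide_paths_disjoint: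
  assumes W: "wide_system P R" and pq: "p \<in># P" "q \<in># P" and w: "w \<in> V - {x0, x1}" "w \<in> set p" "w \<in> set q"
  shows "p = q"
proof (rule ccontr)
  assume ne: "p \<noteq> q"
  note S = systemD[OF wide_systemD(2)[OF W]]
  have sub: "set r \<subseteq> set s" if r: "r \<in># P" "w \<in> set r" and s: "s \<in># P" "w \<in> set s" and rs: "r \<noteq> s" for r s
  proof
    fix w' assume w': "w' \<in> set r"
    show "w' \<in> set s"
    proof (cases "w' \<in> {x0, x1, w}")
      case True
      then show ?thesis using is_path_ends[OF S(1)[OF s(1)]] s(2) by auto
    next
      case False
      have nr: "w' \<in> V - {x0, x1}" using False S(6)[OF r(1)] w' by auto
      obtain P0 where P0: "P = add_mset r P0" using r(1) by (meson multi_member_split)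
      then obtain s' where s': "s' \<in># P0" "w' \<in> set s'" using wide_touched_twice[of r P0 R, OF _ nr] W by blast
      have sP0: "s \<in># P0" using s(1) rs P0 by auto
      show ?thesis
      proof (rule ccontr)
        assume "w' \<notin> set s"
        then have "s' \<noteq> s" using s' by blast
        then have "{#s', s#} \<subseteq># P0" using two_in_mset[OF s'(1) sP0] by blast
        then have "{#s', s, r#} \<subseteq># P" unfolding P0 by (simp add: add_mset_commute)
        then show False using wide_three_paths[OF W _ nr s'(2) w' w(1) s(2) r(2)] False by blast
      qed
    qed
  qed
  have sets: "set p = set q" using sub[OF pq(1) w(2) pq(2) w(3) ne] sub[OF pq(2) w(3) pq(1) w(2) ne[symmetric]] by blast
  have ip: "is_path x0 x1 p" "is_path x0 x1 q" using S(1) pq by auto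
  then have dist: "distinct p" "distinct q" by (auto simp: is_path_def)
  obtain u v l1 l2 l3 k1 k2 k3 where l: "p = l1 @ u # l2 @ v # l3" and k: "q = k1 @ v # k2 @ u # k3"
    using inverted_pair[OF dist sets ne] .
  have "u \<in> V" "v \<in> V" "u \<noteq> v" using S(6)[OF pq(1)] l dist by auto
  moreover have "u \<noteq> x0" using ip(2) k by (cases k1) (auto simp: is_path_def)
  moreover have "v \<noteq> x0" using ip(1) l by (cases l1) (auto simp: is_path_def)
  moreover have "u \<noteq> x1"
  proof -
    have "last (v # l3) = x1" "u \<notin> set (v # l3)" using ip(1) l by (auto simp: is_path_def)
    then show ?thesis using last_in_set[of "v # l3"] by auto
  qed
  moreover have "v \<noteq> x1"
  proof -
    have "last (u # k3) = x1" "v \<notin> set (u # k3)" using ip(2) k by (auto simp: is_path_def)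
    then show ?thesis using last_in_set[of "u # k3"] by auto
  qed
  ultimately show False
    using wide_no_inverted_pair[OF W two_in_mset[OF pq ne] l k] by blast
qed

lemma wide_count_ge_2:
  assumes W: "wide_system P R" and p: "p \<in># P" "p \<noteq> [x0, x1]"
  shows "count P p \<ge> 2" "\<exists>w\<in>V - {x0, x1}. w \<in> set p"
proof -
  note S = systemD[OF wide_systemD(2)[OF W]]
  have "\<not> set p \<subseteq> {x0, x1}" using direct_path[OF S(1)[OF p(1)]] p(2) by blast
  then obtain w where w: "w \<in> set p" "w \<in> V - {x0, x1}" using S(6)[OF p(1)] by blast
  then show "\<exists>w\<in>V - {x0, x1}. w \<in> set p" by blast
  obtain P0 where P0: "P = add_mset p P0" using p(1) by (meson multi_member_split)
  then obtain q where q: "q \<in># P0" "w \<in> set q" using wide_touched_twice[of p P0 R, OF _ w(2)] W by blast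
  then have "q = p" using wide_paths_disjoint[OF W _ p(1) w(2) q(2) w(1)] P0 by simp
  then show "count P p \<ge> 2" using q(1) P0 by (simp flip: count_greater_zero_iff)
qed

text \<open>With a third copy, two copies pass \<open>u\<close> and \<open>v\<close> and the third
  links them.\<close>

lemma wide_count_long:
  assumes W: "wide_system P R" and p: "p \<in># P" "u \<in> set p" "v \<in> set p" "u \<in> V - {x0, x1}" "v \<in> V - {x0, x1}" "u \<noteq> v"
  shows "count P p = 2"
proof -
  have "p \<noteq> [x0, x1]" using p by auto
  then have "count P p \<ge> 2" using wide_count_ge_2[OF W p(1)] by blast
  moreover have "\<not> count P p \<ge> 3"
  proof
    assume "count P p \<ge> 3"
    then have "{#p, p, p#} \<subseteq># P" by (auto simp: subseteq_mset_def)
    then show False using wide_three_paths[OF W _ p(4,2,2) p(5,3,3,6)] by blast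
  qed
  ultimately show ?thesis by simp
qed

text \<open>With \<open>m + 2\<close> paths four can be spent. Two different bundles are each at
  least double: one copy of each passes \<open>u\<close> or \<open>v\<close>, the other copies link
  these through \<open>x0\<close>. A single bundle contains all nonroots, hence has multiplicity 2;
  with at most one root edge there are only 3 paths, fewer than \<open>m + 2\<close>.\<close>

lemma wide_size:
  assumes W: "wide_system P R"
  shows "size P = Suc m"
proof (rule ccontr)
  assume "size P \<noteq> Suc m"
  then have N: "size P \<ge> m + 2" using wide_systemD(3)[OF W] by simp
  note S = systemD[OF wide_systemD(2)[OF W]]
  show False
  proof (cases "\<exists>p q. p \<in># P \<and> q \<in># P \<and> p \<noteq> q \<and> p \<noteq> [x0, x1] \<and> q \<noteq> [x0, x1]")
    case True
    then obtain p q where pq: "p \<in># P" "q \<in># P" "p \<noteq> q" "p \<noteq> [x0, x1]" "q \<noteq> [x0, x1]" by blast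
    obtain u where u: "u \<in> V - {x0, x1}" "u \<in> set p" using wide_count_ge_2(2)[OF W pq(1,4)] by blast
    obtain v where v: "v \<in> V - {x0, x1}" "v \<in> set q" using wide_count_ge_2(2)[OF W pq(2,5)] by blast
    have uv: "u \<noteq> v" using wide_paths_disjoint[OF W pq(1,2) u] v pq(3) by blast
    have "{#p, p, q, q#} \<subseteq># P"
      using wide_count_ge_2(1)[OF W pq(1,4)] wide_count_ge_2(1)[OF W pq(2,5)] pq(3)
      by (auto simp: subseteq_mset_def)
    then obtain P' where P': "P = {#p, p, q, q#} + P'" by (meson subset_mset.le_iff_add)
    have ip: "is_path x0 x1 p" "is_path x0 x1 q" using S(1) pq by auto
    have l: "linked (path_edges p) u x0" "linked (path_edges q) x0 v"
      using path_linked_mem[of u p x0] path_linked_mem[of x0 q v] is_path_ends[OF ip(1)] is_path_ends[OF ip(2)] u(2) v(2)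
      by blast+
    show False
    proof (rule no_D_passes[OF passes_path[OF ip(1) u(2)] passes_path[OF ip(2) v(2)] linked_add_trans[OF l] u(1) v(1) uv])
      show "m \<le> size P' + 2" using N P' by simp
      show "is_path x0 x1 r" if "r \<in># P'" for r using S(1) P' that by simp
      show "path_edges p + path_edges q + (path_edges p + path_edges q) + edges_of P' \<subseteq># M"
        unfolding S(3) P' by (simp add: ac_simps)
    qed
  next
    case False
    have ex: "\<exists>p\<in>#P. w \<in> set p" if w: "w \<in> V - {x0, x1}" for w
    proof -
      have "size P > 0" using N by simp
      then obtain p where "p \<in># P" by (metis nonempty_has_size multiset_nonemptyE)
      then obtain P0 where P0: "P = add_mset p P0" by (meson multi_member_split)
      then show ?thesis using wide_touched_twice[of p P0 R, OF _ w] W by auto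
    qed
    have "card (V - {x0, x1}) \<ge> 2" using card_V roots by (simp add: card_Diff_subset)
    then obtain u where u: "u \<in> V - {x0, x1}" by (metis card.empty ex_in_conv not_numeral_le_zero)
    have "\<not> V - {x0, x1} \<subseteq> {u}"
    proof
      assume "V - {x0, x1} \<subseteq> {u}"
      then have "card (V - {x0, x1}) \<le> card {u}" by (intro card_mono) auto
      then show False using \<open>card (V - {x0, x1}) \<ge> 2\<close> by simp
    qed
    then obtain v where v: "v \<in> V - {x0, x1}" "u \<noteq> v" by blast
    obtain p where p: "p \<in># P" "u \<in> set p" using ex[OF u] by blast
    obtain q where q: "q \<in># P" "v \<in> set q" using ex[OF v(1)] by blast
    have pne: "p \<noteq> [x0, x1]" "q \<noteq> [x0, x1]" using p(2) q(2) u v by auto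
    then have "p = q" using False p(1) q(1) by blast
    then have c2: "count P p = 2" using wide_count_long[OF W p(1,2) _ u v] q(2) by blast
    have others: "r = [x0, x1]" if "r \<in># P" "r \<noteq> p" for r using False that p(1) pne(1) by blast
    have "P = {#r \<in># P. r = p#} + {#r \<in># P. r \<noteq> p#}" by (rule multiset_partition)
    moreover have "{#r \<in># P. r \<noteq> p#} = {#r \<in># P. r = [x0, x1]#}"
      using others pne(1) by (intro filter_mset_cong) auto
    ultimately have "size P = count P p + count P [x0, x1]"
      by (metis filter_eq_replicate_mset size_replicate_mset size_union)
    moreover have "count P [x0, x1] \<le> count M {x0, x1}"
      using count_root_paths_le[of P x0 x1] wide_edges[OF W] by simp
    ultimately show False using N c2 one_root_edge m_ge_2 by linarith
  qed
qed

lemma critical_bundled: "\<exists>P. bundled (Suc m) V M x0 x1 P"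
proof -
  obtain P R where W: "wide_system P R" by (rule wide_system_exists)
  note S = systemD[OF wide_systemD(2)[OF W]]
  have V: "V = {x0, x1} \<union> (\<Union>p \<in> set_mset P. set p)"
  proof
    show "V \<subseteq> {x0, x1} \<union> (\<Union>p \<in> set_mset P. set p)"
    proof
      fix v assume v: "v \<in> V"
      have "size P > 0" using wide_size[OF W] by simp
      then obtain p where "p \<in># P" by (metis nonempty_has_size multiset_nonemptyE)
      then obtain P0 where P0: "P = add_mset p P0" by (meson multi_member_split)
      then show "v \<in> {x0, x1} \<union> (\<Union>p \<in> set_mset P. set p)"
        using wide_touched_twice[of p P0 R v] W v by auto
    qed
  qed (use S(6) roots in auto)
  have long: "count P p = 2" if p: "p \<in># P" "length p \<ge> 4" for p
  proof -
    have "card (set p) \<ge> 4" using p(2) S(7)[OF p(1)] distinct_card[of p] by simp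
    moreover have "{x0, x1} \<subseteq> set p" using is_path_ends[OF S(1)[OF p(1)]] by blast
    ultimately have c: "card (set p - {x0, x1}) \<ge> 2" using roots(3) by (simp add: card_Diff_subset)
    then obtain u where u: "u \<in> set p - {x0, x1}" by (metis card.empty ex_in_conv not_numeral_le_zero)
    have "\<not> set p - {x0, x1} \<subseteq> {u}"
    proof
      assume "set p - {x0, x1} \<subseteq> {u}"
      then have "card (set p - {x0, x1}) \<le> card {u}" by (intro card_mono) auto
      then show False using c by simp
    qed
    then obtain v where "v \<in> set p - {x0, x1}" "u \<noteq> v" by blast
    then show ?thesis using u wide_count_long[OF W p(1), of u v] S(6)[OF p(1)] by blast
  qed
  show ?thesis
    unfolding bundled_def
    using wide_size[OF W] S(1) wide_edges[OF W] V wide_paths_disjoint[OF W] wide_count_ge_2(1)[OF W] long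
    by (intro exI[of _ P] conjI ballI impI) blast+
qed

end

section \<open>The trichotomy\<close>

lemma (in admissible) outcome_step:
  assumes IH: "outcome_below V M"
  shows "outcome m V M x0 x1"
proof (rule ccontr)
  assume no: "\<not> outcome m V M x0 x1"
  have noD: "\<not> has_D m V M x0 x1" and noP: "\<not> (\<exists>P. bundled (Suc m) V M x0 x1 P)"
    using no by (auto simp: outcome_def)
  have "reduced m V M x0 x1"
  proof unfold_locales
    show "\<not> has_D m V M x0 x1" by (rule noD)
    show "cut M X \<ge> Suc m" if X: "X \<subseteq> V" "x0 \<in> X" "x1 \<notin> X" "card X \<ge> 2" "card (V - X) \<ge> 2" for X
      using sep[OF X(1-3)] tight_cut_outcome[OF X(1-3) _ X(4,5) IH] no by fastforce
    show "{x0, x1} \<notin># M" if "m \<ge> 3" using root_edge_outcome[OF that _ IH] no by blast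
  qed (rule IH)
  then interpret r: reduced m V M x0 x1 .
  interpret s: reduced m V M x1 x0 by (rule r.reduced_sym)
  \<comment> \<open>Tight separating cuts are stars of roots by \<open>sep_cases\<close>, and a root
    of degree \<open>m\<close> has been excluded on either side.\<close>
  have sep1: "cut M X \<ge> Suc m" if X: "X \<subseteq> V" "x0 \<in> X" "x1 \<notin> X" for X
    using r.sep_cases[OF X] r.cut_compl_root[of X] r.root_degree_contradiction s.root_degree_contradiction sep[OF X]
    by (metis le_antisym not_less_eq_eq)
  show False
  proof (cases "count M {x0, x1} \<ge> 2")
    case True
    then have "{x0, x1} \<in># M" by (metis count_greater_zero_iff less_le_trans zero_less_numeral)
    then have m2: "m = 2" using r.root_edge m_ge_2 by fastforce
    have "has_D 2 V M x0 x1"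
    proof (rule double_root_edge_has_D[OF m2 True _ IH])
      show "cut M X \<ge> 3" if "X \<subseteq> V" "x0 \<in> X" "x1 \<notin> X" for X using sep1[OF that] m2 by simp
    qed
    then show False using noD m2 by simp
  next
    case False
    have "critical m V M x0 x1"
      by unfold_locales (use sep1 False in auto)
    then have "\<exists>P. bundled (Suc m) V M x0 x1 P" by (rule critical.critical_bundled)
    with noP show False by (rule notE)
  qed
qed

theorem admissible_outcome:
  fixes V :: "'v set"
  shows "admissible m V M x0 x1 \<Longrightarrow> outcome m V M x0 x1"
proof (induction "card V + size M" arbitrary: m V M x0 x1 rule: less_induct)
  case less
  have "outcome_below V M" unfolding outcome_below_def using less.hyps by blast
  then show ?case by (rule admissible.outcome_step[OF less.prems])
qed

section \<open>The two types\<close>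

lemma subset_chain_mono:
  fixes Xs :: "'v set list"
  assumes "\<forall>i. Suc i < length Xs \<longrightarrow> Xs ! i \<subset> Xs ! Suc i" "i \<le> j" "j < length Xs"
  shows "Xs ! i \<subseteq> Xs ! j"
  using assms(2,3)
proof (induction j rule: dec_induct)
  case (step n)
  then show ?case using assms(1)[rule_format, of n] by auto
qed simp

lemma path_edges_conv_nth: "path_edges p = mset (map (\<lambda>i. {p ! i, p ! Suc i}) [0..<length p - 1])"
proof (induction p rule: path_edges.induct)
  case (1 a b p)
  have "[0..<length (a # b # p) - 1] = 0 # map Suc [0..<length (b # p) - 1]"
    using upt_conv_Cons[of 0 "Suc (length p)"] by (simp add: map_Suc_upt del: upt_Suc)
  then have "mset (map (\<lambda>i. {(a # b # p) ! i, (a # b # p) ! Suc i}) [0..<length (a # b # p) - 1])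
      = add_mset {a, b} (mset (map (\<lambda>i. {(b # p) ! i, (b # p) ! Suc i}) [0..<length (b # p) - 1]))"
    by (simp only: list.map map_map comp_def nth_Cons_Suc nth_Cons_0 mset.simps)
  then show ?case using 1 by simp
qed simp_all

lemma edges_of_sum: "finite A \<Longrightarrow> edges_of (\<Sum>x\<in>A. F x) = (\<Sum>x\<in>A. edges_of (F x))"
  by (induction rule: finite_induct) auto

lemma edges_of_replicate_mset: "edges_of (replicate_mset n p) = repeat_mset n (path_edges p)"
  by (induction n) auto

lemma is_thick_path_iff:
  "is_thick_path L x0 x1 n \<longleftrightarrow> (\<exists>p. is_path x0 x1 p \<and> verts L = set p \<and> edges L = repeat_mset n (path_edges p))"
  unfolding is_thick_path_def is_path_def path_edges_conv_nth by blast

locale rooted_multigraph = admissible m "verts G" "edges G" x0 x1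
  for m and G :: "'v mgraph" and x0 x1
begin

lemma cut_size_eq: "cut_size G X = cut (edges G) X"
  by (simp add: cut_size_def cut_def)

lemma two_nonroots:
  obtains u v where "u \<in> verts G - {x0, x1}" "v \<in> verts G - {x0, x1}" "u \<noteq> v"
proof -
  have c: "card (verts G - {x0, x1}) \<ge> 2" using card_V roots by (simp add: card_Diff_subset)
  then obtain u where u: "u \<in> verts G - {x0, x1}" by (metis card.empty ex_in_conv not_numeral_le_zero)
  have "\<not> verts G - {x0, x1} \<subseteq> {u}"
  proof
    assume "verts G - {x0, x1} \<subseteq> {u}"
    then have "card (verts G - {x0, x1}) \<le> card {u}" by (intro card_mono) auto
    then show False using c by simp
  qed
  then show thesis using u that by blast
qed

section \<open>Segmentations as chains of tight cuts\<close>

lemma card_le_2_if_no_pair: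
  assumes "X \<subseteq> verts G" "x \<in> X" "\<And>u v. u \<in> X \<Longrightarrow> v \<in> X \<Longrightarrow> u \<noteq> x \<Longrightarrow> v \<noteq> x \<Longrightarrow> u = v"
  shows "card X \<le> 2"
proof (cases "X \<subseteq> {x}")
  case True
  then have "card X \<le> card {x}" by (intro card_mono) auto
  then show ?thesis by simp
next
  case False
  then obtain u where "u \<in> X" "u \<noteq> x" by blast
  then have "X \<subseteq> {x, u}" using assms(3) by blast
  then have "card X \<le> card {x, u}" by (intro card_mono) auto
  then show ?thesis using \<open>u \<noteq> x\<close> by simp
qed

text \<open>A pair that no member of the segmentation separates cannot enter it: the first set holds
  at most one nonroot, and each step adds one vertex. So both would end up in \<open>X1\<close> next
  to \<open>x1\<close>.\<close>

lemma type_A_tight_separated: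
  assumes "type_A m G x0 x1"
  shows "tight_separated m (verts G) (edges G) x0 x1"
proof -
  obtain X0 X1 Xs where seg: "segmentation G X0 X1 Xs" and w: "has_width G Xs m"
    and c: "card X0 \<le> 2" "card X1 \<le> 2" and x: "x0 \<in> X0" "x1 \<in> X1"
    using assms unfolding type_A_def by blast
  have Xs: "X0 \<subseteq> verts G" "X1 \<subseteq> verts G" "Xs \<noteq> []" "\<And>Z. Z \<in> set Xs \<Longrightarrow> Z \<subseteq> verts G" "hd Xs = X0" "verts G - last Xs = X1"
    and step: "\<forall>i. Suc i < length Xs \<longrightarrow> Xs ! i \<subset> Xs ! Suc i"
    "\<And>i. Suc i < length Xs \<Longrightarrow> card (Xs ! Suc i - Xs ! i) = 1"
    using seg unfolding segmentation_def by blast+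
  have no_pair: False if X: "X \<subseteq> verts G" "card X \<le> 2" "{r, u, v} \<subseteq> X" "r \<noteq> u" "r \<noteq> v" "u \<noteq> v" for X r u v
  proof -
    have "card {r, u, v} \<le> card X" using X(1,3) by (intro card_mono finite_sub[OF X(1)])
    then show False using X by simp
  qed
  have between: "x0 \<in> Xs ! i \<and> x1 \<notin> Xs ! i" if i: "i < length Xs" for i
  proof -
    have "Xs ! 0 \<subseteq> Xs ! i" "Xs ! i \<subseteq> Xs ! (length Xs - 1)"
      using i by (intro subset_chain_mono[OF step(1)]; simp)+
    moreover have "Xs ! 0 = X0" using Xs(3,5) by (simp add: hd_conv_nth)
    moreover have "Xs ! (length Xs - 1) = last Xs" using Xs(3) by (simp add: last_conv_nth)
    ultimately show ?thesis using x Xs(6) by blast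
  qed
  show ?thesis
    unfolding tight_separated_def
  proof (intro ballI impI, rule ccontr)
    fix u v
    assume u: "u \<in> verts G - {x0, x1}" and v: "v \<in> verts G - {x0, x1}" and uv: "u \<noteq> v"
      and no: "\<not> (\<exists>X\<subseteq>verts G. x0 \<in> X \<and> x1 \<notin> X \<and> cut (edges G) X = m \<and> (u \<in> X) \<noteq> (v \<in> X))"
    have same: "(u \<in> Xs ! i) = (v \<in> Xs ! i)" if i: "i < length Xs" for i
      using no between[OF i] Xs(4)[OF nth_mem[OF i]] w nth_mem[OF i] unfolding has_width_def cut_size_eq by blast
    have out: "u \<notin> Xs ! i" if "i < length Xs" for i
      using that
    proof (induction i)
      case 0
      show ?case
      proof
        assume "u \<in> Xs ! 0"
        then have "{x0, u, v} \<subseteq> X0" using same[OF 0] x Xs(3,5) by (simp add: hd_conv_nth)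
        then show False using no_pair[OF Xs(1) c(1)] u v uv by blast
      qed
    next
      case (Suc i)
      show ?case
      proof
        assume u': "u \<in> Xs ! Suc i"
        have i: "i < length Xs" using Suc.prems by simp
        have "u \<notin> Xs ! i" by (rule Suc.IH[OF i])
        then have "{u, v} \<subseteq> Xs ! Suc i - Xs ! i" using u' same[OF Suc.prems] same[OF i] by blast
        moreover have "finite (Xs ! Suc i - Xs ! i)" by (rule card_ge_0_finite) (simp add: step(2)[OF Suc.prems])
        ultimately have "card {u, v} \<le> card (Xs ! Suc i - Xs ! i)" by (intro card_mono)
        then show False using step(2)[OF Suc.prems] uv by simp
      qed
    qed
    have "length Xs - 1 < length Xs" using Xs(3) by simp
    then have "u \<notin> last Xs" "v \<notin> last Xs" using out same Xs(3) by (auto simp: last_conv_nth)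
    then have "{x1, u, v} \<subseteq> X1" using x Xs(6) u v by blast
    then show False using no_pair[OF Xs(2) c(2)] u v uv by blast
  qed
qed

text \<open>As long as two vertices lie between \<open>X\<close> and \<open>Y\<close>, a tight cut
  strictly between them splits the task; the two chains share their middle set, which is listed
  once.\<close>

lemma tight_chain:
  assumes sepd: "tight_separated m (verts G) (edges G) x0 x1"
    and "X \<subseteq> Y" "Y \<subseteq> verts G" "x0 \<in> X" "x1 \<notin> Y" "cut (edges G) X = m" "cut (edges G) Y = m"
  shows "\<exists>Xs. Xs \<noteq> [] \<and> hd Xs = X \<and> last Xs = Y \<and> (\<forall>Z\<in>set Xs. Z \<subseteq> verts G \<and> cut (edges G) Z = m) \<and>
    successively (\<lambda>A B. A \<subset> B \<and> card (B - A) = 1) Xs"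
  using assms(2-)
proof (induction "card (Y - X)" arbitrary: X Y rule: less_induct)
  case less
  have fin: "finite (Y - X)" by (rule finite_sub) (use less.prems in blast)
  show ?case
  proof (cases "X = Y")
    case True
    then show ?thesis using less.prems by (intro exI[of _ "[X]"]) auto
  next
    case False
    then obtain t where t: "t \<in> Y - X" using less.prems(1) by blast
    show ?thesis
    proof (cases "Y - X = {t}")
      case True
      then show ?thesis using less.prems t by (intro exI[of _ "[X, Y]"]) auto
    next
      case False
      then obtain t' where t': "t' \<in> Y - X" "t \<noteq> t'" using t by blast
      have XV: "X \<subseteq> verts G" using less.prems(1,2) by blast
      obtain Z where Z: "X \<subset> Z" "Z \<subset> Y" "cut (edges G) Z = m"
        using tight_refine[OF sepd XV less.prems(3,5,2,4,6,1) t t'] .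
      have cards: "card (Z - X) < card (Y - X)" "card (Y - Z) < card (Y - X)"
        using Z(1,2) by (intro psubset_card_mono[OF fin]; blast)+
      have ZV: "Z \<subseteq> verts G" "X \<subseteq> Z" "Z \<subseteq> Y" "x0 \<in> Z" "x1 \<notin> Z" using Z less.prems by auto
      obtain As where
        A: "As \<noteq> []" "hd As = X" "last As = Z" "\<forall>Z\<in>set As. Z \<subseteq> verts G \<and> cut (edges G) Z = m"
          "successively (\<lambda>A B. A \<subset> B \<and> card (B - A) = 1) As"
        using less.hyps[OF cards(1) ZV(2,1) less.prems(3) ZV(5) less.prems(5) Z(3)] by blast
      obtain Bs where
        B: "Bs \<noteq> []" "hd Bs = Z" "last Bs = Y" "\<forall>Z\<in>set Bs. Z \<subseteq> verts G \<and> cut (edges G) Z = m"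
          "successively (\<lambda>A B. A \<subset> B \<and> card (B - A) = 1) Bs"
        using less.hyps[OF cards(2) ZV(3) less.prems(2) ZV(4) less.prems(4) Z(3) less.prems(6)] by blast
      obtain Cs where Bs: "Bs = Z # Cs" using B(1,2) by (cases Bs) auto
      have "Cs \<noteq> []" using Bs B(3) Z(2) by auto
      then have "successively (\<lambda>A B. A \<subset> B \<and> card (B - A) = 1) (As @ Cs)"
        using A(3,5) B(5) unfolding Bs by (cases Cs) (simp_all add: successively_append_iff)
      then show ?thesis using A B \<open>Cs \<noteq> []\<close> unfolding Bs by (intro exI[of _ "As @ Cs"]) auto
    qed
  qed
qed

text \<open>The chain runs from the least to the greatest tight cut. Two nonroots in the least one,
  or two outside the greatest, would be separated by no tight cut, which bounds the end
  sets.\<close>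

lemma tight_separated_type_A:
  assumes sepd: "tight_separated m (verts G) (edges G) x0 x1"
  shows "type_A m G x0 x1"
proof -
  define T where "T = {X. X \<subseteq> verts G \<and> x0 \<in> X \<and> x1 \<notin> X \<and> cut (edges G) X = m}"
  have T: "X \<union> Y \<in> T" "X \<inter> Y \<in> T" if "X \<in> T" "Y \<in> T" for X Y
    using that tight_Un_Int[of X Y] unfolding T_def by auto
  have sepT: "\<exists>X\<in>T. (u \<in> X) \<noteq> (v \<in> X)" if "u \<in> verts G - {x0, x1}" "v \<in> verts G - {x0, x1}" "u \<noteq> v" for u v
    using sepd that unfolding tight_separated_def T_def by blast
  have finT: "finite T" by (rule finite_subset[of _ "Pow (verts G)"]) (auto simp: T_def finite_V)
  have "T \<noteq> {}" using sepT two_nonroots by blast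
  obtain A where A0: "A \<in> T" "\<forall>X\<in>T. X \<subseteq> A \<longrightarrow> A = X"
    using finite_has_minimal[OF finT \<open>T \<noteq> {}\<close>] by blast
  have A: "A \<subseteq> X" if "X \<in> T" for X
    using A0(2) T(2)[OF A0(1) that] by blast
  obtain B where B0: "B \<in> T" "\<forall>X\<in>T. B \<subseteq> X \<longrightarrow> B = X"
    using finite_has_maximal[OF finT \<open>T \<noteq> {}\<close>] by blast
  have B: "X \<subseteq> B" if "X \<in> T" for X
    using B0(2) T(1)[OF B0(1) that] by blast
  have ends: "A \<subseteq> verts G" "x0 \<in> A" "x1 \<notin> A" "cut (edges G) A = m" "B \<subseteq> verts G" "x0 \<in> B" "x1 \<notin> B" "cut (edges G) B = m"
    using A0(1) B0(1) by (auto simp: T_def)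
  obtain Xs where Xs: "Xs \<noteq> []" "hd Xs = A" "last Xs = B" "\<forall>Z\<in>set Xs. Z \<subseteq> verts G \<and> cut (edges G) Z = m"
    "successively (\<lambda>A B. A \<subset> B \<and> card (B - A) = 1) Xs"
    using tight_chain[OF sepd A[OF B0(1)] ends(5,2,7,4,8)] by blast
  have "card A \<le> 2"
  proof (rule card_le_2_if_no_pair[OF ends(1,2)])
    show "u = v" if "u \<in> A" "v \<in> A" "u \<noteq> x0" "v \<noteq> x0" for u v
      using sepT[of u v] that A ends by blast
  qed
  moreover have "card (verts G - B) \<le> 2"
  proof (rule card_le_2_if_no_pair[of _ x1])
    show "u = v" if "u \<in> verts G - B" "v \<in> verts G - B" "u \<noteq> x1" "v \<noteq> x1" for u v
      using sepT[of u v] that B ends by blast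
  qed (use roots ends in auto)
  moreover have "segmentation G A (verts G - B) Xs"
  proof -
    have "\<forall>i. Suc i < length Xs \<longrightarrow> Xs ! i \<subset> Xs ! Suc i \<and> card (Xs ! Suc i - Xs ! i) = 1"
      using Xs(5) unfolding successively_conv_nth by blast
    moreover have "A \<inter> (verts G - B) = {}" using A[OF B0(1)] by blast
    moreover have "\<forall>Z\<in>set Xs. Z \<subseteq> verts G" using Xs(4) by blast
    ultimately show ?thesis
      unfolding segmentation_def Xs(2,3) using Xs(1) ends(1) by (intro conjI) (assumption | rule Diff_subset refl)+
  qed
  moreover have "has_width G Xs m" using Xs(4) by (simp add: has_width_def cut_size_eq)
  ultimately show ?thesis unfolding type_A_def using ends roots by blast
qed

section \<open>Lobes and bundles\<close>

definition inner :: "'v set multiset" where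
  "inner = {#e \<in># edges G. e \<subseteq> verts G - {x0, x1}#}"

text \<open>The component of \<open>u\<close> after both roots are removed.\<close>

definition branch :: "'v \<Rightarrow> 'v set" where
  "branch u = {v \<in> verts G - {x0, x1}. linked inner u v}"

lemma lobes_eq: "lobes G x0 x1 = (\<lambda>u. lobe G x0 x1 (branch u)) ` (verts G - {x0, x1})"
proof -
  have "verts G \<inter> (verts G - {x0, x1}) = verts G - {x0, x1}" by blast
  then have "components (induced G (verts G - {x0, x1})) = branch ` (verts G - {x0, x1})"
    unfolding components_def induced_def reachable_def branch_def linked_def inner_def by auto
  then show ?thesis unfolding lobes_def by (simp add: image_image)
qed

lemma branch_sub: "branch u \<subseteq> verts G - {x0, x1}"
  by (auto simp: branch_def)

lemma branch_self: "u \<in> verts G - {x0, x1} \<Longrightarrow> u \<in> branch u"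
  by (simp add: branch_def)

lemma branch_cong:
  assumes "w \<in> branch u"
  shows "branch w = branch u"
proof -
  have uw: "linked inner u w" using assms by (simp add: branch_def)
  have "linked inner w v \<longleftrightarrow> linked inner u v" for v
    using linked_trans[OF uw, of v] linked_trans[OF linked_sym[OF uw], of v] by blast
  then show ?thesis unfolding branch_def by blast
qed

lemma inner_edge: "{a, b} \<in># edges G \<Longrightarrow> a \<notin> {x0, x1} \<Longrightarrow> b \<notin> {x0, x1} \<Longrightarrow> {a, b} \<in># inner"
  using simple_edges_pair[OF simple, of a b] by (auto simp: inner_def)

lemma branch_closed:
  assumes "a \<in> branch u" "{a, b} \<in># edges G" "b \<notin> {x0, x1}"
  shows "b \<in> branch u"
proof -
  have a: "linked inner u a" "a \<notin> {x0, x1}" using assms(1) by (auto simp: branch_def)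
  have "linked inner u b" by (rule linked_trans[OF a(1) linked_edge[OF inner_edge[OF assms(2) a(2) assms(3)]]])
  then show ?thesis using simple_edges_pair[OF simple assms(2)] assms(3) by (simp add: branch_def)
qed

lemma verts_lobe: "verts (lobe G x0 x1 (branch u)) = branch u \<union> {x0, x1}"
  using branch_sub[of u] roots by (auto simp: lobe_def induced_def)

lemma edges_lobe: "edges (lobe G x0 x1 (branch u)) = {#e \<in># edges G. e \<subseteq> branch u \<union> {x0, x1} \<and> e \<noteq> {x0, x1}#}"
  by (simp add: lobe_def induced_def filter_filter_mset)

lemma nonroot_in_edge:
  assumes "e \<in># edges G" "e \<noteq> {x0, x1}"
  obtains a b where "e = {a, b}" "a \<in> verts G - {x0, x1}"
proof -
  obtain a b where ab: "e = {a, b}" "a \<noteq> b" "a \<in> verts G" "b \<in> verts G" by (rule simple_edgesD[OF simple assms(1)])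
  show thesis
  proof (cases "a \<in> {x0, x1}")
    case True
    then have "b \<notin> {x0, x1}" using ab assms(2) by auto
    then show thesis using that[of b a] ab by (auto simp: insert_commute)
  qed (use that[of a b] ab in blast)
qed

context
  fixes k P
  assumes B: "bundled k (verts G) (edges G) x0 x1 P"
begin

lemma bundledD:
  shows "size P = k" "\<And>p. p \<in># P \<Longrightarrow> is_path x0 x1 p" "edges G = edges_of P"
    "verts G = {x0, x1} \<union> (\<Union>p \<in> set_mset P. set p)"
    "\<And>p q w. p \<in># P \<Longrightarrow> q \<in># P \<Longrightarrow> w \<in> verts G - {x0, x1} \<Longrightarrow> w \<in> set p \<Longrightarrow> w \<in> set q \<Longrightarrow> p = q"
    "\<And>p. p \<in># P \<Longrightarrow> p \<noteq> [x0, x1] \<Longrightarrow> count P p \<ge> 2"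
    "\<And>p. p \<in># P \<Longrightarrow> p \<noteq> [x0, x1] \<Longrightarrow> length p \<ge> 4 \<Longrightarrow> count P p = 2"
  using B unfolding bundled_def by (simp_all only: simp_thms ball_simps)

text \<open>An edge between nonroots stays on its bundle, because a nonroot lies on one bundle only;
  conversely the interior of the path is connected.\<close>

lemma bundled_branch:
  assumes p: "p \<in># P" and u: "u \<in> set p" "u \<in> verts G - {x0, x1}"
  shows "branch u = set p - {x0, x1}"
proof
  show "branch u \<subseteq> set p - {x0, x1}"
  proof
    fix v assume v: "v \<in> branch u"
    then have l: "linked inner u v" by (simp add: branch_def)
    have "v \<in> set p - {x0, x1}"
    proof (rule linked_closed[OF l])
      show "u \<in> set p - {x0, x1}" using u by blast
      fix a b assume ab: "{a, b} \<in># inner" "a \<in> set p - {x0, x1}"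
      then have "{a, b} \<in># edges_of P" "b \<notin> {x0, x1}" "a \<in> verts G" using bundledD(3) by (auto simp: inner_def)
      then obtain q where q: "q \<in># P" "{a, b} \<in># path_edges q" using in_edges_of by metis
      then have "a \<in> set q" "b \<in> set q" using path_edges_in[OF q(2)] by auto
      then show "b \<in> set p - {x0, x1}" using bundledD(5)[OF p q(1), of a] ab(2) \<open>a \<in> verts G\<close> \<open>b \<notin> {x0, x1}\<close> by blast
    qed
    then show "v \<in> set p - {x0, x1}" .
  qed
  have ip: "is_path x0 x1 p" by (rule bundledD(2)[OF p])
  obtain s where s: "p = x0 # s @ [x1]"
  proof -
    obtain q where q: "p = x0 # q" using ip by (cases p) (auto simp: is_path_def)
    moreover have "q \<noteq> []" using ip q roots(3) by (auto simp: is_path_def)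
    moreover have "last q = x1" using ip q calculation(2) by (simp add: is_path_def)
    ultimately show thesis using that[of "butlast q"] append_butlast_last_id[of q] by simp
  qed
  have us: "u \<in> set s" "x0 \<notin> set s" "x1 \<notin> set s" using u ip s by (auto simp: is_path_def)
  have "path_edges s \<subseteq># path_edges p"
  proof (cases s rule: rev_cases)
    case (snoc s' z)
    then have "path_edges (s @ [x1]) = add_mset {z, x1} (path_edges s)" using path_edges_snoc[of s x1] by simp
    moreover have "path_edges (s @ [x1]) \<subseteq># path_edges p" unfolding s by (cases "s @ [x1]") auto
    ultimately show ?thesis by (metis mset_subset_eq_insertD subset_mset.less_imp_le)
  qed simp
  also have "\<dots> \<subseteq># edges G" using edges_of_mono[of "{#p#}" P] p bundledD(3) by simp
  finally have sub: "path_edges s \<subseteq># edges G" .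
  have sV: "set s \<subseteq> verts G" using bundledD(4) p s by auto
  have inn: "path_edges s \<subseteq># inner"
    unfolding inner_def
  proof (rule subset_mset.order_trans[OF _ multiset_filter_mono[OF sub]])
    have "e \<subseteq> verts G - {x0, x1}" if "e \<in># path_edges s" for e
      using path_edges_in[OF that] us sV by blast
    then have "filter_mset (\<lambda>e. e \<subseteq> verts G - {x0, x1}) (path_edges s) = path_edges s"
      by (simp add: filter_mset_eq_conv)
    then show "path_edges s \<subseteq># filter_mset (\<lambda>e. e \<subseteq> verts G - {x0, x1}) (path_edges s)" by simp
  qed
  show "set p - {x0, x1} \<subseteq> branch u"
  proof
    fix v assume "v \<in> set p - {x0, x1}"
    then have v: "v \<in> set s" using s by auto
    have "linked inner u v" by (rule linked_mono[OF path_linked_mem[OF us(1) v] inn])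
    then show "v \<in> branch u" using v us sV by (auto simp: branch_def)
  qed
qed

lemma bundled_nonroot:
  assumes p: "p \<in># P" "p \<noteq> [x0, x1]"
  obtains u where "u \<in> set p" "u \<in> verts G - {x0, x1}"
proof -
  have ip: "is_path x0 x1 p" by (rule bundledD(2)[OF p(1)])
  obtain c q where cq: "p = x0 # c # q"
    using ip roots(3) by (cases p rule: path_edges.cases) (auto simp: is_path_def)
  have "c \<noteq> x1"
  proof
    assume "c = x1"
    then have "q = []" using ip cq last_in_set[of q] by (cases "q = []") (auto simp: is_path_def)
    then show False using p(2) cq \<open>c = x1\<close> by simp
  qed
  moreover have "c \<noteq> x0" using ip cq by (auto simp: is_path_def)
  moreover have "set p \<subseteq> verts G" using bundledD(4) p(1) by blast
  then have "c \<in> verts G" using cq by simp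
  ultimately show thesis using that[of c] cq by simp
qed

text \<open>Every edge other than a root edge has a nonroot end, which determines the bundle
  containing the edge.\<close>

lemma bundled_lobe_edges:
  assumes p: "p \<in># P" "p \<noteq> [x0, x1]"
  shows "{#e \<in># edges G. e \<subseteq> set p \<and> e \<noteq> {x0, x1}#} = repeat_mset (count P p) (path_edges p)"
proof (rule multiset_eqI)
  fix e
  have other: "q = p" if q: "q \<in># P" "e \<in># path_edges q" "e \<subseteq> set p" "e \<noteq> {x0, x1}" for q
  proof -
    have "e \<in># edges G" using q(1,2) bundledD(3) in_edges_of by metis
    then obtain a b where ab: "e = {a, b}" "a \<in> verts G - {x0, x1}" using q(4) by (rule nonroot_in_edge)
    have "a \<in> set q" "a \<in> set p" using path_edges_in[OF q(2)] q(3) ab by auto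
    then show ?thesis using bundledD(5)[OF q(1) p(1) ab(2)] by blast
  qed
  show "count {#e \<in># edges G. e \<subseteq> set p \<and> e \<noteq> {x0, x1}#} e = count (repeat_mset (count P p) (path_edges p)) e"
  proof (cases "e \<in># path_edges p")
    case True
    have e: "e \<subseteq> set p" "e \<noteq> {x0, x1}"
      using path_edges_in[OF True] is_path_root_edge[OF bundledD(2)[OF p(1)]] True p(2) by blast+
    then have "e \<notin># path_edges q" if "q \<in># P" "q \<noteq> p" for q using other[OF that(1)] that(2) by blast
    then show ?thesis using e count_edges_of_unique[OF p(1), of e] bundledD(3) by simp
  next
    case False
    have "\<not> (e \<in># edges G \<and> e \<subseteq> set p \<and> e \<noteq> {x0, x1})"
    proof
      assume e: "e \<in># edges G \<and> e \<subseteq> set p \<and> e \<noteq> {x0, x1}"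
      then obtain q where "q \<in># P" "e \<in># path_edges q" using bundledD(3) in_edges_of by metis
      then show False using other e False by blast
    qed
    then have "e \<notin># {#e \<in># edges G. e \<subseteq> set p \<and> e \<noteq> {x0, x1}#}" by simp
    then show ?thesis using False by (simp only: not_in_iff count_repeat_mset mult_0_right)
  qed
qed

lemma bundled_lobes:
  "lobes G x0 x1 = (\<lambda>p. lobe G x0 x1 (set p - {x0, x1})) ` (set_mset P - {[x0, x1]})"
proof -
  have *: "branch ` (verts G - {x0, x1}) = (\<lambda>p. set p - {x0, x1}) ` (set_mset P - {[x0, x1]})"
  proof (intro equalityI subsetI)
    fix C assume "C \<in> branch ` (verts G - {x0, x1})"
    then obtain u where u: "u \<in> verts G - {x0, x1}" "C = branch u" by blast
    then obtain p where p: "p \<in># P" "u \<in> set p" using bundledD(4) by auto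
    then have "p \<noteq> [x0, x1]" using u(1) by auto
    then show "C \<in> (\<lambda>p. set p - {x0, x1}) ` (set_mset P - {[x0, x1]})" using bundled_branch[OF p u(1)] u(2) p(1) by blast
  next
    fix C assume "C \<in> (\<lambda>p. set p - {x0, x1}) ` (set_mset P - {[x0, x1]})"
    then obtain p where p: "p \<in># P" "p \<noteq> [x0, x1]" "C = set p - {x0, x1}" by blast
    obtain u where u: "u \<in> set p" "u \<in> verts G - {x0, x1}" using p(1,2) by (rule bundled_nonroot)
    then show "C \<in> branch ` (verts G - {x0, x1})" using bundled_branch[OF p(1) u] p(3) by blast
  qed
  have "lobes G x0 x1 = lobe G x0 x1 ` branch ` (verts G - {x0, x1})" by (simp only: lobes_eq image_image)
  then show ?thesis by (simp only: * image_image)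
qed

lemma bundled_type_B:
  assumes k: "k = m + 1"
  shows "type_B m G x0 x1"
proof -
  \<comment> \<open>Bundles with a nonroot are determined by their vertex sets, so this recovers the
    multiplicity from the lobe.\<close>
  define n where "n L = size {#q \<in># P. set q = verts L#}" for L :: "'v mgraph"
  let ?Q = "set_mset P - {[x0, x1]}" and ?L = "\<lambda>p. lobe G x0 x1 (set p - {x0, x1})"
  have lobe: "verts (?L p) = set p" "edges (?L p) = repeat_mset (count P p) (path_edges p)" "n (?L p) = count P p"
    if p: "p \<in> ?Q" for p
  proof -
    have pP: "p \<in># P" "p \<noteq> [x0, x1]" using p by auto
    have roots_p: "x0 \<in> set p" "x1 \<in> set p" using is_path_ends[OF bundledD(2)[OF pP(1)]] by auto
    obtain u where u: "u \<in> set p" "u \<in> verts G - {x0, x1}" using pP by (rule bundled_nonroot)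
    have b: "set p - {x0, x1} = branch u" using bundled_branch[OF pP(1) u] by simp
    have bp: "branch u \<union> {x0, x1} = set p" unfolding b[symmetric] using roots_p by blast
    show v: "verts (?L p) = set p" unfolding b verts_lobe bp ..
    show "edges (?L p) = repeat_mset (count P p) (path_edges p)"
      unfolding b edges_lobe bp by (rule bundled_lobe_edges[OF pP])
    have "{#q \<in># P. set q = set p#} = {#q \<in># P. q = p#}"
      using bundledD(5)[OF _ pP(1) u(2) _ u(1)] u(1) by (intro filter_mset_cong) auto
    then show "n (?L p) = count P p" unfolding n_def v by (simp add: filter_eq_replicate_mset)
  qed
  have inj: "inj_on ?L ?Q"
  proof (rule inj_onI)
    fix p q assume pq: "p \<in> ?Q" "q \<in> ?Q" "?L p = ?L q"
    have pP: "p \<in># P" "p \<noteq> [x0, x1]" "q \<in># P" using pq by auto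
    obtain u where u: "u \<in> set p" "u \<in> verts G - {x0, x1}" using pP(1,2) by (rule bundled_nonroot)
    have "set p = verts (?L q)" using lobe(1)[OF pq(1)] unfolding pq(3) by (rule HOL.sym)
    then have uq: "u \<in> set q" using u(1) unfolding lobe(1)[OF pq(2)] by blast
    show "p = q" by (rule bundledD(5)[OF pP(1,3) u(2,1) uq])
  qed
  have "count (edges G) {x0, x1} = count P [x0, x1]"
  proof (cases "[x0, x1] \<in># P")
    case True
    have "count (edges_of P) {x0, x1} = count P [x0, x1] * count (path_edges [x0, x1]) {x0, x1}"
    proof (rule count_edges_of_unique[OF True])
      show "{x0, x1} \<notin># path_edges q" if "q \<in># P" "q \<noteq> [x0, x1]" for q
        using is_path_root_edge[OF bundledD(2)[OF that(1)]] that(2) by blast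
    qed
    then show ?thesis using bundledD(3) by simp
  next
    case False
    have "{x0, x1} \<notin># edges_of P"
    proof
      assume "{x0, x1} \<in># edges_of P"
      then obtain q where q: "q \<in># P" "{x0, x1} \<in># path_edges q" using in_edges_of by metis
      then show False using is_path_root_edge[OF bundledD(2)[OF q(1)] q(2)] False by blast
    qed
    then have "{x0, x1} \<notin># edges G" using bundledD(3) by simp
    then show ?thesis using False by (simp only: not_in_iff)
  qed
  moreover have "(\<Sum>L\<in>lobes G x0 x1. n L) = (\<Sum>p\<in>?Q. count P p)"
    unfolding bundled_lobes sum.reindex[OF inj] by (rule sum.cong) (simp_all add: lobe)
  moreover have "size P = count P [x0, x1] + (\<Sum>p\<in>?Q. count P p)"
  proof (cases "[x0, x1] \<in># P")
    case True
    then show ?thesis unfolding size_multiset_overloaded_eq by (intro sum.remove) auto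
  next
    case False
    then have "?Q = set_mset P" "count P [x0, x1] = 0" by (auto simp: not_in_iff)
    then show ?thesis unfolding size_multiset_overloaded_eq by simp
  qed
  ultimately have sum: "edge_mult G x0 x1 + (\<Sum>L\<in>lobes G x0 x1. n L) = m + 1"
    using bundledD(1) k by (simp add: edge_mult_def)
  have "n L \<ge> 2 \<and> is_thick_path L x0 x1 (n L) \<and> (card (verts L) \<ge> 4 \<longrightarrow> n L = 2)" if L: "L \<in> lobes G x0 x1" for L
  proof -
    obtain p where p: "p \<in> ?Q" "L = ?L p" using L unfolding bundled_lobes by blast
    have pP: "p \<in># P" "p \<noteq> [x0, x1]" using p by auto
    have ip: "is_path x0 x1 p" by (rule bundledD(2)[OF pP(1)])
    then have "card (set p) = length p" by (simp add: is_path_def distinct_card)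
    then show ?thesis
      unfolding p(2) is_thick_path_iff lobe[OF p(1)] using bundledD(6,7)[OF pP] ip by auto
  qed
  then show ?thesis unfolding type_B_def using sum by blast
qed

end

text \<open>The edges of \<open>G\<close> are distributed over the lobes and the root edges; each
  lobe is replaced by the copies of its path.\<close>

lemma type_B_bundled:
  assumes "type_B m G x0 x1"
  shows "\<exists>P. bundled (Suc m) (verts G) (edges G) x0 x1 P"
proof -
  let ?\<Lambda> = "lobes G x0 x1"
  obtain n where n: "\<And>L. L \<in> ?\<Lambda> \<Longrightarrow> n L \<ge> 2" "\<And>L. L \<in> ?\<Lambda> \<Longrightarrow> is_thick_path L x0 x1 (n L)"
    "\<And>L. L \<in> ?\<Lambda> \<Longrightarrow> card (verts L) \<ge> 4 \<Longrightarrow> n L = 2" "edge_mult G x0 x1 + (\<Sum>L\<in>?\<Lambda>. n L) = m + 1"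
    using assms unfolding type_B_def by blast
  obtain f where f: "\<And>L. L \<in> ?\<Lambda> \<Longrightarrow> is_path x0 x1 (f L) \<and> verts L = set (f L) \<and> edges L = repeat_mset (n L) (path_edges (f L))"
    using n(2) unfolding is_thick_path_iff by metis
  have fin: "finite ?\<Lambda>" unfolding lobes_eq using finite_V by simp
  let ?c = "edge_mult G x0 x1"
  \<comment> \<open>One copy of the path for each parallel copy in the lobe, and one
    \<open>[x0, x1]\<close> for each root edge.\<close>
  define P where "P = (\<Sum>L\<in>?\<Lambda>. replicate_mset (n L) (f L)) + replicate_mset ?c [x0, x1]"
  have lobe_eqI: "L = L'" if L: "L \<in> ?\<Lambda>" "L' \<in> ?\<Lambda>" and w: "w \<in> verts L" "w \<in> verts L'" "w \<notin> {x0, x1}" for L L' w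
  proof -
    obtain u u' where u: "L = lobe G x0 x1 (branch u)" "L' = lobe G x0 x1 (branch u')"
      using L unfolding lobes_eq by blast
    then have "w \<in> branch u" "w \<in> branch u'" using w verts_lobe by auto
    then have "branch u = branch u'" using branch_cong by metis
    then show ?thesis using u by simp
  qed
  have nonroot: "\<exists>w\<in>verts L. w \<in> verts G - {x0, x1}" if L: "L \<in> ?\<Lambda>" for L
  proof -
    obtain u where u: "u \<in> verts G - {x0, x1}" "L = lobe G x0 x1 (branch u)" using L unfolding lobes_eq by blast
    then show ?thesis using branch_self[OF u(1)] verts_lobe[of u] by blast
  qed
  have f_inj: "L = L'" if "L \<in> ?\<Lambda>" "L' \<in> ?\<Lambda>" "f L = f L'" for L L'
    using nonroot[OF that(1)] lobe_eqI[OF that(1,2)] f[OF that(1)] f[OF that(2)] that(3) by (metis DiffD2)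
  have f_ne: "f L \<noteq> [x0, x1]" if "L \<in> ?\<Lambda>" for L
    using nonroot[OF that] f[OF that] by fastforce
  have countP: "count P p = (\<Sum>L\<in>?\<Lambda>. if f L = p then n L else 0) + (if p = [x0, x1] then ?c else 0)" for p
    unfolding P_def by (auto simp: count_sum intro!: sum.cong)
  have count_f: "count P (f L) = n L" if L: "L \<in> ?\<Lambda>" for L
  proof -
    have "(\<Sum>L'\<in>?\<Lambda>. if f L' = f L then n L' else 0) = (\<Sum>L'\<in>?\<Lambda>. if L' = L then n L' else 0)"
      using f_inj[OF _ L] by (intro sum.cong) auto
    then show ?thesis unfolding countP using f_ne[OF L] L fin by simp
  qed
  have inP: "p \<in># P \<Longrightarrow> p = [x0, x1] \<or> (\<exists>L\<in>?\<Lambda>. p = f L)" for p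
  proof (rule ccontr)
    assume p: "p \<in># P" "\<not> (p = [x0, x1] \<or> (\<exists>L\<in>?\<Lambda>. p = f L))"
    then have "(\<Sum>L\<in>?\<Lambda>. if f L = p then n L else 0) = 0" by (intro sum.neutral) auto
    then have "count P p = 0" unfolding countP using p(2) by simp
    then show False using p(1) not_in_iff[of p P] by blast
  qed
  have fP: "f L \<in># P" if "L \<in> ?\<Lambda>" for L
    using count_f[OF that] n(1)[OF that] by (metis count_greater_zero_iff less_le_trans zero_less_numeral)
  have edges_P: "edges_of P = (\<Sum>L\<in>?\<Lambda>. edges L) + replicate_mset ?c {x0, x1}"
  proof -
    have "edges_of P = (\<Sum>L\<in>?\<Lambda>. edges_of (replicate_mset (n L) (f L))) + edges_of (replicate_mset ?c [x0, x1])"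
      unfolding P_def edges_of_simps edges_of_sum[OF fin] ..
    also have "(\<Sum>L\<in>?\<Lambda>. edges_of (replicate_mset (n L) (f L))) = (\<Sum>L\<in>?\<Lambda>. edges L)"
      using f by (intro sum.cong) (simp_all add: edges_of_replicate_mset)
    also have "edges_of (replicate_mset ?c [x0, x1]) = replicate_mset ?c {x0, x1}"
      by (induction ?c) (auto simp: edges_of_replicate_mset repeat_mset_replicate_mset)
    finally show ?thesis .
  qed
  have "edges G = edges_of P"
  proof (rule multiset_eqI)
    fix e
    have cL: "count (edges_of P) e = (\<Sum>L\<in>?\<Lambda>. count (edges L) e) + (if e = {x0, x1} then ?c else 0)"
      unfolding edges_P by (simp add: count_sum)
    have lobe_count: "count (edges L) e = (if e \<subseteq> verts L \<and> e \<noteq> {x0, x1} then count (edges G) e else 0)" if L: "L \<in> ?\<Lambda>" for L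
    proof -
      obtain u where u: "L = lobe G x0 x1 (branch u)" using L unfolding lobes_eq by blast
      show ?thesis unfolding u edges_lobe verts_lobe by simp
    qed
    show "count (edges G) e = count (edges_of P) e"
    proof (cases "e \<in># edges G \<and> e \<noteq> {x0, x1}")
      case True
      then obtain a b where ab: "e = {a, b}" "a \<in> verts G - {x0, x1}" using nonroot_in_edge by metis
      \<comment> \<open>A nonroot end of \<open>e\<close> singles out the only lobe that contains
        \<open>e\<close>.\<close>
      define L0 where "L0 = lobe G x0 x1 (branch a)"
      have L0: "L0 \<in> ?\<Lambda>" using ab(2) unfolding L0_def lobes_eq by blast
      have aa: "a \<in> branch a" by (rule branch_self[OF ab(2)])
      then have "b \<in> branch a \<union> {x0, x1}" using branch_closed[of a a b] True ab(1) by blast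
      then have eL0: "e \<subseteq> verts L0" unfolding L0_def verts_lobe using aa ab(1) by simp
      have only: "L = L0" if L: "L \<in> ?\<Lambda>" "e \<subseteq> verts L" for L
      proof (rule lobe_eqI[OF L(1) L0])
        show "a \<in> verts L" "a \<in> verts L0" "a \<notin> {x0, x1}" using L(2) eL0 ab by blast+
      qed
      have "(\<Sum>L\<in>?\<Lambda>. count (edges L) e) = (\<Sum>L\<in>?\<Lambda>. if L = L0 then count (edges G) e else 0)"
      proof (rule sum.cong[OF refl])
        fix L assume L: "L \<in> ?\<Lambda>"
        show "count (edges L) e = (if L = L0 then count (edges G) e else 0)"
        proof (cases "L = L0")
          case True
          then show ?thesis using lobe_count[OF L0] eL0 \<open>e \<in># edges G \<and> e \<noteq> {x0, x1}\<close> by simp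
        next
          case False
          then have "\<not> e \<subseteq> verts L" using only[OF L] by blast
          then show ?thesis using lobe_count[OF L] False by simp
        qed
      qed
      then show ?thesis unfolding cL using True L0 fin by simp
    next
      case False
      then have "e = {x0, x1} \<or> count (edges G) e = 0" by (auto simp: not_in_iff)
      then have "(\<Sum>L\<in>?\<Lambda>. count (edges L) e) = 0" using lobe_count by (intro sum.neutral) auto
      then show ?thesis unfolding cL using \<open>e = {x0, x1} \<or> _\<close> by (auto simp: edge_mult_def)
    qed
  qed
  moreover have "size P = Suc m"
  proof -
    have "size (\<Sum>L\<in>?\<Lambda>. replicate_mset (n L) (f L)) = (\<Sum>L\<in>?\<Lambda>. n L)"
      using fin by (induction rule: finite_induct) auto
    then show ?thesis unfolding P_def using n(4) by simp
  qed
  moreover have "is_path x0 x1 p" if "p \<in># P" for p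
    using inP[OF that] f roots(3) by (auto simp: is_path_def)
  moreover have "verts G = {x0, x1} \<union> (\<Union>p \<in> set_mset P. set p)"
  proof (intro equalityI subsetI)
    fix v assume v: "v \<in> verts G"
    show "v \<in> {x0, x1} \<union> (\<Union>p \<in> set_mset P. set p)"
    proof (cases "v \<in> {x0, x1}")
      case False
      then have vn: "v \<in> verts G - {x0, x1}" using v by blast
      define L where "L = lobe G x0 x1 (branch v)"
      have L: "L \<in> ?\<Lambda>" using vn unfolding L_def lobes_eq by blast
      have "v \<in> verts L" using branch_self[OF vn] unfolding L_def verts_lobe by blast
      then show ?thesis using f[OF L] fP[OF L] by blast
    qed blast
  next
    fix v assume "v \<in> {x0, x1} \<union> (\<Union>p \<in> set_mset P. set p)"
    then consider "v \<in> {x0, x1}" | L where "L \<in> ?\<Lambda>" "v \<in> set (f L)" using inP by fastforce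
    then show "v \<in> verts G"
    proof cases
      case 2
      then obtain u where "L = lobe G x0 x1 (branch u)" unfolding lobes_eq by blast
      then have "set (f L) = branch u \<union> {x0, x1}" using f[OF 2(1)] verts_lobe by metis
      then show ?thesis using 2(2) branch_sub[of u] roots by blast
    qed (use roots in blast)
  qed
  moreover have "p = q" if pq: "p \<in># P" "q \<in># P" and w: "w \<in> verts G - {x0, x1}" "w \<in> set p" "w \<in> set q" for p q w
  proof -
    obtain L L' where L: "L \<in> ?\<Lambda>" "p = f L" "L' \<in> ?\<Lambda>" "q = f L'" using inP[OF pq(1)] inP[OF pq(2)] w by auto
    then have "w \<in> verts L" "w \<in> verts L'" using f[OF L(1)] f[OF L(3)] w by simp_all
    then have "L = L'" using w(1) by (intro lobe_eqI[OF L(1,3)]) blast+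
    then show ?thesis unfolding L(2,4) by simp
  qed
  moreover have "count P p \<ge> 2 \<and> (length p \<ge> 4 \<longrightarrow> count P p = 2)" if p: "p \<in># P" "p \<noteq> [x0, x1]" for p
  proof -
    obtain L where L: "L \<in> ?\<Lambda>" "p = f L" using inP[OF p(1)] p(2) by blast
    have "card (verts L) = length p" using f[OF L(1)] L(2) distinct_card[of p] by (simp add: is_path_def)
    then show ?thesis unfolding L(2) count_f[OF L(1)] using n(1,3)[OF L(1)] L(2) by simp
  qed
  ultimately show ?thesis unfolding bundled_def by (intro exI[of _ P] conjI ballI impI) blast+
qed

theorem no_D_iff: "\<not> has_D m (verts G) (edges G) x0 x1 \<longleftrightarrow> type_A m G x0 x1 \<or> type_B m G x0 x1"
proof
  assume "\<not> has_D m (verts G) (edges G) x0 x1"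
  then have "tight_separated m (verts G) (edges G) x0 x1 \<or> (\<exists>P. bundled (Suc m) (verts G) (edges G) x0 x1 P)"
    using admissible_outcome[OF admissible_axioms] unfolding outcome_def by blast
  then show "type_A m G x0 x1 \<or> type_B m G x0 x1"
    using tight_separated_type_A bundled_type_B by auto
next
  assume "type_A m G x0 x1 \<or> type_B m G x0 x1"
  then show "\<not> has_D m (verts G) (edges G) x0 x1"
    using tight_separated_no_D[OF type_A_tight_separated m_ge_2 roots(3)] type_B_bundled
      bundled_no_D[OF _ roots(3) m_ge_2] by blast
qed

end

theorem theorem2p3:
  fixes G :: "'v mgraph" and x0 x1 :: 'v and m :: nat
  assumes "m \<ge> 2"
    and "rooted_graph (G, [x0, x1])"
    and "card (verts G) \<ge> 4"
    and "lambda_n G x0 x1 \<ge> 3"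
    and "lambda_n_int G x0 x1 \<ge> 4"
    and "lambda_s G x0 x1 \<ge> enat m"
  shows "\<not> (G, [x0, x1]) \<succ>\<^sub>r D m \<longleftrightarrow> type_A m G x0 x1 \<or> type_B m G x0 x1"
proof -
  have G: "multigraph G" and roots: "x0 \<in> verts G" "x1 \<in> verts G" "x0 \<noteq> x1" using assms(2) by auto
  have fin: "finite (verts G)" using G by (simp add: multigraph_def)
  have cut: "cut_size G X = cut (edges G) X" for X by (simp add: cut_size_def cut_def)
  have side: "is_cut_side G X" if "X \<subseteq> verts G" "a \<in> X" "b \<in> verts G" "b \<notin> X" for X a b
  proof -
    have "finite X" using that(1) fin by (rule finite_subset)
    then have "card X \<noteq> 0" "card (verts G - X) \<noteq> 0" using that fin by auto
    then show ?thesis using that(1) by (simp add: is_cut_side_def)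
  qed
  interpret rooted_multigraph m G x0 x1
  proof unfold_locales
    show "simple_edges (verts G) (edges G)" using G by (simp add: simple_edges_def multigraph_def)
    show "3 \<le> cut (edges G) X" if X: "X \<subseteq> verts G - {x0, x1}" "X \<noteq> {}" for X
    proof -
      obtain a where "a \<in> X" using X(2) by blast
      then have "is_cut_side G X" using side[of X a x0] X(1) roots by blast
      then have "lambda_n G x0 x1 \<le> enat (cut_size G X)"
        unfolding lambda_n_def using X(1) by (intro INF_lower) (auto simp: separates_def)
      with assms(4) have "3 \<le> enat (cut_size G X)" by (rule order_trans)
      then show ?thesis unfolding cut by (simp add: numeral_eq_enat)
    qed
    show "4 \<le> cut (edges G) X" if X: "X \<subseteq> verts G - {x0, x1}" "card X \<ge> 2" for X
    proof -
      have "{x0, x1} \<subseteq> verts G - X" using X(1) roots by blast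
      then have "card {x0, x1} \<le> card (verts G - X)" using fin by (intro card_mono) auto
      then have "is_internal_cut_side G X" using X roots(3) by (auto simp: is_internal_cut_side_def)
      then have "lambda_n_int G x0 x1 \<le> enat (cut_size G X)"
        unfolding lambda_n_int_def using X(1) by (intro INF_lower) (auto simp: separates_def)
      with assms(5) have "4 \<le> enat (cut_size G X)" by (rule order_trans)
      then show ?thesis unfolding cut by (simp add: numeral_eq_enat)
    qed
    show "m \<le> cut (edges G) X" if X: "X \<subseteq> verts G" "x0 \<in> X" "x1 \<notin> X" for X
    proof -
      have "is_cut_side G X" by (rule side[OF X(1,2) roots(2) X(3)])
      then have "lambda_s G x0 x1 \<le> enat (cut_size G X)"
        unfolding lambda_s_def using X by (intro INF_lower) (auto simp: separates_def)
      with assms(6) have "enat m \<le> enat (cut_size G X)" by (rule order_trans)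
      then show ?thesis unfolding cut by simp
    qed
  qed (use assms(1,3) roots in auto)
  show ?thesis unfolding rooted_immersion_D_iff[OF G roots] by (rule no_D_iff)
qed

end
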